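(* If $\mathcal A$ is a coherent sheaf on a complex submanifold $Y\subset c_{\mathfrak a}X$, then its trivial extension $\tilde{\mathcal A}$ is a coherent sheaf on $c_{\mathfrak a}X$.
   Context: $X_0$ is a connected complex manifold; $p:X\to X_0$ is a regular covering ($X$ connected) with deck transformation group $G$ acting on $X$ from the left. $\ell_\infty(G)$ is the algebra of bounded complex functions on $G$ with pointwise multiplication and sup-norm. $\mathfrak a\subset\ell_\infty(G)$ is a closed unital subalgebra invariant under right translations: $u\in\mathfrak a,\ g\in G$ imply $R_gu\in\mathfrak a$, where $R_gu(h):=u(hg)$. Fibrewise compactification. $M_{\mathfrak a}$ is the maximal ideal space of $\mathfrak a$ (non-zero continuous homomorphisms $\mathfrak a\to\mathbb C$, weak* topology); $j:G\to M_{\mathfrak a}$, $j(g)(u):=u(g)$; $\hat G_{\mathfrak a}$ is the closure of $j(G)$ in $M_{\mathfrak a}$. $G$ acts on $\hat G_{\mathfrak a}$ from the right by $(\eta\cdot g)(u):=\eta(R_gu)$, so $j(h)\cdot g=j(hg)$. Regard $p:X\to X_0$ as a principal $G$-bundle: there are an open cover $\{U_{0,\gamma}\}$ of $X_0$ by simply connected sets and a locally constant cocycle $c_{\delta\gamma}:U_{0,\gamma}\cap U_{0,\delta}\to G$ such that $X$ is obtained from $\sqcup_\gamma U_{0,\gamma}\times G$ by identifying $(x,g)\in U_{0,\delta}\times G$ with $(x,g\cdot c_{\delta\gamma}(x))\in U_{0,\gamma}\times G$. The fibrewise compactification $\bar p:c_{\mathfrak a}X\to X_0$ is the associated bundle with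 fibre $\hat G_{\mathfrak a}$, obtained from $\sqcup_\gamma U_{0,\gamma}\times\hat G_{\mathfrak a}$ by identifying $(x,\omega)\in U_{0,\delta}\times\hat G_{\mathfrak a}$ with $(x,\omega\cdot c_{\delta\gamma}(x))\in U_{0,\gamma}\times\hat G_{\mathfrak a}$. The map $\iota:X\to c_{\mathfrak a}X$ is induced by $\mathrm{Id}\times j$. For $U\subset c_{\mathfrak a}X$ open, $\mathcal O(U)$ is the set of $f\in C(U)$ with $\iota^*f$ holomorphic on $\iota^{-1}(U)$; $\mathcal O=\mathcal O_{c_{\mathfrak a}X}$ is the corresponding sheaf of germs. Charts. Over a simply connected open $U_0\subset X_0$ there are a trivialization $\psi:p^{-1}(U_0)\to U_0\times G$ and a compatible trivialization $\bar\psi:\bar p^{-1}(U_0)\to U_0\times\hat G_{\mathfrak a}$ with $\bar\psi\circ\iota=(\mathrm{Id}\times j)\circ\psi$. For $K\subset\hat G_{\mathfrak a}$, $\hat\Pi(U_0,K):=\bar\psi^{-1}(U_0\times K)$, whose points are written $(z,\omega)\in U_0\times K$. For $K$ open and $f$ holomorphic on $\hat\Pi(U_0,K)$, the functions $f(\cdot,\omega)$, $\omega\in K$, are holomorphic on $U_0$. A closed subset $Y\subset c_{\mathfrak a}X$ is a complex submanifold of codimension $k$ if every $y\in Y$ has a neighbourhood $U=\hat\Pi(U_0,K)$, with $U_0\subset X_0$ open simply connected and $K\subset\hat G_{\mathfrak a}$ open, and functions $h_1,\dots,h_k\in\mathcal O(U)$ such that (1) $Y\cap U=\{x\in U:h_1(x)=\dots=h_k(x)=0\}$;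 (2) the rank of the map $z\mapsto(h_1(z,\omega),\dots,h_k(z,\omega))$ is $k$ at each point $(z,\omega)\in Y\cap U$. Then $\iota^{-1}(Y)$ is a complex submanifold of $X$. For $W\subset Y$ open, a function $f\in C(W)$ is holomorphic if $\iota^*f$ is holomorphic on $\iota^{-1}(W)\subset\iota^{-1}(Y)$; $\mathcal O_Y$ is the sheaf of germs of holomorphic functions on $Y$. A coherent sheaf on $Y$ (resp. on $c_{\mathfrak a}X$) is a sheaf $\mathcal A$ of modules over $\mathcal R=\mathcal O_Y$ (resp. $\mathcal R=\mathcal O_{c_{\mathfrak a}X}$) such that every point has a neighbourhood $V$ over which, for any $N\ge1$, there is an exact sequence of sheaves of modules $\mathcal R^{m_N}|_V\to\dots\to\mathcal R^{m_2}|_V\to\mathcal R^{m_1}|_V\to\mathcal A|_V\to0$ (a free resolution of length $N$). The trivial extension $\tilde{\mathcal A}$ of a sheaf $\mathcal A$ of $\mathcal O_Y$-modules is the sheaf on $c_{\mathfrak a}X$ defined by $\tilde{\mathcal A}|_{c_{\mathfrak a}X\setminus Y}:=0$, $\tilde{\mathcal A}|_Y:=\mathcal A$ (an $\mathcal O$-module via restriction of functions to $Y$). *)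

theory Defs
  imports "HOL-Analysis.Analysis" "Jordan_Normal_Form.DL_Rank"
begin

section \<open>Complex manifolds\<close>

text \<open>
  \<open>\<complex>\<^sup>n\<close> for a natural number \<open>n\<close> (the case \<open>n = 0\<close> included) is modelled, like the library's
  \<^const>\<open>Euclidean_space\<close>, by the sequences that vanish from index \<open>n\<close> on, with the topology of
  coordinatewise convergence.
\<close>

definition Cn :: "nat \<Rightarrow> (nat \<Rightarrow> complex) set" where
  "Cn n = {z. \<forall>i\<ge>n. z i = 0}"

text \<open>Complex (Frechet) differentiability at every point of an open set; \<open>L\<close> is the gradient.\<close>

definition holo_Cn :: "nat \<Rightarrow> (nat \<Rightarrow> complex) set \<Rightarrow> ((nat \<Rightarrow> complex) \<Rightarrow> complex) \<Rightarrow> bool" where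
  "holo_Cn n D f \<longleftrightarrow>
     openin (top_of_set (Cn n)) D \<and>
     (\<forall>z\<in>D. \<exists>L::nat \<Rightarrow> complex.
        ((\<lambda>w. (f w - f z - (\<Sum>j<n. L j * (w j - z j)))
               / complex_of_real (L2_set (\<lambda>j. cmod (w j - z j)) {..<n})) \<longlongrightarrow> 0) (at z within D))"

definition partial_deriv :: "nat \<Rightarrow> ((nat \<Rightarrow> complex) \<Rightarrow> complex) \<Rightarrow> (nat \<Rightarrow> complex) \<Rightarrow> complex" where
  "partial_deriv j f z = deriv (\<lambda>t. f (z(j := t))) (z j)"

type_synonym 'b atlas = "('b set \<times> ('b \<Rightarrow> nat \<Rightarrow> complex)) set"

definition complex_atlas :: "nat \<Rightarrow> 'b::topological_space atlas \<Rightarrow> bool" where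
  "complex_atlas n A \<longleftrightarrow>
     (\<Union>(V, \<phi>)\<in>A. V) = UNIV \<and>
     (\<forall>(V, \<phi>)\<in>A. open V \<and> openin (top_of_set (Cn n)) (\<phi> ` V)
                   \<and> homeomorphism V (\<phi> ` V) \<phi> (inv_into V \<phi>)) \<and>
     (\<forall>(V, \<phi>)\<in>A. \<forall>(W, \<theta>)\<in>A. \<forall>i<n. holo_Cn n (\<phi> ` (V \<inter> W)) (\<lambda>z. \<theta> (inv_into V \<phi> z) i))"

definition mfd_holo :: "nat \<Rightarrow> 'b::topological_space atlas \<Rightarrow> 'b set \<Rightarrow> ('b \<Rightarrow> complex) \<Rightarrow> bool" where
  "mfd_holo n A W f \<longleftrightarrow>
     open W \<and> (\<forall>(V, \<phi>)\<in>A. holo_Cn n (\<phi> ` (V \<inter> W)) (\<lambda>z. f (inv_into V \<phi> z)))"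

text \<open>
  Holomorphic functions on an open subset \<open>W\<close> of a complex submanifold \<open>Z\<close> of a complex manifold:
  locally restrictions of holomorphic functions on open subsets of the ambient manifold.
\<close>

definition submfd_holo ::
  "nat \<Rightarrow> 'b::topological_space atlas \<Rightarrow> 'b set \<Rightarrow> 'b set \<Rightarrow> ('b \<Rightarrow> complex) \<Rightarrow> bool" where
  "submfd_holo n A Z W f \<longleftrightarrow>
     openin (top_of_set Z) W \<and>
     (\<forall>x\<in>W. \<exists>V F. x \<in> V \<and> mfd_holo n A V F \<and> (\<forall>y\<in>V \<inter> W. F y = f y))"

section \<open>Regular coverings as principal bundles\<close>

text \<open>The group operation is composition; the total space is the whole type.\<close>

definition deck :: "('a::topological_space \<Rightarrow> 'b) \<Rightarrow> ('a \<Rightarrow> 'a) set" where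
  "deck p = {g. homeomorphic_map euclidean euclidean g \<and> p \<circ> g = p}"

definition regular_covering :: "('a::topological_space \<Rightarrow> 'b::topological_space) \<Rightarrow> bool" where
  "regular_covering p \<longleftrightarrow>
     covering_space UNIV p UNIV \<and> connected (UNIV :: 'a set) \<and>
     (\<forall>x y. p x = p y \<longrightarrow> (\<exists>g\<in>deck p. g x = y))"

text \<open>The complex structure on the total space that makes \<open>p\<close> locally biholomorphic.\<close>

definition lift_atlas :: "('a::topological_space \<Rightarrow> 'b) \<Rightarrow> 'b atlas \<Rightarrow> 'a atlas" where
  "lift_atlas p A = {(V, \<phi> \<circ> p) | V B \<phi>. (B, \<phi>) \<in> A \<and> open V \<and> inj_on p V \<and> p ` V \<subseteq> B}"

text \<open>
  \<open>\<psi>\<close> is the second component of a trivialization \<open>p -` V \<rightarrow> V \<times> G\<close>, equivariant for the left action of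
  the (discrete) deck group \<open>G\<close>.
\<close>

definition principal_triv ::
  "('a::topological_space \<Rightarrow> 'b::topological_space) \<Rightarrow> 'b set \<Rightarrow> ('a \<Rightarrow> 'a \<Rightarrow> 'a) \<Rightarrow> bool" where
  "principal_triv p V \<psi> \<longleftrightarrow>
     homeomorphic_map (top_of_set (p -` V))
       (prod_topology (top_of_set V) (discrete_topology (deck p))) (\<lambda>x. (p x, \<psi> x)) \<and>
     (\<forall>g\<in>deck p. \<forall>x\<in>p -` V. \<psi> (g x) = g \<circ> \<psi> x)"

section \<open>Subalgebras of bounded functions on the deck group\<close>

text \<open>Functions on \<open>G\<close> are represented by functions that are extensional on \<open>G\<close>.\<close>

definition linf :: "('a \<Rightarrow> 'a) set \<Rightarrow> (('a \<Rightarrow> 'a) \<Rightarrow> complex) set" where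
  "linf G = {u \<in> extensional G. bounded (u ` G)}"

definition linf_norm :: "('a \<Rightarrow> 'a) set \<Rightarrow> (('a \<Rightarrow> 'a) \<Rightarrow> complex) \<Rightarrow> real" where
  "linf_norm G u = (SUP g\<in>G. cmod (u g))"

definition right_translate ::
  "('a \<Rightarrow> 'a) set \<Rightarrow> ('a \<Rightarrow> 'a) \<Rightarrow> (('a \<Rightarrow> 'a) \<Rightarrow> complex) \<Rightarrow> (('a \<Rightarrow> 'a) \<Rightarrow> complex)" where
  "right_translate G g u = (\<lambda>h\<in>G. u (h \<circ> g))"

definition closed_unital_subalgebra ::
  "('a \<Rightarrow> 'a) set \<Rightarrow> (('a \<Rightarrow> 'a) \<Rightarrow> complex) set \<Rightarrow> bool" where
  "closed_unital_subalgebra G \<aa> \<longleftrightarrow>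
     \<aa> \<subseteq> linf G \<and>
     (\<lambda>g\<in>G. 1) \<in> \<aa> \<and>
     (\<forall>u\<in>\<aa>. \<forall>v\<in>\<aa>. (\<lambda>g\<in>G. u g + v g) \<in> \<aa>) \<and>
     (\<forall>u\<in>\<aa>. \<forall>v\<in>\<aa>. (\<lambda>g\<in>G. u g * v g) \<in> \<aa>) \<and>
     (\<forall>c. \<forall>u\<in>\<aa>. (\<lambda>g\<in>G. c * u g) \<in> \<aa>) \<and>
     (\<forall>u\<in>linf G. (\<forall>e>0. \<exists>v\<in>\<aa>. linf_norm G (\<lambda>g\<in>G. u g - v g) < e) \<longrightarrow> u \<in> \<aa>)"

type_synonym 'a character = "(('a \<Rightarrow> 'a) \<Rightarrow> complex) \<Rightarrow> complex"

definition max_ideal_space ::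
  "('a \<Rightarrow> 'a) set \<Rightarrow> (('a \<Rightarrow> 'a) \<Rightarrow> complex) set \<Rightarrow> 'a character set" where
  "max_ideal_space G \<aa> = {\<eta> \<in> extensional \<aa>.
     (\<exists>u\<in>\<aa>. \<eta> u \<noteq> 0) \<and>
     (\<forall>u\<in>\<aa>. \<forall>v\<in>\<aa>. \<eta> (\<lambda>g\<in>G. u g + v g) = \<eta> u + \<eta> v) \<and>
     (\<forall>u\<in>\<aa>. \<forall>v\<in>\<aa>. \<eta> (\<lambda>g\<in>G. u g * v g) = \<eta> u * \<eta> v) \<and>
     (\<forall>c. \<forall>u\<in>\<aa>. \<eta> (\<lambda>g\<in>G. c * u g) = c * \<eta> u) \<and>
     (\<forall>u\<in>\<aa>. \<forall>e>0. \<exists>d>0. \<forall>v\<in>\<aa>. linf_norm G (\<lambda>g\<in>G. v g - u g) < d \<longrightarrow> cmod (\<eta> v - \<eta> u) < e)}"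

definition weak_star_topology ::
  "('a \<Rightarrow> 'a) set \<Rightarrow> (('a \<Rightarrow> 'a) \<Rightarrow> complex) set \<Rightarrow> 'a character topology" where
  "weak_star_topology G \<aa> =
     subtopology (product_topology (\<lambda>_. euclidean) \<aa>) (max_ideal_space G \<aa>)"

definition point_eval ::
  "(('a \<Rightarrow> 'a) \<Rightarrow> complex) set \<Rightarrow> ('a \<Rightarrow> 'a) \<Rightarrow> 'a character" where
  "point_eval \<aa> g = (\<lambda>u\<in>\<aa>. u g)"

text \<open>The closure of the image of \<open>G\<close>, as a topological space.\<close>

definition Ghat :: "('a \<Rightarrow> 'a) set \<Rightarrow> (('a \<Rightarrow> 'a) \<Rightarrow> complex) set \<Rightarrow> 'a character topology" where
  "Ghat G \<aa> = subtopology (weak_star_topology G \<aa>)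
                 (weak_star_topology G \<aa> closure_of (point_eval \<aa> ` G))"

definition right_action ::
  "('a \<Rightarrow> 'a) set \<Rightarrow> (('a \<Rightarrow> 'a) \<Rightarrow> complex) set \<Rightarrow> 'a character \<Rightarrow> ('a \<Rightarrow> 'a) \<Rightarrow> 'a character" where
  "right_action G \<aa> \<eta> g = (\<lambda>u\<in>\<aa>. \<eta> (right_translate G g u))"

section \<open>The fibrewise compactification\<close>

text \<open>
  The data: the covering \<open>p\<close>, the dimension and an atlas of the base, the algebra, and a presentation
  of \<open>p\<close> as a principal bundle by an open cover, trivializations over it (second components), and
  the cocycle.
\<close>

record ('a, 'b, 'i) fc_data =
  cproj :: "'a \<Rightarrow> 'b"
  cdim :: nat
  catlas :: "'b atlas"
  calg :: "(('a \<Rightarrow> 'a) \<Rightarrow> complex) set"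
  cov :: "'i \<Rightarrow> 'b set"
  ctriv :: "'i \<Rightarrow> 'a \<Rightarrow> ('a \<Rightarrow> 'a)"
  cocyc :: "'i \<Rightarrow> 'i \<Rightarrow> 'b \<Rightarrow> ('a \<Rightarrow> 'a)"

definition deckG :: "('a::topological_space, 'b, 'i) fc_data \<Rightarrow> ('a \<Rightarrow> 'a) set" where
  "deckG D = deck (cproj D)"

text \<open>
  The transition condition says that the points \<open>(x, g)\<close> over the \<open>\<delta>\<close>-th set and \<open>(x, g \<circ> c\<^sub>\<delta>\<^sub>\<gamma>(x))\<close> over
  the \<open>\<gamma>\<close>-th set represent the same point of the total space.
\<close>

definition fc_setting ::
  "('a::topological_space, 'b::{t2_space, second_countable_topology}, 'i) fc_data \<Rightarrow> bool" where
  "fc_setting D \<longleftrightarrow>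
     complex_atlas (cdim D) (catlas D) \<and>
     connected (UNIV :: 'b set) \<and>
     regular_covering (cproj D) \<and>
     closed_unital_subalgebra (deckG D) (calg D) \<and>
     (\<forall>u\<in>calg D. \<forall>g\<in>deckG D. right_translate (deckG D) g u \<in> calg D) \<and>
     (\<Union>\<gamma>. cov D \<gamma>) = UNIV \<and>
     (\<forall>\<gamma>. open (cov D \<gamma>) \<and> simply_connected (cov D \<gamma>) \<and>
           principal_triv (cproj D) (cov D \<gamma>) (ctriv D \<gamma>)) \<and>
     (\<forall>\<delta> \<gamma>. \<forall>x\<in>cov D \<gamma> \<inter> cov D \<delta>. cocyc D \<delta> \<gamma> x \<in> deckG D \<and>
           (\<exists>V. open V \<and> x \<in> V \<and> V \<subseteq> cov D \<gamma> \<inter> cov D \<delta> \<and> cocyc D \<delta> \<gamma> constant_on V)) \<and>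
     (\<forall>\<delta> \<gamma> y. cproj D y \<in> cov D \<gamma> \<inter> cov D \<delta> \<longrightarrow>
           ctriv D \<gamma> y = ctriv D \<delta> y \<circ> cocyc D \<delta> \<gamma> (cproj D y))"

definition quotient_topology :: "'x topology \<Rightarrow> ('x \<Rightarrow> 'y) \<Rightarrow> 'y topology" where
  "quotient_topology X q =
     topology (\<lambda>V. V \<subseteq> q ` topspace X \<and> openin X {x \<in> topspace X. q x \<in> V})"

lemma openin_quotient_topology:
  "openin (quotient_topology X q) V \<longleftrightarrow>
     V \<subseteq> q ` topspace X \<and> openin X {x \<in> topspace X. q x \<in> V}"
proof -
  have "istopology (\<lambda>V. V \<subseteq> q ` topspace X \<and> openin X {x \<in> topspace X. q x \<in> V})"
    unfolding istopology_def
  proof (intro conjI allI impI)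
    fix S T
    assume S: "S \<subseteq> q ` topspace X \<and> openin X {x \<in> topspace X. q x \<in> S}"
      and T: "T \<subseteq> q ` topspace X \<and> openin X {x \<in> topspace X. q x \<in> T}"
    have "{x \<in> topspace X. q x \<in> S \<inter> T} = {x \<in> topspace X. q x \<in> S} \<inter> {x \<in> topspace X. q x \<in> T}"
      by blast
    with S T show "openin X {x \<in> topspace X. q x \<in> S \<inter> T}"
      by (simp add: openin_Int)
    show "S \<inter> T \<subseteq> q ` topspace X" using S by blast
  next
    fix \<K>
    assume K: "\<forall>S\<in>\<K>. S \<subseteq> q ` topspace X \<and> openin X {x \<in> topspace X. q x \<in> S}"
    have "{x \<in> topspace X. q x \<in> \<Union>\<K>} = (\<Union>S\<in>\<K>. {x \<in> topspace X. q x \<in> S})"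
      by blast
    moreover have "openin X (\<Union>S\<in>\<K>. {x \<in> topspace X. q x \<in> S})"
      using K by (intro openin_Union) blast
    ultimately show "openin X {x \<in> topspace X. q x \<in> \<Union>\<K>}" by simp
    show "\<Union>\<K> \<subseteq> q ` topspace X" using K by blast
  qed
  then show ?thesis
    by (simp add: quotient_topology_def topology_inverse')
qed

abbreviation fibre :: "('a::topological_space, 'b, 'i) fc_data \<Rightarrow> 'a character topology" where
  "fibre D \<equiv> Ghat (deckG D) (calg D)"

definition local_pieces ::
  "('a::topological_space, 'b::topological_space, 'i) fc_data \<Rightarrow> ('i \<times> 'b \<times> 'a character) topology" where
  "local_pieces D = sum_topology (\<lambda>\<gamma>. prod_topology (top_of_set (cov D \<gamma>)) (fibre D)) UNIV"

definition glue ::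
  "('a::topological_space, 'b, 'i) fc_data \<Rightarrow> (('i \<times> 'b \<times> 'a character) \<times> ('i \<times> 'b \<times> 'a character)) set" where
  "glue D = {((\<delta>, x, \<omega>), (\<gamma>, x, right_action (deckG D) (calg D) \<omega> (cocyc D \<delta> \<gamma> x))) | \<delta> \<gamma> x \<omega>.
               x \<in> cov D \<gamma> \<inter> cov D \<delta> \<and> \<omega> \<in> topspace (fibre D)}"

text \<open>Points of the fibrewise compactification are equivalence classes of the gluing relation.\<close>

type_synonym ('a, 'b, 'i) cpoint = "('i \<times> 'b \<times> 'a character) set"

definition caX ::
  "('a::topological_space, 'b::topological_space, 'i) fc_data \<Rightarrow> ('a, 'b, 'i) cpoint topology" where
  "caX D = quotient_topology (local_pieces D) (\<lambda>e. glue D `` {e})"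

text \<open>All representatives of a class have the same base point.\<close>

definition pbar :: "('a, 'b, 'i) fc_data \<Rightarrow> ('a, 'b, 'i) cpoint \<Rightarrow> 'b" where
  "pbar D P = fst (snd (SOME e. e \<in> P))"

definition iota :: "('a::topological_space, 'b, 'i) fc_data \<Rightarrow> 'a \<Rightarrow> ('a, 'b, 'i) cpoint" where
  "iota D x = (let \<gamma> = (SOME \<gamma>. cproj D x \<in> cov D \<gamma>)
               in glue D `` {(\<gamma>, cproj D x, point_eval (calg D) (ctriv D \<gamma> x))})"

text \<open>\<open>\<Psi>\<close> is a trivialization of the compactification over \<open>U0\<close>, compatible with one of the covering.\<close>

definition compatible_triv ::
  "('a::topological_space, 'b::topological_space, 'i) fc_data \<Rightarrow> 'b set
     \<Rightarrow> (('a, 'b, 'i) cpoint \<Rightarrow> 'b \<times> 'a character) \<Rightarrow> bool" where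
  "compatible_triv D U0 \<Psi> \<longleftrightarrow>
     homeomorphic_map (subtopology (caX D) {P. pbar D P \<in> U0})
       (prod_topology (top_of_set U0) (fibre D)) \<Psi> \<and>
     (\<forall>P\<in>topspace (caX D). pbar D P \<in> U0 \<longrightarrow> fst (\<Psi> P) = pbar D P) \<and>
     (\<exists>\<psi>. principal_triv (cproj D) U0 \<psi> \<and>
        (\<forall>x. cproj D x \<in> U0 \<longrightarrow> \<Psi> (iota D x) = (cproj D x, point_eval (calg D) (\<psi> x))))"

definition Pi_hat ::
  "('a::topological_space, 'b::topological_space, 'i) fc_data
     \<Rightarrow> (('a, 'b, 'i) cpoint \<Rightarrow> 'b \<times> 'a character) \<Rightarrow> 'b set \<Rightarrow> 'a character set
     \<Rightarrow> ('a, 'b, 'i) cpoint set" where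
  "Pi_hat D \<Psi> U0 K = {P \<in> topspace (caX D). pbar D P \<in> U0 \<and> \<Psi> P \<in> U0 \<times> K}"

section \<open>Holomorphic functions and complex submanifolds\<close>

text \<open>Functions on a set \<open>U\<close> are represented by functions that are extensional on \<open>U\<close>.\<close>

definition holo_caX ::
  "('a::topological_space, 'b::topological_space, 'i) fc_data \<Rightarrow> ('a, 'b, 'i) cpoint set
     \<Rightarrow> (('a, 'b, 'i) cpoint \<Rightarrow> complex) set" where
  "holo_caX D U = {f \<in> extensional U.
     continuous_map (subtopology (caX D) U) euclidean f \<and>
     mfd_holo (cdim D) (lift_atlas (cproj D) (catlas D)) (iota D -` U) (\<lambda>x. f (iota D x))}"

definition holo_submfd ::
  "('a::topological_space, 'b::topological_space, 'i) fc_data \<Rightarrow> ('a, 'b, 'i) cpoint set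
     \<Rightarrow> ('a, 'b, 'i) cpoint set \<Rightarrow> (('a, 'b, 'i) cpoint \<Rightarrow> complex) set" where
  "holo_submfd D Y W = {f \<in> extensional W.
     continuous_map (subtopology (caX D) W) euclidean f \<and>
     submfd_holo (cdim D) (lift_atlas (cproj D) (catlas D)) (iota D -` Y) (iota D -` W)
       (\<lambda>x. f (iota D x))}"

text \<open>
  The rank at \<open>z\<close> of a \<open>k\<close>-tuple of functions near \<open>z\<close>, computed in the chart \<open>(V, \<phi>)\<close>.
\<close>

definition chart_rank ::
  "nat \<Rightarrow> 'b set \<Rightarrow> ('b \<Rightarrow> nat \<Rightarrow> complex) \<Rightarrow> nat \<Rightarrow> (nat \<Rightarrow> 'b \<Rightarrow> complex) \<Rightarrow> 'b \<Rightarrow> nat" where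
  "chart_rank n V \<phi> k f z =
     vec_space.rank k (mat k n (\<lambda>(i, j). partial_deriv j (\<lambda>w. f i (inv_into V \<phi> w)) (\<phi> z)))"

definition complex_submanifold ::
  "('a::topological_space, 'b::topological_space, 'i) fc_data \<Rightarrow> nat \<Rightarrow> ('a, 'b, 'i) cpoint set \<Rightarrow> bool" where
  "complex_submanifold D k Y \<longleftrightarrow>
     closedin (caX D) Y \<and>
     (\<forall>y\<in>Y. \<exists>U0 \<Psi> K h.
        open U0 \<and> simply_connected U0 \<and> compatible_triv D U0 \<Psi> \<and> openin (fibre D) K \<and>
        y \<in> Pi_hat D \<Psi> U0 K \<and>
        (\<forall>i<k. h i \<in> holo_caX D (Pi_hat D \<Psi> U0 K)) \<and>
        Y \<inter> Pi_hat D \<Psi> U0 K = {x \<in> Pi_hat D \<Psi> U0 K. \<forall>i<k. h i x = 0} \<and>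
        (\<forall>z\<in>U0. \<forall>\<omega>\<in>K. inv_into (Pi_hat D \<Psi> U0 K) \<Psi> (z, \<omega>) \<in> Y \<longrightarrow>
           (\<forall>(V, \<phi>)\<in>catlas D. z \<in> V \<longrightarrow>
              chart_rank (cdim D) V \<phi> k
                (\<lambda>i z'. h i (inv_into (Pi_hat D \<Psi> U0 K) \<Psi> (z', \<omega>))) z = k)))"

section \<open>Sheaves of modules over a sheaf of rings of functions\<close>

definition function_ring :: "'x set \<Rightarrow> ('x \<Rightarrow> complex) set \<Rightarrow> ('x \<Rightarrow> complex) ring" where
  "function_ring U F =
     \<lparr>carrier = F,
      monoid.mult = (\<lambda>f g. \<lambda>x\<in>U. f x * g x),
      one = (\<lambda>x\<in>U. 1),
      zero = (\<lambda>x\<in>U. 0),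
      add = (\<lambda>f g. \<lambda>x\<in>U. f x + g x)\<rparr>"

definition O_caX ::
  "('a::topological_space, 'b::topological_space, 'i) fc_data \<Rightarrow> ('a, 'b, 'i) cpoint set
     \<Rightarrow> (('a, 'b, 'i) cpoint \<Rightarrow> complex) ring" where
  "O_caX D U = function_ring U (holo_caX D U)"

definition O_submfd ::
  "('a::topological_space, 'b::topological_space, 'i) fc_data \<Rightarrow> ('a, 'b, 'i) cpoint set
     \<Rightarrow> ('a, 'b, 'i) cpoint set \<Rightarrow> (('a, 'b, 'i) cpoint \<Rightarrow> complex) ring" where
  "O_submfd D Y W = function_ring W (holo_submfd D Y W)"

text \<open>
  \<open>R\<close> assigns to every open set a ring of functions on it (with restriction of functions as the
  restriction maps). A sheaf of \<open>R\<close>-modules assigns to every open set a module over the ring of that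
  set, and has restriction maps \<open>res U V\<close> for \<open>V \<subseteq> U\<close>. The fields \<^const>\<open>monoid.mult\<close> and
  \<^const>\<open>monoid.one\<close> of the module records carry no meaning.
\<close>

record ('x, 's) msheaf =
  sec :: "'x set \<Rightarrow> ('x \<Rightarrow> complex, 's) module"
  res :: "'x set \<Rightarrow> 'x set \<Rightarrow> 's \<Rightarrow> 's"

definition sheaf_of_modules ::
  "'x topology \<Rightarrow> ('x set \<Rightarrow> ('x \<Rightarrow> complex) ring) \<Rightarrow> ('x, 's) msheaf \<Rightarrow> bool" where
  "sheaf_of_modules T R A \<longleftrightarrow>
     (\<forall>U. openin T U \<longrightarrow> Module.module (R U) (sec A U)) \<and>
     (\<forall>U V. openin T U \<and> openin T V \<and> V \<subseteq> U \<longrightarrow>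
        res A U V \<in> carrier (sec A U) \<rightarrow> carrier (sec A V) \<and>
        (\<forall>s\<in>carrier (sec A U). \<forall>t\<in>carrier (sec A U).
           res A U V (s \<oplus>\<^bsub>sec A U\<^esub> t) = res A U V s \<oplus>\<^bsub>sec A V\<^esub> res A U V t) \<and>
        (\<forall>f\<in>carrier (R U). \<forall>s\<in>carrier (sec A U).
           res A U V (f \<odot>\<^bsub>sec A U\<^esub> s) = restrict f V \<odot>\<^bsub>sec A V\<^esub> res A U V s)) \<and>
     (\<forall>U. openin T U \<longrightarrow> (\<forall>s\<in>carrier (sec A U). res A U U s = s)) \<and>
     (\<forall>U V W. openin T U \<and> openin T V \<and> openin T W \<and> W \<subseteq> V \<and> V \<subseteq> U \<longrightarrow>
        (\<forall>s\<in>carrier (sec A U). res A V W (res A U V s) = res A U W s)) \<and>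
     (\<forall>\<V>. (\<forall>V\<in>\<V>. openin T V) \<longrightarrow>
        (\<forall>s\<in>carrier (sec A (\<Union>\<V>)). \<forall>t\<in>carrier (sec A (\<Union>\<V>)).
           (\<forall>V\<in>\<V>. res A (\<Union>\<V>) V s = res A (\<Union>\<V>) V t) \<longrightarrow> s = t) \<and>
        (\<forall>\<sigma>. (\<forall>V\<in>\<V>. \<sigma> V \<in> carrier (sec A V)) \<and>
             (\<forall>V\<in>\<V>. \<forall>W\<in>\<V>. res A V (V \<inter> W) (\<sigma> V) = res A W (V \<inter> W) (\<sigma> W)) \<longrightarrow>
             (\<exists>s\<in>carrier (sec A (\<Union>\<V>)). \<forall>V\<in>\<V>. res A (\<Union>\<V>) V s = \<sigma> V)))"

text \<open>The free sheaf \<open>R\<^sup>m\<close>; its sections are \<open>m\<close>-tuples indexed by \<open>{..<m}\<close>.\<close>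

definition free_sheaf ::
  "('x set \<Rightarrow> ('x \<Rightarrow> complex) ring) \<Rightarrow> nat \<Rightarrow> ('x, nat \<Rightarrow> 'x \<Rightarrow> complex) msheaf" where
  "free_sheaf R m =
     \<lparr>sec = (\<lambda>U.
        \<lparr>carrier = {..<m} \<rightarrow>\<^sub>E carrier (R U),
         monoid.mult = undefined,
         one = undefined,
         zero = (\<lambda>i\<in>{..<m}. \<zero>\<^bsub>R U\<^esub>),
         add = (\<lambda>v w. \<lambda>i\<in>{..<m}. v i \<oplus>\<^bsub>R U\<^esub> w i),
         smult = (\<lambda>f v. \<lambda>i\<in>{..<m}. f \<otimes>\<^bsub>R U\<^esub> v i)\<rparr>),
      res = (\<lambda>U V v. \<lambda>i\<in>{..<m}. restrict (v i) V)\<rparr>"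

text \<open>Morphisms, exactness and surjectivity over an open set \<open>V\<close>, in the sense of sheaves.\<close>

definition sheaf_hom ::
  "'x topology \<Rightarrow> ('x set \<Rightarrow> ('x \<Rightarrow> complex) ring) \<Rightarrow> 'x set \<Rightarrow> ('x, 's) msheaf \<Rightarrow> ('x, 't) msheaf
     \<Rightarrow> ('x set \<Rightarrow> 's \<Rightarrow> 't) \<Rightarrow> bool" where
  "sheaf_hom T R V A B \<phi> \<longleftrightarrow>
     (\<forall>W. openin T W \<and> W \<subseteq> V \<longrightarrow>
        \<phi> W \<in> LinearCombinations.module_hom (R W) (sec A W) (sec B W)) \<and>
     (\<forall>W W'. openin T W \<and> openin T W' \<and> W' \<subseteq> W \<and> W \<subseteq> V \<longrightarrow>
        (\<forall>s\<in>carrier (sec A W). \<phi> W' (res A W W' s) = res B W W' (\<phi> W s)))"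

definition locally_in_image ::
  "'x topology \<Rightarrow> ('x, 's) msheaf \<Rightarrow> ('x, 't) msheaf \<Rightarrow> ('x set \<Rightarrow> 's \<Rightarrow> 't) \<Rightarrow> 'x set \<Rightarrow> 't \<Rightarrow> bool" where
  "locally_in_image T A B \<phi> W t \<longleftrightarrow>
     (\<forall>x\<in>W. \<exists>W'. openin T W' \<and> x \<in> W' \<and> W' \<subseteq> W \<and>
        (\<exists>s\<in>carrier (sec A W'). \<phi> W' s = res B W W' t))"

definition exact_at ::
  "'x topology \<Rightarrow> 'x set \<Rightarrow> ('x, 's) msheaf \<Rightarrow> ('x, 't) msheaf \<Rightarrow> ('x, 'u) msheaf
     \<Rightarrow> ('x set \<Rightarrow> 's \<Rightarrow> 't) \<Rightarrow> ('x set \<Rightarrow> 't \<Rightarrow> 'u) \<Rightarrow> bool" where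
  "exact_at T V A B C \<phi> \<psi> \<longleftrightarrow>
     (\<forall>W. openin T W \<and> W \<subseteq> V \<longrightarrow>
        (\<forall>t\<in>carrier (sec B W). \<psi> W t = \<zero>\<^bsub>sec C W\<^esub> \<longleftrightarrow> locally_in_image T A B \<phi> W t))"

definition sheaf_surj ::
  "'x topology \<Rightarrow> 'x set \<Rightarrow> ('x, 's) msheaf \<Rightarrow> ('x, 't) msheaf \<Rightarrow> ('x set \<Rightarrow> 's \<Rightarrow> 't) \<Rightarrow> bool" where
  "sheaf_surj T V A B \<phi> \<longleftrightarrow>
     (\<forall>W. openin T W \<and> W \<subseteq> V \<longrightarrow> (\<forall>t\<in>carrier (sec B W). locally_in_image T A B \<phi> W t))"

text \<open>
  A free resolution \<open>R\<^sup>m\<^sup>N \<rightarrow> \<dots> \<rightarrow> R\<^sup>m\<^sup>2 \<rightarrow> R\<^sup>m\<^sup>1 \<rightarrow> A \<rightarrow> 0\<close> of length \<open>N\<close> over \<open>V\<close>, with exponents \<open>m 1, \<dots>, m N\<close>,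
  augmentation \<open>\<epsilon>\<close> and differentials \<open>d i\<close> from the \<open>(i+1)\<close>-st to the \<open>i\<close>-th free sheaf. No injectivity
  is required at the left end.
\<close>

definition has_free_resolution ::
  "'x topology \<Rightarrow> ('x set \<Rightarrow> ('x \<Rightarrow> complex) ring) \<Rightarrow> ('x, 's) msheaf \<Rightarrow> 'x set \<Rightarrow> nat \<Rightarrow> bool" where
  "has_free_resolution T R A V N \<longleftrightarrow>
     (\<exists>m \<epsilon> d.
        sheaf_hom T R V (free_sheaf R (m 1)) A \<epsilon> \<and>
        sheaf_surj T V (free_sheaf R (m 1)) A \<epsilon> \<and>
        (\<forall>i. 1 \<le> i \<and> i < N \<longrightarrow>
           sheaf_hom T R V (free_sheaf R (m (i + 1))) (free_sheaf R (m i)) (d i)) \<and>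
        (1 < N \<longrightarrow>
           exact_at T V (free_sheaf R (m 2)) (free_sheaf R (m 1)) A (d 1) \<epsilon>) \<and>
        (\<forall>i. 1 \<le> i \<and> i + 1 < N \<longrightarrow>
           exact_at T V (free_sheaf R (m (i + 2))) (free_sheaf R (m (i + 1))) (free_sheaf R (m i))
             (d (i + 1)) (d i)))"

definition coherent_sheaf ::
  "'x topology \<Rightarrow> ('x set \<Rightarrow> ('x \<Rightarrow> complex) ring) \<Rightarrow> ('x, 's) msheaf \<Rightarrow> bool" where
  "coherent_sheaf T R A \<longleftrightarrow>
     sheaf_of_modules T R A \<and>
     (\<forall>x\<in>topspace T. \<exists>V. openin T V \<and> x \<in> V \<and> (\<forall>N\<ge>1. has_free_resolution T R A V N))"

text \<open>
  The extension by zero of a sheaf on a closed set \<open>Y\<close>: its sections over \<open>V\<close> are the sections over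
  \<open>V \<inter> Y\<close>, on which functions on \<open>V\<close> act through restriction. So it has the given germs at the points of
  \<open>Y\<close> and, as \<open>Y\<close> is closed, zero germs elsewhere (lemma \<open>trivial_extension_off\<close>).
\<close>

definition trivial_extension :: "'x set \<Rightarrow> ('x, 's) msheaf \<Rightarrow> ('x, 's) msheaf" where
  "trivial_extension Y A =
     \<lparr>sec = (\<lambda>V. (sec A (V \<inter> Y))
        \<lparr>smult := (\<lambda>f s. restrict f (V \<inter> Y) \<odot>\<^bsub>sec A (V \<inter> Y)\<^esub> s)\<rparr>),
      res = (\<lambda>U V. res A (U \<inter> Y) (V \<inter> Y))\<rparr>"

lemma trivial_extension_off:
  assumes "sheaf_of_modules T R A" and "V \<inter> Y = {}"
  shows "carrier (sec (trivial_extension Y A) V) = {\<zero>\<^bsub>sec (trivial_extension Y A) V\<^esub>}"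
proof -
  have "Module.module (R {}) (sec A {})"
    using assms(1) by (simp add: sheaf_of_modules_def)
  then have "abelian_group (sec A {})"
    by (simp add: Module.module_def)
  then have zero: "\<zero>\<^bsub>sec A {}\<^esub> \<in> carrier (sec A {})"
    by (simp add: abelian_groupE(2))
  have glue: "(\<forall>V\<in>\<V>. openin T V) \<Longrightarrow>
      \<forall>s\<in>carrier (sec A (\<Union>\<V>)). \<forall>t\<in>carrier (sec A (\<Union>\<V>)).
        (\<forall>V\<in>\<V>. res A (\<Union>\<V>) V s = res A (\<Union>\<V>) V t) \<longrightarrow> s = t" for \<V>
    using assms(1)[unfolded sheaf_of_modules_def, THEN conjunct2, THEN conjunct2, THEN conjunct2,
        THEN conjunct2] by meson
  from glue[of "{}"] zero have "carrier (sec A {}) = {\<zero>\<^bsub>sec A {}\<^esub>}" by auto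
  then show ?thesis by (simp add: trivial_extension_def assms(2))
qed

end

theory Submission
  imports Defs "HOL-Complex_Analysis.Complex_Analysis"
begin

text \<open>
  Near a point of \<open>Y\<close>, the inverse function theorem with the fibre coordinate \<open>\<omega>\<close> as a continuous
  parameter makes the defining functions \<open>h\<^sub>1, \<dots>, h\<^sub>k\<close> into linear coordinates. The linear projections
  onto their zero sets are retractions \<open>r\<^sub>i\<close>, and a section vanishing where \<open>h\<^sub>i = 0\<close> is divisible by
  \<open>h\<^sub>i\<close>, so it suffices to extend resolutions from \<open>S = {h = 0}\<close> one function at a time. There the
  pullback by \<open>r\<close> lifts the matrices of a resolution on \<open>S\<close> to the ambient space, and the mapping cone
  of multiplication by \<open>h\<close> on the lifted free sheaves resolves the trivial extension (this covers the
  Koszul complex of \<open>h\<^sub>1, \<dots>, h\<^sub>k\<close>, when \<open>\<A> = \<O>\<^sub>Y\<close>). Holomorphy of a continuous function on the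
  fibrewise compactification can be checked on the slices \<open>\<omega> \<in> j(G)\<close>, because these are dense and
  Cauchy's formula passes to limits; thus the rings in the straightened chart are those of
  \<open>c\<^sub>\<aa>X\<close> and \<open>Y\<close>. Off the closed set \<open>Y\<close> the extension is zero.
\<close>

section \<open>Free resolutions across a hypersurface\<close>

text \<open>A chart of the compactification has complex coordinates only along the base; in the
  fibre there is just a topology. So each analytic tool is needed in the form: holomorphic in z,
  continuous in \<omega>, on a neighbourhood common to all nearby \<omega>. The definitions give
  less: a section of the structure sheaf of \<open>Y\<close> has its holomorphic extensions sheet by
  sheet in X, on sets that may shrink from sheet to sheet. Composition with the retraction is one
  extension for all sheets. Therefore the ring of a zero set is encoded by such pullbacks
  (\<open>Fz\<close>) and compared with \<open>holo_submfd\<close> only in the final chart. Lifting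
  a complex of free sheaves from a subspace normally produces matrices whose products vanish only
  modulo the ideal, and homotopies must repair this. Composition with \<open>r\<close> is a ring
  homomorphism, so identities on \<open>S\<close> hold verbatim upstairs, and the cone consists of
  the lifted matrices and \<open>h\<close> alone. Its exactness reduces to division by
  \<open>h\<close> and cancellation of \<open>h\<close>. No length is lost: the cone in degree i
  uses the degrees i and i - 1 of the given resolution, so length N on \<open>S\<close> gives length
  N.\<close>

definition function_subring :: "'x set \<Rightarrow> ('x \<Rightarrow> complex) set \<Rightarrow> bool" where
  "function_subring U F \<longleftrightarrow> F \<subseteq> extensional U \<and> (\<forall>c. (\<lambda>x\<in>U. c) \<in> F) \<and>
     (\<forall>f\<in>F. \<forall>g\<in>F. (\<lambda>x\<in>U. f x + g x) \<in> F \<and> (\<lambda>x\<in>U. f x * g x) \<in> F)"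

lemma function_subring_extensional: "function_subring U F \<Longrightarrow> f \<in> F \<Longrightarrow> f \<in> extensional U"
  by (auto simp: function_subring_def)

lemma function_subring_uminus:
  assumes "function_subring U F" "f \<in> F"
  shows "(\<lambda>x\<in>U. - f x) \<in> F"
proof -
  have "(\<lambda>x\<in>U. (\<lambda>x\<in>U. - 1) x * f x) \<in> F"
    using assms unfolding function_subring_def by blast
  moreover have "(\<lambda>x\<in>U. (\<lambda>x\<in>U. - 1) x * f x) = (\<lambda>x\<in>U. - f x)"
    by (auto simp: fun_eq_iff)
  ultimately show ?thesis by simp
qed

lemma function_subring_sum:
  assumes "function_subring U F" "finite I" "\<And>i. i \<in> I \<Longrightarrow> (\<lambda>x\<in>U. f i x) \<in> F"
  shows "(\<lambda>x\<in>U. \<Sum>i\<in>I. f i x) \<in> F"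
  using assms(2,3)
proof (induction I rule: finite_induct)
  case empty
  show ?case using assms(1) unfolding function_subring_def sum.empty by blast
next
  case (insert i I)
  then have "(\<lambda>x\<in>U. (\<lambda>x\<in>U. f i x) x + (\<lambda>x\<in>U. \<Sum>i\<in>I. f i x) x) \<in> F"
    using assms(1) unfolding function_subring_def by blast
  moreover have "(\<lambda>x\<in>U. (\<lambda>x\<in>U. f i x) x + (\<lambda>x\<in>U. \<Sum>i\<in>I. f i x) x)
      = (\<lambda>x\<in>U. \<Sum>i\<in>insert i I. f i x)"
    using insert by (auto simp: fun_eq_iff)
  ultimately show ?case by (simp only:)
qed

lemma function_ring_sel [simp]:
  "carrier (function_ring U F) = F"
  "f \<otimes>\<^bsub>function_ring U F\<^esub> g = (\<lambda>x\<in>U. f x * g x)"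
  "\<one>\<^bsub>function_ring U F\<^esub> = (\<lambda>x\<in>U. 1)"
  "\<zero>\<^bsub>function_ring U F\<^esub> = (\<lambda>x\<in>U. 0)"
  "f \<oplus>\<^bsub>function_ring U F\<^esub> g = (\<lambda>x\<in>U. f x + g x)"
  by (simp_all add: function_ring_def)

lemma function_subring_cring:
  assumes "function_subring U F"
  shows "cring (function_ring U F)"
proof (rule cringI)
  show "abelian_group (function_ring U F)"
  proof (rule abelian_groupI)
    fix f assume f: "f \<in> carrier (function_ring U F)"
    then have "f \<in> extensional U"
      using function_subring_extensional[OF assms] by simp
    then show "\<zero>\<^bsub>function_ring U F\<^esub> \<oplus>\<^bsub>function_ring U F\<^esub> f = f"
      by (auto simp: fun_eq_iff extensional_def)
    show "\<exists>g\<in>carrier (function_ring U F). g \<oplus>\<^bsub>function_ring U F\<^esub> f = \<zero>\<^bsub>function_ring U F\<^esub>"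
      using f function_subring_uminus[OF assms, of f] by (intro bexI[of _ "\<lambda>x\<in>U. - f x"]) auto
  qed (use assms in \<open>auto simp: function_subring_def fun_eq_iff\<close>)
  show "Group.comm_monoid (function_ring U F)"
  proof (rule comm_monoidI)
    fix f assume f: "f \<in> carrier (function_ring U F)"
    then have "f \<in> extensional U"
      using function_subring_extensional[OF assms] by simp
    then show "\<one>\<^bsub>function_ring U F\<^esub> \<otimes>\<^bsub>function_ring U F\<^esub> f = f"
      by (auto simp: fun_eq_iff extensional_def)
  qed (use assms in \<open>auto simp: function_subring_def fun_eq_iff\<close>)
qed (auto simp: fun_eq_iff algebra_simps)

section \<open>Free sheaves over rings of functions, and their matrices\<close>

abbreviation free_mod :: "('x set \<Rightarrow> ('x \<Rightarrow> complex) set) \<Rightarrow> nat \<Rightarrow> ('x, nat \<Rightarrow> 'x \<Rightarrow> complex) msheaf" where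
  "free_mod F m \<equiv> free_sheaf (\<lambda>U. function_ring U (F U)) m"

lemma free_sheaf_sel [simp]:
  "carrier (sec (free_mod F m) U) = {..<m} \<rightarrow>\<^sub>E F U"
  "\<zero>\<^bsub>sec (free_mod F m) U\<^esub> = (\<lambda>i\<in>{..<m}. \<lambda>x\<in>U. 0)"
  "v \<oplus>\<^bsub>sec (free_mod F m) U\<^esub> w = (\<lambda>i\<in>{..<m}. \<lambda>x\<in>U. v i x + w i x)"
  "f \<odot>\<^bsub>sec (free_mod F m) U\<^esub> v = (\<lambda>i\<in>{..<m}. \<lambda>x\<in>U. f x * v i x)"
  "res (free_mod F m) U V v = (\<lambda>i\<in>{..<m}. restrict (v i) V)"
  by (simp_all add: free_sheaf_def)

text \<open>The entries of \<open>E\<close> live on a fixed larger open set and are only evaluated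
  at points of \<open>W\<close>, so one matrix acts over all smaller open sets.\<close>

definition mat_map ::
  "nat \<Rightarrow> nat \<Rightarrow> (nat \<Rightarrow> nat \<Rightarrow> 'x \<Rightarrow> complex) \<Rightarrow> 'x set \<Rightarrow> (nat \<Rightarrow> 'x \<Rightarrow> complex) \<Rightarrow> nat \<Rightarrow> 'x \<Rightarrow> complex" where
  "mat_map p q E W v = (\<lambda>a\<in>{..<p}. \<lambda>x\<in>W. \<Sum>b<q. E a b x * v b x)"

text \<open>Rings of functions with restriction. Sections are extensional functions, so equality of
  values is equality of sections (\<open>ext_eqI\<close>).\<close>

locale function_sheaf =
  fixes T :: "'x topology" and F :: "'x set \<Rightarrow> ('x \<Rightarrow> complex) set"
  assumes subring: "openin T U \<Longrightarrow> function_subring U (F U)"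
    and restr: "openin T U \<Longrightarrow> openin T W \<Longrightarrow> W \<subseteq> U \<Longrightarrow> f \<in> F U \<Longrightarrow> restrict f W \<in> F W"
begin

abbreviation "R \<equiv> \<lambda>U. function_ring U (F U)"

lemma ext_eqI:
  assumes "openin T U" "f \<in> F U" "g \<in> F U" "\<And>x. x \<in> U \<Longrightarrow> f x = g x"
  shows "f = g"
  using function_subring_extensional[OF subring[OF assms(1)]] assms(2-4)
  by (metis extensionalityI)

lemma vec_eqI:
  assumes "openin T U" "v \<in> {..<m} \<rightarrow>\<^sub>E F U" "w \<in> {..<m} \<rightarrow>\<^sub>E F U" "\<And>i x. i < m \<Longrightarrow> x \<in> U \<Longrightarrow> v i x = w i x"
  shows "v = w"
proof (rule PiE_ext[OF assms(2,3)])
  fix i assume "i \<in> {..<m}"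
  then show "v i = w i" using assms by (intro ext_eqI[of U]) auto
qed

lemma const: "openin T U \<Longrightarrow> (\<lambda>x\<in>U. c) \<in> F U"
  and add: "openin T U \<Longrightarrow> f \<in> F U \<Longrightarrow> g \<in> F U \<Longrightarrow> (\<lambda>x\<in>U. f x + g x) \<in> F U"
  and mult: "openin T U \<Longrightarrow> f \<in> F U \<Longrightarrow> g \<in> F U \<Longrightarrow> (\<lambda>x\<in>U. f x * g x) \<in> F U"
  and uminus: "openin T U \<Longrightarrow> f \<in> F U \<Longrightarrow> (\<lambda>x\<in>U. - f x) \<in> F U"
  using subring[of U] function_subring_uminus[of U] by (auto simp: function_subring_def)

lemma mat_map_in:
  assumes "openin T V" "openin T W" "W \<subseteq> V" "\<And>a b. a < p \<Longrightarrow> b < q \<Longrightarrow> E a b \<in> F V"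
    and "v \<in> {..<q} \<rightarrow>\<^sub>E F W"
  shows "mat_map p q E W v \<in> {..<p} \<rightarrow>\<^sub>E F W"
proof -
  have "(\<lambda>x\<in>W. \<Sum>b<q. E a b x * v b x) \<in> F W" if "a < p" for a
  proof (rule function_subring_sum[OF subring])
    fix b assume "b \<in> {..<q}"
    then have "(\<lambda>x\<in>W. restrict (E a b) W x * v b x) \<in> F W"
      using assms that by (intro mult restr) auto
    then show "(\<lambda>x\<in>W. E a b x * v b x) \<in> F W"
      by (simp cong: restrict_cong)
  qed (use assms in auto)
  then show ?thesis by (auto simp: mat_map_def)
qed

lemma mat_map_hom:
  assumes "openin T V" "\<And>a b. a < p \<Longrightarrow> b < q \<Longrightarrow> E a b \<in> F V"
  shows "sheaf_hom T R V (free_mod F q) (free_mod F p) (mat_map p q E)"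
  unfolding sheaf_hom_def
proof (intro conjI allI impI ballI)
  fix W assume "openin T W \<and> W \<subseteq> V"
  then have W: "openin T W" "W \<subseteq> V" by auto
  show "mat_map p q E W \<in> LinearCombinations.module_hom (R W) (sec (free_mod F q) W) (sec (free_mod F p) W)"
    using mat_map_in[OF assms(1) W assms(2)]
    by (auto simp: module_hom_def mat_map_def fun_eq_iff sum.distrib algebra_simps sum_distrib_left)
next
  fix W W' s
  assume "openin T W \<and> openin T W' \<and> W' \<subseteq> W \<and> W \<subseteq> V"
  then show "mat_map p q E W' (res (free_mod F q) W W' s) = res (free_mod F p) W W' (mat_map p q E W s)"
    by (auto simp: mat_map_def fun_eq_iff)
qed

text \<open>A morphism out of a free sheaf is determined by the images of the unit vectors over the
  largest set \<open>V\<close>: over \<open>W\<close> every vector is a finite combination of their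
  restrictions.\<close>

lemma hom_mat_map:
  assumes "openin T V" and hom: "sheaf_hom T R V (free_mod F q) (free_mod F p) \<phi>"
  obtains E where "\<And>a b. a < p \<Longrightarrow> b < q \<Longrightarrow> E a b \<in> F V"
    and "\<And>W v. openin T W \<Longrightarrow> W \<subseteq> V \<Longrightarrow> v \<in> {..<q} \<rightarrow>\<^sub>E F W \<Longrightarrow> \<phi> W v = mat_map p q E W v"
proof -
  define e where "e W b = (\<lambda>i\<in>{..<q}. \<lambda>x\<in>W. if i = b then 1 else (0::complex))" for W :: "'x set" and b
  define E where "E a b = \<phi> V (e V b) a" for a b
  have \<phi>: "\<phi> W \<in> LinearCombinations.module_hom (R W) (sec (free_mod F q) W) (sec (free_mod F p) W)"
    if "openin T W" "W \<subseteq> V" for W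
    using hom that by (auto simp: sheaf_hom_def)
  have \<phi>_in: "\<phi> W v \<in> {..<p} \<rightarrow>\<^sub>E F W" if "openin T W" "W \<subseteq> V" "v \<in> {..<q} \<rightarrow>\<^sub>E F W" for W v
    using module_hom_closed[OF \<phi>[OF that(1,2)]] that(3) by auto
  have e_in: "e W b \<in> {..<q} \<rightarrow>\<^sub>E F W" if "openin T W" for W b
    using const[OF that] by (auto simp: e_def)
  have EV: "E a b \<in> F V" if "a < p" "b < q" for a b
    using \<phi>_in[OF assms(1) subset_refl e_in[OF assms(1)]] that by (auto simp: E_def)
  have "\<phi> W v = mat_map p q E W v" if W: "openin T W" "W \<subseteq> V" and v: "v \<in> {..<q} \<rightarrow>\<^sub>E F W" for W v
  proof -
    \<comment> \<open>The vector \<open>v\<close> with the coordinates from \<open>n\<close> on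
      replaced by zero; induction on \<open>n\<close> adds one multiple of a unit vector at a
      time.\<close>
    let ?t = "\<lambda>n. \<lambda>i\<in>{..<q}. \<lambda>x\<in>W. if i < n then v i x else 0"
    have vi: "v i \<in> F W" if "i < q" for i using v that by auto
    have t_in: "?t n \<in> {..<q} \<rightarrow>\<^sub>E F W" for n
    proof (rule restrict_PiE_iff[THEN iffD2], rule ballI)
      fix i assume "i \<in> {..<q}"
      moreover have "restrict (v i) W = v i" if "i < q"
        using function_subring_extensional[OF subring[OF W(1)] vi[OF that]] by (simp add: extensional_restrict)
      ultimately show "(\<lambda>x\<in>W. if i < n then v i x else 0) \<in> F W"
        using const[OF W(1)] vi[of i] by (cases "i < n") auto
    qed
    have \<phi>e: "\<phi> W (e W b) = (\<lambda>a\<in>{..<p}. restrict (E a b) W)" for b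
    proof -
      have "e W b = res (free_mod F q) V W (e V b)"
        using W by (auto simp: e_def fun_eq_iff)
      then have "\<phi> W (e W b) = res (free_mod F p) V W (\<phi> V (e V b))"
        using hom W assms(1) e_in[OF assms(1), of b] by (simp add: sheaf_hom_def)
      then show ?thesis by (simp add: E_def fun_eq_iff)
    qed
    have step: "\<phi> W (?t n) = (\<lambda>a\<in>{..<p}. \<lambda>x\<in>W. \<Sum>b<n. E a b x * v b x)" if "n \<le> q" for n
      using that
    proof (induction n)
      case 0
      \<comment> \<open>\<open>module_hom\<close> contains additivity and homogeneity only; that
        zero goes to zero follows by writing the zero vector as 0 times itself.\<close>
      have eq: "(\<lambda>x\<in>W. 0) \<odot>\<^bsub>sec (free_mod F q) W\<^esub> (?t 0) = ?t 0"
        by (auto simp: fun_eq_iff)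
      have "\<phi> W (?t 0) = (\<lambda>x\<in>W. 0) \<odot>\<^bsub>sec (free_mod F p) W\<^esub> \<phi> W (?t 0)"
        using module_hom_smult[OF \<phi>[OF W], of "\<lambda>x\<in>W. 0" "?t 0"] t_in[of 0] const[OF W(1), of 0]
        unfolding eq by simp
      also have "\<dots> = (\<lambda>a\<in>{..<p}. \<lambda>x\<in>W. \<Sum>b<0. E a b x * v b x)"
        by (auto simp: fun_eq_iff)
      finally show ?case .
    next
      case (Suc n)
      then have n: "n < q" by simp
      have eq: "?t (Suc n) = ?t n \<oplus>\<^bsub>sec (free_mod F q) W\<^esub> (v n \<odot>\<^bsub>sec (free_mod F q) W\<^esub> e W n)"
        using n by (auto simp: fun_eq_iff e_def less_Suc_eq)
      have ve: "v n \<odot>\<^bsub>sec (free_mod F q) W\<^esub> e W n \<in> carrier (sec (free_mod F q) W)"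
        using mult[OF W(1) vi[OF n]] e_in[OF W(1), of n] by auto
      have te: "?t n \<in> carrier (sec (free_mod F q) W)" and ee: "e W n \<in> carrier (sec (free_mod F q) W)"
        using t_in[of n] e_in[OF W(1), of n] by (simp_all only: free_sheaf_sel)
      have vn: "v n \<in> carrier (R W)"
        using vi[OF n] by simp
      have "\<phi> W (?t (Suc n)) = \<phi> W (?t n) \<oplus>\<^bsub>sec (free_mod F p) W\<^esub> (v n \<odot>\<^bsub>sec (free_mod F p) W\<^esub> \<phi> W (e W n))"
        unfolding eq module_hom_add[OF \<phi>[OF W] te ve] module_hom_smult[OF \<phi>[OF W] vn ee] ..
      also have "\<phi> W (?t n) = (\<lambda>a\<in>{..<p}. \<lambda>x\<in>W. \<Sum>b<n. E a b x * v b x)"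
        by (rule Suc.IH) (use n in simp)
      finally show ?case
        unfolding \<phi>e by (simp add: fun_eq_iff mult.commute[of "v n _"])
    qed
    have "?t q = v"
      by (rule vec_eqI[OF W(1) t_in v]) auto
    then show ?thesis using step[of q] by (simp add: mat_map_def)
  qed
  then show thesis using EV that by blast
qed

text \<open>Extensional equality of vectors becomes a system of pointwise linear equations, the form
  in which all exactness arguments are carried out.\<close>

lemma locally_in_image_mat_map:
  assumes "openin T W" "t \<in> {..<p} \<rightarrow>\<^sub>E F W" "openin T V" "W \<subseteq> V" "\<And>a b. a < p \<Longrightarrow> b < q \<Longrightarrow> E a b \<in> F V"
  shows "locally_in_image T (free_mod F q) (free_mod F p) (mat_map p q E) W t \<longleftrightarrow>
    (\<forall>x\<in>W. \<exists>W'. openin T W' \<and> x \<in> W' \<and> W' \<subseteq> W \<and>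
       (\<exists>s\<in>{..<q} \<rightarrow>\<^sub>E F W'. \<forall>a<p. \<forall>y\<in>W'. t a y = (\<Sum>b<q. E a b y * s b y)))"
proof -
  have "mat_map p q E W' s = (\<lambda>i\<in>{..<p}. restrict (t i) W')
      \<longleftrightarrow> (\<forall>a<p. \<forall>y\<in>W'. t a y = (\<Sum>b<q. E a b y * s b y))"
    if "openin T W'" "W' \<subseteq> W" "s \<in> {..<q} \<rightarrow>\<^sub>E F W'" for W' s
    by (auto simp: mat_map_def fun_eq_iff)
  then show ?thesis
    unfolding locally_in_image_def by (simp cong: conj_cong bex_cong)
qed

lemma mat_map_zero_iff:
  "mat_map p q E W t = \<zero>\<^bsub>sec (free_mod F p) W\<^esub> \<longleftrightarrow> (\<forall>a<p. \<forall>y\<in>W. (\<Sum>b<q. E a b y * t b y) = 0)"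
  by (auto simp: mat_map_def fun_eq_iff)

end

section \<open>The cone of multiplication by one equation\<close>

lemma sum_lessThan_add: "(\<Sum>b<p + q. f b) = (\<Sum>b<p. f b) + (\<Sum>b<q. f (p + b))"
  for f :: "nat \<Rightarrow> 'c::comm_monoid_add"
  by (induction q) (simp_all add: add.assoc)

text \<open>The share of the sheaf axioms that enters the cone argument: restrictions stay in the
  carriers, and over the empty set there is at most one section, which makes any two sections agree
  off the closed set.\<close>

definition sections_restrict :: "'x topology \<Rightarrow> ('x, 's) msheaf \<Rightarrow> bool" where
  "sections_restrict T A \<longleftrightarrow>
     (\<forall>U W. openin T U \<and> openin T W \<and> W \<subseteq> U \<longrightarrow> res A U W \<in> carrier (sec A U) \<rightarrow> carrier (sec A W)) \<and>
     (\<exists>z. carrier (sec A {}) \<subseteq> {z})"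

lemma trivial_extension_sel [simp]:
  "carrier (sec (trivial_extension Y A) V) = carrier (sec A (V \<inter> Y))"
  "\<zero>\<^bsub>sec (trivial_extension Y A) V\<^esub> = \<zero>\<^bsub>sec A (V \<inter> Y)\<^esub>"
  "s \<oplus>\<^bsub>sec (trivial_extension Y A) V\<^esub> t = s \<oplus>\<^bsub>sec A (V \<inter> Y)\<^esub> t"
  "f \<odot>\<^bsub>sec (trivial_extension Y A) V\<^esub> s = restrict f (V \<inter> Y) \<odot>\<^bsub>sec A (V \<inter> Y)\<^esub> s"
  "res (trivial_extension Y A) U V s = res A (U \<inter> Y) (V \<inter> Y) s"
  by (simp_all add: trivial_extension_def)

text \<open>An axiomatic hypersurface \<open>S\<close>: \<open>division\<close> and
  \<open>cancel\<close> say that multiplication by \<open>h\<close> is injective with image the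
  ideal of \<open>S\<close>, and \<open>lift\<close>, composition with the retraction, splits the
  restriction \<open>restrict_S\<close>. Thus \<open>G\<close> behaves as the quotient of
  \<open>F\<close> by \<open>h\<close>, with a multiplicative splitting.\<close>

locale codim_one =
  function_sheaf T F + Sub: function_sheaf "subtopology T S" G
  for T :: "'x topology" and F and S and G +
  fixes r :: "'x \<Rightarrow> 'x" and h :: "'x \<Rightarrow> complex"
  assumes S_sub: "S \<subseteq> topspace T"
    and S_closed: "openin T (topspace T - S)"
    and r_cont: "continuous_map T (subtopology T S) r"
    and r_id: "x \<in> S \<Longrightarrow> r x = x"
    and lift: "openin (subtopology T S) W \<Longrightarrow> g \<in> G W \<Longrightarrow>
      (\<lambda>x\<in>{x \<in> topspace T. r x \<in> W}. g (r x)) \<in> F {x \<in> topspace T. r x \<in> W}"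
    and restrict_S: "openin T U \<Longrightarrow> f \<in> F U \<Longrightarrow> restrict f (U \<inter> S) \<in> G (U \<inter> S)"
    and h: "h \<in> F (topspace T)"
    and h_S: "x \<in> S \<Longrightarrow> h x = 0"
    and division: "openin T U \<Longrightarrow> f \<in> F U \<Longrightarrow> (\<And>x. x \<in> U \<inter> S \<Longrightarrow> f x = 0) \<Longrightarrow>
      \<exists>e\<in>F U. \<forall>x\<in>U. f x = h x * e x"
    and cancel: "openin T U \<Longrightarrow> e \<in> F U \<Longrightarrow> (\<And>x. x \<in> U \<Longrightarrow> h x * e x = 0) \<Longrightarrow> x \<in> U \<Longrightarrow> e x = 0"
begin

lemma openin_Int_S: "openin T U \<Longrightarrow> openin (subtopology T S) (U \<inter> S)"
  by (auto simp: openin_subtopology)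

lemma openin_S: "openin (subtopology T S) S"
  using openin_Int_S[OF openin_topspace] S_sub by (simp add: Int_absorb1)

lemma openin_vimage: "openin (subtopology T S) W \<Longrightarrow> openin T {x \<in> topspace T. r x \<in> W}"
  using r_cont by (simp add: continuous_map)

lemma sub_openin: "openin (subtopology T S) W \<Longrightarrow> W \<subseteq> S"
  by (auto simp: openin_subtopology)

lemma r_in: "x \<in> topspace T \<Longrightarrow> r x \<in> S"
  using r_cont by (auto simp: continuous_map_def)

lemma lift_restrict:
  assumes "openin T U" "openin (subtopology T S) W" "U \<subseteq> {x \<in> topspace T. r x \<in> W}" "g \<in> G W"
  shows "(\<lambda>x\<in>U. g (r x)) \<in> F U"
proof -
  have "restrict (\<lambda>x\<in>{x \<in> topspace T. r x \<in> W}. g (r x)) U \<in> F U"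
    using assms by (intro restr[OF openin_vimage[OF assms(2)]] lift) auto
  moreover have "restrict (\<lambda>x\<in>{x \<in> topspace T. r x \<in> W}. g (r x)) U = (\<lambda>x\<in>U. g (r x))"
    using assms(3) by (auto simp: fun_eq_iff)
  ultimately show ?thesis by simp
qed

lemma lift_S: "g \<in> G S \<Longrightarrow> openin T U \<Longrightarrow> (\<lambda>x\<in>U. g (r x)) \<in> F U"
  using lift_restrict[OF _ openin_S] r_in openin_subset by fastforce

text \<open>A solution on \<open>S\<close> is pulled back by \<open>r\<close>; the error vanishes on
  \<open>S\<close> and so is divisible by \<open>h\<close>. Conversely, on restriction to
  \<open>S\<close> the term with \<open>h\<close> disappears and \<open>r\<close> becomes the
  identity.\<close>

lemma local_split:
  fixes p q :: nat
  assumes D: "\<And>a b. a < p \<Longrightarrow> b < q \<Longrightarrow> D a b \<in> G S"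
    and W: "openin T W" and t: "t \<in> {..<p} \<rightarrow>\<^sub>E F W"
  shows "(\<forall>x\<in>W \<inter> S. \<exists>W'. openin (subtopology T S) W' \<and> x \<in> W' \<and> W' \<subseteq> W \<inter> S \<and>
       (\<exists>s\<in>{..<q} \<rightarrow>\<^sub>E G W'. \<forall>a<p. \<forall>y\<in>W'. t a y = (\<Sum>b<q. D a b y * s b y)))
   \<longleftrightarrow> (\<forall>x\<in>W. \<exists>W'. openin T W' \<and> x \<in> W' \<and> W' \<subseteq> W \<and>
       (\<exists>c\<in>{..<q} \<rightarrow>\<^sub>E F W'. \<exists>e\<in>{..<p} \<rightarrow>\<^sub>E F W'. \<forall>a<p. \<forall>y\<in>W'.
          t a y = (\<Sum>b<q. D a b (r y) * c b y) + h y * e a y))" (is "(\<forall>x\<in>W \<inter> S. ?P x) \<longleftrightarrow> (\<forall>x\<in>W. ?Q x)")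
proof
  assume L: "\<forall>x\<in>W \<inter> S. ?P x"
  have W_top: "W \<subseteq> topspace T" using W by (rule openin_subset)
  \<comment> \<open>Any \<open>c\<close> that solves the system at the points of \<open>S\<close>
    determines \<open>e\<close> by division; this serves the points on and off \<open>S\<close>
    alike.\<close>
  have quotient: "\<exists>e\<in>{..<p} \<rightarrow>\<^sub>E F W'. \<forall>a<p. \<forall>y\<in>W'. t a y = (\<Sum>b<q. D a b (r y) * c b y) + h y * e a y"
    if W': "openin T W'" "W' \<subseteq> W" and c: "c \<in> {..<q} \<rightarrow>\<^sub>E F W'"
      and vanish: "\<And>a y. a < p \<Longrightarrow> y \<in> W' \<Longrightarrow> y \<in> S \<Longrightarrow> t a y = (\<Sum>b<q. D a b (r y) * c b y)" for W' c
  proof -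
    have "\<exists>e\<in>F W'. \<forall>y\<in>W'. t a y - (\<Sum>b<q. D a b (r y) * c b y) = h y * e y" if a: "a < p" for a
    proof -
      \<comment> \<open>The combination is recognised as a section of \<open>F\<close> by writing it
        with \<open>mat_map\<close> and the lifted matrix.\<close>
      have "mat_map p q (\<lambda>a b. \<lambda>x\<in>topspace T. D a b (r x)) W' c \<in> {..<p} \<rightarrow>\<^sub>E F W'"
        using W' c D lift_S[OF _ openin_topspace] openin_subset[OF W'(1)]
        by (intro mat_map_in[OF openin_topspace]) auto
      then have "mat_map p q (\<lambda>a b. \<lambda>x\<in>topspace T. D a b (r x)) W' c a \<in> F W'"
        using a by auto
      moreover have "restrict (t a) W' \<in> F W'"
        using t W' a by (intro restr[OF W]) auto
      ultimately have "(\<lambda>x\<in>W'. restrict (t a) W' x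
          + (\<lambda>x\<in>W'. - mat_map p q (\<lambda>a b. \<lambda>x\<in>topspace T. D a b (r x)) W' c a x) x) \<in> F W'" (is "?f \<in> _")
        by (intro add uminus W'(1))
      moreover have f_eq: "?f y = t a y - (\<Sum>b<q. D a b (r y) * c b y)" if "y \<in> W'" for y
      proof -
        have "y \<in> topspace T" using that W' W_top by auto
        then show ?thesis using that a by (simp add: mat_map_def)
      qed
      ultimately show ?thesis
        using division[OF W'(1), of ?f] vanish[OF a] by auto
    qed
    then obtain e where e: "\<And>a. a < p \<Longrightarrow> e a \<in> F W'"
      "\<And>a y. a < p \<Longrightarrow> y \<in> W' \<Longrightarrow> t a y - (\<Sum>b<q. D a b (r y) * c b y) = h y * e a y"
      by metis
    show ?thesis
      by (rule bexI[of _ "\<lambda>a\<in>{..<p}. e a"]) (use e in \<open>auto simp: algebra_simps\<close>)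
  qed
  show "\<forall>x\<in>W. ?Q x"
  proof
    fix x assume x: "x \<in> W"
    show "?Q x"
    proof (cases "x \<in> S")
      case True
      have "?P x" by (rule bspec[OF L]) (use x True in simp)
      then obtain W1 s where W1: "openin (subtopology T S) W1" "x \<in> W1" "W1 \<subseteq> W \<inter> S"
        and s: "s \<in> {..<q} \<rightarrow>\<^sub>E G W1" "\<And>a y. a < p \<Longrightarrow> y \<in> W1 \<Longrightarrow> t a y = (\<Sum>b<q. D a b y * s b y)"
        by (elim exE conjE bexE) simp
      define W' where "W' = W \<inter> {x \<in> topspace T. r x \<in> W1}"
      define c where "c = (\<lambda>b\<in>{..<q}. \<lambda>x\<in>W'. s b (r x))"
      have W': "openin T W'" "W' \<subseteq> W"
        using openin_Int[OF W openin_vimage[OF W1(1)]] by (auto simp: W'_def)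
      have xW': "x \<in> W'"
        using x True W1(2) r_id[of x] W_top by (auto simp: W'_def)
      have c: "c \<in> {..<q} \<rightarrow>\<^sub>E F W'"
        unfolding c_def
      proof (rule restrict_PiE_iff[THEN iffD2], rule ballI)
        fix b assume "b \<in> {..<q}"
        then show "(\<lambda>x\<in>W'. s b (r x)) \<in> F W'"
          using s(1) by (intro lift_restrict[OF W'(1) W1(1), where g = "s b"]) (auto simp: W'_def)
      qed
      have "t a y = (\<Sum>b<q. D a b (r y) * c b y)" if "a < p" "y \<in> W'" "y \<in> S" for a y
        using that s(2)[of a y] r_id[of y] by (simp add: c_def W'_def)
      with quotient[OF W' c]
      have "\<exists>e\<in>{..<p} \<rightarrow>\<^sub>E F W'. \<forall>a<p. \<forall>y\<in>W'. t a y = (\<Sum>b<q. D a b (r y) * c b y) + h y * e a y"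
        by simp
      with W' xW' c show ?thesis
        by - (rule exI[of _ W'], intro conjI, simp, simp, simp, rule bexI[of _ c], simp, simp)
    next
      case False
      \<comment> \<open>Off \<open>S\<close> nothing has to vanish, so already the zero vector is an
        admissible \<open>c\<close>.\<close>
      define W' where "W' = W \<inter> (topspace T - S)"
      have W': "openin T W'" "W' \<subseteq> W" "x \<in> W'"
        using openin_Int[OF W S_closed] x False W_top by (auto simp: W'_def)
      have c: "(\<lambda>b\<in>{..<q}. \<lambda>x\<in>W'. 0) \<in> {..<q} \<rightarrow>\<^sub>E F W'" (is "?c \<in> _")
        using const[OF W'(1)] by auto
      have "\<exists>e\<in>{..<p} \<rightarrow>\<^sub>E F W'. \<forall>a<p. \<forall>y\<in>W'. t a y = (\<Sum>b<q. D a b (r y) * ?c b y) + h y * e a y"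
        by (rule quotient[OF W'(1,2) c]) (simp add: W'_def)
      with W' c show ?thesis
        by - (rule exI[of _ W'], intro conjI, simp, simp, simp, rule bexI[of _ ?c], assumption+)
    qed
  qed
next
  assume R: "\<forall>x\<in>W. ?Q x"
  show "\<forall>x\<in>W \<inter> S. ?P x"
  proof
    fix x assume x: "x \<in> W \<inter> S"
    have "?Q x" by (rule bspec[OF R]) (use x in simp)
    then obtain W' c e where W': "openin T W'" "x \<in> W'" "W' \<subseteq> W" and c: "c \<in> {..<q} \<rightarrow>\<^sub>E F W'"
      and eq: "\<forall>a<p. \<forall>y\<in>W'. t a y = (\<Sum>b<q. D a b (r y) * c b y) + h y * e a y"
      by (elim exE conjE bexE) (rule that)
    have "(\<lambda>b\<in>{..<q}. restrict (c b) (W' \<inter> S)) \<in> {..<q} \<rightarrow>\<^sub>E G (W' \<inter> S)"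
      using c restrict_S[OF W'(1)] by auto
    moreover have "t a y = (\<Sum>b<q. D a b y * (\<lambda>b\<in>{..<q}. restrict (c b) (W' \<inter> S)) b y)"
      if "a < p" "y \<in> W' \<inter> S" for a y
      using eq that by (simp add: r_id h_S)
    ultimately show "?P x"
      using openin_Int_S[OF W'(1)] x W'
      by - (rule exI[of _ "W' \<inter> S"], intro conjI, simp, simp, blast,
        rule bexI[of _ "\<lambda>b\<in>{..<q}. restrict (c b) (W' \<inter> S)"], simp, assumption)
  qed
qed

end

lemma PiE_lessThan_split:
  assumes "s \<in> {..<p + q::nat} \<rightarrow>\<^sub>E X"
  shows "(\<lambda>b\<in>{..<p}. s b) \<in> {..<p} \<rightarrow>\<^sub>E X" "(\<lambda>b\<in>{..<q}. s (p + b)) \<in> {..<q} \<rightarrow>\<^sub>E X"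
  using PiE_mem[OF assms] by auto

lemma PiE_lessThan_join:
  assumes "c \<in> {..<p::nat} \<rightarrow>\<^sub>E X" "e \<in> {..<q} \<rightarrow>\<^sub>E X"
  shows "(\<lambda>b\<in>{..<p + q}. if b < p then c b else e (b - p)) \<in> {..<p + q} \<rightarrow>\<^sub>E X"
  using PiE_mem[OF assms(1)] PiE_mem[OF assms(2)] by auto

context codim_one
begin

text \<open>In the cone of \<open>h\<close> on the lifted complex a cycle is a pair (a, b) with D a
  + h b = 0 and D b = 0. On \<open>S\<close> the part a is a cycle of the given resolution, so
  \<open>local_split\<close> gives a = D c + h e; then h (b + D e) = 0 and \<open>cancel\<close>
  yields b = - D e, that is, (a, b) is the image of (c, e). At the augmentation the splitting of a
  is the whole argument.\<close>

lemma free_resolution_trivial_extension: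
  assumes A: "sections_restrict (subtopology T S) A"
    and resolution: "has_free_resolution (subtopology T S) (\<lambda>W. function_ring W (G W)) A S N"
  shows "has_free_resolution T R (trivial_extension S A) (topspace T) N"
proof -
  obtain m \<epsilon> d where
    \<epsilon>_hom: "sheaf_hom (subtopology T S) Sub.R S (free_mod G (m 1)) A \<epsilon>"
    and \<epsilon>_surj: "sheaf_surj (subtopology T S) S (free_mod G (m 1)) A \<epsilon>"
    and d_hom: "\<And>i. 1 \<le> i \<Longrightarrow> i < N \<Longrightarrow> sheaf_hom (subtopology T S) Sub.R S (free_mod G (m (i + 1))) (free_mod G (m i)) (d i)"
    and exact1: "1 < N \<Longrightarrow> exact_at (subtopology T S) S (free_mod G (m 2)) (free_mod G (m 1)) A (d 1) \<epsilon>"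
    and exact: "\<And>i. 1 \<le> i \<Longrightarrow> i + 1 < N \<Longrightarrow> exact_at (subtopology T S) S (free_mod G (m (i + 2)))
                   (free_mod G (m (i + 1))) (free_mod G (m i)) (d (i + 1)) (d i)"
    using resolution unfolding has_free_resolution_def by blast
  have "\<exists>D. (\<forall>a<m i. \<forall>b<m (i + 1). D a b \<in> G S) \<and>
      (\<forall>W v. openin (subtopology T S) W \<longrightarrow> v \<in> {..<m (i + 1)} \<rightarrow>\<^sub>E G W \<longrightarrow> d i W v = mat_map (m i) (m (i + 1)) D W v)"
    if "1 \<le> i" "i < N" for i
    using Sub.hom_mat_map[OF openin_S d_hom[OF that]] sub_openin by metis
  then obtain D where D: "\<And>i a b. 1 \<le> i \<Longrightarrow> i < N \<Longrightarrow> a < m i \<Longrightarrow> b < m (i + 1) \<Longrightarrow> D i a b \<in> G S"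
    and dD: "\<And>i W v. 1 \<le> i \<Longrightarrow> i < N \<Longrightarrow> openin (subtopology T S) W \<Longrightarrow> v \<in> {..<m (i + 1)} \<rightarrow>\<^sub>E G W
      \<Longrightarrow> d i W v = mat_map (m i) (m (i + 1)) (D i) W v"
    by metis
  define img where "img i W t \<longleftrightarrow> (\<forall>x\<in>W. \<exists>W'. openin (subtopology T S) W' \<and> x \<in> W' \<and> W' \<subseteq> W \<and>
       (\<exists>s\<in>{..<m (i + 1)} \<rightarrow>\<^sub>E G W'. \<forall>a<m i. \<forall>y\<in>W'. t a y = (\<Sum>b<m (i + 1). D i a b y * s b y)))"
    for i W t
  have img: "locally_in_image (subtopology T S) (free_mod G (m (i + 1))) (free_mod G (m i)) (d i) W t \<longleftrightarrow> img i W t"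
    if i: "1 \<le> i" "i < N" and W: "openin (subtopology T S) W" and t: "t \<in> {..<m i} \<rightarrow>\<^sub>E G W" for i W t
  proof -
    have "locally_in_image (subtopology T S) (free_mod G (m (i + 1))) (free_mod G (m i)) (d i) W t
      \<longleftrightarrow> locally_in_image (subtopology T S) (free_mod G (m (i + 1))) (free_mod G (m i))
        (mat_map (m i) (m (i + 1)) (D i)) W t"
      unfolding locally_in_image_def free_sheaf_sel(1) by (simp only: dD[OF i] cong: conj_cong bex_cong)
    also have "\<dots> \<longleftrightarrow> img i W t"
      unfolding img_def by (rule Sub.locally_in_image_mat_map[OF W t openin_S sub_openin[OF W] D[OF i]])
    finally show ?thesis .
  qed
  have ker1: "\<epsilon> W t = \<zero>\<^bsub>sec A W\<^esub> \<longleftrightarrow> img 1 W t"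
    if "1 < N" "openin (subtopology T S) W" "t \<in> {..<m 1} \<rightarrow>\<^sub>E G W" for W t
    using exact1[OF that(1)] img[of 1 W t] that sub_openin[OF that(2)]
    by (simp add: exact_at_def numeral_2_eq_2)
  have ker: "(\<forall>a<m i. \<forall>y\<in>W. (\<Sum>b<m (i + 1). D i a b y * t b y) = 0) \<longleftrightarrow> img (i + 1) W t"
    if i: "1 \<le> i" "i + 1 < N" and W: "openin (subtopology T S) W" and t: "t \<in> {..<m (i + 1)} \<rightarrow>\<^sub>E G W" for i W t
  proof -
    have "d i W t = \<zero>\<^bsub>sec (free_mod G (m i)) W\<^esub> \<longleftrightarrow> img (i + 1) W t"
      using exact[OF i] img[of "i + 1" W t] i W t sub_openin[OF W]
      by (simp add: exact_at_def)
    moreover have "d i W t = mat_map (m i) (m (i + 1)) (D i) W t"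
      using dD i W t by simp
    ultimately show ?thesis by (simp only: Sub.mat_map_zero_iff)
  qed
  \<comment> \<open>Each column of \<open>D (i + 1)\<close> is the image of a unit vector, so
    exactness on \<open>S\<close> puts it into the kernel of \<open>D i\<close>.\<close>
  have DD: "(\<Sum>b<m (i + 1). D i a b x * D (i + 1) b c x) = 0"
    if i: "1 \<le> i" "i + 1 < N" and a: "a < m i" and c: "c < m (i + 2)" and x: "x \<in> S" for i a c x
  proof -
    let ?t = "\<lambda>b\<in>{..<m (i + 1)}. D (i + 1) b c"
    have t: "?t \<in> {..<m (i + 1)} \<rightarrow>\<^sub>E G S" using D[of "i + 1" _ c] i c by auto
    have "img (i + 1) S ?t"
      unfolding img_def
    proof (intro ballI exI[of _ S] conjI)
      let ?s = "\<lambda>c'\<in>{..<m (i + 1 + 1)}. \<lambda>x\<in>S. if c' = c then 1 else 0"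
      have "(\<Sum>c'<m (i + 1 + 1). D (i + 1) a c' y * ?s c' y) = D (i + 1) a c y" if "y \<in> S" for a y
      proof -
        have "(\<Sum>c'<m (i + 1 + 1). D (i + 1) a c' y * ?s c' y) = (\<Sum>c'<m (i + 1 + 1). if c' = c then D (i + 1) a c' y else 0)"
          using that by (intro sum.cong) auto
        then show ?thesis using c by simp
      qed
      then show "\<exists>s\<in>{..<m (i + 1 + 1)} \<rightarrow>\<^sub>E G S. \<forall>a<m (i + 1). \<forall>y\<in>S. ?t a y = (\<Sum>b<m (i + 1 + 1). D (i + 1) a b y * s b y)"
        using Sub.const[OF openin_S] by (intro bexI[of _ ?s]) auto
    qed (use openin_S in auto)
    then have "\<forall>a<m i. \<forall>y\<in>S. (\<Sum>b<m (i + 1). D i a b y * ?t b y) = 0"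
      using ker[OF i openin_S t] by simp
    then show ?thesis using a x by simp
  qed
  have DDv: "(\<Sum>b<m (i + 1). D i a b x * (\<Sum>c<m (i + 2). D (i + 1) b c x * u c)) = 0"
    if i: "1 \<le> i" "i + 1 < N" and a: "a < m i" and x: "x \<in> S" for i a x u
  proof -
    have "(\<Sum>b<m (i + 1). D i a b x * (\<Sum>c<m (i + 2). D (i + 1) b c x * u c))
        = (\<Sum>c<m (i + 2). (\<Sum>b<m (i + 1). D i a b x * D (i + 1) b c x) * u c)"
      unfolding sum_distrib_left sum_distrib_right by (subst sum.swap) (simp add: mult.assoc)
    then show ?thesis using DD[OF i a _ x] by simp
  qed
  \<comment> \<open>The second block is the shifted copy, of rank \<open>m (i - 1)\<close>. It has
    to be cut off at \<open>i = 1\<close>, where \<open>m 0\<close> is an arbitrary number.\<close>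
  define M where "M i = m i + (if i \<ge> 2 then m (i - 1) else 0)" for i
  have M1: "M 1 = m 1" by (simp add: M_def)
  have MS: "M (i + 1) = m (i + 1) + m i" if "1 \<le> i" for i using that by (simp add: M_def)
  \<comment> \<open>the differential of the cone of multiplication by \<open>h\<close>, in blocks \<open>(D, h; 0, - D)\<close>\<close>
  define E where "E i a b = (\<lambda>x\<in>topspace T.
      if a < m i then (if b < m (i + 1) then D i a b (r x) else if b = m (i + 1) + a then h x else 0)
      else if b < m (i + 1) then 0 else - D (i - 1) (a - m i) (b - m (i + 1)) (r x))" for i a b
  have E_in: "E i a b \<in> F (topspace T)" if i: "1 \<le> i" "i < N" and ab: "a < M i" "b < M (i + 1)" for i a b
  proof -
    have hext: "restrict h (topspace T) = h"
      using function_subring_extensional[OF subring[OF openin_topspace] h] by (simp add: extensional_restrict)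
    consider "a < m i" "b < m (i + 1)" | "a < m i" "b = m (i + 1) + a"
      | "(a < m i) \<noteq> (b < m (i + 1))" "\<not> (a < m i \<and> b = m (i + 1) + a)"
      | "\<not> a < m i" "\<not> b < m (i + 1)" by blast
    then show ?thesis
    proof cases
      case 1
      then show ?thesis using lift_S[OF D[OF i] openin_topspace] by (simp add: E_def)
    next
      case 2
      then have "E i a b = restrict h (topspace T)" by (auto simp: E_def fun_eq_iff)
      then show ?thesis using h hext by simp
    next
      case 3
      then have "E i a b = (\<lambda>x\<in>topspace T. 0)" by (auto simp: E_def fun_eq_iff)
      then show ?thesis using const[OF openin_topspace] by simp
    next
      case 4
      then have i2: "2 \<le> i" "a - m i < m (i - 1)" "b - m (i + 1) < m i"
        using ab MS[OF i(1)] by (auto simp: M_def split: if_splits)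
      then have "D (i - 1) (a - m i) (b - m (i + 1)) \<in> G S"
        using D[of "i - 1"] i by simp
      then have "(\<lambda>x\<in>topspace T. - (\<lambda>x\<in>topspace T. D (i - 1) (a - m i) (b - m (i + 1)) (r x)) x) \<in> F (topspace T)"
        by (intro uminus lift_S openin_topspace)
      moreover have "(\<lambda>x\<in>topspace T. - (\<lambda>x\<in>topspace T. D (i - 1) (a - m i) (b - m (i + 1)) (r x)) x) = E i a b"
        using 4 by (auto simp: E_def fun_eq_iff)
      ultimately show ?thesis by simp
    qed
  qed
  \<comment> \<open>The block of \<open>h\<close> is diagonal, so row \<open>a\<close> meets it in
    the single column \<open>m (i + 1) + a\<close>.\<close>
  have E_upper: "(\<Sum>b<M (i + 1). E i a b x * v b) = (\<Sum>b<m (i + 1). D i a b (r x) * v b) + h x * v (m (i + 1) + a)"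
    if "1 \<le> i" "a < m i" "x \<in> topspace T" for i a x v
  proof -
    have "(\<Sum>b<m i. E i a (m (i + 1) + b) x * v (m (i + 1) + b))
        = (\<Sum>b<m i. if b = a then h x * v (m (i + 1) + b) else 0)"
      using that by (intro sum.cong) (auto simp: E_def)
    also have "\<dots> = h x * v (m (i + 1) + a)" using that(2) by simp
    finally have "(\<Sum>b<m i. E i a (m (i + 1) + b) x * v (m (i + 1) + b)) = h x * v (m (i + 1) + a)" .
    moreover have "(\<Sum>b<m (i + 1). E i a b x * v b) = (\<Sum>b<m (i + 1). D i a b (r x) * v b)"
      using that by (intro sum.cong) (auto simp: E_def)
    ultimately show ?thesis unfolding MS[OF that(1)] sum_lessThan_add by (simp only:)
  qed
  have E_lower: "(\<Sum>b<M (i + 1). E i (m i + a) b x * v b) = - (\<Sum>b<m i. D (i - 1) a b (r x) * v (m (i + 1) + b))"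
    if "1 \<le> i" "x \<in> topspace T" for i a x v
    unfolding MS[OF that(1)] sum_lessThan_add using that by (simp add: E_def sum_negf)
  have all_M: "(\<forall>a<M (i + 1). P a) \<longleftrightarrow> (\<forall>a<m (i + 1). P a) \<and> (\<forall>a<m i. P (m (i + 1) + a))" if "1 \<le> i" for i P
  proof -
    have "P a" if "\<forall>a<m (i + 1). P a" "\<forall>a<m i. P (m (i + 1) + a)" "a < m (i + 1) + m i" for a
      using that by (cases "a < m (i + 1)") (auto dest!: spec[of _ "a - m (i + 1)"])
    then show ?thesis using MS[OF that] by auto
  qed
  \<comment> \<open>This is \<open>local_split\<close> in terms of the vector restricted to
    \<open>S\<close>, the form in which exactness on \<open>S\<close> is available.\<close>
  have split: "(\<forall>x\<in>W. \<exists>W'. openin T W' \<and> x \<in> W' \<and> W' \<subseteq> W \<and>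
       (\<exists>c\<in>{..<m (i + 1)} \<rightarrow>\<^sub>E F W'. \<exists>e\<in>{..<m i} \<rightarrow>\<^sub>E F W'. \<forall>a<m i. \<forall>y\<in>W'.
          t a y = (\<Sum>b<m (i + 1). D i a b (r y) * c b y) + h y * e a y)) \<longleftrightarrow>
       img i (W \<inter> S) (\<lambda>a\<in>{..<m i}. restrict (t a) (W \<inter> S))"
    if "1 \<le> i" "i < N" "openin T W" "t \<in> {..<m i} \<rightarrow>\<^sub>E F W" for i W t
  proof -
    have "img i (W \<inter> S) (\<lambda>a\<in>{..<m i}. restrict (t a) (W \<inter> S)) \<longleftrightarrow> img i (W \<inter> S) t"
      unfolding img_def
      by (intro ball_cong refl ex_cong1 conj_cong bex_cong all_cong) (auto dest: subsetD)
    then show ?thesis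
      using local_split[OF D[OF that(1,2)] that(3,4)] unfolding img_def by simp
  qed
  have vec_S: "(\<lambda>a\<in>{..<p}. restrict (t a) (W \<inter> S)) \<in> {..<p} \<rightarrow>\<^sub>E G (W \<inter> S)"
    if "openin T W" "t \<in> {..<p} \<rightarrow>\<^sub>E F W" for p :: nat and t W
    using that restrict_S[OF that(1)] by auto
  have join: "\<exists>s\<in>{..<M (i + 1)} \<rightarrow>\<^sub>E F W. (\<forall>b<m (i + 1). s b = c b) \<and> (\<forall>a<m i. s (m (i + 1) + a) = e a)"
    if "1 \<le> i" "c \<in> {..<m (i + 1)} \<rightarrow>\<^sub>E F W" "e \<in> {..<m i} \<rightarrow>\<^sub>E F W" for i W c e
    unfolding MS[OF that(1)] using PiE_lessThan_join[OF that(2,3)] by (rule bexI[rotated]) auto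
  have img_E: "locally_in_image T (free_mod F (M (i + 1))) (free_mod F (M i)) (mat_map (M i) (M (i + 1)) (E i)) W t \<longleftrightarrow>
    (\<forall>x\<in>W. \<exists>W'. openin T W' \<and> x \<in> W' \<and> W' \<subseteq> W \<and>
       (\<exists>s\<in>{..<M (i + 1)} \<rightarrow>\<^sub>E F W'. \<forall>a<M i. \<forall>y\<in>W'. t a y = (\<Sum>b<M (i + 1). E i a b y * s b y)))"
    if "1 \<le> i" "i < N" "openin T W" "t \<in> {..<M i} \<rightarrow>\<^sub>E F W" for i W t
    by (rule locally_in_image_mat_map[OF that(3,4) openin_topspace openin_subset[OF that(3)] E_in[OF that(1,2)]])
  \<comment> \<open>Restrict to \<open>S\<close>, then augment: since \<open>h\<close> vanishes on
    \<open>S\<close>, the multiples of \<open>h\<close> are killed.\<close>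
  define \<epsilon>' where "\<epsilon>' W t = \<epsilon> (W \<inter> S) (\<lambda>a\<in>{..<m 1}. restrict (t a) (W \<inter> S))" for W t
  have \<epsilon>h: "\<epsilon> W \<in> LinearCombinations.module_hom (Sub.R W) (sec (free_mod G (m 1)) W) (sec A W)"
    if "openin (subtopology T S) W" for W
    using \<epsilon>_hom that sub_openin[OF that] by (simp add: sheaf_hom_def)
  have \<epsilon>_in: "\<epsilon> W t \<in> carrier (sec A W)" if "openin (subtopology T S) W" "t \<in> {..<m 1} \<rightarrow>\<^sub>E G W" for W t
    using funcset_mem[OF module_hom_closed[OF \<epsilon>h[OF that(1)]], of t] that(2) by (simp only: free_sheaf_sel)
  have \<epsilon>_res: "\<epsilon> W' (\<lambda>i\<in>{..<m 1}. restrict (s i) W') = res A W W' (\<epsilon> W s)"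
    if "openin (subtopology T S) W" "openin (subtopology T S) W'" "W' \<subseteq> W" "s \<in> {..<m 1} \<rightarrow>\<^sub>E G W" for W W' s
    using conjunct2[OF \<epsilon>_hom[unfolded sheaf_hom_def], rule_format, of W W' s] that sub_openin[OF that(1)]
    unfolding free_sheaf_sel by (simp only: simp_thms)
  have "sheaf_hom T R (topspace T) (free_mod F (M 1)) (trivial_extension S A) \<epsilon>'"
    unfolding sheaf_hom_def M1
  proof (intro conjI allI impI ballI)
    fix W assume "openin T W \<and> W \<subseteq> topspace T"
    then have W: "openin T W" by simp
    note WS = openin_Int_S[OF W]
    show "\<epsilon>' W \<in> LinearCombinations.module_hom (R W) (sec (free_mod F (m 1)) W) (sec (trivial_extension S A) W)"
      unfolding module_hom_def
    proof (intro CollectI conjI allI impI)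
      show "\<epsilon>' W \<in> carrier (sec (free_mod F (m 1)) W) \<rightarrow> carrier (sec (trivial_extension S A) W)"
        unfolding \<epsilon>'_def trivial_extension_sel free_sheaf_sel by (intro funcsetI \<epsilon>_in[OF WS] vec_S[OF W])
    next
      fix s t assume "s \<in> carrier (sec (free_mod F (m 1)) W) \<and> t \<in> carrier (sec (free_mod F (m 1)) W)"
      then have st: "s \<in> {..<m 1} \<rightarrow>\<^sub>E F W" "t \<in> {..<m 1} \<rightarrow>\<^sub>E F W" by simp_all
      let ?s = "\<lambda>a\<in>{..<m 1}. restrict (s a) (W \<inter> S)" and ?t = "\<lambda>a\<in>{..<m 1}. restrict (t a) (W \<inter> S)"
      have "(\<lambda>a\<in>{..<m 1}. restrict ((s \<oplus>\<^bsub>sec (free_mod F (m 1)) W\<^esub> t) a) (W \<inter> S)) = ?s \<oplus>\<^bsub>sec (free_mod G (m 1)) (W \<inter> S)\<^esub> ?t"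
        by (auto simp: fun_eq_iff)
      moreover have "\<epsilon> (W \<inter> S) (?s \<oplus>\<^bsub>sec (free_mod G (m 1)) (W \<inter> S)\<^esub> ?t) = \<epsilon> (W \<inter> S) ?s \<oplus>\<^bsub>sec A (W \<inter> S)\<^esub> \<epsilon> (W \<inter> S) ?t"
        by (rule module_hom_add[OF \<epsilon>h[OF WS]]) (use vec_S[OF W] st in \<open>simp_all only: free_sheaf_sel\<close>)
      ultimately show "\<epsilon>' W (s \<oplus>\<^bsub>sec (free_mod F (m 1)) W\<^esub> t) = \<epsilon>' W s \<oplus>\<^bsub>sec (trivial_extension S A) W\<^esub> \<epsilon>' W t"
        by (simp only: \<epsilon>'_def trivial_extension_sel)
    next
      fix f t assume "f \<in> carrier (R W) \<and> t \<in> carrier (sec (free_mod F (m 1)) W)"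
      then have ft: "f \<in> F W" "t \<in> {..<m 1} \<rightarrow>\<^sub>E F W" by simp_all
      let ?t = "\<lambda>a\<in>{..<m 1}. restrict (t a) (W \<inter> S)" and ?f = "restrict f (W \<inter> S)"
      have "(\<lambda>a\<in>{..<m 1}. restrict ((f \<odot>\<^bsub>sec (free_mod F (m 1)) W\<^esub> t) a) (W \<inter> S)) = ?f \<odot>\<^bsub>sec (free_mod G (m 1)) (W \<inter> S)\<^esub> ?t"
        by (auto simp: fun_eq_iff)
      moreover have "\<epsilon> (W \<inter> S) (?f \<odot>\<^bsub>sec (free_mod G (m 1)) (W \<inter> S)\<^esub> ?t) = ?f \<odot>\<^bsub>sec A (W \<inter> S)\<^esub> \<epsilon> (W \<inter> S) ?t"
        by (rule module_hom_smult[OF \<epsilon>h[OF WS]])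
          (use vec_S[OF W] restrict_S[OF W] ft in \<open>simp_all only: free_sheaf_sel function_ring_sel\<close>)
      ultimately show "\<epsilon>' W (f \<odot>\<^bsub>sec (free_mod F (m 1)) W\<^esub> t) = f \<odot>\<^bsub>sec (trivial_extension S A) W\<^esub> \<epsilon>' W t"
        by (simp only: \<epsilon>'_def trivial_extension_sel)
    qed
  next
    fix W W' s
    assume "openin T W \<and> openin T W' \<and> W' \<subseteq> W \<and> W \<subseteq> topspace T"
      and "s \<in> carrier (sec (free_mod F (m 1)) W)"
    then have W: "openin T W" "openin T W'" "W' \<subseteq> W" and s: "s \<in> {..<m 1} \<rightarrow>\<^sub>E F W" by simp_all
    have "\<epsilon> (W' \<inter> S) (\<lambda>i\<in>{..<m 1}. restrict ((\<lambda>a\<in>{..<m 1}. restrict (s a) (W \<inter> S)) i) (W' \<inter> S))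
        = res A (W \<inter> S) (W' \<inter> S) (\<epsilon> (W \<inter> S) (\<lambda>a\<in>{..<m 1}. restrict (s a) (W \<inter> S)))"
      by (rule \<epsilon>_res[OF openin_Int_S[OF W(1)] openin_Int_S[OF W(2)] _ vec_S[OF W(1) s]]) (use W(3) in blast)
    moreover have "(\<lambda>i\<in>{..<m 1}. restrict ((\<lambda>a\<in>{..<m 1}. restrict (s a) (W \<inter> S)) i) (W' \<inter> S))
        = (\<lambda>a\<in>{..<m 1}. restrict (res (free_mod F (m 1)) W W' s a) (W' \<inter> S))"
      using W(3) by (auto simp: fun_eq_iff)
    ultimately show "\<epsilon>' W' (res (free_mod F (m 1)) W W' s) = res (trivial_extension S A) W W' (\<epsilon>' W s)"
      by (simp only: \<epsilon>'_def trivial_extension_sel)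
  qed
  moreover have "sheaf_surj T (topspace T) (free_mod F (M 1)) (trivial_extension S A) \<epsilon>'"
    unfolding sheaf_surj_def M1 locally_in_image_def
  proof (intro allI impI ballI)
    fix W t x
    assume "openin T W \<and> W \<subseteq> topspace T" and "t \<in> carrier (sec (trivial_extension S A) W)" and x: "x \<in> W"
    then have W: "openin T W" "W \<subseteq> topspace T" and t: "t \<in> carrier (sec A (W \<inter> S))" by simp_all
    show "\<exists>W'. openin T W' \<and> x \<in> W' \<and> W' \<subseteq> W \<and>
       (\<exists>s\<in>carrier (sec (free_mod F (m 1)) W'). \<epsilon>' W' s = res (trivial_extension S A) W W' t)"
    proof (cases "x \<in> S")
      case True
      have "locally_in_image (subtopology T S) (free_mod G (m 1)) A \<epsilon> (W \<inter> S) t"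
        using \<epsilon>_surj openin_Int_S[OF W(1)] t by (simp add: sheaf_surj_def)
      from bspec[OF this[unfolded locally_in_image_def free_sheaf_sel(1)] IntI[OF x True]]
      obtain W1 s where W1: "openin (subtopology T S) W1" "x \<in> W1" "W1 \<subseteq> W \<inter> S"
        and s: "s \<in> {..<m 1} \<rightarrow>\<^sub>E G W1" "\<epsilon> W1 s = res A (W \<inter> S) W1 t"
        by (elim exE conjE bexE) (rule that)
      define W' where "W' = W \<inter> {x \<in> topspace T. r x \<in> W1}"
      have W': "openin T W'" "W' \<subseteq> W" "x \<in> W'"
        using openin_Int[OF W(1) openin_vimage[OF W1(1)]] x True W1(2) r_id[of x] W(2) by (auto simp: W'_def)
      \<comment> \<open>On \<open>S\<close> the map \<open>r\<close> is the identity, so the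
        saturated neighbourhood cuts out exactly \<open>W1\<close>, and the vector pulled back from
        \<open>s\<close> restricts to \<open>s\<close> itself.\<close>
      have W'S: "W' \<inter> S = W1"
        using W1(3) W(2) by (auto simp: W'_def r_id)
      have c: "(\<lambda>b\<in>{..<m 1}. \<lambda>x\<in>W'. s b (r x)) \<in> {..<m 1} \<rightarrow>\<^sub>E F W'"
      proof (rule restrict_PiE_iff[THEN iffD2], rule ballI)
        fix b assume "b \<in> {..<m 1}"
        then show "(\<lambda>x\<in>W'. s b (r x)) \<in> F W'"
          using s(1) by (intro lift_restrict[OF W'(1) W1(1), where g = "s b"]) (auto simp: W'_def)
      qed
      have "(\<lambda>a\<in>{..<m 1}. restrict ((\<lambda>b\<in>{..<m 1}. \<lambda>x\<in>W'. s b (r x)) a) (W' \<inter> S)) = s"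
        using W'S W1(3) r_id
        by (intro Sub.vec_eqI[OF W1(1) _ s(1)]) (use vec_S[OF W'(1) c] in auto)
      then show ?thesis
        using W' c s(2) W'S unfolding free_sheaf_sel(1) trivial_extension_sel
        by - (rule exI[of _ W'], intro conjI, assumption+, rule bexI[OF _ c], simp only: \<epsilon>'_def)
    next
      case False
      define W' where "W' = W \<inter> (topspace T - S)"
      have W': "openin T W'" "W' \<subseteq> W" "x \<in> W'" "W' \<inter> S = {}"
        using openin_Int[OF W(1) S_closed] x False W(2) by (auto simp: W'_def)
      have c: "(\<lambda>b\<in>{..<m 1}. \<lambda>x\<in>W'. 0) \<in> {..<m 1} \<rightarrow>\<^sub>E F W'"
        using const[OF W'(1)] by auto
      \<comment> \<open>Both sides are sections over the empty set, of which there is at most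
        one.\<close>
      have "\<epsilon>' W' (\<lambda>b\<in>{..<m 1}. \<lambda>x\<in>W'. 0) \<in> carrier (sec A {})"
        using \<epsilon>_in[OF openin_Int_S[OF W'(1)] vec_S[OF W'(1) c]] unfolding \<epsilon>'_def W'(4) .
      moreover have "res A (W \<inter> S) {} t \<in> carrier (sec A {})"
        using conjunct1[OF A[unfolded sections_restrict_def], rule_format, of "W \<inter> S" "{}"] openin_Int_S[OF W(1)] t
        by (auto intro: funcset_mem)
      ultimately have "\<epsilon>' W' (\<lambda>b\<in>{..<m 1}. \<lambda>x\<in>W'. 0) = res (trivial_extension S A) W W' t"
        using conjunct2[OF A[unfolded sections_restrict_def]] unfolding trivial_extension_sel W'(4)
        by (metis singletonD subsetD)
      with W' c show ?thesis
        unfolding free_sheaf_sel(1) by - (rule exI[of _ W'], intro conjI, assumption+, rule bexI)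
    qed
  qed
  moreover have "sheaf_hom T R (topspace T) (free_mod F (M (i + 1))) (free_mod F (M i)) (mat_map (M i) (M (i + 1)) (E i))"
    if "1 \<le> i" "i < N" for i
    using mat_map_hom[OF openin_topspace E_in[OF that]] .
  moreover have "exact_at T (topspace T) (free_mod F (M 2)) (free_mod F (M 1)) (trivial_extension S A)
      (mat_map (M 1) (M 2) (E 1)) \<epsilon>'" if N: "1 < N"
    unfolding exact_at_def
  proof (intro allI impI ballI)
    fix W t assume "openin T W \<and> W \<subseteq> topspace T" and "t \<in> carrier (sec (free_mod F (M 1)) W)"
    then have W: "openin T W" "W \<subseteq> topspace T" and t: "t \<in> {..<m 1} \<rightarrow>\<^sub>E F W"
      unfolding free_sheaf_sel M1 by auto
    have "\<epsilon>' W t = \<zero>\<^bsub>sec (trivial_extension S A) W\<^esub> \<longleftrightarrow> img 1 (W \<inter> S) (\<lambda>a\<in>{..<m 1}. restrict (t a) (W \<inter> S))"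
      using ker1[OF N openin_Int_S[OF W(1)] vec_S[OF W(1) t]] by (simp add: \<epsilon>'_def)
    also have "\<dots> \<longleftrightarrow> locally_in_image T (free_mod F (M (1 + 1))) (free_mod F (M 1)) (mat_map (M 1) (M (1 + 1)) (E 1)) W t"
      unfolding split[OF le_refl N W(1) t, symmetric] img_E[OF le_refl N W(1) t[folded M1]]
    proof (intro ball_cong refl ex_cong1 conj_cong)
      fix x W' assume W': "W' \<subseteq> W"
      have up: "(\<Sum>b<M (1 + 1). E 1 a b y * s b y) = (\<Sum>b<m (1 + 1). D 1 a b (r y) * s b y) + h y * s (m (1 + 1) + a) y"
        if "a < m 1" "y \<in> W'" for a y s
        using E_upper[of 1 a y "\<lambda>b. s b y"] that W W' by auto
      show "(\<exists>c\<in>{..<m (1 + 1)} \<rightarrow>\<^sub>E F W'. \<exists>e\<in>{..<m 1} \<rightarrow>\<^sub>E F W'. \<forall>a<m 1. \<forall>y\<in>W'.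
          t a y = (\<Sum>b<m (1 + 1). D 1 a b (r y) * c b y) + h y * e a y) \<longleftrightarrow>
        (\<exists>s\<in>{..<M (1 + 1)} \<rightarrow>\<^sub>E F W'. \<forall>a<M 1. \<forall>y\<in>W'. t a y = (\<Sum>b<M (1 + 1). E 1 a b y * s b y))" (is "?L \<longleftrightarrow> ?R")
      proof
        assume ?L
        then obtain c e where ce: "c \<in> {..<m (1 + 1)} \<rightarrow>\<^sub>E F W'" "e \<in> {..<m 1} \<rightarrow>\<^sub>E F W'"
          and eq: "\<forall>a<m 1. \<forall>y\<in>W'. t a y = (\<Sum>b<m (1 + 1). D 1 a b (r y) * c b y) + h y * e a y"
          by (elim bexE) (rule that)
        from join[OF le_refl ce]
        obtain s where s: "s \<in> {..<M (1 + 1)} \<rightarrow>\<^sub>E F W'" "\<forall>b<m (1 + 1). s b = c b" "\<forall>a<m 1. s (m (1 + 1) + a) = e a"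
          by (elim bexE conjE) (rule that)
        have "(\<Sum>b<m (1 + 1). D 1 a b (r y) * s b y) = (\<Sum>b<m (1 + 1). D 1 a b (r y) * c b y)" for a y
          by (intro sum.cong refl) (simp only: s(2) lessThan_iff)
        then have "\<forall>a<M 1. \<forall>y\<in>W'. t a y = (\<Sum>b<M (1 + 1). E 1 a b y * s b y)"
          unfolding M1 using eq up[of _ _ s] s(3) by (simp only:) simp
        then show ?R by (rule bexI[OF _ s(1)])
      next
        assume ?R
        then obtain s where s: "s \<in> {..<M (1 + 1)} \<rightarrow>\<^sub>E F W'"
          and eq: "\<forall>a<m 1. \<forall>y\<in>W'. t a y = (\<Sum>b<M (1 + 1). E 1 a b y * s b y)"
          unfolding M1 by (elim bexE) (rule that)
        have ce: "(\<lambda>b\<in>{..<m (1 + 1)}. s b) \<in> {..<m (1 + 1)} \<rightarrow>\<^sub>E F W'"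
          "(\<lambda>a\<in>{..<m 1}. s (m (1 + 1) + a)) \<in> {..<m 1} \<rightarrow>\<^sub>E F W'"
          using PiE_lessThan_split[OF s[unfolded MS[OF le_refl]]] .
        have "\<forall>a<m 1. \<forall>y\<in>W'. t a y = (\<Sum>b<m (1 + 1). D 1 a b (r y) * (\<lambda>b\<in>{..<m (1 + 1)}. s b) b y)
            + h y * (\<lambda>a\<in>{..<m 1}. s (m (1 + 1) + a)) a y"
          using eq up[of _ _ s] by simp
        then show ?L by (intro bexI[OF _ ce(1)] bexI[OF _ ce(2)])
      qed
    qed
    finally show "\<epsilon>' W t = \<zero>\<^bsub>sec (trivial_extension S A) W\<^esub> \<longleftrightarrow>
       locally_in_image T (free_mod F (M 2)) (free_mod F (M 1)) (mat_map (M 1) (M 2) (E 1)) W t"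
      by (simp add: numeral_2_eq_2)
  qed
  moreover have "exact_at T (topspace T) (free_mod F (M (i + 2))) (free_mod F (M (i + 1))) (free_mod F (M i))
      (mat_map (M (i + 1)) (M (i + 2)) (E (i + 1))) (mat_map (M i) (M (i + 1)) (E i))" if i: "1 \<le> i" "i + 1 < N" for i
    unfolding exact_at_def mat_map_zero_iff
  proof (intro allI impI ballI)
    fix W t assume "openin T W \<and> W \<subseteq> topspace T" and "t \<in> carrier (sec (free_mod F (M (i + 1))) W)"
    then have W: "openin T W" "W \<subseteq> topspace T" and t: "t \<in> {..<M (i + 1)} \<rightarrow>\<^sub>E F W" by simp_all
    have i': "1 \<le> i + 1" "i + 1 < N" using i by auto
    have img_t: "locally_in_image T (free_mod F (M (i + 2))) (free_mod F (M (i + 1))) (mat_map (M (i + 1)) (M (i + 2)) (E (i + 1))) W t \<longleftrightarrow>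
      (\<forall>x\<in>W. \<exists>W'. openin T W' \<and> x \<in> W' \<and> W' \<subseteq> W \<and>
       (\<exists>s\<in>{..<M (i + 2)} \<rightarrow>\<^sub>E F W'. (\<forall>a<m (i + 1). \<forall>y\<in>W'. t a y = (\<Sum>b<m (i + 2). D (i + 1) a b (r y) * s b y) + h y * s (m (i + 2) + a) y)
         \<and> (\<forall>a<m i. \<forall>y\<in>W'. t (m (i + 1) + a) y = - (\<Sum>b<m (i + 1). D i a b (r y) * s (m (i + 2) + b) y))))" (is "_ \<longleftrightarrow> ?R")
    proof -
      have "(\<forall>a<M (i + 1). \<forall>y\<in>W'. t a y = (\<Sum>b<M (i + 2). E (i + 1) a b y * s b y)) \<longleftrightarrow>
        (\<forall>a<m (i + 1). \<forall>y\<in>W'. t a y = (\<Sum>b<m (i + 2). D (i + 1) a b (r y) * s b y) + h y * s (m (i + 2) + a) y)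
         \<and> (\<forall>a<m i. \<forall>y\<in>W'. t (m (i + 1) + a) y = - (\<Sum>b<m (i + 1). D i a b (r y) * s (m (i + 2) + b) y))"
        if W': "W' \<subseteq> W" for W' s
      proof -
        have "y \<in> topspace T" if "y \<in> W'" for y using that W W' by auto
        then show ?thesis
          unfolding all_M[OF i(1)]
          using E_upper[OF i'(1), of _ _ "\<lambda>b. s b _"] E_lower[OF i'(1), of _ _ "\<lambda>b. s b _"]
          by (simp add: add.assoc[symmetric] cong: ball_cong)
      qed
      then show ?thesis
        using img_E[OF i' W(1) t] by (simp cong: conj_cong bex_cong)
    qed
    \<comment> \<open>The row blocks written out. At \<open>i = 1\<close> there is no lower row, and
      \<open>D (i - 1)\<close> would have no meaning.\<close>
    have ker_t: "(\<forall>a<M i. \<forall>y\<in>W. (\<Sum>b<M (i + 1). E i a b y * t b y) = 0) \<longleftrightarrow>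
      (\<forall>a<m i. \<forall>y\<in>W. (\<Sum>b<m (i + 1). D i a b (r y) * t b y) + h y * t (m (i + 1) + a) y = 0)
      \<and> (i \<ge> 2 \<longrightarrow> (\<forall>a<m (i - 1). \<forall>y\<in>W. (\<Sum>b<m i. D (i - 1) a b (r y) * t (m (i + 1) + b) y) = 0))"
    proof -
      have top: "y \<in> topspace T" if "y \<in> W" for y using that W by auto
      show ?thesis
      proof (cases "i \<ge> 2")
        case True
        then have i1: "1 \<le> i - 1" "i - 1 + 1 = i" by auto
        show ?thesis
          using all_M[OF i1(1), unfolded i1(2)] E_upper[OF i(1), of _ _ "\<lambda>b. t b _"] E_lower[OF i(1), of _ _ "\<lambda>b. t b _"] True top
          by (simp cong: ball_cong)
      next
        case False
        then have "M i = m i" by (simp add: M_def)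
        then show ?thesis using False E_upper[OF i(1), of _ _ "\<lambda>b. t b _"] top by (simp cong: ball_cong)
      qed
    qed
    show "(\<forall>a<M i. \<forall>y\<in>W. (\<Sum>b<M (i + 1). E i a b y * t b y) = 0) \<longleftrightarrow>
      locally_in_image T (free_mod F (M (i + 2))) (free_mod F (M (i + 1))) (mat_map (M (i + 1)) (M (i + 2)) (E (i + 1))) W t"
      unfolding ker_t img_t
    proof
      assume L: "(\<forall>a<m i. \<forall>y\<in>W. (\<Sum>b<m (i + 1). D i a b (r y) * t b y) + h y * t (m (i + 1) + a) y = 0)
      \<and> (i \<ge> 2 \<longrightarrow> (\<forall>a<m (i - 1). \<forall>y\<in>W. (\<Sum>b<m i. D (i - 1) a b (r y) * t (m (i + 1) + b) y) = 0))"
      let ?a = "\<lambda>a\<in>{..<m (i + 1)}. t a"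
      have a: "?a \<in> {..<m (i + 1)} \<rightarrow>\<^sub>E F W"
        using PiE_lessThan_split(1)[OF t[unfolded MS[OF i(1)]]] .
      \<comment> \<open>On \<open>S\<close> the term with \<open>h\<close> drops out of the kernel
        equation, so the upper block is a cycle of the original complex.\<close>
      have "\<forall>a<m i. \<forall>y\<in>W \<inter> S. (\<Sum>b<m (i + 1). D i a b y * (\<lambda>a\<in>{..<m (i + 1)}. restrict (?a a) (W \<inter> S)) b y) = 0"
      proof (intro allI impI ballI)
        fix a y assume "a < m i" "y \<in> W \<inter> S"
        then show "(\<Sum>b<m (i + 1). D i a b y * (\<lambda>a\<in>{..<m (i + 1)}. restrict (?a a) (W \<inter> S)) b y) = 0"
          using conjunct1[OF L, rule_format, of a y] h_S[of y] r_id[of y] by simp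
      qed
      then have "img (i + 1) (W \<inter> S) (\<lambda>a\<in>{..<m (i + 1)}. restrict (?a a) (W \<inter> S))"
        using ker[OF i openin_Int_S[OF W(1)] vec_S[OF W(1) a]] by blast
      note split' = split[OF i' W(1) a, THEN iffD2, OF this]
      show ?R
      proof
        fix x assume "x \<in> W"
        from bspec[OF split' this]
        obtain W' c e where W': "openin T W'" "x \<in> W'" "W' \<subseteq> W"
          and ce: "c \<in> {..<m (i + 1 + 1)} \<rightarrow>\<^sub>E F W'" "e \<in> {..<m (i + 1)} \<rightarrow>\<^sub>E F W'"
          and "\<forall>a<m (i + 1). \<forall>y\<in>W'. ?a a y = (\<Sum>b<m (i + 1 + 1). D (i + 1) a b (r y) * c b y) + h y * e a y"
          by (elim exE conjE bexE) (rule that)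
        then have eq: "\<And>a y. a < m (i + 1) \<Longrightarrow> y \<in> W' \<Longrightarrow> t a y = (\<Sum>b<m (i + 2). D (i + 1) a b (r y) * c b y) + h y * e a y"
          by simp
        from join[OF i'(1) ce]
        obtain s where "s \<in> {..<M (i + 1 + 1)} \<rightarrow>\<^sub>E F W'" "\<forall>b<m (i + 1 + 1). s b = c b"
            "\<forall>a<m (i + 1). s (m (i + 1 + 1) + a) = e a"
          by (elim bexE conjE) (rule that)
        then have s: "s \<in> {..<M (i + 2)} \<rightarrow>\<^sub>E F W'" "\<And>b. b < m (i + 2) \<Longrightarrow> s b = c b"
            "\<And>a. a < m (i + 1) \<Longrightarrow> s (m (i + 2) + a) = e a"
          by simp_all
        have s_c: "(\<Sum>b<m (i + 2). D (i + 1) a b (r y) * s b y) = (\<Sum>b<m (i + 2). D (i + 1) a b (r y) * c b y)" for a y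
          by (intro sum.cong refl) (simp only: s(2) lessThan_iff)
        have s_e: "(\<Sum>b<m (i + 1). D i a b (r y) * s (m (i + 2) + b) y) = (\<Sum>b<m (i + 1). D i a b (r y) * e b y)" for a y
          by (intro sum.cong refl) (simp only: s(3) lessThan_iff)
        \<comment> \<open>Inserting \<open>eq\<close> into the kernel equation and using
          \<open>DDv\<close> leaves \<open>h\<close> times the sum of the lower block and
          \<open>D e\<close> equal to 0, so \<open>cancel\<close> determines the lower
          block.\<close>
        have low: "t (m (i + 1) + a) y = - (\<Sum>b<m (i + 1). D i a b (r y) * e b y)" if a: "a < m i" and y: "y \<in> W'" for a y
        proof -
          let ?g = "\<lambda>y\<in>W'. restrict (t (m (i + 1) + a)) W' y + mat_map (m i) (m (i + 1)) (\<lambda>a b. \<lambda>x\<in>topspace T. D i a b (r x)) W' e a y"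
          have top: "y \<in> topspace T" if "y \<in> W'" for y using that W W' by auto
          have iN: "i < N" using i(2) by simp
          have "mat_map (m i) (m (i + 1)) (\<lambda>a b. \<lambda>x\<in>topspace T. D i a b (r x)) W' e \<in> {..<m i} \<rightarrow>\<^sub>E F W'"
            by (rule mat_map_in[OF openin_topspace W'(1) openin_subset[OF W'(1)] lift_S[OF D[OF i(1) iN] openin_topspace] ce(2)])
          from PiE_mem[OF this, of a] a
          have 1: "mat_map (m i) (m (i + 1)) (\<lambda>a b. \<lambda>x\<in>topspace T. D i a b (r x)) W' e a \<in> F W'"
            by simp
          have "m (i + 1) + a \<in> {..<M (i + 1)}" using a MS[OF i(1)] by simp
          then have "restrict (t (m (i + 1) + a)) W' \<in> F W'"
            by (intro restr[OF W(1) W'(1,3)] PiE_mem[OF t])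
          then have g: "?g \<in> F W'" using 1 by (rule add[OF W'(1)])
          have gy: "?g y = t (m (i + 1) + a) y + (\<Sum>b<m (i + 1). D i a b (r y) * e b y)" if "y \<in> W'" for y
            using that a top[OF that] unfolding mat_map_def by simp
          have "h y * ?g y = 0" if y: "y \<in> W'" for y
          proof -
            have "r y \<in> S" using r_in top y by auto
            have "0 = (\<Sum>b<m (i + 1). D i a b (r y) * t b y) + h y * t (m (i + 1) + a) y"
              using L a y W' by auto
            also have "(\<Sum>b<m (i + 1). D i a b (r y) * t b y)
                = (\<Sum>b<m (i + 1). D i a b (r y) * ((\<Sum>c'<m (i + 2). D (i + 1) b c' (r y) * c c' y) + h y * e b y))"
              using eq y by (intro sum.cong) auto
            also have "\<dots> = (\<Sum>b<m (i + 1). D i a b (r y) * (\<Sum>c'<m (i + 2). D (i + 1) b c' (r y) * c c' y))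
                + h y * (\<Sum>b<m (i + 1). D i a b (r y) * e b y)"
              by (simp add: sum.distrib algebra_simps sum_distrib_left)
            also have "(\<Sum>b<m (i + 1). D i a b (r y) * (\<Sum>c'<m (i + 2). D (i + 1) b c' (r y) * c c' y)) = 0"
              by (rule DDv[OF i a \<open>r y \<in> S\<close>])
            finally show ?thesis using gy[OF y] by (simp add: algebra_simps)
          qed
          then have "?g y = 0" by (rule cancel[OF W'(1) g]) (use y in auto)
          then show ?thesis using gy[OF y] by (simp add: eq_neg_iff_add_eq_0)
        qed
        have "(\<forall>a<m (i + 1). \<forall>y\<in>W'. t a y = (\<Sum>b<m (i + 2). D (i + 1) a b (r y) * s b y) + h y * s (m (i + 2) + a) y)
            \<and> (\<forall>a<m i. \<forall>y\<in>W'. t (m (i + 1) + a) y = - (\<Sum>b<m (i + 1). D i a b (r y) * s (m (i + 2) + b) y))"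
          unfolding s_c s_e using eq low s(3) by simp
        then show "\<exists>W'. openin T W' \<and> x \<in> W' \<and> W' \<subseteq> W \<and>
          (\<exists>s\<in>{..<M (i + 2)} \<rightarrow>\<^sub>E F W'. (\<forall>a<m (i + 1). \<forall>y\<in>W'. t a y = (\<Sum>b<m (i + 2). D (i + 1) a b (r y) * s b y) + h y * s (m (i + 2) + a) y)
            \<and> (\<forall>a<m i. \<forall>y\<in>W'. t (m (i + 1) + a) y = - (\<Sum>b<m (i + 1). D i a b (r y) * s (m (i + 2) + b) y)))"
          using W' by - (rule exI[of _ W'], intro conjI, assumption+, rule bexI[OF _ s(1)], intro conjI; simp)
      qed
    next
      assume R: ?R
      \<comment> \<open>The converse is substitution: products of consecutive matrices vanish by
        \<open>DDv\<close>, which applies because \<open>r y\<close> lies in \<open>S\<close>, and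
        the two terms with \<open>h\<close> cancel by the sign in the lower block.\<close>
      have main: "(\<forall>a<m i. (\<Sum>b<m (i + 1). D i a b (r y) * t b y) + h y * t (m (i + 1) + a) y = 0)
        \<and> (i \<ge> 2 \<longrightarrow> (\<forall>a<m (i - 1). (\<Sum>b<m i. D (i - 1) a b (r y) * t (m (i + 1) + b) y) = 0))" if y: "y \<in> W" for y
      proof -
        from bspec[OF R y] obtain W' s where yW': "y \<in> W'"
          and up: "\<forall>a<m (i + 1). \<forall>y\<in>W'. t a y = (\<Sum>b<m (i + 2). D (i + 1) a b (r y) * s b y) + h y * s (m (i + 2) + a) y"
          and low: "\<forall>a<m i. \<forall>y\<in>W'. t (m (i + 1) + a) y = - (\<Sum>b<m (i + 1). D i a b (r y) * s (m (i + 2) + b) y)"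
          by (elim exE conjE bexE) (rule that)
        have ry: "r y \<in> S" using r_in y W by auto
        have "(\<Sum>b<m (i + 1). D i a b (r y) * t b y) + h y * t (m (i + 1) + a) y = 0" if a: "a < m i" for a
        proof -
          have "(\<Sum>b<m (i + 1). D i a b (r y) * t b y)
                = (\<Sum>b<m (i + 1). D i a b (r y) * ((\<Sum>c'<m (i + 2). D (i + 1) b c' (r y) * s c' y) + h y * s (m (i + 2) + b) y))"
            using up yW' by (intro sum.cong) auto
          also have "\<dots> = (\<Sum>b<m (i + 1). D i a b (r y) * (\<Sum>c'<m (i + 2). D (i + 1) b c' (r y) * s c' y))
                + h y * (\<Sum>b<m (i + 1). D i a b (r y) * s (m (i + 2) + b) y)"
            by (simp add: sum.distrib algebra_simps sum_distrib_left)
          also have "(\<Sum>b<m (i + 1). D i a b (r y) * (\<Sum>c'<m (i + 2). D (i + 1) b c' (r y) * s c' y)) = 0"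
            by (rule DDv[OF i a ry])
          finally show ?thesis using low a yW' by simp
        qed
        moreover have "(\<Sum>b<m i. D (i - 1) a b (r y) * t (m (i + 1) + b) y) = 0" if i2: "i \<ge> 2" and a: "a < m (i - 1)" for a
        proof -
          have "(\<Sum>b<m i. D (i - 1) a b (r y) * t (m (i + 1) + b) y)
            = - (\<Sum>b<m i. D (i - 1) a b (r y) * (\<Sum>c<m (i + 1). D i b c (r y) * s (m (i + 2) + c) y))"
            using low yW' by (simp add: sum_negf)
          moreover have "i - 1 + 1 = i" "i - 1 + 2 = i + 1" using i2 by auto
          ultimately show ?thesis
            using DDv[of "i - 1" a "r y" "\<lambda>c. s (m (i + 2) + c) y"] i i2 a ry by simp
        qed
        ultimately show ?thesis by blast
      qed
      then show "(\<forall>a<m i. \<forall>y\<in>W. (\<Sum>b<m (i + 1). D i a b (r y) * t b y) + h y * t (m (i + 1) + a) y = 0)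
      \<and> (i \<ge> 2 \<longrightarrow> (\<forall>a<m (i - 1). \<forall>y\<in>W. (\<Sum>b<m i. D (i - 1) a b (r y) * t (m (i + 1) + b) y) = 0))"
        by blast
    qed
  qed
  ultimately show ?thesis
    unfolding has_free_resolution_def
    by (intro exI[of _ M] exI[of _ \<epsilon>'] exI[of _ "\<lambda>i. mat_map (M i) (M (i + 1)) (E i)"]) (simp add: numeral_2_eq_2)
qed

end

section \<open>Iterated hypersurfaces\<close>

text \<open>Agreement is asked on carriers only: \<open>trivial_extension\<close> replaces the
  scalar multiplication by one that first restricts the scalar, which changes nothing for the
  extensional functions in the ring but may do so for others.\<close>

definition agree_over ::
  "'x topology \<Rightarrow> ('x set \<Rightarrow> ('x \<Rightarrow> complex) ring) \<Rightarrow> 'x set \<Rightarrow> ('x, 's) msheaf \<Rightarrow> ('x, 's) msheaf \<Rightarrow> bool" where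
  "agree_over T R V A A' \<longleftrightarrow> (\<forall>W. openin T W \<and> W \<subseteq> V \<longrightarrow>
     carrier (sec A' W) = carrier (sec A W) \<and> \<zero>\<^bsub>sec A' W\<^esub> = \<zero>\<^bsub>sec A W\<^esub> \<and>
     (\<forall>s\<in>carrier (sec A W). \<forall>t\<in>carrier (sec A W). s \<oplus>\<^bsub>sec A' W\<^esub> t = s \<oplus>\<^bsub>sec A W\<^esub> t) \<and>
     (\<forall>f\<in>carrier (R W). \<forall>s\<in>carrier (sec A W). f \<odot>\<^bsub>sec A' W\<^esub> s = f \<odot>\<^bsub>sec A W\<^esub> s) \<and>
     (\<forall>W'. openin T W' \<and> W' \<subseteq> W \<longrightarrow> (\<forall>s\<in>carrier (sec A W). res A' W W' s = res A W W' s)))"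

lemma sheaf_hom_cong:
  assumes opens: "\<And>W. W \<subseteq> V \<Longrightarrow> openin T' W \<longleftrightarrow> openin T W"
    and rings: "\<And>W. openin T W \<Longrightarrow> W \<subseteq> V \<Longrightarrow> R' W = R W"
    and A: "agree_over T R V A A'" and B: "agree_over T R V B B'"
    and hom: "sheaf_hom T R V A B \<phi>"
  shows "sheaf_hom T' R' V A' B' \<phi>"
  unfolding sheaf_hom_def
proof (intro conjI allI impI ballI)
  fix W assume W: "openin T' W \<and> W \<subseteq> V"
  then have W': "openin T W \<and> W \<subseteq> V" using opens by blast
  have \<phi>: "\<phi> W \<in> LinearCombinations.module_hom (R W) (sec A W) (sec B W)"
    using hom W' by (simp add: sheaf_hom_def)
  note AW = A[unfolded agree_over_def, rule_format, OF W']
  note BW = B[unfolded agree_over_def, rule_format, OF W']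
  have "\<phi> W s \<in> carrier (sec B W)" if "s \<in> carrier (sec A W)" for s
    using module_hom_closed[OF \<phi>] that by auto
  then show "\<phi> W \<in> LinearCombinations.module_hom (R' W) (sec A' W) (sec B' W)"
    using \<phi> AW BW rings W' by (simp add: module_hom_def)
next
  fix W W' s assume W: "openin T' W \<and> openin T' W' \<and> W' \<subseteq> W \<and> W \<subseteq> V" and s: "s \<in> carrier (sec A' W)"
  then have W': "openin T W \<and> W \<subseteq> V" "openin T W'" "W' \<subseteq> W" using opens by auto
  note AW = A[unfolded agree_over_def, rule_format, OF W'(1)]
  note BW = B[unfolded agree_over_def, rule_format, OF W'(1)]
  have "\<phi> W \<in> LinearCombinations.module_hom (R W) (sec A W) (sec B W)"
    using hom W' by (simp add: sheaf_hom_def)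
  then have "\<phi> W s \<in> carrier (sec B W)"
    using funcset_mem[OF module_hom_closed] s AW by fastforce
  then show "\<phi> W' (res A' W W' s) = res B' W W' (\<phi> W s)"
    using hom W' s AW BW by (simp add: sheaf_hom_def)
qed

lemma locally_in_image_cong:
  assumes opens: "\<And>W. W \<subseteq> V \<Longrightarrow> openin T' W \<longleftrightarrow> openin T W"
    and A: "agree_over T R V A A'" and B: "agree_over T R V B B'"
    and W: "openin T W" "W \<subseteq> V" and t: "t \<in> carrier (sec B W)"
  shows "locally_in_image T' A' B' \<phi> W t \<longleftrightarrow> locally_in_image T A B \<phi> W t"
proof -
  have "carrier (sec A' W') = carrier (sec A W')" "res B' W W' t = res B W W' t" "openin T' W' \<longleftrightarrow> openin T W'"
    if "W' \<subseteq> W" "openin T W'" for W'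
    using A B that W t opens by (auto simp: agree_over_def)
  moreover have "openin T' W' \<longleftrightarrow> openin T W'" if "W' \<subseteq> W" for W' using opens that W by blast
  ultimately have "(openin T' W' \<and> x \<in> W' \<and> W' \<subseteq> W \<and> (\<exists>s\<in>carrier (sec A' W'). \<phi> W' s = res B' W W' t)) \<longleftrightarrow>
      (openin T W' \<and> x \<in> W' \<and> W' \<subseteq> W \<and> (\<exists>s\<in>carrier (sec A W'). \<phi> W' s = res B W W' t))" for x W'
    by (cases "W' \<subseteq> W \<and> openin T W'") auto
  then show ?thesis unfolding locally_in_image_def by (simp only:)
qed

text \<open>A resolution over \<open>V\<close> involves only the open subsets of \<open>V\<close>,
  so topology, rings and sheaf may be exchanged for others that coincide below \<open>V\<close>.
  This moves resolutions between a space and its subspaces.\<close>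

lemma has_free_resolution_cong:
  assumes opens: "\<And>W. W \<subseteq> V \<Longrightarrow> openin T' W \<longleftrightarrow> openin T W"
    and rings: "\<And>W. openin T W \<Longrightarrow> W \<subseteq> V \<Longrightarrow> R' W = R W"
    and A: "agree_over T R V A A'"
    and resolution: "has_free_resolution T R A V N"
  shows "has_free_resolution T' R' A' V N"
proof -
  have free: "agree_over T R V (free_sheaf R m) (free_sheaf R' m)" for m
    using rings by (simp add: agree_over_def free_sheaf_def)
  have surj: "sheaf_surj T' V A1' B1' \<phi>"
    if "agree_over T R V A1 A1'" "agree_over T R V B1 B1'" "sheaf_surj T V A1 B1 \<phi>" for A1 A1' :: "('a, 'c) msheaf" and B1 B1' :: "('a, 'd) msheaf" and \<phi>
    unfolding sheaf_surj_def
  proof (intro allI impI ballI)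
    fix W t assume W: "openin T' W \<and> W \<subseteq> V" and t: "t \<in> carrier (sec B1' W)"
    have W: "openin T W" "W \<subseteq> V" using W opens by auto
    have "carrier (sec B1' W) = carrier (sec B1 W)" using that(2) W by (simp add: agree_over_def)
    then have t: "t \<in> carrier (sec B1 W)" using t by simp
    then have "locally_in_image T A1 B1 \<phi> W t" using that(3) W by (simp add: sheaf_surj_def)
    then show "locally_in_image T' A1' B1' \<phi> W t"
      using locally_in_image_cong[OF opens that(1,2) W t] by simp
  qed
  have exact: "exact_at T' V A1' B1' C1' \<phi> \<psi>"
    if "agree_over T R V A1 A1'" "agree_over T R V B1 B1'" "agree_over T R V C1 C1'" "exact_at T V A1 B1 C1 \<phi> \<psi>"
    for A1 A1' :: "('a, 'c) msheaf" and B1 B1' :: "('a, 'd) msheaf" and C1 C1' :: "('a, 'e) msheaf" and \<phi> \<psi>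
    unfolding exact_at_def
  proof (intro allI impI ballI)
    fix W t assume W: "openin T' W \<and> W \<subseteq> V" and t: "t \<in> carrier (sec B1' W)"
    have W: "openin T W" "W \<subseteq> V" using W opens by auto
    have "carrier (sec B1' W) = carrier (sec B1 W)" using that(2) W by (simp add: agree_over_def)
    then have t: "t \<in> carrier (sec B1 W)" using t by simp
    then have "\<psi> W t = \<zero>\<^bsub>sec C1 W\<^esub> \<longleftrightarrow> locally_in_image T A1 B1 \<phi> W t" using that(4) W by (simp add: exact_at_def)
    moreover have "\<zero>\<^bsub>sec C1' W\<^esub> = \<zero>\<^bsub>sec C1 W\<^esub>" using that(3) W by (simp add: agree_over_def)
    ultimately show "\<psi> W t = \<zero>\<^bsub>sec C1' W\<^esub> \<longleftrightarrow> locally_in_image T' A1' B1' \<phi> W t"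
      using locally_in_image_cong[OF opens that(1,2) W t] by simp
  qed
  obtain m \<epsilon> d where
    1: "sheaf_hom T R V (free_sheaf R (m 1)) A \<epsilon>"
    and 2: "sheaf_surj T V (free_sheaf R (m 1)) A \<epsilon>"
    and 3: "\<forall>i. 1 \<le> i \<and> i < N \<longrightarrow> sheaf_hom T R V (free_sheaf R (m (i + 1))) (free_sheaf R (m i)) (d i)"
    and 4: "1 < N \<longrightarrow> exact_at T V (free_sheaf R (m 2)) (free_sheaf R (m 1)) A (d 1) \<epsilon>"
    and 5: "\<forall>i. 1 \<le> i \<and> i + 1 < N \<longrightarrow> exact_at T V (free_sheaf R (m (i + 2))) (free_sheaf R (m (i + 1))) (free_sheaf R (m i))
             (d (i + 1)) (d i)"
    using resolution unfolding has_free_resolution_def by (elim exE conjE) (rule that)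
  show ?thesis
    unfolding has_free_resolution_def
  proof (intro exI conjI allI impI)
    show "sheaf_hom T' R' V (free_sheaf R' (m 1)) A' \<epsilon>"
      by (rule sheaf_hom_cong[OF opens rings free A 1])
    show "sheaf_surj T' V (free_sheaf R' (m 1)) A' \<epsilon>"
      by (rule surj[OF free A 2])
    show "sheaf_hom T' R' V (free_sheaf R' (m (i + 1))) (free_sheaf R' (m i)) (d i)" if "1 \<le> i \<and> i < N" for i
      by (rule sheaf_hom_cong[OF opens rings free free 3[rule_format, OF that]])
    show "exact_at T' V (free_sheaf R' (m 2)) (free_sheaf R' (m 1)) A' (d 1) \<epsilon>" if "1 < N"
      by (rule exact[OF free free A 4[rule_format, OF that]])
    show "exact_at T' V (free_sheaf R' (m (i + 2))) (free_sheaf R' (m (i + 1))) (free_sheaf R' (m i)) (d (i + 1)) (d i)"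
      if "1 \<le> i \<and> i + 1 < N" for i
      by (rule exact[OF free free free 5[rule_format, OF that]])
  qed
qed

lemma has_free_resolution_mono:
  assumes resolution: "has_free_resolution T R A V N" and "V' \<subseteq> V"
  shows "has_free_resolution T R A V' N"
proof -
  have sub: "W \<subseteq> V" if "W \<subseteq> V'" for W using that assms(2) by blast
  obtain m \<epsilon> d where
    1: "sheaf_hom T R V (free_sheaf R (m 1)) A \<epsilon>"
    and 2: "sheaf_surj T V (free_sheaf R (m 1)) A \<epsilon>"
    and 3: "\<forall>i. 1 \<le> i \<and> i < N \<longrightarrow> sheaf_hom T R V (free_sheaf R (m (i + 1))) (free_sheaf R (m i)) (d i)"
    and 4: "1 < N \<longrightarrow> exact_at T V (free_sheaf R (m 2)) (free_sheaf R (m 1)) A (d 1) \<epsilon>"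
    and 5: "\<forall>i. 1 \<le> i \<and> i + 1 < N \<longrightarrow> exact_at T V (free_sheaf R (m (i + 2))) (free_sheaf R (m (i + 1))) (free_sheaf R (m i))
             (d (i + 1)) (d i)"
    using resolution unfolding has_free_resolution_def by (elim exE conjE) (rule that)
  show ?thesis
    unfolding has_free_resolution_def
  proof (intro exI conjI allI impI)
    show "sheaf_hom T R V' (free_sheaf R (m 1)) A \<epsilon>"
      using 1 sub by (simp add: sheaf_hom_def)
    show "sheaf_surj T V' (free_sheaf R (m 1)) A \<epsilon>"
      using 2 sub by (simp add: sheaf_surj_def)
    show "sheaf_hom T R V' (free_sheaf R (m (i + 1))) (free_sheaf R (m i)) (d i)" if "1 \<le> i \<and> i < N" for i
      using 3[rule_format, OF that] sub by (simp add: sheaf_hom_def)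
    show "exact_at T V' (free_sheaf R (m 2)) (free_sheaf R (m 1)) A (d 1) \<epsilon>" if "1 < N"
      using 4[rule_format, OF that] sub by (simp add: exact_at_def)
    show "exact_at T V' (free_sheaf R (m (i + 2))) (free_sheaf R (m (i + 1))) (free_sheaf R (m i)) (d (i + 1)) (d i)"
      if "1 \<le> i \<and> i + 1 < N" for i
      using 5[rule_format, OF that] sub by (simp add: exact_at_def)
  qed
qed

text \<open>Lets the induction over the equations carry one and the same extended sheaf through all
  stages.\<close>

lemma trivial_extension_trans:
  fixes Y :: "'x set"
  assumes "Y \<subseteq> S"
  shows "trivial_extension S (trivial_extension Y A) = trivial_extension Y A"
proof -
  have "V \<inter> S \<inter> Y = V \<inter> Y" for V using assms by blast
  moreover have "restrict (restrict f (V \<inter> S)) (V \<inter> Y) = restrict f (V \<inter> Y)" for f :: "'x \<Rightarrow> complex" and V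
    using assms by (auto simp: fun_eq_iff)
  ultimately show ?thesis by (simp add: trivial_extension_def)
qed

lemma sections_restrict_trivial_extension:
  assumes "sections_restrict (subtopology T Y) A" "Y \<subseteq> S"
  shows "sections_restrict (subtopology T S) (trivial_extension Y A)"
proof -
  have "openin (subtopology T Y) (U \<inter> Y)" if "openin (subtopology T S) U" for U
    using that assms(2) by (auto simp: openin_subtopology)
  moreover have "U \<inter> Y \<subseteq> W \<inter> Y" if "U \<subseteq> W" for U W using that by blast
  moreover have "res (trivial_extension Y A) U W = res A (U \<inter> Y) (W \<inter> Y)" for U W
    by (simp add: trivial_extension_def)
  ultimately show ?thesis
    using assms(1) unfolding sections_restrict_def by simp
qed

lemma agree_over_trivial_extension:
  assumes "function_sheaf T F" "V \<subseteq> S"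
  shows "agree_over T (\<lambda>U. function_ring U (F U)) V A (trivial_extension S A)"
proof -
  have ext: "restrict f W = f" if "openin T W" "f \<in> F W" for f W
    using function_subring_extensional[OF function_sheaf.subring[OF assms(1) that(1)] that(2)]
    by (simp add: extensional_restrict)
  show ?thesis
    unfolding agree_over_def
  proof (intro allI impI)
    fix W assume W: "openin T W \<and> W \<subseteq> V"
    then have [simp]: "W \<inter> S = W" using assms(2) by blast
    have "W' \<inter> S = W'" if "W' \<subseteq> W" for W' using that W assms(2) by blast
    then show "carrier (sec (trivial_extension S A) W) = carrier (sec A W) \<and> \<zero>\<^bsub>sec (trivial_extension S A) W\<^esub> = \<zero>\<^bsub>sec A W\<^esub> \<and>
     (\<forall>s\<in>carrier (sec A W). \<forall>t\<in>carrier (sec A W). s \<oplus>\<^bsub>sec (trivial_extension S A) W\<^esub> t = s \<oplus>\<^bsub>sec A W\<^esub> t) \<and>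
     (\<forall>f\<in>carrier (function_ring W (F W)). \<forall>s\<in>carrier (sec A W). f \<odot>\<^bsub>sec (trivial_extension S A) W\<^esub> s = f \<odot>\<^bsub>sec A W\<^esub> s) \<and>
     (\<forall>W'. openin T W' \<and> W' \<subseteq> W \<longrightarrow> (\<forall>s\<in>carrier (sec A W). res (trivial_extension S A) W W' s = res A W W' s))"
      using W ext by simp
  qed
qed

lemma agree_over_refl: "agree_over T R V A A"
  by (simp add: agree_over_def)

lemma agree_over_trivial_extension_Int:
  "agree_over T R V (trivial_extension (V \<inter> Y) A) (trivial_extension Y A)"
proof -
  have [simp]: "W \<inter> (V \<inter> Y) = W \<inter> Y" if "W \<subseteq> V" for W using that by blast
  have [simp]: "W' \<inter> (V \<inter> Y) = W' \<inter> Y" if "W' \<subseteq> W" "W \<subseteq> V" for W W' using that by blast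
  show ?thesis unfolding agree_over_def by auto
qed

text \<open>Models linear coordinates: \<open>r i\<close> is the projection that kills
  \<open>h i\<close> and keeps the other \<open>h j\<close> (\<open>h_r\<close>). Keeping the others
  is what lets \<open>r j\<close> act on the common zero set of the earlier functions, so that the
  hypersurface step can be iterated.\<close>

locale straightened = function_sheaf T F
  for T :: "'x topology" and F +
  fixes k :: nat and h :: "nat \<Rightarrow> 'x \<Rightarrow> complex" and r :: "nat \<Rightarrow> 'x \<Rightarrow> 'x"
  assumes r_cont: "i < k \<Longrightarrow> continuous_map T T (r i)"
    and h_in: "i < k \<Longrightarrow> h i \<in> F (topspace T)"
    and h_open: "i < k \<Longrightarrow> openin T {x \<in> topspace T. h i x \<noteq> 0}"
    and h_r: "i < k \<Longrightarrow> j < k \<Longrightarrow> x \<in> topspace T \<Longrightarrow> h j (r i x) = (if i = j then 0 else h j x)"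
    and r_id: "i < k \<Longrightarrow> x \<in> topspace T \<Longrightarrow> h i x = 0 \<Longrightarrow> r i x = x"
    and pull: "i < k \<Longrightarrow> openin T Z \<Longrightarrow> g \<in> F Z \<Longrightarrow>
      (\<lambda>x\<in>{x \<in> topspace T. r i x \<in> Z}. g (r i x)) \<in> F {x \<in> topspace T. r i x \<in> Z}"
    and division: "i < k \<Longrightarrow> openin T Z \<Longrightarrow> g \<in> F Z \<Longrightarrow> (\<And>x. x \<in> Z \<Longrightarrow> h i x = 0 \<Longrightarrow> g x = 0) \<Longrightarrow>
      \<exists>e\<in>F Z. \<forall>x\<in>Z. g x = h i x * e x"
    and cancel: "i < k \<Longrightarrow> openin T Z \<Longrightarrow> e \<in> F Z \<Longrightarrow> (\<And>x. x \<in> Z \<Longrightarrow> h i x * e x = 0) \<Longrightarrow> x \<in> Z \<Longrightarrow> e x = 0"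
begin

primrec retr :: "nat \<Rightarrow> 'x \<Rightarrow> 'x" where
  "retr 0 x = x"
| "retr (Suc j) x = r j (retr j x)"

definition zeros :: "nat \<Rightarrow> 'x set" where
  "zeros j = {x \<in> topspace T. \<forall>i<j. h i x = 0}"

definition preim :: "nat \<Rightarrow> 'x set \<Rightarrow> 'x set" where
  "preim j W = {x \<in> topspace T. retr j x \<in> W}"

text \<open>Functions on the \<open>j\<close>-th zero set are tested by one pullback along the
  composed retraction instead of by local extensions. Membership is then a statement about
  \<open>F\<close> alone.\<close>

definition Fz :: "nat \<Rightarrow> 'x set \<Rightarrow> ('x \<Rightarrow> complex) set" where
  "Fz j W = {f \<in> extensional W. (\<lambda>x\<in>preim j W. f (retr j x)) \<in> F (preim j W)}"

lemma r_in: "i < k \<Longrightarrow> x \<in> topspace T \<Longrightarrow> r i x \<in> topspace T"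
  using r_cont by (auto simp: continuous_map_def)

lemma retr_cont: "j \<le> k \<Longrightarrow> continuous_map T T (retr j)"
proof (induction j)
  case 0
  then show ?case by simp
next
  case (Suc j)
  then have "continuous_map T T (r j \<circ> retr j)"
    by (intro continuous_map_compose[of T T]) (auto intro: r_cont)
  then show ?case by (simp add: comp_def)
qed

lemma retr_in: "j \<le> k \<Longrightarrow> x \<in> topspace T \<Longrightarrow> retr j x \<in> topspace T"
  using retr_cont by (auto simp: continuous_map_def)

lemma h_retr: "j \<le> k \<Longrightarrow> i < k \<Longrightarrow> x \<in> topspace T \<Longrightarrow> h i (retr j x) = (if i < j then 0 else h i x)"
  by (induction j) (auto simp: h_r retr_in less_Suc_eq)

lemma retr_zeros: "j \<le> k \<Longrightarrow> x \<in> topspace T \<Longrightarrow> retr j x \<in> zeros j"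
  by (simp add: zeros_def h_retr retr_in)

lemma retr_id: "j \<le> k \<Longrightarrow> x \<in> zeros j \<Longrightarrow> retr j x = x"
  by (induction j) (auto simp: zeros_def r_id less_Suc_eq)

lemma zeros_sub: "zeros j \<subseteq> topspace T"
  and zeros_antimono: "i \<le> j \<Longrightarrow> zeros j \<subseteq> zeros i"
  by (auto simp: zeros_def)

lemma zeros_0: "zeros 0 = topspace T"
  by (simp add: zeros_def)

lemma topspace_zeros [simp]: "topspace (subtopology T (zeros j)) = zeros j"
  using zeros_sub by auto

lemma openin_preim:
  assumes "j \<le> k" "openin (subtopology T (zeros j)) W"
  shows "openin T (preim j W)"
proof -
  have "continuous_map T (subtopology T (zeros j)) (retr j)"
    using retr_cont[OF assms(1)] retr_zeros[OF assms(1)] by (auto simp: continuous_map_in_subtopology)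
  then show ?thesis using assms(2) by (simp add: preim_def continuous_map)
qed

lemma pull_retr: "j \<le> k \<Longrightarrow> openin T Z \<Longrightarrow> g \<in> F Z \<Longrightarrow> openin T (preim j Z) \<and> (\<lambda>x\<in>preim j Z. g (retr j x)) \<in> F (preim j Z)"
proof (induction j arbitrary: Z g)
  case 0
  then have "preim 0 Z = Z" using openin_subset by (fastforce simp: preim_def)
  then show ?case
    using 0 function_subring_extensional[OF subring, of Z g] by (simp add: extensional_restrict)
next
  case (Suc j)
  let ?Z = "{x \<in> topspace T. r j x \<in> Z}"
  have "continuous_map T T (r j)" using Suc.prems by (intro r_cont) simp
  then have Z: "openin T ?Z" using Suc.prems(2) by (simp add: continuous_map)
  have "(\<lambda>x\<in>?Z. g (r j x)) \<in> F ?Z" using Suc.prems by (intro pull) auto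
  note IH = Suc.IH[OF _ Z this]
  have eq: "preim (Suc j) Z = preim j ?Z"
    using Suc.prems retr_in by (auto simp: preim_def)
  have "(\<lambda>x\<in>preim j ?Z. g (retr (Suc j) x)) = (\<lambda>x\<in>preim j ?Z. (\<lambda>x\<in>?Z. g (r j x)) (retr j x))"
    using Suc.prems retr_in by (auto simp: preim_def fun_eq_iff)
  then show ?case unfolding eq using IH Suc.prems by simp
qed

lemma sheaf_Fz:
  assumes j: "j \<le> k"
  shows "function_sheaf (subtopology T (zeros j)) (Fz j)"
proof
  fix U assume "openin (subtopology T (zeros j)) U"
  then have sub: "function_subring (preim j U) (F (preim j U))"
    by (intro subring openin_preim j)
  have mem: "retr j x \<in> U" if "x \<in> preim j U" for x using that by (simp add: preim_def)
  have "(\<lambda>x\<in>U. c) \<in> Fz j U" for c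
  proof -
    have "(\<lambda>x\<in>preim j U. (\<lambda>x\<in>U. c) (retr j x)) = (\<lambda>x\<in>preim j U. c)"
      using mem by (auto simp: fun_eq_iff)
    then show ?thesis using sub by (simp add: Fz_def function_subring_def)
  qed
  moreover have "(\<lambda>x\<in>U. f x + g x) \<in> Fz j U \<and> (\<lambda>x\<in>U. f x * g x) \<in> Fz j U" if "f \<in> Fz j U" "g \<in> Fz j U" for f g
  proof -
    let ?f = "\<lambda>x\<in>preim j U. f (retr j x)" and ?g = "\<lambda>x\<in>preim j U. g (retr j x)"
    have "(\<lambda>x\<in>preim j U. (\<lambda>x\<in>U. f x + g x) (retr j x)) = (\<lambda>x\<in>preim j U. ?f x + ?g x)"
      "(\<lambda>x\<in>preim j U. (\<lambda>x\<in>U. f x * g x) (retr j x)) = (\<lambda>x\<in>preim j U. ?f x * ?g x)"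
      using mem by (auto simp: fun_eq_iff)
    moreover have fg: "?f \<in> F (preim j U)" "?g \<in> F (preim j U)" using that by (simp_all add: Fz_def)
    moreover from fg have "(\<lambda>x\<in>preim j U. ?f x + ?g x) \<in> F (preim j U)" "(\<lambda>x\<in>preim j U. ?f x * ?g x) \<in> F (preim j U)"
      using sub unfolding function_subring_def by blast+
    ultimately show ?thesis unfolding Fz_def by (simp only: mem_Collect_eq restrict_extensional simp_thms)
  qed
  ultimately show "function_subring U (Fz j U)"
    by (auto simp: function_subring_def Fz_def)
next
  fix U W f assume UW: "openin (subtopology T (zeros j)) U" "openin (subtopology T (zeros j)) W" "W \<subseteq> U" and f: "f \<in> Fz j U"
  have "restrict (\<lambda>x\<in>preim j U. f (retr j x)) (preim j W) \<in> F (preim j W)"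
    by (rule restr[OF openin_preim[OF j UW(1)] openin_preim[OF j UW(2)]]) (use UW(3) f in \<open>auto simp: preim_def Fz_def simp del: restrict_apply\<close>)
  moreover have "restrict (\<lambda>x\<in>preim j U. f (retr j x)) (preim j W) = (\<lambda>x\<in>preim j W. (restrict f W) (retr j x))"
    using UW(3) by (auto simp: preim_def fun_eq_iff)
  ultimately show "restrict f W \<in> Fz j W" by (simp add: Fz_def)
qed

text \<open>Every axiom is transferred to \<open>F\<close> along \<open>retr j\<close>: functions on
  \<open>U\<close> are replaced by their pullbacks to the saturated set \<open>preim j U\<close>,
  where the axioms of \<open>straightened\<close> apply, and the result is restricted to
  \<open>U\<close>.\<close>

lemma codim_one_step:
  assumes j: "j < k"
  shows "codim_one (subtopology T (zeros j)) (Fz j) (zeros (Suc j)) (Fz (Suc j)) (r j) (restrict (h j) (zeros j))"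
proof -
  have j': "j \<le> k" "Suc j \<le> k" using j by auto
  have sub: "subtopology (subtopology T (zeros j)) (zeros (Suc j)) = subtopology T (zeros (Suc j))"
    using zeros_antimono[of j "Suc j"] by (simp add: subtopology_subtopology Int_absorb1)
  have zS: "x \<in> zeros (Suc j) \<longleftrightarrow> x \<in> zeros j \<and> h j x = 0" for x
    by (auto simp: zeros_def less_Suc_eq)
  have r_zeros: "r j x \<in> zeros (Suc j)" if "x \<in> zeros j" for x
    using that j by (auto simp: zeros_def r_in h_r less_Suc_eq)
  have preim_sub: "U \<subseteq> preim j U" if "openin (subtopology T (zeros j)) U" for U
  proof
    fix x assume "x \<in> U"
    then have "x \<in> zeros j" using openin_subset[OF that] by auto
    then show "x \<in> preim j U" using \<open>x \<in> U\<close> retr_id[OF j'(1), of x] zeros_sub by (auto simp: preim_def)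
  qed
  have open_Int: "openin (subtopology T (zeros j)) (Z \<inter> zeros j)" if "openin T Z" for Z
    using that by (auto simp: openin_subtopology)
  have S_U: "openin (subtopology T (zeros (Suc j))) (U \<inter> zeros (Suc j))" if "openin (subtopology T (zeros j)) U" for U
    using that zeros_antimono[of j "Suc j"] by (auto simp: openin_subtopology)
  have preim_Suc: "preim (Suc j) W = preim j {x \<in> zeros j. r j x \<in> W}" for W
    using retr_zeros[OF j'(1)] by (auto simp: preim_def)
  show ?thesis
    unfolding codim_one_def codim_one_axioms_def sub topspace_zeros
  proof (intro conjI allI impI)
    show "function_sheaf (subtopology T (zeros j)) (Fz j)" "function_sheaf (subtopology T (zeros (Suc j))) (Fz (Suc j))"
      using sheaf_Fz j' by auto
    show "zeros (Suc j) \<subseteq> zeros j" using zeros_antimono[of j "Suc j"] by simp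
    have "zeros j - zeros (Suc j) = {x \<in> topspace T. h j x \<noteq> 0} \<inter> zeros j"
      using zS zeros_sub by auto
    then show "openin (subtopology T (zeros j)) (zeros j - zeros (Suc j))"
      using open_Int[OF h_open[OF j]] by simp
    show "continuous_map (subtopology T (zeros j)) (subtopology T (zeros (Suc j))) (r j)"
      using r_cont[OF j] r_zeros by (auto simp: continuous_map_in_subtopology continuous_map_from_subtopology)
    show "r j x = x" if "x \<in> zeros (Suc j)" for x
      using that j zeros_sub by (auto simp: zS intro: r_id)
    show "(\<lambda>x\<in>{x \<in> zeros j. r j x \<in> W}. g (r j x)) \<in> Fz j {x \<in> zeros j. r j x \<in> W}"
      if "openin (subtopology T (zeros (Suc j))) W" "g \<in> Fz (Suc j) W" for W g
    proof -
      have "(\<lambda>x\<in>preim j {x \<in> zeros j. r j x \<in> W}. (\<lambda>x\<in>{x \<in> zeros j. r j x \<in> W}. g (r j x)) (retr j x))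
         = (\<lambda>x\<in>preim (Suc j) W. g (retr (Suc j) x))"
        unfolding preim_Suc by (auto simp: preim_def fun_eq_iff)
      then show ?thesis using that(2) by (simp add: Fz_def preim_Suc)
    qed
    show "restrict f (U \<inter> zeros (Suc j)) \<in> Fz (Suc j) (U \<inter> zeros (Suc j))"
      if U: "openin (subtopology T (zeros j)) U" "f \<in> Fz j U" for U f
    proof -
      let ?P = "preim (Suc j) (U \<inter> zeros (Suc j))"
      \<comment> \<open>The image of \<open>retr (Suc j)\<close> lies in \<open>zeros j\<close>, on
        which \<open>retr j\<close> is the identity; so pulling back along both is pulling back
        along \<open>retr (Suc j)\<close>.\<close>
      have retr2: "retr j (retr (Suc j) x) = retr (Suc j) x" if "x \<in> topspace T" for x
        using retr_zeros[OF j'(2) that] zeros_antimono[of j "Suc j"] by (intro retr_id j') auto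
      have P: "?P = preim (Suc j) (preim j U)"
        using retr_zeros[OF j'(2)] retr2 retr_in[OF j'(2)] by (auto simp: preim_def simp del: retr.simps)
      have "(\<lambda>x\<in>preim j U. f (retr j x)) \<in> F (preim j U)" using U(2) by (simp add: Fz_def)
      from pull_retr[OF j'(2) openin_preim[OF j'(1) U(1)] this]
      have "(\<lambda>x\<in>?P. (\<lambda>x\<in>preim j U. f (retr j x)) (retr (Suc j) x)) \<in> F ?P"
        unfolding P by blast
      moreover have "(\<lambda>x\<in>?P. (\<lambda>x\<in>preim j U. f (retr j x)) (retr (Suc j) x))
          = (\<lambda>x\<in>?P. restrict f (U \<inter> zeros (Suc j)) (retr (Suc j) x))"
        using retr2 retr_in[OF j'(2)] by (auto simp: preim_def fun_eq_iff simp del: retr.simps)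
      ultimately show ?thesis by (simp add: Fz_def del: retr.simps)
    qed
    have "preim j (zeros j) = topspace T" using retr_zeros[OF j'(1)] by (auto simp: preim_def)
    moreover have "(\<lambda>x\<in>topspace T. restrict (h j) (zeros j) (retr j x)) = h j"
    proof -
      have "h j \<in> extensional (topspace T)"
        using function_subring_extensional[OF subring[OF openin_topspace] h_in[OF j]] .
      then show ?thesis
        using retr_zeros[OF j'(1)] h_retr[OF j'(1) j] by (auto simp: fun_eq_iff extensional_def)
    qed
    ultimately show "restrict (h j) (zeros j) \<in> Fz j (zeros j)"
      using h_in[OF j] by (simp add: Fz_def)
    show "restrict (h j) (zeros j) x = 0" if "x \<in> zeros (Suc j)" for x
      using that by (simp add: zS)
    show "\<exists>e\<in>Fz j U. \<forall>x\<in>U. f x = restrict (h j) (zeros j) x * e x"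
      if U: "openin (subtopology T (zeros j)) U" "f \<in> Fz j U" and f0: "\<forall>x. x \<in> U \<inter> zeros (Suc j) \<longrightarrow> f x = 0" for U f
    proof -
      let ?Z = "preim j U" and ?g = "\<lambda>x\<in>preim j U. f (retr j x)"
      note Z = openin_preim[OF j'(1) U(1)]
      have g: "?g \<in> F ?Z" using U(2) by (simp add: Fz_def)
      have "?g x = 0" if x: "x \<in> ?Z" "h j x = 0" for x
      proof -
        have "x \<in> topspace T" "retr j x \<in> U" using x by (auto simp: preim_def)
        then have "retr j x \<in> U \<inter> zeros (Suc j)"
          using h_retr[OF j'(1) j] retr_zeros[OF j'(1)] x(2) by (simp add: zS)
        then show ?thesis using f0 x by simp
      qed
      from division[OF j Z g this] obtain e where e: "e \<in> F ?Z" "\<forall>x\<in>?Z. ?g x = h j x * e x" by blast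
      have U_sub: "U \<subseteq> zeros j" using openin_subset[OF U(1)] by auto
      \<comment> \<open>\<open>retr j\<close> is idempotent, so the saturated set is its own
        saturation and \<open>e\<close> composed with \<open>retr j\<close> is again defined on all
        of it.\<close>
      have Z_Z: "preim j ?Z = ?Z"
        using retr_zeros[OF j'(1)] retr_in[OF j'(1)] retr_id[OF j'(1)] by (auto simp: preim_def)
      have "(\<lambda>x\<in>?Z. restrict e U (retr j x)) = (\<lambda>x\<in>preim j ?Z. e (retr j x))"
        unfolding Z_Z by (auto simp: preim_def fun_eq_iff)
      then have "restrict e U \<in> Fz j U"
        using pull_retr[OF j'(1) Z e(1)] unfolding Fz_def Z_Z by simp
      moreover have "f x = restrict (h j) (zeros j) x * restrict e U x" if "x \<in> U" for x
      proof -
        have "x \<in> zeros j" "x \<in> ?Z" using that U_sub preim_sub[OF U(1)] by auto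
        then show ?thesis using e(2) that retr_id[OF j'(1), of x] by auto
      qed
      ultimately show ?thesis by blast
    qed
    show "e x = 0"
      if U: "openin (subtopology T (zeros j)) U" "e \<in> Fz j U" and e0: "\<forall>x. x \<in> U \<longrightarrow> restrict (h j) (zeros j) x * e x = 0"
        and x: "x \<in> U" for U e x
    proof -
      let ?Z = "preim j U" and ?g = "\<lambda>x\<in>preim j U. e (retr j x)"
      have g: "?g \<in> F ?Z" using U(2) by (simp add: Fz_def)
      have "h j y * ?g y = 0" if y: "y \<in> ?Z" for y
      proof -
        have "y \<in> topspace T" "retr j y \<in> U" using y by (auto simp: preim_def)
        then show ?thesis using e0[rule_format, of "retr j y"] retr_zeros[OF j'(1)] h_retr[OF j'(1) j] y by auto
      qed
      then have "?g x = 0"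
        using preim_sub[OF U(1)] x by (intro cancel[OF j openin_preim[OF j'(1) U(1)] g]) auto
      moreover have "x \<in> zeros j" using openin_subset[OF U(1)] x by auto
      ultimately show ?thesis
        using preim_sub[OF U(1)] x retr_id[OF j'(1)] by auto
    qed
  qed
qed

text \<open>Downward induction from \<open>j = k\<close> to \<open>j = 0\<close>, one cone per
  equation; at \<open>j = 0\<close> the retraction is the identity and \<open>Fz 0\<close> is
  \<open>F\<close>.\<close>

theorem free_resolution_extension:
  assumes A: "sections_restrict (subtopology T (zeros k)) A"
    and resolution: "has_free_resolution (subtopology T (zeros k)) (\<lambda>W. function_ring W (Fz k W)) A (zeros k) N"
  shows "has_free_resolution T R (trivial_extension (zeros k) A) (topspace T) N"
proof -
  have "has_free_resolution (subtopology T (zeros j)) (\<lambda>W. function_ring W (Fz j W)) (trivial_extension (zeros k) A) (zeros j) N"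
    if "j \<le> k" for j
    using that
  proof (induction j rule: inc_induct)
    \<comment> \<open>The extension of \<open>A\<close> from \<open>zeros k\<close> to itself
      differs from \<open>A\<close> only in its action of functions outside the ring.\<close>
    case base
    show ?case
      by (rule has_free_resolution_cong[OF refl refl agree_over_trivial_extension[OF sheaf_Fz[OF le_refl] subset_refl] resolution])
  next
    case (step j)
    have sub: "subtopology (subtopology T (zeros j)) (zeros (Suc j)) = subtopology T (zeros (Suc j))"
      using zeros_antimono[of j "Suc j"] by (simp add: subtopology_subtopology Int_absorb1)
    have k: "zeros k \<subseteq> zeros (Suc j)" using step.hyps by (intro zeros_antimono) simp
    show ?case
      using codim_one.free_resolution_trivial_extension[OF codim_one_step[OF step.hyps(2)], unfolded sub topspace_zeros, OF sections_restrict_trivial_extension[OF A k] step.IH]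
      unfolding trivial_extension_trans[OF k] .
  qed
  from this[of 0]
  have res0: "has_free_resolution (subtopology T (topspace T)) (\<lambda>W. function_ring W (Fz 0 W)) (trivial_extension (zeros k) A) (topspace T) N"
    by (simp add: zeros_0)
  have Fz0: "Fz 0 W = F W" if "openin T W" for W
  proof -
    have "preim 0 W = W" using openin_subset[OF that] by (auto simp: preim_def)
    then show ?thesis
      using function_subring_extensional[OF subring[OF that]] by (auto simp: Fz_def extensional_restrict)
  qed
  show ?thesis
    by (rule has_free_resolution_cong[OF _ _ _ res0]) (simp_all add: subtopology_topspace agree_over_def Fz0)
qed

end

section \<open>The sheaf axioms for the trivial extension\<close>

lemma sheaf_of_modules_sections_restrict:
  assumes "sheaf_of_modules T R A"
  shows "sections_restrict T A"
proof -
  have "res A U W \<in> carrier (sec A U) \<rightarrow> carrier (sec A W)" if "openin T U \<and> openin T W \<and> W \<subseteq> U" for U W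
    using assms[unfolded sheaf_of_modules_def, THEN conjunct2, THEN conjunct1, rule_format, OF that] by (rule conjunct1)
  moreover have "carrier (sec A {}) \<subseteq> {\<zero>\<^bsub>sec A {}\<^esub>}"
    using trivial_extension_off[OF assms, of "{}" "{}"] by simp
  ultimately show ?thesis unfolding sections_restrict_def by blast
qed

text \<open>All ranks are 0: the free sheaf of rank 0 and the extension both have exactly one
  section over each open subset of \<open>V\<close>, so every exactness condition is an equality of
  zeros.\<close>

lemma free_resolution_off:
  assumes sheaf: "function_sheaf T F" and sheafS: "function_sheaf (subtopology T Y) G"
    and A: "sheaf_of_modules (subtopology T Y) (\<lambda>U. function_ring U (G U)) A"
    and V: "openin T V" "V \<inter> Y = {}"
  shows "has_free_resolution T (\<lambda>U. function_ring U (F U)) (trivial_extension Y A) V N"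
proof -
  interpret function_sheaf T F by fact
  interpret A0: Module.module "function_ring {} (G {})" "sec A {}"
    using conjunct1[OF A[unfolded sheaf_of_modules_def], rule_format, OF openin_empty] .
  have WY: "W \<inter> Y = {}" if "W \<subseteq> V" for W using that V(2) by blast
  have WY': "W' \<inter> Y = {}" if "W' \<subseteq> W" "W \<subseteq> V" for W W' using that V(2) by blast
  have carr: "carrier (sec A {}) = {\<zero>\<^bsub>sec A {}\<^esub>}"
    using trivial_extension_off[OF A, of "{}" "{}"] by simp
  \<comment> \<open>Every function restricted to the empty set is the constantly undefined one,
    which is a constant section over the empty set.\<close>
  have G0: "restrict f {} \<in> G {}" for f
    using function_sheaf.const[OF sheafS openin_empty, of undefined] by (simp add: restrict_def)
  have empty: "carrier (sec (free_mod F 0) W) = {\<lambda>i. undefined}" for W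
    by simp
  define \<epsilon> where "\<epsilon> = (\<lambda>(W::'a set) (s::nat \<Rightarrow> 'a \<Rightarrow> complex). \<zero>\<^bsub>sec A {}\<^esub>)"
  define d where "d = (\<lambda>(i::nat) (W::'a set) (s::nat \<Rightarrow> 'a \<Rightarrow> complex). (\<lambda>i::nat. undefined :: 'a \<Rightarrow> complex))"
  have res0: "res A {} {} \<zero>\<^bsub>sec A {}\<^esub> = \<zero>\<^bsub>sec A {}\<^esub>"
    using A carr unfolding sheaf_of_modules_def by (metis openin_empty singletonI)
  have \<epsilon>: "sheaf_hom T R V (free_mod F 0) (trivial_extension Y A) \<epsilon>"
    unfolding sheaf_hom_def
  proof (intro conjI allI impI ballI)
    fix W assume "openin T W \<and> W \<subseteq> V"
    then have "W \<inter> Y = {}" using WY by blast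
    then show "\<epsilon> W \<in> LinearCombinations.module_hom (R W) (sec (free_mod F 0) W) (sec (trivial_extension Y A) W)"
      using carr A0.smult_r_null G0 by (simp add: \<epsilon>_def module_hom_def)
  next
    fix W W' s assume "openin T W \<and> openin T W' \<and> W' \<subseteq> W \<and> W \<subseteq> V"
    then have "W \<inter> Y = {}" "W' \<inter> Y = {}" using WY WY' by auto
    then show "\<epsilon> W' (res (free_mod F 0) W W' s) = res (trivial_extension Y A) W W' (\<epsilon> W s)"
      using res0 by (simp add: \<epsilon>_def)
  qed
  have surj: "sheaf_surj T V (free_mod F 0) (trivial_extension Y A) \<epsilon>"
    unfolding sheaf_surj_def locally_in_image_def empty
  proof (intro allI impI ballI)
    fix W t x assume "openin T W \<and> W \<subseteq> V" "t \<in> carrier (sec (trivial_extension Y A) W)" "x \<in> W"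
    then have "openin T W" "W \<inter> Y = {}" "t = \<zero>\<^bsub>sec A {}\<^esub>" using WY carr by auto
    then show "\<exists>W'. openin T W' \<and> x \<in> W' \<and> W' \<subseteq> W \<and> (\<exists>s\<in>{\<lambda>i. undefined}. \<epsilon> W' s = res (trivial_extension Y A) W W' t)"
      using \<open>x \<in> W\<close> res0 by (intro exI[of _ W]) (simp add: \<epsilon>_def)
  qed
  have d: "sheaf_hom T R V (free_mod F 0) (free_mod F 0) (d i)" for i
    unfolding sheaf_hom_def module_hom_def by (simp add: d_def fun_eq_iff)
  have img: "locally_in_image T (free_mod F 0) (free_mod F 0) (d i) W (\<lambda>i. undefined)" if "openin T W" for i W
    unfolding locally_in_image_def empty using that by (auto simp: d_def)
  have exact1: "exact_at T V (free_mod F 0) (free_mod F 0) (trivial_extension Y A) (d 1) \<epsilon>"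
    unfolding exact_at_def empty using img WY by (simp add: \<epsilon>_def)
  have exact: "exact_at T V (free_mod F 0) (free_mod F 0) (free_mod F 0) (d i) (d j)" for i j
    unfolding exact_at_def empty using img by (simp add: d_def fun_eq_iff)
  show ?thesis
    unfolding has_free_resolution_def
    by (intro exI[of _ "\<lambda>_. 0"] exI[of _ \<epsilon>] exI[of _ d] conjI allI impI \<epsilon> surj d exact1 exact)
qed

lemma sheaf_of_modules_trivial_extension:
  assumes sheaf: "function_sheaf T F" and sheafY: "function_sheaf (subtopology T Y) G"
    and restr_Y: "\<And>U f. openin T U \<Longrightarrow> f \<in> F U \<Longrightarrow> restrict f (U \<inter> Y) \<in> G (U \<inter> Y)"
    and A: "sheaf_of_modules (subtopology T Y) (\<lambda>U. function_ring U (G U)) A"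
  shows "sheaf_of_modules T (\<lambda>U. function_ring U (F U)) (trivial_extension Y A)"
proof -
  interpret function_sheaf T F by fact
  let ?Y = "subtopology T Y"
  have open_Y: "openin ?Y (U \<inter> Y)" if "openin T U" for U
    using that by (auto simp: openin_subtopology)
  note A' = A[unfolded sheaf_of_modules_def]
  have modA: "Module.module (function_ring W (G W)) (sec A W)" if "openin ?Y W" for W
    using conjunct1[OF A', rule_format, OF that] .
  have resA: "res A U V \<in> carrier (sec A U) \<rightarrow> carrier (sec A V) \<and>
        (\<forall>s\<in>carrier (sec A U). \<forall>t\<in>carrier (sec A U).
           res A U V (s \<oplus>\<^bsub>sec A U\<^esub> t) = res A U V s \<oplus>\<^bsub>sec A V\<^esub> res A U V t) \<and>
        (\<forall>f\<in>carrier (function_ring U (G U)). \<forall>s\<in>carrier (sec A U).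
           res A U V (f \<odot>\<^bsub>sec A U\<^esub> s) = restrict f V \<odot>\<^bsub>sec A V\<^esub> res A U V s)"
    if "openin ?Y U" "openin ?Y V" "V \<subseteq> U" for U V
    by (rule A'[THEN conjunct2, THEN conjunct1, THEN spec, THEN spec, THEN mp]) (intro conjI that)
  have resA_id: "res A U U s = s" if "openin ?Y U" "s \<in> carrier (sec A U)" for U s
    using A'[THEN conjunct2, THEN conjunct2, THEN conjunct1] that by simp
  have resA_trans: "res A V W (res A U V s) = res A U W s"
    if "openin ?Y U" "openin ?Y V" "openin ?Y W" "W \<subseteq> V" "V \<subseteq> U" "s \<in> carrier (sec A U)" for U V W s
    using A'[THEN conjunct2, THEN conjunct2, THEN conjunct2, THEN conjunct1, rule_format, of U V W s] that by simp
  note glueA = A'[THEN conjunct2, THEN conjunct2, THEN conjunct2, THEN conjunct2, rule_format]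
  show ?thesis
    unfolding sheaf_of_modules_def
  proof (intro conjI allI impI)
    fix U assume U: "openin T U"
    interpret M: Module.module "function_ring (U \<inter> Y) (G (U \<inter> Y))" "sec A (U \<inter> Y)"
      by (rule modA[OF open_Y[OF U]])
    have ab: "abelian_group (sec (trivial_extension Y A) U)"
    proof (rule abelian_groupI)
      fix x assume "x \<in> carrier (sec (trivial_extension Y A) U)"
      then show "\<exists>y\<in>carrier (sec (trivial_extension Y A) U).
          y \<oplus>\<^bsub>sec (trivial_extension Y A) U\<^esub> x = \<zero>\<^bsub>sec (trivial_extension Y A) U\<^esub>"
        by (intro bexI[of _ "\<ominus>\<^bsub>sec A (U \<inter> Y)\<^esub> x"]) (simp_all add: M.l_neg)
    qed (simp_all add: M.a_ac)
    show "Module.module (function_ring U (F U)) (sec (trivial_extension Y A) U)"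
    proof (rule moduleI[OF function_subring_cring[OF subring[OF U]] ab])
      fix a x assume "a \<in> carrier (R U)" "x \<in> carrier (sec (trivial_extension Y A) U)"
      then show "a \<odot>\<^bsub>sec (trivial_extension Y A) U\<^esub> x \<in> carrier (sec (trivial_extension Y A) U)"
        using restr_Y[OF U] by simp
    next
      fix a b x assume *: "a \<in> carrier (R U)" "b \<in> carrier (R U)" "x \<in> carrier (sec (trivial_extension Y A) U)"
      have "restrict (\<lambda>x\<in>U. a x + b x) (U \<inter> Y) = (\<lambda>x\<in>U \<inter> Y. restrict a (U \<inter> Y) x + restrict b (U \<inter> Y) x)"
        "restrict (\<lambda>x\<in>U. a x * b x) (U \<inter> Y) = (\<lambda>x\<in>U \<inter> Y. restrict a (U \<inter> Y) x * restrict b (U \<inter> Y) x)"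
        by (auto simp: fun_eq_iff)
      then show "(a \<oplus>\<^bsub>R U\<^esub> b) \<odot>\<^bsub>sec (trivial_extension Y A) U\<^esub> x
          = (a \<odot>\<^bsub>sec (trivial_extension Y A) U\<^esub> x) \<oplus>\<^bsub>sec (trivial_extension Y A) U\<^esub> (b \<odot>\<^bsub>sec (trivial_extension Y A) U\<^esub> x)"
        "(a \<otimes>\<^bsub>R U\<^esub> b) \<odot>\<^bsub>sec (trivial_extension Y A) U\<^esub> x = a \<odot>\<^bsub>sec (trivial_extension Y A) U\<^esub> (b \<odot>\<^bsub>sec (trivial_extension Y A) U\<^esub> x)"
        using * restr_Y[OF U] M.smult_l_distr[of "restrict a (U \<inter> Y)" "restrict b (U \<inter> Y)" x]
          M.smult_assoc1[of "restrict a (U \<inter> Y)" "restrict b (U \<inter> Y)" x] by simp_all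
    next
      fix a x y assume "a \<in> carrier (R U)" "x \<in> carrier (sec (trivial_extension Y A) U)" "y \<in> carrier (sec (trivial_extension Y A) U)"
      then show "a \<odot>\<^bsub>sec (trivial_extension Y A) U\<^esub> (x \<oplus>\<^bsub>sec (trivial_extension Y A) U\<^esub> y)
          = (a \<odot>\<^bsub>sec (trivial_extension Y A) U\<^esub> x) \<oplus>\<^bsub>sec (trivial_extension Y A) U\<^esub> (a \<odot>\<^bsub>sec (trivial_extension Y A) U\<^esub> y)"
        using restr_Y[OF U] M.smult_r_distr[of "restrict a (U \<inter> Y)" x y] by simp
    next
      fix x assume "x \<in> carrier (sec (trivial_extension Y A) U)"
      moreover have "restrict (\<lambda>x\<in>U. 1) (U \<inter> Y) = (\<lambda>x\<in>U \<inter> Y. 1::complex)" by (auto simp: fun_eq_iff)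
      ultimately show "\<one>\<^bsub>R U\<^esub> \<odot>\<^bsub>sec (trivial_extension Y A) U\<^esub> x = x"
        using M.smult_one[of x] by simp
    qed
  next
    fix U V assume "openin T U \<and> openin T V \<and> V \<subseteq> U"
    then have UV: "openin T U" "openin T V" "V \<subseteq> U" "V \<inter> Y \<subseteq> U \<inter> Y" by auto
    note resUV = resA[OF open_Y[OF UV(1)] open_Y[OF UV(2)] UV(4)]
    show "res (trivial_extension Y A) U V \<in> carrier (sec (trivial_extension Y A) U) \<rightarrow> carrier (sec (trivial_extension Y A) V)"
      using resUV by auto
    show "\<forall>s\<in>carrier (sec (trivial_extension Y A) U). \<forall>t\<in>carrier (sec (trivial_extension Y A) U).
           res (trivial_extension Y A) U V (s \<oplus>\<^bsub>sec (trivial_extension Y A) U\<^esub> t)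
           = res (trivial_extension Y A) U V s \<oplus>\<^bsub>sec (trivial_extension Y A) V\<^esub> res (trivial_extension Y A) U V t"
      using resUV by simp
    have "restrict (restrict f (U \<inter> Y)) (V \<inter> Y) = restrict (restrict f V) (V \<inter> Y)" for f :: "'a \<Rightarrow> complex"
      using UV(3) by (auto simp: fun_eq_iff)
    then show "\<forall>f\<in>carrier (R U). \<forall>s\<in>carrier (sec (trivial_extension Y A) U).
           res (trivial_extension Y A) U V (f \<odot>\<^bsub>sec (trivial_extension Y A) U\<^esub> s)
           = restrict f V \<odot>\<^bsub>sec (trivial_extension Y A) V\<^esub> res (trivial_extension Y A) U V s"
      using resUV restr_Y[OF UV(1)] by (simp del: restrict_restrict)
  next
    fix U assume "openin T U"
    then show "\<forall>s\<in>carrier (sec (trivial_extension Y A) U). res (trivial_extension Y A) U U s = s"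
      using resA_id[OF open_Y] by simp
  next
    fix U V W assume "openin T U \<and> openin T V \<and> openin T W \<and> W \<subseteq> V \<and> V \<subseteq> U"
    then have "openin T U" "openin T V" "openin T W" "W \<inter> Y \<subseteq> V \<inter> Y" "V \<inter> Y \<subseteq> U \<inter> Y" by auto
    then show "\<forall>s\<in>carrier (sec (trivial_extension Y A) U).
        res (trivial_extension Y A) V W (res (trivial_extension Y A) U V s) = res (trivial_extension Y A) U W s"
      using resA_trans[OF open_Y open_Y open_Y] by simp
  next
    fix \<V> assume \<V>: "\<forall>V\<in>\<V>. openin T V"
    let ?\<W> = "(\<lambda>V. V \<inter> Y) ` \<V>"
    have U: "\<Union>?\<W> = \<Union>\<V> \<inter> Y" by blast
    have \<W>: "openin ?Y V" if "V \<in> ?\<W>" for V using that \<V> open_Y by auto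
    show "\<forall>s\<in>carrier (sec (trivial_extension Y A) (\<Union>\<V>)). \<forall>t\<in>carrier (sec (trivial_extension Y A) (\<Union>\<V>)).
           (\<forall>V\<in>\<V>. res (trivial_extension Y A) (\<Union>\<V>) V s = res (trivial_extension Y A) (\<Union>\<V>) V t) \<longrightarrow> s = t"
      using conjunct1[OF glueA, OF \<W>] unfolding U by simp
    fix \<sigma>
    assume \<sigma>: "(\<forall>V\<in>\<V>. \<sigma> V \<in> carrier (sec (trivial_extension Y A) V)) \<and>
             (\<forall>V\<in>\<V>. \<forall>W\<in>\<V>. res (trivial_extension Y A) V (V \<inter> W) (\<sigma> V) = res (trivial_extension Y A) W (V \<inter> W) (\<sigma> W))"
    \<comment> \<open>Different members of the cover may have the same trace on \<open>Y\<close>.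
      Choosing one of them is harmless, because sections with a common trace agree already by their
      compatibility on the intersection.\<close>
    define \<tau> where "\<tau> W = \<sigma> (SOME V. V \<in> \<V> \<and> V \<inter> Y = W)" for W
    have \<sigma>c: "\<sigma> V \<in> carrier (sec A (V \<inter> Y))" if "V \<in> \<V>" for V
      using conjunct1[OF \<sigma>] that by simp
    have int: "V \<inter> W \<inter> Y = (V \<inter> Y) \<inter> (W \<inter> Y)" for V W by blast
    have \<sigma>r: "res A (V \<inter> Y) ((V \<inter> Y) \<inter> (W \<inter> Y)) (\<sigma> V) = res A (W \<inter> Y) ((V \<inter> Y) \<inter> (W \<inter> Y)) (\<sigma> W)" if "V \<in> \<V>" "W \<in> \<V>" for V W
      using conjunct2[OF \<sigma>, rule_format, OF that] by (simp only: trivial_extension_sel int)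
    have \<tau>: "\<tau> (V \<inter> Y) = \<sigma> V" if V: "V \<in> \<V>" for V
    proof -
      define V' where "V' = (SOME V'. V' \<in> \<V> \<and> V' \<inter> Y = V \<inter> Y)"
      have V': "V' \<in> \<V> \<and> V' \<inter> Y = V \<inter> Y"
        unfolding V'_def by (rule someI[of _ V]) (use V in simp)
      have "res A (V \<inter> Y) (V \<inter> Y) (\<sigma> V') = res A (V \<inter> Y) (V \<inter> Y) (\<sigma> V)"
        using \<sigma>r[of V' V] V V' by simp
      then have "\<sigma> V' = \<sigma> V"
        using resA_id[OF open_Y] \<V> V V' \<sigma>c[of V] \<sigma>c[of V'] by simp
      then show ?thesis by (simp add: \<tau>_def V'_def)
    qed
    have "\<exists>s\<in>carrier (sec A (\<Union>?\<W>)). \<forall>V\<in>?\<W>. res A (\<Union>?\<W>) V s = \<tau> V"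
    proof (rule conjunct2[OF glueA, rule_format, OF \<W>])
      show "(\<forall>V\<in>?\<W>. \<tau> V \<in> carrier (sec A V)) \<and> (\<forall>V\<in>?\<W>. \<forall>W\<in>?\<W>. res A V (V \<inter> W) (\<tau> V) = res A W (V \<inter> W) (\<tau> W))"
        by (simp add: \<sigma>c \<tau>) (intro ballI \<sigma>r)
    qed
    then show "\<exists>s\<in>carrier (sec (trivial_extension Y A) (\<Union>\<V>)). \<forall>V\<in>\<V>. res (trivial_extension Y A) (\<Union>\<V>) V s = \<sigma> V"
      using \<tau> unfolding U by simp
  qed
qed

section \<open>Holomorphic families of functions of several variables\<close>

definition polydisc :: "nat \<Rightarrow> (nat \<Rightarrow> complex) \<Rightarrow> real \<Rightarrow> (nat \<Rightarrow> complex) set" where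
  "polydisc n c r = {v \<in> Cn n. \<forall>i<n. cmod (v i - c i) < r}"

lemma polydisc_mono: "r \<le> s \<Longrightarrow> polydisc n c r \<subseteq> polydisc n c s"
  by (force simp: polydisc_def)

lemma polydisc_center: "0 < r \<Longrightarrow> c \<in> Cn n \<Longrightarrow> c \<in> polydisc n c r"
  by (simp add: polydisc_def)

lemma Cn_fun_upd: "u \<in> Cn n \<Longrightarrow> i < n \<Longrightarrow> u(i := t) \<in> Cn n"
  by (auto simp: Cn_def)

lemma polydisc_upd: "u \<in> polydisc n c r \<Longrightarrow> i < n \<Longrightarrow> cmod (t - c i) < r \<Longrightarrow> u(i := t) \<in> polydisc n c r"
  by (auto simp: polydisc_def Cn_def)

lemma openin_polydisc: "openin (top_of_set (Cn n)) (polydisc n c r)"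
proof -
  have "open {v::nat \<Rightarrow> complex. \<forall>i\<in>{..<n}. v i \<in> ball (c i) r}"
    by (rule product_topology_basis') auto
  moreover have "polydisc n c r = Cn n \<inter> {v. \<forall>i\<in>{..<n}. v i \<in> ball (c i) r}"
    by (auto simp: polydisc_def dist_norm norm_minus_commute)
  ultimately show ?thesis by (auto simp: openin_open)
qed

lemma open_contains_polydisc:
  assumes "open U" "u \<in> U" "u \<in> Cn n"
  shows "\<exists>\<delta>>0. polydisc n u \<delta> \<subseteq> U"
proof -
  have "openin (product_topology (\<lambda>i. euclidean) UNIV) U"
    using assms(1) by (simp add: euclidean_product_topology)
  from product_topology_open_contains_basis[OF this assms(2)]
  obtain X where X: "u \<in> (\<Pi>\<^sub>E i\<in>UNIV. X i)" "\<And>i. open (X i)" "(\<Pi>\<^sub>E i\<in>UNIV. X i) \<subseteq> U"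
    by (auto simp flip: open_openin)
  have "\<exists>d>0. ball (u i) d \<subseteq> X i" for i
    using X(1,2) by (meson PiE_mem UNIV_I openE)
  then obtain d where d: "\<And>i. d i > 0" "\<And>i. ball (u i) (d i) \<subseteq> X i" by metis
  \<comment> \<open>\<open>insert 1\<close> keeps the minimum meaningful for
    \<open>n = 0\<close>.\<close>
  define \<delta> where "\<delta> = Min (insert 1 (d ` {..<n}))"
  have "\<delta> > 0" using d(1) by (simp add: \<delta>_def)
  moreover have "v \<in> U" if v: "v \<in> polydisc n u \<delta>" for v
  proof -
    have "v i \<in> X i" for i
    proof (cases "i < n")
      case True
      then have "\<delta> \<le> d i" by (simp add: \<delta>_def)
      then have "v i \<in> ball (u i) (d i)"
        using v True by (force simp: polydisc_def dist_norm norm_minus_commute)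
      then show ?thesis using d(2) by blast
    next
      case False
      then have "v i = u i" using v assms(3) by (simp add: polydisc_def Cn_def)
      then show ?thesis using X(1) by (simp add: PiE_mem)
    qed
    then show ?thesis using X(3) by (auto simp: PiE_def)
  qed
  ultimately show ?thesis by blast
qed

text \<open>\<open>P\<close> is the set of parameters. It carries a topology and nothing else,
  because the fibre has no complex coordinates.\<close>

abbreviation rel_open :: "nat \<Rightarrow> 'p::topological_space set \<Rightarrow> ((nat \<Rightarrow> complex) \<times> 'p) set \<Rightarrow> bool" where
  "rel_open n P Z \<equiv> openin (top_of_set (Cn n \<times> P)) Z"

lemma rel_open_sub: "rel_open n P Z \<Longrightarrow> Z \<subseteq> Cn n \<times> P"
  using openin_subset by fastforce

lemma rel_open_polydisc:
  assumes "openin (top_of_set P) W"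
  shows "rel_open n P (polydisc n c r \<times> W)"
  using assms openin_polydisc by (rule openin_Times[rotated])

lemma rel_open_contains_polydisc:
  assumes Z: "rel_open n P Z" and x: "(u, \<omega>) \<in> Z"
  obtains \<delta> W where "\<delta> > 0" "openin (top_of_set P) W" "\<omega> \<in> W" "polydisc n u \<delta> \<times> W \<subseteq> Z"
proof -
  obtain O' where O': "open O'" "Z = (Cn n \<times> P) \<inter> O'" using Z by (auto simp: openin_open)
  obtain A B where AB: "open A" "open B" "(u, \<omega>) \<in> A \<times> B" "A \<times> B \<subseteq> O'"
    using open_prod_elim[OF O'(1), of "(u, \<omega>)"] x O'(2) by auto
  obtain \<delta> where \<delta>: "\<delta> > 0" "polydisc n u \<delta> \<subseteq> A"
    using open_contains_polydisc[OF AB(1), of u n] AB(3) x O'(2) by auto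
  show thesis
  proof (rule that[OF \<delta>(1)])
    show "openin (top_of_set P) (P \<inter> B)" using AB(2) by (auto simp: openin_open)
    show "\<omega> \<in> P \<inter> B" using AB(3) x O'(2) by auto
    show "polydisc n u \<delta> \<times> (P \<inter> B) \<subseteq> Z"
      using \<delta>(2) AB(4) O'(2) by (auto simp: polydisc_def)
  qed
qed

lemma continuous_on_upd: "continuous_on UNIV (\<lambda>t. u(i := t))" for u :: "nat \<Rightarrow> complex"
proof (rule continuous_on_coordinatewise_then_product)
  fix j show "continuous_on UNIV (\<lambda>t. (u(i := t)) j)" by (cases "j = i") auto
qed

lemma line_open:
  assumes "rel_open n P Z" "u \<in> Cn n" "i < n"
  shows "open {t. (u(i := t), \<omega>) \<in> Z}"
proof -
  obtain O' where O': "open O'" "Z = (Cn n \<times> P) \<inter> O'" using assms(1) by (auto simp: openin_open)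
  have "open ((\<lambda>t. (u(i := t), \<omega>)) -` O')"
    using O'(1) by (intro open_vimage continuous_intros continuous_on_upd)
  moreover have "{t. (u(i := t), \<omega>) \<in> Z} = (if \<omega> \<in> P then (\<lambda>t. (u(i := t), \<omega>)) -` O' else {})"
    using O'(2) Cn_fun_upd[OF assms(2,3)] by auto
  ultimately show ?thesis by simp
qed

text \<open>Holomorphy is required in each variable separately; with continuity this gives joint
  differentiability (\<open>frechet_estimate\<close>). The parameter stands for the fibre coordinate.\<close>

definition PH :: "nat \<Rightarrow> ((nat \<Rightarrow> complex) \<times> 'p::topological_space) set \<Rightarrow> ((nat \<Rightarrow> complex) \<times> 'p \<Rightarrow> complex) \<Rightarrow> bool" where
  "PH n Z g \<longleftrightarrow> continuous_on Z g \<and>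
     (\<forall>u \<omega>. (u, \<omega>) \<in> Z \<longrightarrow> (\<forall>i<n. (\<lambda>t. g (u(i := t), \<omega>)) field_differentiable at (u i)))"

definition PD :: "nat \<Rightarrow> ((nat \<Rightarrow> complex) \<times> 'p \<Rightarrow> complex) \<Rightarrow> (nat \<Rightarrow> complex) \<times> 'p \<Rightarrow> complex" where
  "PD i g x = deriv (\<lambda>t. g ((fst x)(i := t), snd x)) (fst x i)"

lemma PH_continuous: "PH n Z g \<Longrightarrow> continuous_on Z g"
  by (simp add: PH_def)

lemma PH_differentiable: "PH n Z g \<Longrightarrow> (u, \<omega>) \<in> Z \<Longrightarrow> i < n \<Longrightarrow> (\<lambda>t. g (u(i := t), \<omega>)) field_differentiable at (u i)"
  by (simp add: PH_def)

lemma PH_subset: "PH n Z g \<Longrightarrow> Z' \<subseteq> Z \<Longrightarrow> PH n Z' g"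
  unfolding PH_def by (meson continuous_on_subset subsetD)

lemma PH_const [intro]: "PH n Z (\<lambda>_. c)"
  by (simp add: PH_def)

lemma PH_coord: "PH n Z (\<lambda>x. fst x i)"
proof -
  have "continuous_on Z (\<lambda>x. fst x i)"
    by (rule continuous_on_compose2[OF continuous_on_product_coordinates[of i]]) (auto intro: continuous_intros)
  moreover have "(\<lambda>t. (u(j := t)) i) field_differentiable at x" for u :: "nat \<Rightarrow> complex" and j x
    by (cases "i = j") (auto simp: field_differentiable_ident)
  ultimately show ?thesis by (simp add: PH_def)
qed

lemma PH_add [intro]: "PH n Z f \<Longrightarrow> PH n Z g \<Longrightarrow> PH n Z (\<lambda>x. f x + g x)"
  by (auto simp: PH_def intro!: continuous_on_add field_differentiable_add)

lemma PH_diff [intro]: "PH n Z f \<Longrightarrow> PH n Z g \<Longrightarrow> PH n Z (\<lambda>x. f x - g x)"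
  by (auto simp: PH_def intro!: continuous_on_diff field_differentiable_diff)

lemma PH_mult [intro]: "PH n Z f \<Longrightarrow> PH n Z g \<Longrightarrow> PH n Z (\<lambda>x. f x * g x)"
  by (auto simp: PH_def intro!: continuous_on_mult field_differentiable_mult)

lemma PH_sum [intro]: "finite I \<Longrightarrow> (\<And>i. i \<in> I \<Longrightarrow> PH n Z (f i)) \<Longrightarrow> PH n Z (\<lambda>x. \<Sum>i\<in>I. f i x)"
  by (induction I rule: finite_induct) auto

lemma PH_divide:
  assumes "PH n Z f" "PH n Z g" "\<And>x. x \<in> Z \<Longrightarrow> g x \<noteq> 0"
  shows "PH n Z (\<lambda>x. f x / g x)"
  using assms unfolding PH_def
  by (auto intro!: continuous_on_divide field_differentiable_divide simp: fun_upd_triv)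

lemma PH_holomorphic_line:
  assumes "PH n Z g" "i < n"
  shows "(\<lambda>t. g (u(i := t), \<omega>)) holomorphic_on {t. (u(i := t), \<omega>) \<in> Z}"
  unfolding holomorphic_on_def
proof
  fix t assume "t \<in> {t. (u(i := t), \<omega>) \<in> Z}"
  then show "(\<lambda>t. g (u(i := t), \<omega>)) field_differentiable at t within {t. (u(i := t), \<omega>) \<in> Z}"
    using PH_differentiable[OF assms(1), of "u(i := t)" \<omega> i] assms(2)
    by (simp add: field_differentiable_at_within)
qed

lemma continuous_on_Cn_valued:
  fixes f :: "'x::topological_space \<Rightarrow> nat \<Rightarrow> complex"
  assumes "\<And>j. j < n \<Longrightarrow> continuous_on Z (\<lambda>y. f y j)" "\<And>y. y \<in> Z \<Longrightarrow> f y \<in> Cn n"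
  shows "continuous_on Z f"
proof (rule continuous_on_coordinatewise_then_product)
  fix j
  show "continuous_on Z (\<lambda>y. f y j)"
  proof (cases "j < n")
    case True then show ?thesis by (rule assms(1))
  next
    case False
    then have "f y j = 0" if "y \<in> Z" for y using assms(2)[OF that] by (simp add: Cn_def)
    then show ?thesis by (simp cong: continuous_on_cong)
  qed
qed

lemma continuous_on_locally:
  assumes "\<And>x. x \<in> Z \<Longrightarrow> \<exists>Z'. openin (top_of_set Z) Z' \<and> x \<in> Z' \<and> continuous_on Z' g"
  shows "continuous_on Z g"
  unfolding continuous_on_def
proof
  fix x assume "x \<in> Z"
  then obtain Z' where Z': "openin (top_of_set Z) Z'" "x \<in> Z'" "(g \<longlongrightarrow> g x) (at x within Z')"
    using assms unfolding continuous_on_def by blast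
  then obtain S where S: "open S" "Z' = Z \<inter> S" by (auto simp: openin_open)
  have "at x within Z = at x within Z'"
    using S Z'(2) by (intro at_within_nhd[of x S]) auto
  then show "(g \<longlongrightarrow> g x) (at x within Z)" using Z'(3) by simp
qed

text \<open>Both halves of \<open>PH\<close> are local: a coordinate line meets a relatively open
  set in an open subset of the plane (\<open>line_open\<close>), so differentiability on the line is
  decided nearby.\<close>

lemma PH_local:
  assumes Z: "rel_open n P Z"
    and loc: "\<And>x. x \<in> Z \<Longrightarrow> \<exists>Z' g'. rel_open n P Z' \<and> x \<in> Z' \<and> Z' \<subseteq> Z \<and> PH n Z' g' \<and> (\<forall>y\<in>Z'. g' y = g y)"
  shows "PH n Z g"
  unfolding PH_def
proof (intro conjI allI impI)
  have "\<exists>Z'. openin (top_of_set Z) Z' \<and> x \<in> Z' \<and> continuous_on Z' g" if x: "x \<in> Z" for x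
  proof -
    obtain Z' g' where Z': "rel_open n P Z'" "x \<in> Z'" "Z' \<subseteq> Z" "PH n Z' g'" "\<forall>y\<in>Z'. g' y = g y"
      using loc[OF x] by blast
    have "openin (top_of_set Z) Z'"
      using Z'(1,3) rel_open_sub[OF Z] by (rule openin_subset_trans)
    moreover have "continuous_on Z' g"
      using PH_continuous[OF Z'(4)] Z'(5) by (simp cong: continuous_on_cong)
    ultimately show ?thesis using Z'(2) by blast
  qed
  then show "continuous_on Z g" by (rule continuous_on_locally)
next
  fix u \<omega> i assume x: "(u, \<omega>) \<in> Z" and i: "i < n"
  obtain Z' g' where Z': "rel_open n P Z'" "(u, \<omega>) \<in> Z'" "Z' \<subseteq> Z" "PH n Z' g'" "\<forall>y\<in>Z'. g' y = g y"
    using loc[OF x] by blast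
  have u: "u \<in> Cn n" using x rel_open_sub[OF Z] by auto
  have "(\<lambda>t. g' (u(i := t), \<omega>)) field_differentiable at (u i)"
    by (rule PH_differentiable[OF Z'(4,2) i])
  moreover have "\<forall>\<^sub>F t in nhds (u i). g' (u(i := t), \<omega>) = g (u(i := t), \<omega>)"
    using line_open[OF Z'(1) u i, of \<omega>] Z'(2,5)
    by (auto simp: eventually_nhds intro!: exI[of _ "{t. (u(i := t), \<omega>) \<in> Z'}"])
  ultimately show "(\<lambda>t. g (u(i := t), \<omega>)) field_differentiable at (u i)"
    unfolding field_differentiable_def by (simp add: DERIV_cong_ev[OF refl _ refl])
qed

lemma PH_cong: "PH n Z f \<Longrightarrow> rel_open n P Z \<Longrightarrow> (\<And>x. x \<in> Z \<Longrightarrow> f x = g x) \<Longrightarrow> PH n Z g"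
  by (rule PH_local[of n P Z g], assumption, rule exI[of _ Z], rule exI[of _ f]) auto

lemma continuous_on_line:
  fixes a :: "'c::topological_space \<Rightarrow> nat \<Rightarrow> complex"
  assumes g: "continuous_on Z g" and \<gamma>: "continuous_on S a" "continuous_on S b" "continuous_on S c"
    and sub: "\<And>x. x \<in> S \<Longrightarrow> ((a x)(i := c x), b x) \<in> Z"
  shows "continuous_on S (\<lambda>x. g ((a x)(i := c x), b x))"
proof (rule continuous_on_compose2[OF g])
  have "continuous_on S (\<lambda>x. (a x)(i := c x))"
  proof (rule continuous_on_coordinatewise_then_product)
    fix j
    have "continuous_on S (\<lambda>x. a x j)"
      by (rule continuous_on_compose2[OF continuous_on_product_coordinates[of j]]) (auto intro: \<gamma>)
    then show "continuous_on S (\<lambda>x. ((a x)(i := c x)) j)" using \<gamma>(3) by (cases "j = i") auto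
  qed
  then show "continuous_on S (\<lambda>x. ((a x)(i := c x), b x))" using \<gamma>(2) by (rule continuous_on_Pair)
qed (use sub in auto)

section \<open>Cauchy's formula, joint differentiability and the chain rule\<close>

lemma contour_integral_circlepath_eq:
  "contour_integral (circlepath z r) f
    = integral {0..1} (\<lambda>x. f (circlepath z r x) * (2 * pi * \<i> * r * exp (2 * of_real pi * \<i> * x)))"
  unfolding contour_integral_integral
  by (rule integral_cong) (simp add: vector_derivative_circlepath)

lemma continuous_circlepath: "continuous_on S (circlepath z r)"
  unfolding circlepath_def part_circlepath_def linepath_def by (intro continuous_intros)

lemma circlepath_dist: "dist z (circlepath z r x) = \<bar>r\<bar>"
  by (simp add: circlepath dist_norm norm_mult)

text \<open>Cauchy's formula for the derivative, with one circle around the base coordinate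
  \<open>u0 i\<close> used for all points nearby, writes the partial derivative as an integral of a
  jointly continuous kernel.\<close>

lemma continuous_PD:
  assumes Z: "rel_open n P Z" and g: "PH n Z g" and i: "i < n"
  shows "continuous_on Z (PD i g)"
proof -
  have loc: "\<exists>Z'. openin (top_of_set Z) Z' \<and> x \<in> Z' \<and> continuous_on Z' (PD i g)" if xZ: "x \<in> Z" for x
  proof -
    obtain u0 \<omega>0 where x: "x = (u0, \<omega>0)" by (cases x)
    obtain \<delta> W where \<delta>: "\<delta> > 0" "openin (top_of_set P) W" "\<omega>0 \<in> W" "polydisc n u0 \<delta> \<times> W \<subseteq> Z"
      using rel_open_contains_polydisc[OF Z xZ[unfolded x]] .
    \<comment> \<open>Half of \<open>\<delta>\<close>: the circle stays in the domain, while the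
      \<open>i\<close>-th coordinates of the points of \<open>Z'\<close> stay strictly inside
      it.\<close>
    define r where "r = \<delta> / 2"
    have r: "0 < r" "r < \<delta>" using \<delta>(1) by (auto simp: r_def)
    define Z' where "Z' = polydisc n u0 r \<times> W"
    have Z': "rel_open n P Z'" unfolding Z'_def by (rule rel_open_polydisc[OF \<delta>(2)])
    have Z'_Z: "Z' \<subseteq> Z" using \<delta>(4) polydisc_mono[of r \<delta> n u0] r by (auto simp: Z'_def)
    have u0: "u0 \<in> Cn n" using xZ x rel_open_sub[OF Z] by auto
    have in_Z: "(u(i := t), \<omega>) \<in> Z" if "(u, \<omega>) \<in> Z'" "cmod (t - u0 i) < \<delta>" for u \<omega> t
      using that polydisc_mono[of r \<delta> n u0] r \<delta>(4) polydisc_upd[of u n u0 \<delta> i t] i by (auto simp: Z'_def)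
    let ?\<gamma> = "circlepath (u0 i) r"
    define I where "I = (\<lambda>x. integral (cbox 0 1) (\<lambda>s::real. g ((fst x)(i := ?\<gamma> s), snd x) / (?\<gamma> s - fst x i)\<^sup>2
        * (2 * pi * \<i> * r * exp (2 * of_real pi * \<i> * s))))"
    have PD_eq: "PD i g x = 1 / (2 * of_real pi * \<i>) * I x" if "x \<in> Z'" for x
    proof -
      obtain u \<omega> where x: "x = (u, \<omega>)" by (cases x)
      have xZ': "(u, \<omega>) \<in> Z'" using that x by simp
      let ?F = "\<lambda>t. g (u(i := t), \<omega>)"
      have hol: "?F holomorphic_on cball (u0 i) r"
        by (rule holomorphic_on_subset[OF PH_holomorphic_line[OF g i]])
          (use in_Z[OF xZ'] r in \<open>auto simp: dist_norm norm_minus_commute\<close>)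
      have ui: "u i \<in> ball (u0 i) r"
        using xZ' i by (auto simp: Z'_def polydisc_def dist_norm norm_minus_commute)
      have "(?F has_field_derivative 1 / (2 * of_real pi * \<i>) * contour_integral ?\<gamma> (\<lambda>w. ?F w / (w - u i)^2)) (at (u i))"
        using Cauchy_derivative_integral_circlepath(2)[OF holomorphic_on_imp_continuous_on[OF hol]
            holomorphic_on_subset[OF hol ball_subset_cball] ui] .
      then show ?thesis
        unfolding PD_def I_def x contour_integral_circlepath_eq by (simp add: DERIV_imp_deriv)
    qed
    have "continuous_on Z' I"
      unfolding I_def
    proof (rule integral_continuous_on_param, unfold case_prod_unfold)
      let ?S = "Z' \<times> cbox (0::real) 1"
      have fst_i: "continuous_on ?S (\<lambda>x. fst (fst x) i)"
        by (rule continuous_on_compose2[OF continuous_on_product_coordinates[of i]]) (intro continuous_intros, simp)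
      have circ: "continuous_on ?S (\<lambda>x. ?\<gamma> (snd x))"
        by (rule continuous_on_compose2[OF continuous_circlepath[of UNIV]]) (intro continuous_intros, simp)
      have "continuous_on ?S (\<lambda>x. g ((fst (fst x))(i := ?\<gamma> (snd x)), snd (fst x)))"
      proof (rule continuous_on_line[OF PH_continuous[OF g]])
        show "((fst (fst x))(i := ?\<gamma> (snd x)), snd (fst x)) \<in> Z" if "x \<in> ?S" for x
          using that r circlepath_dist[of "u0 i" r "snd x"]
          by (intro in_Z) (auto simp: dist_norm norm_minus_commute)
      qed (intro continuous_intros circ)+
      moreover have "?\<gamma> (snd x) - fst (fst x) i \<noteq> 0" if "x \<in> ?S" for x
      proof
        assume "?\<gamma> (snd x) - fst (fst x) i = 0"
        then have "dist (u0 i) (fst (fst x) i) = r" using circlepath_dist[of "u0 i" r "snd x"] r by simp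
        then show False using that i by (auto simp: Z'_def polydisc_def dist_norm norm_minus_commute)
      qed
      ultimately show "continuous_on ?S (\<lambda>x. g ((fst (fst x))(i := ?\<gamma> (snd x)), snd (fst x)) / (?\<gamma> (snd x) - fst (fst x) i)\<^sup>2
        * (2 * pi * \<i> * r * exp (2 * of_real pi * \<i> * snd x)))"
        by (intro continuous_intros fst_i circ) auto
    qed
    then have "continuous_on Z' (\<lambda>x. 1 / (2 * of_real pi * \<i>) * I x)"
      by (intro continuous_intros)
    then have "continuous_on Z' (PD i g)"
      by (rule continuous_on_eq) (use PD_eq in auto)
    moreover have "openin (top_of_set Z) Z'"
      using Z' Z'_Z rel_open_sub[OF Z] by (rule openin_subset_trans)
    moreover have "x \<in> Z'" using x polydisc_center[OF r(1) u0] \<delta>(3) by (simp add: Z'_def)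
    ultimately show ?thesis by blast
  qed
  show ?thesis by (rule continuous_on_locally[OF loc])
qed

lemma PD_has_derivative:
  assumes "PH n Z g" "(u, \<omega>) \<in> Z" "i < n"
  shows "((\<lambda>t. g (u(i := t), \<omega>)) has_field_derivative PD i g (u, \<omega>)) (at (u i))"
  using PH_differentiable[OF assms] by (simp add: PD_def DERIV_deriv_iff_field_differentiable)

text \<open>Moving from \<open>z\<close> to \<open>w\<close> one coordinate at a time inside a polydisc.\<close>

lemma polydisc_increment_bound:
  assumes g: "PH n Z g" and sub: "polydisc n c r \<times> {\<omega>} \<subseteq> Z"
    and L: "\<And>v j. v \<in> polydisc n c r \<Longrightarrow> j < n \<Longrightarrow> cmod (PD j g (v, \<omega>) - L j) \<le> \<epsilon>"
    and w: "w \<in> polydisc n c r" and z: "z \<in> polydisc n c r"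
  shows "cmod (g (w, \<omega>) - g (z, \<omega>) - (\<Sum>j<n. L j * (w j - z j))) \<le> \<epsilon> * (\<Sum>j<n. cmod (w j - z j))"
proof -
  define v where "v m = (\<lambda>i. if i < m then w i else z i)" for m
  have v_in: "v m \<in> polydisc n c r" for m
    using w z by (auto simp: v_def polydisc_def Cn_def)
  have step: "cmod (g (v (Suc m), \<omega>) - g (v m, \<omega>) - L m * (w m - z m)) \<le> \<epsilon> * cmod (w m - z m)" if m: "m < n" for m
  proof -
    let ?F = "\<lambda>t. g ((v m)(m := t), \<omega>) - L m * t"
    have upd: "(v m)(m := w m) = v (Suc m)" "(v m)(m := z m) = v m"
      by (auto simp: v_def fun_eq_iff less_Suc_eq)
    have "cmod (?F (w m) - ?F (z m)) \<le> \<epsilon> * cmod (w m - z m)"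
    proof (rule field_differentiable_bound)
      show "convex (ball (c m) r)" by simp
      show "w m \<in> ball (c m) r" "z m \<in> ball (c m) r"
        using w z m by (auto simp: polydisc_def dist_norm norm_minus_commute)
      fix t assume t: "t \<in> ball (c m) r"
      then have vt: "(v m)(m := t) \<in> polydisc n c r"
        by (intro polydisc_upd v_in m) (simp add: dist_norm norm_minus_commute)
      then have "((v m)(m := t), \<omega>) \<in> Z" using sub by auto
      from PD_has_derivative[OF g this m]
      have "((\<lambda>t. g ((v m)(m := t), \<omega>)) has_field_derivative PD m g ((v m)(m := t), \<omega>)) (at t)" by simp
      then show "(?F has_field_derivative PD m g ((v m)(m := t), \<omega>) - L m) (at t within ball (c m) r)"
        by (auto intro!: derivative_eq_intros intro: has_field_derivative_at_within)
      show "cmod (PD m g ((v m)(m := t), \<omega>) - L m) \<le> \<epsilon>" by (rule L[OF vt m])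
    qed
    then show ?thesis by (simp add: upd algebra_simps)
  qed
  have "v 0 = z" "v n = w"
    using w z by (auto simp: v_def fun_eq_iff polydisc_def Cn_def)
  then have "g (w, \<omega>) - g (z, \<omega>) = (\<Sum>m<n. g (v (Suc m), \<omega>) - g (v m, \<omega>))"
    by (simp add: sum_lessThan_telescope[of "\<lambda>m. g (v m, \<omega>)"])
  then have "g (w, \<omega>) - g (z, \<omega>) - (\<Sum>j<n. L j * (w j - z j))
      = (\<Sum>m<n. (g (v (Suc m), \<omega>) - g (v m, \<omega>) - L m * (w m - z m)))"
    by (simp add: sum_subtractf)
  also have "cmod \<dots> \<le> (\<Sum>m<n. \<epsilon> * cmod (w m - z m))"
    by (rule sum_norm_le) (use step in auto)
  finally show ?thesis by (simp add: sum_distrib_left)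
qed

text \<open>By \<open>continuous_PD\<close> the partial derivatives are nearly constant on a small
  polydisc; the increment bound then turns separate holomorphy into joint differentiability.\<close>

lemma frechet_estimate:
  assumes Z: "rel_open n P Z" and g: "PH n Z g" and x: "(z, \<omega>) \<in> Z" and \<epsilon>: "\<epsilon> > 0"
  shows "\<exists>\<delta>>0. \<forall>w\<in>polydisc n z \<delta>. (w, \<omega>) \<in> Z \<and>
    cmod (g (w, \<omega>) - g (z, \<omega>) - (\<Sum>j<n. PD j g (z, \<omega>) * (w j - z j))) \<le> \<epsilon> * (\<Sum>j<n. cmod (w j - z j))"
proof -
  have zC: "z \<in> Cn n" using x rel_open_sub[OF Z] by auto
  have "\<exists>\<delta>>0. polydisc n z \<delta> \<times> {\<omega>} \<subseteq> Z \<and> (\<forall>v\<in>polydisc n z \<delta>. cmod (PD j g (v, \<omega>) - PD j g (z, \<omega>)) \<le> \<epsilon>)"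
    if j: "j < n" for j
  proof -
    have "openin (top_of_set Z) (Z \<inter> PD j g -` ball (PD j g (z, \<omega>)) \<epsilon>)"
      by (rule continuous_openin_preimage_gen[OF continuous_PD[OF Z g j] open_ball])
    then have "rel_open n P (Z \<inter> PD j g -` ball (PD j g (z, \<omega>)) \<epsilon>)"
      using Z by (rule openin_trans)
    moreover have "(z, \<omega>) \<in> Z \<inter> PD j g -` ball (PD j g (z, \<omega>)) \<epsilon>" using x \<epsilon> by simp
    ultimately obtain \<delta> W where "\<delta> > 0" "openin (top_of_set P) W" "\<omega> \<in> W"
        "polydisc n z \<delta> \<times> W \<subseteq> Z \<inter> PD j g -` ball (PD j g (z, \<omega>)) \<epsilon>"
      by (rule rel_open_contains_polydisc)
    then have "(v, \<omega>) \<in> Z \<inter> PD j g -` ball (PD j g (z, \<omega>)) \<epsilon>" if "v \<in> polydisc n z \<delta>" for v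
      using that by blast
    then have "(v, \<omega>) \<in> Z \<and> cmod (PD j g (v, \<omega>) - PD j g (z, \<omega>)) \<le> \<epsilon>" if "v \<in> polydisc n z \<delta>" for v
      using that by (fastforce simp: dist_norm norm_minus_commute)
    with \<open>\<delta> > 0\<close> show ?thesis by blast
  qed
  then obtain d where d: "\<And>j. j < n \<Longrightarrow> d j > 0" "\<And>j. j < n \<Longrightarrow> polydisc n z (d j) \<times> {\<omega>} \<subseteq> Z"
    "\<And>j v. j < n \<Longrightarrow> v \<in> polydisc n z (d j) \<Longrightarrow> cmod (PD j g (v, \<omega>) - PD j g (z, \<omega>)) \<le> \<epsilon>"
    by metis
  obtain \<delta>0 W where "\<delta>0 > 0" "openin (top_of_set P) W" "\<omega> \<in> W" "polydisc n z \<delta>0 \<times> W \<subseteq> Z"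
    by (rule rel_open_contains_polydisc[OF Z x])
  then have \<delta>0: "\<delta>0 > 0" "polydisc n z \<delta>0 \<times> {\<omega>} \<subseteq> Z" by auto
  define \<delta> where "\<delta> = Min (insert \<delta>0 (d ` {..<n}))"
  have \<delta>: "\<delta> > 0" "\<delta> \<le> \<delta>0" "\<And>j. j < n \<Longrightarrow> \<delta> \<le> d j"
    using \<delta>0(1) d(1) by (auto simp: \<delta>_def)
  have sub: "polydisc n z \<delta> \<times> {\<omega>} \<subseteq> Z" using \<delta>0(2) polydisc_mono[OF \<delta>(2), of n z] by blast
  have "cmod (g (w, \<omega>) - g (z, \<omega>) - (\<Sum>j<n. PD j g (z, \<omega>) * (w j - z j))) \<le> \<epsilon> * (\<Sum>j<n. cmod (w j - z j))"
    if "w \<in> polydisc n z \<delta>" for w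
  proof (rule polydisc_increment_bound[OF g sub _ that polydisc_center[OF \<delta>(1) zC]])
    fix v j assume "v \<in> polydisc n z \<delta>" and j: "j < n"
    then have "v \<in> polydisc n z (d j)" using polydisc_mono[OF \<delta>(3)[OF j]] by blast
    then show "cmod (PD j g (v, \<omega>) - PD j g (z, \<omega>)) \<le> \<epsilon>" by (rule d(3)[OF j])
  qed
  moreover have "(w, \<omega>) \<in> Z" if "w \<in> polydisc n z \<delta>" for w using sub that by blast
  ultimately show ?thesis using \<delta>(1) by blast
qed

lemma has_field_derivative_zeroI:
  fixes f :: "complex \<Rightarrow> complex"
  assumes "\<And>e. e > 0 \<Longrightarrow> \<forall>\<^sub>F t in at t0. cmod (f t - f t0) \<le> e * cmod (t - t0)"
  shows "(f has_field_derivative 0) (at t0)"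
  unfolding has_field_derivative_iff
proof (rule tendstoI)
  fix e :: real assume "e > 0"
  then have "\<forall>\<^sub>F t in at t0. cmod (f t - f t0) \<le> e / 2 * cmod (t - t0)" by (intro assms) simp
  moreover have "\<forall>\<^sub>F t in at t0. t \<noteq> t0" by (simp add: eventually_at_filter)
  ultimately show "\<forall>\<^sub>F t in at t0. dist ((f t - f t0) / (t - t0)) 0 < e"
  proof eventually_elim
    case (elim t)
    then have "cmod (f t - f t0) / cmod (t - t0) \<le> e / 2" by (simp add: divide_le_eq)
    then have "cmod (f t - f t0) / cmod (t - t0) < e" using \<open>e > 0\<close> by linarith
    then show ?case by (simp add: norm_divide)
  qed
qed

lemma eventually_line:
  assumes "rel_open n P Z" "(u, \<omega>) \<in> Z" "i < n"
  shows "\<forall>\<^sub>F t in at (u i). (u(i := t), \<omega>) \<in> Z"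
proof -
  have "u \<in> Cn n" using assms(1,2) rel_open_sub by blast
  from line_open[OF assms(1) this assms(3)]
  show ?thesis using assms(2) unfolding eventually_at_topological by (intro exI[of _ "{t. (u(i := t), \<omega>) \<in> Z}"]) auto
qed

text \<open>Along a coordinate line of the source all coordinates of \<open>T\<close> move at once,
  so separate differentiability of \<open>G\<close> does not suffice and the joint
  \<open>frechet_estimate\<close> is used. The parameter is transformed by \<open>\<sigma>\<close>
  independently of the point, hence is constant on the line.\<close>

lemma PH_compose:
  assumes Z': "rel_open n' P' Z'" and G: "PH n' Z' G" and Z: "rel_open n P Z"
    and T: "\<And>j. j < n' \<Longrightarrow> PH n Z (\<lambda>x. T x j)"
    and \<sigma>: "continuous_on Z (\<lambda>x. \<sigma> (snd x))"
    and sub: "\<And>x. x \<in> Z \<Longrightarrow> (T x, \<sigma> (snd x)) \<in> Z'"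
  shows "PH n Z (\<lambda>x. G (T x, \<sigma> (snd x)))"
  unfolding PH_def
proof (intro conjI allI impI)
  have T0: "T x j = 0" if "x \<in> Z" "\<not> j < n'" for x j
    using sub[OF that(1)] rel_open_sub[OF Z'] that(2) by (auto simp: Cn_def)
  have "continuous_on Z T"
  proof (rule continuous_on_coordinatewise_then_product)
    fix j show "continuous_on Z (\<lambda>x. T x j)"
    proof (cases "j < n'")
      case True
      then show ?thesis using T PH_continuous by blast
    next
      case False
      then show ?thesis using T0 continuous_on_cong[of Z Z "\<lambda>x. T x j" "\<lambda>_. 0"] by simp
    qed
  qed
  then show "continuous_on Z (\<lambda>x. G (T x, \<sigma> (snd x)))"
    by (intro continuous_on_compose2[OF PH_continuous[OF G]] continuous_on_Pair \<sigma>) (use sub in auto)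
next
  fix u \<omega> i assume x: "(u, \<omega>) \<in> Z" and i: "i < n"
  define w where "w t = T (u(i := t), \<omega>)" for t
  define v where "v = T (u, \<omega>)"
  have wv: "w (u i) = v" by (simp add: w_def v_def)
  have vZ: "(v, \<sigma> \<omega>) \<in> Z'" using sub[OF x] by (simp add: v_def)
  define d where "d j = PD i (\<lambda>x. T x j) (u, \<omega>)" for j
  define L where "L j = PD j G (v, \<sigma> \<omega>)" for j
  have d: "((\<lambda>t. w t j) has_field_derivative d j) (at (u i))" if "j < n'" for j
    unfolding d_def w_def by (rule PD_has_derivative[OF T[OF that] x i])
  have lip: "\<forall>\<^sub>F t in at (u i). \<forall>j\<in>{..<n'}. cmod (w t j - v j) \<le> (cmod (d j) + 1) * cmod (t - u i)"
  proof (rule eventually_ball_finite, simp, rule ballI)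
    fix j assume j: "j \<in> {..<n'}"
    have "((\<lambda>t. (w t j - w (u i) j) / (t - u i)) \<longlongrightarrow> d j) (at (u i))"
      using d[of j] j by (simp add: has_field_derivative_iff)
    then have "((\<lambda>t. cmod ((w t j - v j) / (t - u i))) \<longlongrightarrow> cmod (d j)) (at (u i))"
      unfolding wv by (rule tendsto_norm)
    then have "\<forall>\<^sub>F t in at (u i). cmod ((w t j - v j) / (t - u i)) < cmod (d j) + 1"
      by (rule order_tendstoD) simp
    moreover have "\<forall>\<^sub>F t in at (u i). t \<noteq> u i" by (simp add: eventually_at_filter)
    ultimately show "\<forall>\<^sub>F t in at (u i). cmod (w t j - v j) \<le> (cmod (d j) + 1) * cmod (t - u i)"
    proof eventually_elim
      case (elim t)
      then have "cmod (w t j - v j) / cmod (t - u i) \<le> cmod (d j) + 1" by (simp add: norm_divide)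
      moreover have "cmod (t - u i) > 0" using elim by simp
      ultimately show ?case by (simp add: divide_le_eq)
    qed
  qed
  have small: "\<forall>\<^sub>F t in at (u i). w t \<in> polydisc n' v \<delta>" if \<delta>: "\<delta> > 0" for \<delta>
  proof -
    have "\<forall>\<^sub>F t in at (u i). \<forall>j\<in>{..<n'}. cmod (w t j - v j) < \<delta>"
    proof (rule eventually_ball_finite, simp, rule ballI)
      fix j assume "j \<in> {..<n'}"
      then have "isCont (\<lambda>t. w t j) (u i)" using d DERIV_isCont by blast
      then have "((\<lambda>t. w t j) \<longlongrightarrow> v j) (at (u i))" by (simp add: isCont_def wv)
      from tendstoD[OF this \<delta>] show "\<forall>\<^sub>F t in at (u i). cmod (w t j - v j) < \<delta>"
        by (simp add: dist_norm)
    qed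
    with eventually_line[OF Z x i] show ?thesis
    proof eventually_elim
      case (elim t)
      have "w t \<in> Cn n'" using sub[OF elim(1)] rel_open_sub[OF Z'] by (auto simp: w_def)
      then show ?case using elim(2) by (simp add: polydisc_def)
    qed
  qed
  \<comment> \<open>Subtracting the linear part reduces the chain rule to a derivative 0, for which
    a bound of order o(t) suffices.\<close>
  let ?g = "\<lambda>t. G (w t, \<sigma> \<omega>) - (\<Sum>j<n'. L j * w t j)"
  have "(?g has_field_derivative 0) (at (u i))"
  proof (rule has_field_derivative_zeroI)
    fix e :: real assume e: "e > 0"
    define C where "C = (\<Sum>j<n'. cmod (d j) + 1)"
    have C: "C \<ge> 0" by (auto simp: C_def intro!: sum_nonneg add_nonneg_nonneg)
    \<comment> \<open>\<open>C\<close> sums the Lipschitz constants of the coordinates of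
      \<open>w\<close> from \<open>lip\<close>; the added 1 keeps the denominator positive also when
      the sum is empty.\<close>
    define \<epsilon> where "\<epsilon> = e / (C + 1)"
    have \<epsilon>: "\<epsilon> > 0" "\<epsilon> * C \<le> e" using e C by (auto simp: \<epsilon>_def field_simps)
    from frechet_estimate[OF Z' G vZ \<epsilon>(1)] obtain \<delta> where \<delta>: "\<delta> > 0"
      and est: "\<And>w. w \<in> polydisc n' v \<delta> \<Longrightarrow> cmod (G (w, \<sigma> \<omega>) - G (v, \<sigma> \<omega>) - (\<Sum>j<n'. L j * (w j - v j))) \<le> \<epsilon> * (\<Sum>j<n'. cmod (w j - v j))"
      unfolding L_def by blast
    from small[OF \<delta>] lip show "\<forall>\<^sub>F t in at (u i). cmod (?g t - ?g (u i)) \<le> e * cmod (t - u i)"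
    proof eventually_elim
      case (elim t)
      have eq: "?g t - ?g (u i) = G (w t, \<sigma> \<omega>) - G (v, \<sigma> \<omega>) - (\<Sum>j<n'. L j * (w t j - v j))"
        by (simp add: wv right_diff_distrib sum_subtractf)
      have "cmod (?g t - ?g (u i)) \<le> \<epsilon> * (\<Sum>j<n'. cmod (w t j - v j))"
        unfolding eq by (rule est[OF elim(1)])
      also have "\<dots> \<le> \<epsilon> * (\<Sum>j<n'. (cmod (d j) + 1) * cmod (t - u i))"
        using elim(2) \<epsilon>(1) by (intro mult_left_mono sum_mono) auto
      also have "\<dots> = \<epsilon> * C * cmod (t - u i)"
        by (simp only: C_def sum_distrib_right[symmetric] mult.assoc)
      also have "\<dots> \<le> e * cmod (t - u i)"
        using \<epsilon>(2) by (intro mult_right_mono) auto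
      finally show ?case .
    qed
  qed
  moreover have "((\<lambda>t. \<Sum>j<n'. L j * w t j) has_field_derivative (\<Sum>j<n'. L j * d j)) (at (u i))"
    using d by (intro DERIV_sum DERIV_cmult) auto
  ultimately have "((\<lambda>t. ?g t + (\<Sum>j<n'. L j * w t j)) has_field_derivative 0 + (\<Sum>j<n'. L j * d j)) (at (u i))"
    by (rule DERIV_add)
  then have "((\<lambda>t. G (w t, \<sigma> \<omega>)) has_field_derivative (\<Sum>j<n'. L j * d j)) (at (u i))" by simp
  then show "(\<lambda>t. G (T (u(i := t), \<omega>), \<sigma> (snd (u(i := t), \<omega>)))) field_differentiable at (u i)"
    unfolding field_differentiable_def w_def by auto
qed

section \<open>Comparison with complex Frechet differentiability\<close>

lemma L2_set_single: "i < (n::nat) \<Longrightarrow> L2_set (\<lambda>j. cmod ((u(i := t)) j - u j)) {..<n} = cmod (t - u i)"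
proof -
  assume i: "i < n"
  have "(\<Sum>j<n. (cmod ((u(i := t)) j - u j))\<^sup>2) = (\<Sum>j<n. if j = i then (cmod (t - u i))\<^sup>2 else 0)"
    by (intro sum.cong) auto
  also have "\<dots> = (cmod (t - u i))\<^sup>2" using i by (subst sum.delta) auto
  finally show ?thesis by (simp add: L2_set_def)
qed

text \<open>A one-point parameter set makes holomorphy on a manifold an instance of
  \<open>PH\<close>; together with \<open>PH_imp_holo_Cn\<close> this trades the Frechet form of the
  definition for the separate one.\<close>

lemma holo_Cn_imp_PH:
  assumes "holo_Cn n D f"
  shows "PH n (D \<times> {0::real}) (\<lambda>x. f (fst x))"
proof -
  have D: "openin (top_of_set (Cn n)) D" using assms by (simp add: holo_Cn_def)
  have D_sub: "D \<subseteq> Cn n" using openin_subset[OF D] by simp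
  have "continuous_on D f"
    unfolding continuous_on_def
  proof
    fix z assume z: "z \<in> D"
    obtain L where L: "((\<lambda>w. (f w - f z - (\<Sum>j<n. L j * (w j - z j)))
               / complex_of_real (L2_set (\<lambda>j. cmod (w j - z j)) {..<n})) \<longlongrightarrow> 0) (at z within D)" (is "(?q \<longlongrightarrow> 0) _")
      using assms z by (auto simp: holo_Cn_def)
    let ?l = "\<lambda>w. L2_set (\<lambda>j. cmod (w j - z j)) {..<n}"
    have coord: "((\<lambda>w. w j) \<longlongrightarrow> z j) (at z within D)" for j
    proof -
      have "continuous_on D (\<lambda>w. w j)" by (rule continuous_on_subset[OF continuous_on_product_coordinates]) simp
      then show ?thesis using z by (simp add: continuous_on_def)
    qed
    have l: "(?l \<longlongrightarrow> 0) (at z within D)"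
    proof -
      have "(?l \<longlongrightarrow> L2_set (\<lambda>j. cmod (z j - z j)) {..<n}) (at z within D)"
        unfolding L2_set_def by (intro tendsto_intros coord)
      then show ?thesis by (simp add: L2_set_def)
    qed
    \<comment> \<open>The difference quotient is undone: \<open>f\<close> is its value at
      \<open>z\<close> plus the linear part plus the quotient times the distance, and both
      corrections tend to 0.\<close>
    have "((\<lambda>w. f z + (\<Sum>j<n. L j * (w j - z j)) + ?q w * complex_of_real (?l w)) \<longlongrightarrow>
        f z + (\<Sum>j<n. L j * (z j - z j)) + 0 * complex_of_real 0) (at z within D)"
      by (intro tendsto_intros coord L l)
    moreover have "\<forall>\<^sub>F w in at z within D. f z + (\<Sum>j<n. L j * (w j - z j)) + ?q w * complex_of_real (?l w) = f w"
      unfolding eventually_at_filter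
    proof (intro always_eventually allI impI)
      fix w assume "w \<noteq> z" "w \<in> D"
      then obtain j where wz: "w j \<noteq> z j" by auto
      have "w \<in> Cn n" "z \<in> Cn n" using D_sub z \<open>w \<in> D\<close> by auto
      then have "j < n" using wz by (metis (mono_tags) Cn_def mem_Collect_eq not_less)
      with wz have "?l w \<noteq> 0" using member_le_L2_set[of "{..<n}" j "\<lambda>j. cmod (w j - z j)"] by auto
      then show "f z + (\<Sum>j<n. L j * (w j - z j)) + ?q w * complex_of_real (?l w) = f w" by simp
    qed
    ultimately show "(f \<longlongrightarrow> f z) (at z within D)"
      using Lim_transform_eventually by fastforce
  qed
  then have "continuous_on (D \<times> {0::real}) (\<lambda>x. f (fst x))"
    by (rule continuous_on_compose2) (auto intro: continuous_intros)
  moreover have "(\<lambda>t. f (u(i := t))) field_differentiable at (u i)" if u: "u \<in> D" and i: "i < n" for u i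
  proof -
    obtain L where L: "((\<lambda>w. (f w - f u - (\<Sum>j<n. L j * (w j - u j)))
               / complex_of_real (L2_set (\<lambda>j. cmod (w j - u j)) {..<n})) \<longlongrightarrow> 0) (at u within D)" (is "(?q \<longlongrightarrow> 0) _")
      using assms u by (auto simp: holo_Cn_def)
    have rel: "rel_open n {0::real} (D \<times> {0})" using D by (intro openin_Times) auto
    have "filterlim (\<lambda>t. u(i := t)) (at u within D) (at (u i))"
      unfolding filterlim_at
    proof (intro conjI)
      show "\<forall>\<^sub>F t in at (u i). u(i := t) \<in> D \<and> u(i := t) \<noteq> u"
        using eventually_line[OF rel, of u 0 i] u i
        by (auto simp: eventually_at_filter fun_eq_iff elim: eventually_mono)
      have "((\<lambda>t. u(i := t)) \<longlongrightarrow> u(i := u i)) (at (u i))"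
        using continuous_on_upd[of u i] by (metis UNIV_I continuous_on_def)
      then show "((\<lambda>t. u(i := t)) \<longlongrightarrow> u) (at (u i))" by simp
    qed
    from filterlim_compose[OF L this]
    have *: "((\<lambda>t. ?q (u(i := t))) \<longlongrightarrow> 0) (at (u i))" .
    have "(\<Sum>j<n. L j * ((u(i := t)) j - u j)) = L i * (t - u i)" for t
    proof -
      have "(\<Sum>j<n. L j * ((u(i := t)) j - u j)) = (\<Sum>j<n. if j = i then L i * (t - u i) else 0)"
        by (intro sum.cong) auto
      then show ?thesis using i by simp
    qed
    with * have q: "((\<lambda>t. (f (u(i := t)) - f u - L i * (t - u i)) / complex_of_real (cmod (t - u i))) \<longlongrightarrow> 0) (at (u i))"
      by (simp only: L2_set_single[OF i])
    let ?g = "\<lambda>t. f (u(i := t)) - L i * t"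
    have "(?g has_field_derivative 0) (at (u i))"
    proof (rule has_field_derivative_zeroI)
      fix e :: real assume "e > 0"
      from tendstoD[OF q this] have "\<forall>\<^sub>F t in at (u i). cmod (f (u(i := t)) - f u - L i * (t - u i)) / cmod (t - u i) < e"
        by (simp add: norm_divide)
      moreover have "\<forall>\<^sub>F t in at (u i). t \<noteq> u i" by (simp add: eventually_at_filter)
      ultimately show "\<forall>\<^sub>F t in at (u i). cmod (?g t - ?g (u i)) \<le> e * cmod (t - u i)"
      proof eventually_elim
        case (elim t)
        then have "cmod (f (u(i := t)) - f u - L i * (t - u i)) \<le> e * cmod (t - u i)"
          by (simp add: divide_less_eq)
        then show ?case by (simp add: algebra_simps)
      qed
    qed
    then have "((\<lambda>t. ?g t + L i * t) has_field_derivative 0 + L i) (at (u i))"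
      by (intro DERIV_add) (auto intro!: derivative_eq_intros)
    then show ?thesis unfolding field_differentiable_def by auto
  qed
  ultimately show ?thesis by (auto simp: PH_def)
qed

lemma PH_imp_holo_Cn:
  assumes D: "openin (top_of_set (Cn n)) D" and f: "PH n (D \<times> {0::real}) (\<lambda>x. f (fst x))"
  shows "holo_Cn n D f"
  unfolding holo_Cn_def
proof (intro conjI ballI D)
  fix z assume z: "z \<in> D"
  have rel: "rel_open n {0::real} (D \<times> {0})" using D by (intro openin_Times) auto
  define L where "L j = PD j (\<lambda>x. f (fst x)) (z, 0::real)" for j
  have "((\<lambda>w. (f w - f z - (\<Sum>j<n. L j * (w j - z j)))
               / complex_of_real (L2_set (\<lambda>j. cmod (w j - z j)) {..<n})) \<longlongrightarrow> 0) (at z within D)"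
  proof (rule tendstoI)
    fix e :: real assume e: "e > 0"
    \<comment> \<open>The sum of the \<open>n\<close> coordinate distances is at most
      \<open>n\<close> times the Euclidean one; \<open>n + 1\<close> gives a strict inequality and
      allows \<open>n = 0\<close>.\<close>
    define \<epsilon> where "\<epsilon> = e / (n + 1)"
    have \<epsilon>: "\<epsilon> > 0" "\<epsilon> * n < e" using e by (auto simp: \<epsilon>_def field_simps)
    obtain \<delta> where \<delta>: "\<delta> > 0"
      and est: "\<And>w. w \<in> polydisc n z \<delta> \<Longrightarrow> cmod (f w - f z - (\<Sum>j<n. L j * (w j - z j))) \<le> \<epsilon> * (\<Sum>j<n. cmod (w j - z j))"
      using frechet_estimate[OF rel f, of z 0 \<epsilon>] z \<epsilon>(1) by (auto simp: L_def)
    have zC: "z \<in> Cn n" using openin_subset[OF D] z by auto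
    have "openin (top_of_set D) (D \<inter> polydisc n z \<delta>)"
      using openin_polydisc[of n z \<delta>] openin_subset[OF D] by (auto simp: openin_open)
    then obtain S where S: "open S" "D \<inter> polydisc n z \<delta> = D \<inter> S" by (auto simp: openin_open)
    then have "z \<in> S" using z polydisc_center[OF \<delta> zC] by blast
    then have "\<forall>\<^sub>F w in at z within D. w \<in> D \<and> w \<in> polydisc n z \<delta>"
      unfolding eventually_at_topological using S by (intro exI[of _ S]) blast
    then show "\<forall>\<^sub>F w in at z within D. dist ((f w - f z - (\<Sum>j<n. L j * (w j - z j)))
               / complex_of_real (L2_set (\<lambda>j. cmod (w j - z j)) {..<n})) 0 < e"
    proof eventually_elim
      case (elim w)
      let ?l = "L2_set (\<lambda>j. cmod (w j - z j)) {..<n}"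
      have "(\<Sum>j<n. cmod (w j - z j)) \<le> (\<Sum>j<n. ?l)"
        by (intro sum_mono member_le_L2_set) auto
      then have "\<epsilon> * (\<Sum>j<n. cmod (w j - z j)) \<le> \<epsilon> * (n * ?l)"
        using \<epsilon>(1) by (intro mult_left_mono) auto
      with est[of w] elim have *: "cmod (f w - f z - (\<Sum>j<n. L j * (w j - z j))) \<le> \<epsilon> * n * ?l" by simp
      show ?case
      proof (cases "?l = 0")
        case True
        then show ?thesis using e by simp
      next
        case False
        then have "?l > 0" using L2_set_nonneg[of "\<lambda>j. cmod (w j - z j)" "{..<n}"] by linarith
        then have "cmod (f w - f z - (\<Sum>j<n. L j * (w j - z j))) / ?l \<le> \<epsilon> * n" using * by (simp add: divide_le_eq)
        then show ?thesis using \<epsilon>(2) \<open>?l > 0\<close> by (simp add: norm_divide)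
      qed
    qed
  qed
  then show "\<exists>L. ((\<lambda>w. (f w - f z - (\<Sum>j<n. L j * (w j - z j)))
               / complex_of_real (L2_set (\<lambda>j. cmod (w j - z j)) {..<n})) \<longlongrightarrow> 0) (at z within D)"
    by blast
qed

section \<open>Extension from dense slices, and division by a linear form\<close>

lemma agree_on_dense:
  fixes f g :: "'p::topological_space \<Rightarrow> complex"
  assumes "continuous_on W f" "continuous_on W g" "W0 \<subseteq> W" "W \<subseteq> closure W0" "\<And>x. x \<in> W0 \<Longrightarrow> f x = g x" "x \<in> W"
  shows "f x = g x"
proof -
  have "closedin (top_of_set W) (W \<inter> (\<lambda>x. f x - g x) -` {0})"
    by (intro continuous_closedin_preimage continuous_on_diff assms) auto
  then obtain C where C: "closed C" "W \<inter> (\<lambda>x. f x - g x) -` {0} = W \<inter> C" by (auto simp: closedin_closed)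
  then have "W0 \<subseteq> C" using assms(3,5) by force
  then have "closure W0 \<subseteq> C" using C(1) by (rule closure_minimal)
  then have "x \<in> W \<inter> C" using assms(4,6) by blast
  then have "x \<in> W \<inter> (\<lambda>x. f x - g x) -` {0}" using C(2) by simp
  then show ?thesis by simp
qed

text \<open>For fixed \<open>u\<close> the Cauchy integral depends continuously on the parameter, so Cauchy's formula
  extends from the dense set \<open>P0\<close>.\<close>

lemma PH_dense:
  assumes Z: "rel_open n P Z" and cont: "continuous_on Z g" and P0: "P0 \<subseteq> P" "P \<subseteq> closure P0"
    and diff: "\<And>u \<omega> i. (u, \<omega>) \<in> Z \<Longrightarrow> \<omega> \<in> P0 \<Longrightarrow> i < n \<Longrightarrow> (\<lambda>t. g (u(i := t), \<omega>)) field_differentiable at (u i)"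
  shows "PH n Z g"
  unfolding PH_def
proof (intro conjI cont allI impI)
  fix u \<omega>0 i assume x: "(u, \<omega>0) \<in> Z" and i: "i < n"
  have u: "u \<in> Cn n" using x rel_open_sub[OF Z] by auto
  obtain \<delta> W where \<delta>: "\<delta> > 0" "openin (top_of_set P) W" "\<omega>0 \<in> W" "polydisc n u \<delta> \<times> W \<subseteq> Z"
    by (rule rel_open_contains_polydisc[OF Z x])
  define r where "r = \<delta> / 2"
  have r: "0 < r" "r < \<delta>" using \<delta>(1) by (auto simp: r_def)
  have in_Z: "(u(i := t), \<omega>) \<in> Z" if "cmod (t - u i) < \<delta>" "\<omega> \<in> W" for t \<omega>
    using polydisc_upd[OF polydisc_center[OF \<delta>(1) u] i that(1)] \<delta>(4) that(2) by auto
  let ?\<gamma> = "circlepath (u i) r"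
  define J where "J w \<omega> = contour_integral ?\<gamma> (\<lambda>s. g (u(i := s), \<omega>) / (s - w))" for w \<omega>
  have off: "s - w \<noteq> 0" if "w \<in> ball (u i) r" "s \<in> sphere (u i) r" for s w
    using that by auto
  have cont_line: "continuous_on (cball (u i) r) (\<lambda>s. g (u(i := s), \<omega>))" if "\<omega> \<in> W" for \<omega>
    by (rule continuous_on_line[OF cont]) (use in_Z that r in \<open>auto intro: continuous_intros simp: dist_norm norm_minus_commute\<close>)
  have J: "((\<lambda>s. g (u(i := s), \<omega>) / (s - w)) has_contour_integral J w \<omega>) ?\<gamma>" if "w \<in> ball (u i) r" "\<omega> \<in> W" for w \<omega>
    unfolding J_def
  proof (rule has_contour_integral_integral, rule contour_integrable_continuous_circlepath)
    show "continuous_on (path_image ?\<gamma>) (\<lambda>s. g (u(i := s), \<omega>) / (s - w))"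
      using off[OF that(1)] r continuous_on_subset[OF cont_line[OF that(2)], of "sphere (u i) r"]
      by (intro continuous_intros) auto
  qed
  have "J w \<omega> = 2 * of_real pi * \<i> * g (u(i := w), \<omega>)" if w: "w \<in> ball (u i) r" and \<omega>: "\<omega> \<in> W" for w \<omega>
  proof (rule agree_on_dense[OF _ _ _ _ _ \<omega>])
    obtain S where S: "open S" "W = P \<inter> S" using \<delta>(2) by (auto simp: openin_open)
    show "W \<inter> P0 \<subseteq> W" by simp
    \<comment> \<open>\<open>W\<close> is relatively open in \<open>P\<close>, so density survives
      in it.\<close>
    show "W \<subseteq> closure (W \<inter> P0)"
    proof
      fix y assume "y \<in> W"
      then have "y \<in> S \<inter> closure P0" using S P0 by auto
      then have "y \<in> closure (S \<inter> P0)" using open_Int_closure_subset[OF S(1)] by blast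
      moreover have "S \<inter> P0 = W \<inter> P0" using S(2) P0(1) by auto
      ultimately show "y \<in> closure (W \<inter> P0)" by simp
    qed
    show "continuous_on W (\<lambda>\<omega>. 2 * of_real pi * \<i> * g (u(i := w), \<omega>))"
      by (intro continuous_intros continuous_on_line[OF cont, of _ "\<lambda>_. u" "\<lambda>\<omega>. \<omega>" "\<lambda>_. w"])
        (use in_Z w r in \<open>auto simp: dist_norm norm_minus_commute\<close>)
    have "continuous_on W (\<lambda>\<omega>. integral (cbox 0 1) (\<lambda>s. g (u(i := ?\<gamma> s), \<omega>) / (?\<gamma> s - w) * (2 * pi * \<i> * r * exp (2 * of_real pi * \<i> * s))))"
    proof (rule integral_continuous_on_param, unfold case_prod_unfold)
      let ?S = "W \<times> cbox (0::real) 1"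
      have circ: "continuous_on ?S (\<lambda>x. ?\<gamma> (snd x))"
        by (rule continuous_on_compose2[OF continuous_circlepath[of UNIV]]) (intro continuous_intros, simp)
      have "continuous_on ?S (\<lambda>x. g (u(i := ?\<gamma> (snd x)), fst x))"
      proof (rule continuous_on_line[OF cont])
        show "(u(i := ?\<gamma> (snd x)), fst x) \<in> Z" if "x \<in> ?S" for x
          using that r circlepath_dist[of "u i" r "snd x"]
          by (intro in_Z) (auto simp: dist_norm norm_minus_commute)
      qed (intro continuous_intros circ)+
      moreover have "?\<gamma> s - w \<noteq> 0" for s
        using off[OF w, of "?\<gamma> s"] circlepath_dist[of "u i" r s] r by auto
      ultimately show "continuous_on ?S (\<lambda>x. g (u(i := ?\<gamma> (snd x)), fst x) / (?\<gamma> (snd x) - w)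
        * (2 * pi * \<i> * r * exp (2 * of_real pi * \<i> * snd x)))"
        by (intro continuous_intros circ) auto
    qed
    then show "continuous_on W (J w)"
      unfolding J_def contour_integral_circlepath_eq by simp
    fix \<omega> assume \<omega>: "\<omega> \<in> W \<inter> P0"
    have "(\<lambda>s. g (u(i := s), \<omega>)) holomorphic_on cball (u i) r"
      unfolding holomorphic_on_def
    proof
      fix t assume "t \<in> cball (u i) r"
      then have "(u(i := t), \<omega>) \<in> Z" using r \<omega> by (intro in_Z) (auto simp: dist_norm norm_minus_commute)
      from diff[OF this _ i] \<omega> show "(\<lambda>s. g (u(i := s), \<omega>)) field_differentiable at t within cball (u i) r"
        by (simp add: field_differentiable_at_within)
    qed
    from Cauchy_integral_circlepath_simple[OF this, of w] w
    show "J w \<omega> = 2 * of_real pi * \<i> * g (u(i := w), \<omega>)"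
      unfolding J_def by (intro contour_integral_unique) (simp add: dist_norm norm_minus_commute)
  qed
  then have eq: "g (u(i := w), \<omega>0) = J w \<omega>0 / (2 * of_real pi * \<i>)" if "w \<in> ball (u i) r" for w
    using that \<delta>(3) by simp
  \<comment> \<open>The Cauchy transform of a merely continuous function on the circle is
    differentiable inside, and continuity is all that is known about the slice
    \<open>\<omega>0\<close>.\<close>
  have "((\<lambda>w. J w \<omega>0) has_field_derivative 1 * contour_integral ?\<gamma> (\<lambda>s. g (u(i := s), \<omega>0) / (s - u i) ^ Suc 1)) (at (u i))"
    using Cauchy_next_derivative_circlepath(2)[of "u i" r "\<lambda>s. g (u(i := s), \<omega>0)" 1 "\<lambda>w. J w \<omega>0" "u i"]
      J \<delta>(3) r continuous_on_subset[OF cont_line[OF \<delta>(3)], of "sphere (u i) r"] by auto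
  then have "(\<lambda>w. J w \<omega>0) field_differentiable at (u i)" unfolding field_differentiable_def by blast
  then have "(\<lambda>w. J w \<omega>0 / (2 * of_real pi * \<i>)) field_differentiable at (u i)"
    by (intro field_differentiable_divide) auto
  moreover have "\<forall>\<^sub>F w in nhds (u i). J w \<omega>0 / (2 * of_real pi * \<i>) = g (u(i := w), \<omega>0)"
    unfolding eventually_nhds using r(1) by (intro exI[of _ "ball (u i) r"]) (auto simp: eq)
  ultimately show "(\<lambda>t. g (u(i := t), \<omega>0)) field_differentiable at (u i)"
    unfolding field_differentiable_def by (simp add: DERIV_cong_ev[OF refl _ refl])
qed

text \<open>The integration variable is counted as a second parameter: then the kernel is of type
  \<open>PH\<close>, and \<open>continuous_PD\<close> provides the continuity that Leibniz' rule
  asks for.\<close>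

lemma PH_integral:
  fixes K :: "(nat \<Rightarrow> complex) \<times> ('p::topological_space \<times> real) \<Rightarrow> complex"
  assumes Z: "rel_open n P Z" and K: "PH n {x. (fst x, fst (snd x)) \<in> Z \<and> snd (snd x) \<in> {0..1}} K"
  shows "PH n Z (\<lambda>x. integral {0..1} (\<lambda>s. K (fst x, (snd x, s))))"
proof -
  let ?Z = "{x. (fst x, fst (snd x)) \<in> Z \<and> snd (snd x) \<in> {0..1::real}}"
  obtain O' where O': "open O'" "Z = (Cn n \<times> P) \<inter> O'" using Z by (auto simp: openin_open)
  have "open ((\<lambda>x::(nat \<Rightarrow> complex) \<times> ('p \<times> real). (fst x, fst (snd x))) -` O')"
    by (intro open_vimage O'(1) continuous_intros)
  moreover have "?Z = (Cn n \<times> (P \<times> {0..1})) \<inter> (\<lambda>x. (fst x, fst (snd x))) -` O'"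
    using O'(2) by auto
  ultimately have Z1: "rel_open n (P \<times> {0..1}) ?Z" by (auto simp: openin_open)
  show ?thesis
    unfolding PH_def
  proof (intro conjI allI impI)
    have "continuous_on Z (\<lambda>x. integral (cbox 0 1) (\<lambda>s. K (fst x, (snd x, s))))"
    proof (rule integral_continuous_on_param, unfold case_prod_unfold)
      show "continuous_on (Z \<times> cbox 0 1) (\<lambda>x. K (fst (fst x), (snd (fst x), snd x)))"
        by (rule continuous_on_compose2[OF PH_continuous[OF K]])
          (intro continuous_on_Pair continuous_on_fst continuous_on_snd continuous_on_id, auto)
    qed
    then show "continuous_on Z (\<lambda>x. integral {0..1} (\<lambda>s. K (fst x, (snd x, s))))" by simp
  next
    fix u \<omega> i assume x: "(u, \<omega>) \<in> Z" and i: "i < n"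
    have u: "u \<in> Cn n" using x rel_open_sub[OF Z] by auto
    obtain d where d: "d > 0" "ball (u i) d \<subseteq> {t. (u(i := t), \<omega>) \<in> Z}"
      using line_open[OF Z u i, of \<omega>] x by (metis (no_types, lifting) fun_upd_triv mem_Collect_eq openE)
    let ?U = "ball (u i) d"
    have in_Z: "(u(i := t), (\<omega>, s)) \<in> ?Z" if "t \<in> ?U" "s \<in> {0..1}" for t s
      using that d(2) by auto
    have "((\<lambda>t. integral (cbox 0 1) (\<lambda>s. K (u(i := t), (\<omega>, s)))) has_field_derivative
        integral (cbox 0 1) (\<lambda>s. PD i K (u(i := u i), (\<omega>, s)))) (at (u i) within ?U)"
    proof (rule leibniz_rule_field_derivative)
      fix t s assume "t \<in> ?U" "s \<in> cbox (0::real) 1"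
      then have "(u(i := t), (\<omega>, s)) \<in> ?Z" using in_Z by simp
      from PD_has_derivative[OF K this i]
      show "((\<lambda>t. K (u(i := t), (\<omega>, s))) has_field_derivative PD i K (u(i := t), (\<omega>, s))) (at t within ?U)"
        by (simp add: has_field_derivative_at_within)
    next
      fix t assume t: "t \<in> ?U"
      have "continuous_on (cbox 0 1) (\<lambda>s. K (u(i := t), (\<omega>, s)))"
        by (rule continuous_on_compose2[OF PH_continuous[OF K]]) (intro continuous_on_Pair continuous_on_const continuous_on_id, use in_Z[OF t] in auto)
      then show "(\<lambda>s. K (u(i := t), (\<omega>, s))) integrable_on cbox 0 1" by (rule integrable_continuous)
    next
      show "continuous_on (?U \<times> cbox 0 1) (\<lambda>(t, s). PD i K (u(i := t), (\<omega>, s)))"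
        unfolding case_prod_unfold
        by (rule continuous_on_line[OF continuous_PD[OF Z1 K i], of _ "\<lambda>_. u" "\<lambda>x. (\<omega>, snd x)" fst])
          (use in_Z in \<open>auto intro!: continuous_intros\<close>)
    qed (use d in auto)
    then show "(\<lambda>t. integral {0..1} (\<lambda>s. K (fst (u(i := t), \<omega>), (snd (u(i := t), \<omega>), s)))) field_differentiable at (u i)"
      using d(1) unfolding field_differentiable_def by (auto simp: at_within_open[of "u i" ?U])
  qed
qed

lemma PH_param:
  assumes "continuous_on Z (\<lambda>x. f (snd x))"
  shows "PH n Z (\<lambda>x. f (snd x))"
  using assms by (simp add: PH_def)

lemma rel_open_preimage:
  assumes "rel_open n P Z" "continuous_on Z f" "open U"
  shows "rel_open n P {x \<in> Z. f x \<in> U}"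
proof -
  have "openin (top_of_set Z) (Z \<inter> f -` U)"
    by (rule continuous_openin_preimage_gen[OF assms(2,3)])
  then have "rel_open n P (Z \<inter> f -` U)" using assms(1) by (rule openin_trans)
  moreover have "Z \<inter> f -` U = {x \<in> Z. f x \<in> U}" by auto
  ultimately show ?thesis by simp
qed

text \<open>A line in direction \<open>N\<close> is an affine map with source \<open>Cn 1\<close>,
  so this is an instance of the chain rule \<open>PH_compose\<close>.\<close>

lemma holomorphic_direction:
  assumes Z: "rel_open n P Z" and g: "PH n Z g" and N: "N \<in> Cn n" and u: "u \<in> Cn n"
    and D: "open D" "\<And>s. s \<in> D \<Longrightarrow> ((\<lambda>m. u m + s * N m), \<omega>) \<in> Z"
  shows "(\<lambda>s. g ((\<lambda>m. u m + s * N m), \<omega>)) holomorphic_on D"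
  unfolding holomorphic_on_def
proof
  fix s assume s: "s \<in> D"
  let ?f = "\<lambda>x::(nat \<Rightarrow> complex) \<times> 'a. ((\<lambda>m. u m + fst x 0 * N m), snd x)"
  define Z1 where "Z1 = {x \<in> Cn 1 \<times> P. ?f x \<in> Z}"
  have coord: "continuous_on S (\<lambda>x::(nat \<Rightarrow> complex) \<times> 'a. fst x 0)" for S
    using PH_continuous[OF PH_coord] .
  have f: "continuous_on (Cn 1 \<times> P) ?f"
  proof (rule continuous_on_Pair[OF continuous_on_coordinatewise_then_product])
    show "continuous_on (Cn 1 \<times> P) (\<lambda>x::(nat \<Rightarrow> complex) \<times> 'a. u m + fst x 0 * N m)" for m
      by (intro continuous_intros coord)
  qed (intro continuous_intros)
  have "?f ` (Cn 1 \<times> P) \<subseteq> Cn n \<times> P"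
    using u N by (auto simp: Cn_def)
  then have Z1: "rel_open 1 P Z1"
    using continuous_openin_preimage[OF f _ Z] by (auto simp: Z1_def Int_def vimage_def Pi_iff image_subset_iff)
  have "PH 1 Z1 (\<lambda>x. g ((\<lambda>m. u m + fst x 0 * N m), snd x))"
  proof (rule PH_compose[OF Z g Z1])
    show "PH 1 Z1 (\<lambda>x. u j + fst x 0 * N j)" for j
      by (intro PH_add PH_mult PH_const PH_coord)
  qed (auto simp: Z1_def intro!: continuous_intros)
  moreover have "((\<lambda>i. if i = 0 then s else 0), \<omega>) \<in> Z1"
    using D(2)[OF s] rel_open_sub[OF Z] by (auto simp: Z1_def Cn_def)
  ultimately have "(\<lambda>t. g ((\<lambda>m. u m + ((\<lambda>i. if i = 0 then s else 0)(0 := t)) 0 * N m), \<omega>)) field_differentiable at ((\<lambda>i. if i = 0 then s else 0) 0)"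
    using PH_differentiable[of 1 Z1 _ "\<lambda>i. if i = 0 then s else 0" \<omega> 0] by fastforce
  then show "(\<lambda>s. g ((\<lambda>m. u m + s * N m), \<omega>)) field_differentiable at s within D"
    by (simp add: field_differentiable_at_within)
qed

text \<open>On the lines in direction \<open>N\<close> the quotient has a removable singularity, and the mean value
  property on small circles avoiding the zero set gives its holomorphy in all variables.\<close>

lemma PH_division:
  assumes Z: "rel_open n P Z" and g: "PH n Z g" and N: "N \<in> Cn n"
    and aN: "(\<Sum>m<n. a m * N m) = 1"
    and vanish: "\<And>u \<omega>. (u, \<omega>) \<in> Z \<Longrightarrow> (\<Sum>m<n. a m * u m) = 0 \<Longrightarrow> g (u, \<omega>) = 0"
  shows "\<exists>e. PH n Z e \<and> (\<forall>u \<omega>. (u, \<omega>) \<in> Z \<longrightarrow> g (u, \<omega>) = (\<Sum>m<n. a m * u m) * e (u, \<omega>))"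
proof -
  define l where "l u = (\<Sum>m<n. a m * u m)" for u :: "nat \<Rightarrow> complex"
  define sh where "sh u s = (\<lambda>m. u m + s * N m)" for u :: "nat \<Rightarrow> complex" and s
  have l_sh: "l (sh u s) = l u + s" for u s
  proof -
    have "l (sh u s) = l u + s * (\<Sum>m<n. a m * N m)"
      by (simp add: l_def sh_def algebra_simps sum.distrib sum_distrib_left)
    then show ?thesis by (simp add: aN)
  qed
  have PH_l: "PH n S (\<lambda>x. l (fst x))" for S :: "((nat \<Rightarrow> complex) \<times> 'c::topological_space) set"
    unfolding l_def by (intro PH_sum PH_mult PH_const PH_coord) simp
  \<comment> \<open>Where the form vanishes, the quotient has to be the derivative in direction
    \<open>N\<close>, because the form grows with slope 1 along \<open>N\<close>
    (\<open>l_sh\<close>).\<close>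
  define e where "e x = (if l (fst x) \<noteq> 0 then g x / l (fst x) else deriv (\<lambda>s. g (sh (fst x) s, snd x)) 0)" for x
  have "PH n Z e"
  proof (rule PH_local[OF Z])
    fix x0 assume x0: "x0 \<in> Z"
    obtain u0 \<omega>0 where x0_eq: "x0 = (u0, \<omega>0)" by (cases x0)
    show "\<exists>Z' g'. rel_open n P Z' \<and> x0 \<in> Z' \<and> Z' \<subseteq> Z \<and> PH n Z' g' \<and> (\<forall>y\<in>Z'. g' y = e y)"
    proof (cases "l u0 = 0")
      case False
      define Z' where "Z' = {x \<in> Z. l (fst x) \<in> - {0}}"
      have "rel_open n P Z'" unfolding Z'_def
        by (rule rel_open_preimage[OF Z PH_continuous[OF PH_l]]) auto
      moreover have "PH n Z' (\<lambda>x. g x / l (fst x))"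
        by (intro PH_divide PH_subset[OF g] PH_l) (auto simp: Z'_def)
      moreover have "x0 \<in> Z'" using x0 False by (simp add: Z'_def x0_eq)
      ultimately show ?thesis
        by (intro exI[of _ Z'] exI[of _ "\<lambda>x. g x / l (fst x)"]) (auto simp: Z'_def e_def)
    next
      case True
      obtain \<delta>0 W where \<delta>0: "\<delta>0 > 0" "openin (top_of_set P) W" "\<omega>0 \<in> W" "polydisc n u0 \<delta>0 \<times> W \<subseteq> Z"
        by (rule rel_open_contains_polydisc[OF Z x0[unfolded x0_eq]])
      have u0: "u0 \<in> Cn n" using x0 rel_open_sub[OF Z] by (auto simp: x0_eq)
      define B where "B = 1 + (\<Sum>m<n. cmod (N m))"
      have B: "B \<ge> 1" by (simp add: B_def sum_nonneg)
      have N_B: "cmod (N m) \<le> B" if "m < n" for m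
        using member_le_sum[of m "{..<n}" "\<lambda>m. cmod (N m)"] that by (simp add: B_def)
      \<comment> \<open>With this constant a shift by \<open>s N\<close>, \<open>s\<close> of size
        at most \<open>2 * \<delta>\<close>, moves each coordinate by at most
        \<open>\<delta>0 / 2\<close>. The factor 2 leaves room for an open disc of holomorphy around
        the closed disc of radius \<open>\<delta>\<close>.\<close>
      define \<delta> where "\<delta> = \<delta>0 / (4 * B)"
      have \<delta>: "\<delta> > 0" using \<delta>0(1) B by (simp add: \<delta>_def)
      define Z' where "Z' = {x \<in> polydisc n u0 (\<delta>0 / 2) \<times> W. l (fst x) \<in> ball 0 \<delta>}"
      have Z': "rel_open n P Z'" unfolding Z'_def
        by (intro rel_open_preimage rel_open_polydisc \<delta>0 PH_continuous[OF PH_l]) simp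
      have sh_Z: "(sh u s, \<omega>) \<in> Z" if "(u, \<omega>) \<in> Z'" "cmod s \<le> 2 * \<delta>" for u \<omega> s
      proof -
        have "cmod (u m + s * N m - u0 m) < \<delta>0" if m: "m < n" for m
        proof -
          have "cmod (s * N m) \<le> (2 * \<delta>) * B"
            unfolding norm_mult using N_B[OF m] \<open>cmod s \<le> 2 * \<delta>\<close> \<delta> by (intro mult_mono) auto
          also have "\<dots> = \<delta>0 / 2" using B by (simp add: \<delta>_def)
          finally have 1: "cmod (s * N m) \<le> \<delta>0 / 2" .
          have 2: "cmod (u m - u0 m) < \<delta>0 / 2" using \<open>(u, \<omega>) \<in> Z'\<close> m by (auto simp: Z'_def polydisc_def)
          have "cmod (u m + s * N m - u0 m) \<le> cmod (u m - u0 m) + cmod (s * N m)"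
            using norm_triangle_ineq[of "u m - u0 m" "s * N m"] by (simp add: algebra_simps)
          then show ?thesis using 1 2 by linarith
        qed
        moreover have "sh u s \<in> Cn n" using that(1) N by (auto simp: Z'_def polydisc_def Cn_def sh_def)
        ultimately have "sh u s \<in> polydisc n u0 \<delta>0" by (simp add: polydisc_def sh_def)
        then show ?thesis using \<delta>0(4) that(1) by (auto simp: Z'_def)
      qed
      have Z'_Z: "Z' \<subseteq> Z" using sh_Z[of _ _ 0] \<delta> by (auto simp: sh_def)
      define c where "c = circlepath 0 \<delta>"
      have c_eq: "c t = \<delta> * exp (2 * of_real pi * \<i> * t)" for t by (simp add: c_def circlepath)
      have c_norm: "cmod (c t) = \<delta>" for t using circlepath_dist[of 0 \<delta> t] \<delta> by (simp add: c_def)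
      have l_small: "cmod (l u) < \<delta>" if "(u, \<omega>) \<in> Z'" for u \<omega> using that by (simp add: Z'_def)
      \<comment> \<open>The integrand of the mean value over the circle of radius
        \<open>\<delta>\<close>: at the shifted point the form has the value \<open>c + l u\<close>,
        which is nonzero because \<open>l u\<close> is smaller than \<open>\<delta>\<close>.\<close>
      define K where "K = (\<lambda>x::(nat \<Rightarrow> complex) \<times> ('a \<times> real). g (sh (fst x) (c (snd (snd x))), fst (snd x)) / (c (snd (snd x)) + l (fst x)))"
      have mean: "e x = integral {0..1} (\<lambda>s. K (fst x, (snd x, s)))" if xZ': "x \<in> Z'" for x
      proof -
        obtain u \<omega> where x: "x = (u, \<omega>)" by (cases x)
        have uZ: "(u, \<omega>) \<in> Z'" using xZ' x by simp
        have uC: "u \<in> Cn n" using uZ rel_open_sub[OF Z'] by auto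
        define \<gamma> where "\<gamma> = (\<lambda>s. g (sh u s, \<omega>))"
        \<comment> \<open>The line through \<open>u\<close> meets the zero set at the parameter
          \<open>b\<close>; the quotient along the line is singular only there, and removably
          so.\<close>
        define b where "b = - l u"
        have "\<gamma> holomorphic_on ball 0 (2 * \<delta>)"
          unfolding \<gamma>_def sh_def
          by (rule holomorphic_direction[OF Z g N uC open_ball]) (use sh_Z[OF uZ] in \<open>auto simp: sh_def\<close>)
        from pole_lemma_open[OF this open_ball, of b]
        have hol: "(\<lambda>z. if z = b then deriv \<gamma> b else (\<gamma> z - \<gamma> b) / (z - b)) holomorphic_on ball 0 (2 * \<delta>)" (is "?\<psi> holomorphic_on _") .
        have "\<gamma> b = 0"
          unfolding \<gamma>_def
        proof (rule vanish)
          show "(sh u b, \<omega>) \<in> Z" using l_small[OF uZ] \<delta> by (intro sh_Z[OF uZ]) (simp add: b_def)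
          show "(\<Sum>m<n. a m * sh u b m) = 0" using l_sh[of u b] by (simp add: l_def b_def)
        qed
        moreover have "\<gamma> 0 = g (u, \<omega>)" by (simp add: \<gamma>_def sh_def)
        ultimately have e_x: "e x = ?\<psi> 0"
          unfolding e_def x fst_conv snd_conv \<gamma>_def[symmetric] by (cases "l u = 0") (simp_all add: b_def)
        have "?\<psi> holomorphic_on cball 0 \<delta>"
          by (rule holomorphic_on_subset[OF hol]) (use \<delta> in auto)
        from Cauchy_integral_circlepath_simple[OF this, of 0] \<delta>
        have "2 * of_real pi * \<i> * ?\<psi> 0 = contour_integral (circlepath 0 \<delta>) (\<lambda>s. ?\<psi> s / (s - 0))"
          by (intro contour_integral_unique[symmetric]) simp
        also have "\<dots> = integral {0..1} (\<lambda>s. 2 * of_real pi * \<i> * K (u, (\<omega>, s)))"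
          unfolding contour_integral_circlepath_eq
        proof (rule integral_cong)
          fix s :: real
          have "c s \<noteq> b" using c_norm[of s] l_small[OF uZ] by (auto simp: b_def)
          then have "?\<psi> (c s) = K (u, (\<omega>, s))"
            using \<open>\<gamma> b = 0\<close> by (simp add: K_def \<gamma>_def b_def)
          then show "?\<psi> (circlepath 0 \<delta> s) / (circlepath 0 \<delta> s - 0) * (2 * pi * \<i> * \<delta> * exp (2 * of_real pi * \<i> * s))
              = 2 * of_real pi * \<i> * K (u, (\<omega>, s))"
            using \<delta> unfolding c_def[symmetric] by (simp add: c_eq)
        qed
        also have "\<dots> = 2 * of_real pi * \<i> * integral {0..1} (\<lambda>s. K (u, (\<omega>, s)))"
          by simp
        finally show ?thesis unfolding e_x by (simp add: x)
      qed
      let ?Z1 = "{x. (fst x, fst (snd x)) \<in> Z' \<and> snd (snd x) \<in> {0..1::real}}"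
      have Z1: "rel_open n (P \<times> {0..1}) ?Z1"
      proof -
        obtain O' where O': "open O'" "Z' = (Cn n \<times> P) \<inter> O'" using Z' by (auto simp: openin_open)
        have "open ((\<lambda>x::(nat \<Rightarrow> complex) \<times> ('a \<times> real). (fst x, fst (snd x))) -` O')"
          by (intro open_vimage O'(1) continuous_intros)
        moreover have "?Z1 = (Cn n \<times> (P \<times> {0..1})) \<inter> (\<lambda>x. (fst x, fst (snd x))) -` O'"
          using O'(2) by auto
        ultimately show ?thesis by (auto simp: openin_open)
      qed
      have PH_c: "PH n ?Z1 (\<lambda>x. c (snd (snd x)))"
      proof (rule PH_param[where f = "\<lambda>p. c (snd p)"])
        show "continuous_on ?Z1 (\<lambda>x. c (snd (snd x)))" unfolding c_eq by (intro continuous_intros)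
      qed
      have "PH n ?Z1 K"
        unfolding K_def
      proof (rule PH_divide)
        show "PH n ?Z1 (\<lambda>x. g (sh (fst x) (c (snd (snd x))), fst (snd x)))"
        proof (rule PH_compose[OF Z g Z1, where \<sigma> = fst])
          show "PH n ?Z1 (\<lambda>x. sh (fst x) (c (snd (snd x))) j)" for j
            unfolding sh_def by (intro PH_add PH_mult PH_const PH_coord PH_c)
          show "(sh (fst x) (c (snd (snd x))), fst (snd x)) \<in> Z" if "x \<in> ?Z1" for x
            using that \<delta> c_norm by (intro sh_Z) auto
        qed (intro continuous_intros)
        show "PH n ?Z1 (\<lambda>x. c (snd (snd x)) + l (fst x))" by (intro PH_add PH_c PH_l)
        show "c (snd (snd x)) + l (fst x) \<noteq> 0" if "x \<in> ?Z1" for x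
        proof
          assume "c (snd (snd x)) + l (fst x) = 0"
          then have "cmod (c (snd (snd x))) = cmod (l (fst x))" by (metis add_eq_0_iff norm_minus_cancel)
          then show False using c_norm l_small[of "fst x" "fst (snd x)"] that by simp
        qed
      qed
      from PH_integral[OF Z' this]
      have "PH n Z' (\<lambda>x. integral {0..1} (\<lambda>s. K (fst x, (snd x, s))))" .
      moreover have "x0 \<in> Z'"
        using polydisc_center[OF _ u0, of "\<delta>0 / 2"] \<delta>0 True \<delta> by (simp add: Z'_def x0_eq)
      ultimately show ?thesis
        using Z' Z'_Z mean[symmetric]
        by (intro exI[of _ Z'] exI[of _ "\<lambda>x. integral {0..1} (\<lambda>s. K (fst x, (snd x, s)))"]) blast
    qed
  qed
  moreover have "g (u, \<omega>) = l u * e (u, \<omega>)" if "(u, \<omega>) \<in> Z" for u \<omega>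
    using vanish[OF that] by (auto simp: e_def l_def)
  ultimately show ?thesis unfolding l_def by blast
qed

section \<open>Straightening\<close>

lemma openin_Int_INT:
  "finite I \<Longrightarrow> openin T U \<Longrightarrow> (\<And>i. i \<in> I \<Longrightarrow> openin T (X i)) \<Longrightarrow> openin T (U \<inter> (\<Inter>i\<in>I. X i))"
proof (induction I rule: finite_induct)
  case (insert i I)
  then have "openin T (U \<inter> (\<Inter>i\<in>I. X i))" "openin T (X i)" by auto
  from openin_Int[OF this(2,1)] have "openin T (X i \<inter> (U \<inter> (\<Inter>i\<in>I. X i)))" .
  then show ?case by (simp add: Int_left_commute)
qed simp

text \<open>Picard iteration for z = z0 + u - E (z, \<omega>): since the first derivatives of
  \<open>E\<close> vanish at the base point, \<open>E\<close> is a contraction near it, uniformly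
  for the parameters in \<open>W\<close>. The iterates are of type \<open>PH\<close>, and uniform
  convergence carries continuity in the parameter and holomorphy on coordinate lines over to the
  limit.\<close>

lemma PH_inverse:
  assumes \<Omega>: "rel_open n P \<Omega>" and x0: "(z0, \<omega>0) \<in> \<Omega>"
    and E: "\<And>m. m < n \<Longrightarrow> PH n \<Omega> (E m)"
    and E0: "\<And>m. m < n \<Longrightarrow> E m (z0, \<omega>0) = 0"
    and dE: "\<And>m j. m < n \<Longrightarrow> j < n \<Longrightarrow> PD j (E m) (z0, \<omega>0) = 0"
  obtains \<rho> \<tau> W G where "\<rho> > 0" "\<tau> > 0" "openin (top_of_set P) W" "\<omega>0 \<in> W" "polydisc n z0 \<rho> \<times> W \<subseteq> \<Omega>"
    "\<And>m. m < n \<Longrightarrow> PH n (polydisc n (\<lambda>_. 0) \<tau> \<times> W) (\<lambda>x. G x m)"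
    "\<And>u \<omega>. u \<in> polydisc n (\<lambda>_. 0) \<tau> \<Longrightarrow> \<omega> \<in> W \<Longrightarrow> G (u, \<omega>) \<in> polydisc n z0 \<rho> \<and>
       (\<forall>m<n. G (u, \<omega>) m - z0 m + E m (G (u, \<omega>), \<omega>) = u m)"
    "\<And>u z \<omega>. u \<in> polydisc n (\<lambda>_. 0) \<tau> \<Longrightarrow> \<omega> \<in> W \<Longrightarrow> z \<in> polydisc n z0 \<rho> \<Longrightarrow>
       (\<And>m. m < n \<Longrightarrow> z m - z0 m + E m (z, \<omega>) = u m) \<Longrightarrow> G (u, \<omega>) = z"
proof -
  have z0: "z0 \<in> Cn n" using x0 rel_open_sub[OF \<Omega>] by auto
  \<comment> \<open>Chosen so that \<open>n\<close> partial derivatives of size at most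
    \<open>\<epsilon>\<close> give a Lipschitz constant of at most 1/2 in the maximum norm
    (\<open>lip2\<close>).\<close>
  define \<epsilon> where "\<epsilon> = 1 / (2 * (real n + 1))"
  have \<epsilon>: "\<epsilon> > 0" "\<epsilon> * n \<le> 1 / 2" by (auto simp: \<epsilon>_def field_simps)
  define \<Omega>1 where "\<Omega>1 = \<Omega> \<inter> (\<Inter>q\<in>{..<n} \<times> {..<n}. {x \<in> \<Omega>. PD (snd q) (E (fst q)) x \<in> ball 0 \<epsilon>})"
  have "rel_open n P {x \<in> \<Omega>. PD (snd q) (E (fst q)) x \<in> ball 0 \<epsilon>}" if "q \<in> {..<n} \<times> {..<n}" for q
    using that by (intro rel_open_preimage \<Omega> continuous_PD[OF \<Omega> E]) auto
  then have \<Omega>1: "rel_open n P \<Omega>1"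
    unfolding \<Omega>1_def by (intro openin_Int_INT \<Omega>) auto
  have "(z0, \<omega>0) \<in> \<Omega>1" using x0 dE \<epsilon>(1) by (auto simp: \<Omega>1_def)
  then obtain \<rho> W0 where \<rho>: "\<rho> > 0" "openin (top_of_set P) W0" "\<omega>0 \<in> W0" "polydisc n z0 \<rho> \<times> W0 \<subseteq> \<Omega>1"
    by (rule rel_open_contains_polydisc[OF \<Omega>1])
  have z0\<rho>: "z0 \<in> polydisc n z0 \<rho>" using polydisc_center[OF \<rho>(1) z0] .
  \<comment> \<open>The base value \<open>E m (z0, \<omega>)\<close> is only known to vanish at
    \<open>\<omega>0\<close>; shrinking the parameter set keeps it below
    \<open>\<rho> / 8\<close>.\<close>
  define W where "W = W0 \<inter> (\<Inter>m\<in>{..<n}. W0 \<inter> (\<lambda>\<omega>. E m (z0, \<omega>)) -` ball 0 (\<rho> / 8))"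
  have W: "openin (top_of_set P) W"
  proof -
    have "openin (top_of_set W0) (W0 \<inter> (\<lambda>\<omega>. E m (z0, \<omega>)) -` ball 0 (\<rho> / 8))" if "m < n" for m
    proof (rule continuous_openin_preimage_gen[OF _ open_ball])
      show "continuous_on W0 (\<lambda>\<omega>. E m (z0, \<omega>))"
        by (rule continuous_on_compose2[OF PH_continuous[OF E[OF that]]])
          (intro continuous_on_Pair continuous_on_const continuous_on_id, use \<rho>(4) z0\<rho> in \<open>auto simp: \<Omega>1_def\<close>)
    qed
    then have "openin (top_of_set W0) W"
      unfolding W_def by (intro openin_Int_INT) auto
    then show ?thesis using \<rho>(2) by (rule openin_trans)
  qed
  have \<omega>0W: "\<omega>0 \<in> W" using \<rho>(1,3) E0 by (auto simp: W_def)
  have sub: "polydisc n z0 \<rho> \<times> W \<subseteq> \<Omega>" using \<rho>(4) by (auto simp: W_def \<Omega>1_def)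
  have Ez0: "cmod (E m (z0, \<omega>)) \<le> \<rho> / 8" if "\<omega> \<in> W" "m < n" for m \<omega>
  proof -
    have "\<omega> \<in> W0 \<inter> (\<lambda>\<omega>. E m (z0, \<omega>)) -` ball 0 (\<rho> / 8)" using that unfolding W_def by blast
    then show ?thesis by simp
  qed
  have lip: "cmod (E m (z, \<omega>) - E m (z', \<omega>)) \<le> \<epsilon> * (\<Sum>j<n. cmod (z j - z' j))"
    if m: "m < n" and \<omega>: "\<omega> \<in> W" and z: "z \<in> polydisc n z0 \<rho>" "z' \<in> polydisc n z0 \<rho>" for m \<omega> z z'
  proof -
    have "cmod (E m (z, \<omega>) - E m (z', \<omega>) - (\<Sum>j<n. 0 * (z j - z' j))) \<le> \<epsilon> * (\<Sum>j<n. cmod (z j - z' j))"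
    proof (rule polydisc_increment_bound[OF E[OF m] _ _ z, where L = "\<lambda>_. 0"])
      show "polydisc n z0 \<rho> \<times> {\<omega>} \<subseteq> \<Omega>" using sub \<omega> by auto
      fix v j assume v: "v \<in> polydisc n z0 \<rho>" and j: "j < n"
      then have "(v, \<omega>) \<in> \<Omega>1" using \<rho>(4) \<omega> by (auto simp: W_def)
      then have "PD j (E m) (v, \<omega>) \<in> ball 0 \<epsilon>" using m j by (auto simp: \<Omega>1_def)
      then show "cmod (PD j (E m) (v, \<omega>) - 0) \<le> \<epsilon>" by simp
    qed
    then show ?thesis by simp
  qed
  have lip2: "cmod (E m (z, \<omega>) - E m (z', \<omega>)) \<le> d / 2"
    if m: "m < n" and \<omega>: "\<omega> \<in> W" and z: "z \<in> polydisc n z0 \<rho>" "z' \<in> polydisc n z0 \<rho>"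
      and d: "\<And>j. j < n \<Longrightarrow> cmod (z j - z' j) \<le> d" for m \<omega> z z' d
  proof -
    have "0 \<le> d" using d[OF m] norm_ge_zero order_trans by blast
    have "(\<Sum>j<n. cmod (z j - z' j)) \<le> (\<Sum>j<n. d)" by (intro sum_mono) (use d in auto)
    then have "\<epsilon> * (\<Sum>j<n. cmod (z j - z' j)) \<le> \<epsilon> * (n * d)"
      using \<epsilon>(1) by (intro mult_left_mono) auto
    also have "\<dots> = (\<epsilon> * n) * d" by simp
    also have "\<dots> \<le> 1 / 2 * d" using \<epsilon>(2) \<open>0 \<le> d\<close> by (intro mult_right_mono) auto
    finally show ?thesis using lip[OF m \<omega> z] by linarith
  qed
  \<comment> \<open>The budget of one iteration: \<open>\<rho> / 4\<close> from \<open>u\<close>,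
    half of \<open>7 / 8 * \<rho>\<close> from the contraction and \<open>\<rho> / 8\<close> from
    the base value, in total at most \<open>7 / 8 * \<rho>\<close>.\<close>
  define \<tau> where "\<tau> = \<rho> / 4"
  have \<tau>: "\<tau> > 0" using \<rho>(1) by (simp add: \<tau>_def)
  define Q where "Q = polydisc n (\<lambda>_. 0) \<tau> \<times> W"
  have Q: "rel_open n P Q" unfolding Q_def by (rule rel_open_polydisc[OF W])
  define it where "it = rec_nat (\<lambda>_. z0) (\<lambda>s f x m. if m < n then z0 m + fst x m - E m (f x, snd x) else 0)"
  have it0: "it 0 x = z0" and itS: "it (Suc s) x = (\<lambda>m. if m < n then z0 m + fst x m - E m (it s x, snd x) else 0)" for s x
    unfolding it_def by simp_all
  have it_Cn: "it s x \<in> Cn n" for s x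
    using z0 by (cases s) (auto simp: it0 itS Cn_def)
  \<comment> \<open>The bound \<open>7 / 8 * \<rho>\<close> is closed and lies below
    \<open>\<rho>\<close>, so the limit of the iterates stays in the open polydisc as well.\<close>
  have discI: "v \<in> polydisc n z0 \<rho>" if "v \<in> Cn n" "\<forall>m<n. cmod (v m - z0 m) \<le> 7 / 8 * \<rho>" for v
  proof -
    have "cmod (v m - z0 m) < \<rho>" if "m < n" for m
    proof -
      have "cmod (v m - z0 m) \<le> 7 / 8 * \<rho>" using \<open>\<forall>m<n. cmod (v m - z0 m) \<le> 7 / 8 * \<rho>\<close> that by blast
      then show ?thesis using \<rho>(1) by linarith
    qed
    then show ?thesis using that(1) by (simp add: polydisc_def)
  qed
  have it_bound: "\<forall>m<n. cmod (it s x m - z0 m) \<le> 7 / 8 * \<rho>" if x: "x \<in> Q" for s x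
  proof (induction s)
    case 0
    then show ?case using \<rho>(1) by (simp add: it0)
  next
    case (Suc s)
    have \<omega>: "snd x \<in> W" using x by (auto simp: Q_def)
    have "it s x \<in> polydisc n z0 \<rho>" by (rule discI[OF it_Cn Suc])
    then have *: "cmod (E m (it s x, snd x) - E m (z0, snd x)) \<le> 7 / 8 * \<rho> / 2" if "m < n" for m
      using lip2[OF that \<omega> _ z0\<rho>, of "it s x" "7 / 8 * \<rho>"] Suc by blast
    show ?case
    proof (intro allI impI)
      fix m assume m: "m < n"
      have "it (Suc s) x m - z0 m = fst x m - (E m (it s x, snd x) - E m (z0, snd x)) - E m (z0, snd x)"
        using m by (simp add: itS)
      also have "cmod \<dots> \<le> cmod (fst x m) + cmod (E m (it s x, snd x) - E m (z0, snd x)) + cmod (E m (z0, snd x))"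
        by (rule order_trans[OF norm_triangle_ineq4 add_right_mono[OF norm_triangle_ineq4]])
      also have "\<dots> \<le> \<rho> / 4 + 7 / 8 * \<rho> / 2 + \<rho> / 8"
        using x m *[OF m] Ez0[OF \<omega> m] by (intro add_mono) (auto simp: Q_def polydisc_def \<tau>_def intro: less_imp_le)
      also have "\<dots> \<le> 7 / 8 * \<rho>" using \<rho>(1) by simp
      finally show "cmod (it (Suc s) x m - z0 m) \<le> 7 / 8 * \<rho>" .
    qed
  qed
  have it_disc: "it s x \<in> polydisc n z0 \<rho>" if "x \<in> Q" for s x
    by (rule discI[OF it_Cn it_bound[OF that]])
  have it_diff: "\<forall>m<n. cmod (it (Suc s) x m - it s x m) \<le> \<rho> * (1 / 2) ^ s" if x: "x \<in> Q" for s x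
  proof (induction s)
    case 0
    show ?case
    proof (intro allI impI)
      fix m assume "m < n"
      then have "cmod (it (Suc 0) x m - it 0 x m) \<le> 7 / 8 * \<rho>" using it_bound[OF x, of "Suc 0"] by (simp add: it0)
      then show "cmod (it (Suc 0) x m - it 0 x m) \<le> \<rho> * (1 / 2) ^ 0" using \<rho>(1) by simp
    qed
  next
    case (Suc s)
    show ?case
    proof (intro allI impI)
      fix m assume m: "m < n"
      have "it (Suc (Suc s)) x m - it (Suc s) x m = E m (it s x, snd x) - E m (it (Suc s) x, snd x)"
        using m by (subst (1 2) itS) simp
      also have "cmod \<dots> = cmod (E m (it (Suc s) x, snd x) - E m (it s x, snd x))"
        by (rule norm_minus_commute)
      also have "\<dots> \<le> \<rho> * (1 / 2) ^ s / 2"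
        using x Suc by (intro lip2[OF m] it_disc) (auto simp: Q_def)
      finally show "cmod (it (Suc (Suc s)) x m - it (Suc s) x m) \<le> \<rho> * (1 / 2) ^ Suc s" by simp
    qed
  qed
  have it_PH: "\<forall>m<n. PH n Q (\<lambda>x. it s x m)" for s
  proof (induction s)
    case 0
    then show ?case by (auto simp: it0)
  next
    case (Suc s)
    show ?case
    proof (intro allI impI)
      fix m assume m: "m < n"
      have "PH n Q (\<lambda>x. E m (it s x, snd x))"
      proof (rule PH_compose[OF \<Omega> E[OF m] Q, where \<sigma> = "\<lambda>\<omega>. \<omega>"])
        show "(it s x, snd x) \<in> \<Omega>" if "x \<in> Q" for x
          using it_disc[OF that] that sub by (auto simp: Q_def)
      qed (use Suc in \<open>auto intro: continuous_intros\<close>)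
      then have "PH n Q (\<lambda>x. z0 m + fst x m - E m (it s x, snd x))"
        by (intro PH_diff PH_add PH_const PH_coord)
      then show "PH n Q (\<lambda>x. it (Suc s) x m)" using m by (simp add: itS)
    qed
  qed
  define G where "G x = (\<lambda>m. if m < n then z0 m + (\<Sum>i. it (Suc i) x m - it i x m) else 0)" for x
  \<comment> \<open>The differences of the iterates are dominated by a geometric series, so the
    convergence is uniform on all of \<open>Q\<close>.\<close>
  have unif: "uniform_limit Q (\<lambda>s x. it s x m) (\<lambda>x. G x m) sequentially" if m: "m < n" for m
  proof -
    have "uniform_limit Q (\<lambda>s x. \<Sum>i<s. it (Suc i) x m - it i x m) (\<lambda>x. \<Sum>i. it (Suc i) x m - it i x m) sequentially"
    proof (rule Weierstrass_m_test)
      show "norm (it (Suc i) x m - it i x m) \<le> \<rho> * (1 / 2) ^ i" if "x \<in> Q" for i x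
        using it_diff[OF that, of i] m by simp
      show "summable (\<lambda>i. \<rho> * (1 / 2) ^ i)" by (intro summable_mult summable_geometric) simp
    qed
    then have "uniform_limit Q (\<lambda>s x. z0 m + (\<Sum>i<s. it (Suc i) x m - it i x m)) (\<lambda>x. z0 m + (\<Sum>i. it (Suc i) x m - it i x m)) sequentially"
      by (intro uniform_limit_intros)
    moreover have "z0 m + (\<Sum>i<s. it (Suc i) x m - it i x m) = it s x m" for s x
      using sum_lessThan_telescope[of "\<lambda>i. it i x m" s] by (simp add: it0)
    ultimately show ?thesis using m by (simp add: G_def)
  qed
  have lim: "(\<lambda>s. it s x m) \<longlonglongrightarrow> G x m" if "x \<in> Q" "m < n" for x m
    using tendsto_uniform_limitI[OF unif[OF that(2)] that(1)] .
  have G_disc: "G x \<in> polydisc n z0 \<rho>" if x: "x \<in> Q" for x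
  proof -
    have "cmod (G x m - z0 m) < \<rho>" if m: "m < n" for m
    proof -
      have "(\<lambda>s. it s x m - z0 m) \<longlonglongrightarrow> G x m - z0 m" by (intro tendsto_intros lim x m)
      then have "cmod (G x m - z0 m) \<le> 7 / 8 * \<rho>"
        by (rule Lim_norm_ubound[rotated]) (use it_bound[OF x] m in auto)
      then show ?thesis using \<rho>(1) by linarith
    qed
    then show ?thesis by (simp add: polydisc_def G_def Cn_def)
  qed
  have G_eq: "G x m - z0 m + E m (G x, snd x) = fst x m" if x: "x \<in> Q" and m: "m < n" for x m
  proof -
    have \<omega>: "snd x \<in> W" using x by (auto simp: Q_def)
    have "(\<lambda>s. E m (it s x, snd x) - E m (G x, snd x)) \<longlonglongrightarrow> 0"
    proof (rule Lim_null_comparison)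
      show "\<forall>\<^sub>F s in sequentially. cmod (E m (it s x, snd x) - E m (G x, snd x)) \<le> \<epsilon> * (\<Sum>j<n. cmod (it s x j - G x j))"
        using lip[OF m \<omega> it_disc[OF x] G_disc[OF x]] by simp
      have "(\<lambda>s. \<epsilon> * (\<Sum>j<n. cmod (it s x j - G x j))) \<longlonglongrightarrow> \<epsilon> * (\<Sum>j<n. cmod (G x j - G x j))"
        by (intro tendsto_intros lim x) auto
      then show "(\<lambda>s. \<epsilon> * (\<Sum>j<n. cmod (it s x j - G x j))) \<longlonglongrightarrow> 0" by simp
    qed
    then have "(\<lambda>s. E m (it s x, snd x)) \<longlonglongrightarrow> E m (G x, snd x)" by (simp add: LIM_zero_iff)
    then have "(\<lambda>s. it (Suc s) x m) \<longlonglongrightarrow> z0 m + fst x m - E m (G x, snd x)"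
      using m by (auto simp: itS intro!: tendsto_intros)
    moreover have "(\<lambda>s. it (Suc s) x m) \<longlonglongrightarrow> G x m"
      using lim[OF x m] by (rule LIMSEQ_Suc)
    ultimately have "z0 m + fst x m - E m (G x, snd x) = G x m" by (rule LIMSEQ_unique)
    then show ?thesis by (simp add: algebra_simps)
  qed
  have G_unique: "G (u, \<omega>) = z" if u: "u \<in> polydisc n (\<lambda>_. 0) \<tau>" and \<omega>: "\<omega> \<in> W" and z: "z \<in> polydisc n z0 \<rho>"
    and eq: "\<And>m. m < n \<Longrightarrow> z m - z0 m + E m (z, \<omega>) = u m" for u z \<omega>
  proof -
    have x: "(u, \<omega>) \<in> Q" using u \<omega> by (simp add: Q_def)
    let ?S = "\<Sum>j<n. cmod (G (u, \<omega>) j - z j)"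
    have "cmod (G (u, \<omega>) m - z m) \<le> \<epsilon> * ?S" if m: "m < n" for m
    proof -
      have "G (u, \<omega>) m - z m = - (E m (G (u, \<omega>), \<omega>) - E m (z, \<omega>))"
        using G_eq[OF x m] eq[OF m] by (simp add: algebra_simps)
      then have "cmod (G (u, \<omega>) m - z m) = cmod (E m (G (u, \<omega>), \<omega>) - E m (z, \<omega>))" by (metis norm_minus_cancel)
      then show ?thesis using lip[OF m \<omega> G_disc[OF x] z] by simp
    qed
    \<comment> \<open>Summing the Lipschitz bound over the coordinates makes the distance
      \<open>?S\<close> at most half of itself.\<close>
    then have "?S \<le> (\<Sum>j<n. \<epsilon> * ?S)" by (intro sum_mono) auto
    also have "\<dots> = (\<epsilon> * n) * ?S" by simp
    also have "\<dots> \<le> 1 / 2 * ?S" using \<epsilon>(2) by (intro mult_right_mono sum_nonneg) auto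
    finally have "?S \<le> 0" by simp
    then have "?S = 0" by (intro antisym sum_nonneg) auto
    then have "G (u, \<omega>) m = z m" if "m < n" for m
      using that by (simp add: sum_nonneg_eq_0_iff)
    moreover have "G (u, \<omega>) m = z m" if "\<not> m < n" for m
      using that z by (auto simp: G_def polydisc_def Cn_def)
    ultimately show ?thesis by blast
  qed
  have G_PH: "PH n Q (\<lambda>x. G x m)" if m: "m < n" for m
    unfolding PH_def
  proof (intro conjI allI impI)
    show "continuous_on Q (\<lambda>x. G x m)"
      by (rule uniform_limit_theorem[OF always_eventually[OF allI[OF PH_continuous[OF it_PH[rule_format, OF m]]]] unif[OF m]])
        (rule sequentially_bot)
    fix u \<omega> i assume x: "(u, \<omega>) \<in> Q" and i: "i < n"
    have u: "u \<in> Cn n" using x rel_open_sub[OF Q] by auto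
    have "u i \<in> {t. (u(i := t), \<omega>) \<in> Q}" using x by simp
    with line_open[OF Q u i, of \<omega>]
    obtain r where r: "r > 0" "cball (u i) r \<subseteq> {t. (u(i := t), \<omega>) \<in> Q}"
      unfolding open_contains_cball by blast
    have hol: "(\<lambda>t. it s (u(i := t), \<omega>) m) holomorphic_on cball (u i) r" for s
      by (rule holomorphic_on_subset[OF PH_holomorphic_line[OF it_PH[rule_format, OF m] i] r(2)])
    have ev: "\<forall>\<^sub>F s in sequentially. continuous_on (cball (u i) r) (\<lambda>t. it s (u(i := t), \<omega>) m) \<and>
        (\<lambda>t. it s (u(i := t), \<omega>) m) holomorphic_on ball (u i) r"
      by (intro always_eventually allI conjI holomorphic_on_imp_continuous_on hol holomorphic_on_subset[OF hol ball_subset_cball])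
    have "uniform_limit (cball (u i) r) (\<lambda>s t. it s (u(i := t), \<omega>) m) (\<lambda>t. G (u(i := t), \<omega>) m) sequentially"
      unfolding uniform_limit_iff
    proof (intro allI impI)
      fix e :: real assume "e > 0"
      with unif[OF m] have "\<forall>\<^sub>F s in sequentially. \<forall>x\<in>Q. dist (it s x m) (G x m) < e"
        by (simp add: uniform_limit_iff)
      then show "\<forall>\<^sub>F s in sequentially. \<forall>t\<in>cball (u i) r. dist (it s (u(i := t), \<omega>) m) (G (u(i := t), \<omega>) m) < e"
        by eventually_elim (use r(2) in auto)
    qed
    from holomorphic_uniform_limit[OF ev this sequentially_bot]
    have "(\<lambda>t. G (u(i := t), \<omega>) m) holomorphic_on ball (u i) r"
      by blast
    then show "(\<lambda>t. G (u(i := t), \<omega>) m) field_differentiable at (u i)"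
      using r(1) by (simp add: holomorphic_on_imp_differentiable_at)
  qed
  show thesis
  proof (rule that[OF \<rho>(1) \<tau> W \<omega>0W sub])
    show "PH n (polydisc n (\<lambda>_. 0) \<tau> \<times> W) (\<lambda>x. G x m)" if "m < n" for m
      using G_PH[OF that] by (simp add: Q_def)
    show "G (u, \<omega>) \<in> polydisc n z0 \<rho> \<and> (\<forall>m<n. G (u, \<omega>) m - z0 m + E m (G (u, \<omega>), \<omega>) = u m)"
      if "u \<in> polydisc n (\<lambda>_. 0) \<tau>" "\<omega> \<in> W" for u \<omega>
      using G_disc[of "(u, \<omega>)"] G_eq[of "(u, \<omega>)"] that by (simp add: Q_def)
  qed (rule G_unique)
qed

text \<open>Rank \<open>k\<close> makes the columns span the whole space, so each unit vector has a
  preimage; these preimages form a right inverse. \<open>N i'\<close> is the column that belongs to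
  the unit vector with index \<open>i'\<close>.\<close>

lemma rank_right_inverse:
  fixes M :: "nat \<Rightarrow> nat \<Rightarrow> complex"
  assumes rank: "vec_space.rank k (mat k n (\<lambda>(i, j). M i j)) = k"
  shows "\<exists>N. \<forall>i<k. \<forall>i'<k. (\<Sum>j<n. M i j * N i' j) = (if i = i' then 1 else 0)"
proof -
  interpret vec_space "TYPE(complex)" k .
  define A where "A = mat k n (\<lambda>(i, j). M i j)"
  have A: "A \<in> carrier_mat k n" by (simp add: A_def)
  have cols: "set (cols A) \<subseteq> carrier_vec k" using cols_dim[of A] A by simp
  have "lin_indpt {}" by (auto simp: lin_dep_def)
  then obtain U where U: "maximal U (\<lambda>T. T \<subseteq> set (cols A) \<and> lin_indpt T)"
    using maximal_exists_superset[of "set (cols A)" "\<lambda>T. T \<subseteq> set (cols A) \<and> lin_indpt T" "{}"] by auto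
  then have U': "U \<subseteq> set (cols A)" "lin_indpt U" by (auto simp: maximal_def)
  have "card U = k"
    using rank_card_indpt[OF A U] rank by (simp add: A_def)
  then have "basis U"
    using U' cols finite_subset[OF U'(1)] by (intro dim_li_is_basis) (auto simp: dim_is_n)
  then have "span U = carrier_vec k" by (simp add: basis_def)
  moreover have "span U \<subseteq> span (set (cols A))" by (rule span_is_monotone[OF U'(1)])
  ultimately have full: "carrier_vec k \<subseteq> col_space A" by (simp add: col_space_def)
  have "\<exists>x. x \<in> carrier_vec n \<and> A *\<^sub>v x = unit_vec k i'" if "i' < k" for i'
    using subsetD[OF full unit_vec_carrier[of k i']] A unfolding col_space_eq[OF A] by auto
  then obtain x where x: "\<And>i'. i' < k \<Longrightarrow> x i' \<in> carrier_vec n" "\<And>i'. i' < k \<Longrightarrow> A *\<^sub>v x i' = unit_vec k i'" by metis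
  have "(\<Sum>j<n. M i j * x i' $ j) = (if i = i' then 1 else 0)" if "i < k" "i' < k" for i i'
  proof -
    have "(A *\<^sub>v x i') $ i = (\<Sum>j<n. M i j * x i' $ j)"
      using that x(1)[OF that(2)] by (auto simp: A_def scalar_prod_def lessThan_atLeast0 intro!: sum.cong)
    then show ?thesis using x(2)[OF that(2)] that by simp
  qed
  then show ?thesis by (intro exI[of _ "\<lambda>i' j. x i' $ j"]) simp
qed

text \<open>Let \<open>l i\<close> be the differential of \<open>H i\<close> at the base point and
  \<open>N\<close> a right inverse. The map \<open>\<Phi>\<close> adds to z - z0 the vectors
  \<open>N i\<close> with the coefficients \<open>H i - l i (z - z0)\<close>. Then
  \<open>l i\<close> applied to \<open>\<Phi>\<close> is exactly \<open>H i\<close>, and the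
  correction has zero value and zero derivative at the base point, so \<open>PH_inverse\<close>
  inverts \<open>\<Phi>\<close>. The set \<open>Q\<close> must be stable under all projections along
  the \<open>N i\<close>, which an ordinary polydisc need not be.\<close>

lemma PH_straighten:
  assumes \<Omega>: "rel_open n P \<Omega>" and x0: "(z0, \<omega>0) \<in> \<Omega>"
    and H: "\<And>i. i < k \<Longrightarrow> PH n \<Omega> (H i)" and H0: "\<And>i. i < k \<Longrightarrow> H i (z0, \<omega>0) = 0"
    and rank: "vec_space.rank k (mat k n (\<lambda>(i, j). PD j (H i) (z0, \<omega>0))) = k"
  obtains \<rho> W Q N M \<Phi> G where "\<rho> > 0" "openin (top_of_set P) W" "\<omega>0 \<in> W" "polydisc n z0 \<rho> \<times> W \<subseteq> \<Omega>"
    "openin (top_of_set (Cn n)) Q"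
    "\<And>i. i < k \<Longrightarrow> N i \<in> Cn n"
    "\<And>i i'. i < k \<Longrightarrow> i' < k \<Longrightarrow> (\<Sum>m<n. M i m * N i' m) = (if i = i' then 1 else 0)"
    "\<And>i u. i < k \<Longrightarrow> u \<in> Q \<Longrightarrow> (\<lambda>m. u m - (\<Sum>j<n. M i j * u j) * N i m) \<in> Q"
    "\<And>m. m < n \<Longrightarrow> PH n (polydisc n z0 \<rho> \<times> W) (\<lambda>x. \<Phi> x m)"
    "\<And>x. \<Phi> x \<in> Cn n"
    "\<And>m. m < n \<Longrightarrow> PH n (Q \<times> W) (\<lambda>x. G x m)"
    "\<And>u \<omega>. u \<in> Q \<Longrightarrow> \<omega> \<in> W \<Longrightarrow> G (u, \<omega>) \<in> polydisc n z0 \<rho> \<and> \<Phi> (G (u, \<omega>), \<omega>) = u"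
    "\<And>z \<omega>. z \<in> polydisc n z0 \<rho> \<Longrightarrow> \<omega> \<in> W \<Longrightarrow> \<Phi> (z, \<omega>) \<in> Q \<Longrightarrow> G (\<Phi> (z, \<omega>), \<omega>) = z"
    "\<And>i x. i < k \<Longrightarrow> H i x = (\<Sum>m<n. M i m * \<Phi> x m)"
    "\<Phi> (z0, \<omega>0) \<in> Q"
proof -
  define M where "M i j = PD j (H i) (z0, \<omega>0)" for i j
  obtain N0 where N0: "\<And>i i'. i < k \<Longrightarrow> i' < k \<Longrightarrow> (\<Sum>j<n. M i j * N0 i' j) = (if i = i' then 1 else 0)"
    using rank_right_inverse[of k n M] rank by (auto simp: M_def)
  define N where "N i = (\<lambda>m. if m < n then N0 i m else 0)" for i
  have N_Cn: "N i \<in> Cn n" for i by (simp add: N_def Cn_def)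
  have MN: "(\<Sum>m<n. M i m * N i' m) = (if i = i' then 1 else 0)" if "i < k" "i' < k" for i i'
  proof -
    have "(\<Sum>m<n. M i m * N i' m) = (\<Sum>j<n. M i j * N0 i' j)" by (intro sum.cong) (auto simp: N_def)
    then show ?thesis using N0[OF that] by simp
  qed
  define l where "l i u = (\<Sum>m<n. M i m * u m)" for i and u :: "nat \<Rightarrow> complex"
  have l_comb: "l i (\<lambda>m. \<Sum>i'<k. N i' m * c i') = c i" if "i < k" for i c
  proof -
    have "l i (\<lambda>m. \<Sum>i'<k. N i' m * c i') = (\<Sum>i'<k. (\<Sum>m<n. M i m * N i' m) * c i')"
      unfolding l_def sum_distrib_left sum_distrib_right by (subst sum.swap) (simp add: mult.assoc)
    also have "\<dots> = (\<Sum>i'<k. if i' = i then c i' else 0)" using MN[OF that] by (intro sum.cong) auto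
    finally show ?thesis using that by simp
  qed
  have l_diff: "l i (\<lambda>m. u m - v m) = l i u - l i v" for i u v
    by (simp add: l_def right_diff_distrib sum_subtractf)
  have l_add: "l i (\<lambda>m. u m + v m) = l i u + l i v" for i u v
    by (simp add: l_def distrib_left sum.distrib)
  have l_N: "l j (\<lambda>m. c * N i m) = (if j = i then c else 0)" if "i < k" "j < k" for i j c
  proof -
    have "l j (\<lambda>m. c * N i m) = c * (\<Sum>m<n. M j m * N i m)"
      by (simp add: l_def sum_distrib_left mult.left_commute)
    then show ?thesis using MN[OF that(2,1)] by simp
  qed
  define E where "E m x = (\<Sum>i<k. N i m * (H i x - l i (\<lambda>j. fst x j - z0 j)))" for m x
  define \<Phi> where "\<Phi> x = (\<lambda>m. if m < n then fst x m - z0 m + E m x else 0)" for x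
  have z0: "z0 \<in> Cn n" using x0 rel_open_sub[OF \<Omega>] by auto
  have E_PH: "PH n \<Omega> (E m)" for m
    unfolding E_def l_def by (intro PH_sum PH_mult PH_diff PH_const PH_coord H) auto
  have E0: "E m (z0, \<omega>0) = 0" for m
    by (simp add: E_def H0 l_def)
  have dE: "PD j (E m) (z0, \<omega>0) = 0" if j: "j < n" for m j
  proof -
    have l_line: "l i (\<lambda>j'. (z0(j := t)) j' - z0 j') = M i j * (t - z0 j)" for i t
    proof -
      have "l i (\<lambda>j'. (z0(j := t)) j' - z0 j') = (\<Sum>m<n. if m = j then M i j * (t - z0 j) else 0)"
        unfolding l_def by (intro sum.cong) auto
      then show ?thesis using j by simp
    qed
    \<comment> \<open>\<open>M i j\<close> is the derivative of \<open>H i\<close> in the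
      \<open>j\<close>-th coordinate, so each bracket has derivative 0.\<close>
    have "((\<lambda>t. \<Sum>i<k. N i m * (H i (z0(j := t), \<omega>0) - M i j * (t - z0 j))) has_field_derivative
        (\<Sum>i<k. N i m * (M i j - M i j * 1))) (at (z0 j))"
      unfolding M_def
      by (intro DERIV_sum DERIV_cmult DERIV_diff PD_has_derivative[OF H x0 j])
        (auto intro!: derivative_eq_intros)
    then show ?thesis
      unfolding PD_def E_def fst_conv snd_conv l_line by (simp add: DERIV_imp_deriv)
  qed
  obtain \<rho> \<tau> W G where G: "\<rho> > 0" "\<tau> > 0" "openin (top_of_set P) W" "\<omega>0 \<in> W" "polydisc n z0 \<rho> \<times> W \<subseteq> \<Omega>"
    and G_PH: "\<And>m. m < n \<Longrightarrow> PH n (polydisc n (\<lambda>_. 0) \<tau> \<times> W) (\<lambda>x. G x m)"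
    and G_in: "\<And>u \<omega>. u \<in> polydisc n (\<lambda>_. 0) \<tau> \<Longrightarrow> \<omega> \<in> W \<Longrightarrow> G (u, \<omega>) \<in> polydisc n z0 \<rho> \<and>
       (\<forall>m<n. G (u, \<omega>) m - z0 m + E m (G (u, \<omega>), \<omega>) = u m)"
    and G_unique: "\<And>u z \<omega>. u \<in> polydisc n (\<lambda>_. 0) \<tau> \<Longrightarrow> \<omega> \<in> W \<Longrightarrow> z \<in> polydisc n z0 \<rho> \<Longrightarrow>
       (\<And>m. m < n \<Longrightarrow> z m - z0 m + E m (z, \<omega>) = u m) \<Longrightarrow> G (u, \<omega>) = z"
    by (rule PH_inverse[where E = E, OF \<Omega> x0 E_PH E0 dE]) auto
  \<comment> \<open>On \<open>Q\<close> the \<open>m\<close>-th coordinate is the sum of a part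
    below \<open>\<epsilon>\<close> and a combination of the \<open>N i\<close> of size at most
    \<open>(C - 1) * \<epsilon>\<close>, hence is smaller than
    \<open>C * \<epsilon> = \<tau>\<close>.\<close>
  define C where "C = 1 + (\<Sum>m<n. \<Sum>i<k. cmod (N i m))"
  have C: "C \<ge> 1" by (simp add: C_def sum_nonneg)
  define \<epsilon> where "\<epsilon> = \<tau> / C"
  have \<epsilon>: "\<epsilon> > 0" using G(2) C by (simp add: \<epsilon>_def)
  \<comment> \<open>A box for the splitting into the span of the \<open>N i\<close> and the common
    kernel of the \<open>l i\<close>: the projection along \<open>N i\<close> sets the component
    \<open>l i\<close> to 0 and leaves the others unchanged.\<close>
  define Q where "Q = Cn n \<inter> (\<Inter>i\<in>{..<k}. {u \<in> Cn n. l i u \<in> ball 0 \<epsilon>})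
      \<inter> (\<Inter>m\<in>{..<n}. {u \<in> Cn n. u m - (\<Sum>i<k. N i m * l i u) \<in> ball 0 \<epsilon>})"
  have Q_iff: "u \<in> Q \<longleftrightarrow> u \<in> Cn n \<and> (\<forall>i<k. cmod (l i u) < \<epsilon>) \<and> (\<forall>m<n. cmod (u m - (\<Sum>i<k. N i m * l i u)) < \<epsilon>)" for u
    by (auto simp: Q_def)
  have coord: "continuous_on S (\<lambda>u::nat \<Rightarrow> complex. u m)" for S m
    by (rule continuous_on_subset[OF continuous_on_product_coordinates]) simp
  have cont_l: "continuous_on S (l i)" for S i
    unfolding l_def by (intro continuous_intros coord)
  have pre: "openin (top_of_set (Cn n)) {u \<in> Cn n. f u \<in> ball (0::complex) \<epsilon>}" if "continuous_on (Cn n) f" for f :: "(nat \<Rightarrow> complex) \<Rightarrow> complex"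
    using continuous_openin_preimage_gen[OF that open_ball, of 0 \<epsilon>] by (simp add: Int_def vimage_def)
  have Q: "openin (top_of_set (Cn n)) Q"
    unfolding Q_def by (intro openin_Int_INT pre cont_l continuous_on_diff continuous_on_sum continuous_on_mult continuous_on_const coord) auto
  have Q_disc: "Q \<subseteq> polydisc n (\<lambda>_. 0) \<tau>"
  proof
    fix u assume u: "u \<in> Q"
    have "cmod (u m) < \<tau>" if m: "m < n" for m
    proof -
      have "cmod (\<Sum>i<k. N i m * l i u) \<le> (\<Sum>i<k. cmod (N i m) * \<epsilon>)"
      proof (rule sum_norm_le)
        fix i assume "i \<in> {..<k}"
        then have "cmod (l i u) \<le> \<epsilon>" using u Q_iff by (simp add: less_imp_le)
        then show "cmod (N i m * l i u) \<le> cmod (N i m) * \<epsilon>"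
          unfolding norm_mult by (rule mult_left_mono) simp
      qed
      also have "\<dots> \<le> (C - 1) * \<epsilon>"
        unfolding sum_distrib_right[symmetric] C_def
      proof (rule mult_right_mono)
        have "(\<Sum>i<k. cmod (N i m)) \<le> (\<Sum>m<n. \<Sum>i<k. cmod (N i m))"
          by (rule member_le_sum[of m "{..<n}" "\<lambda>m. \<Sum>i<k. cmod (N i m)"]) (use m in \<open>auto intro: sum_nonneg\<close>)
        then show "(\<Sum>i<k. cmod (N i m)) \<le> 1 + (\<Sum>m<n. \<Sum>i<k. cmod (N i m)) - 1" by simp
      qed (use \<epsilon> in simp)
      finally have "cmod (\<Sum>i<k. N i m * l i u) \<le> (C - 1) * \<epsilon>" .
      moreover have "cmod (u m - (\<Sum>i<k. N i m * l i u)) < \<epsilon>" using u m Q_iff by blast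
      moreover have "cmod (u m) \<le> cmod (u m - (\<Sum>i<k. N i m * l i u)) + cmod (\<Sum>i<k. N i m * l i u)"
        using norm_triangle_ineq[of "u m - (\<Sum>i<k. N i m * l i u)" "\<Sum>i<k. N i m * l i u"] by simp
      ultimately have "cmod (u m) < C * \<epsilon>" by (simp add: algebra_simps)
      then show ?thesis using C by (simp add: \<epsilon>_def)
    qed
    then show "u \<in> polydisc n (\<lambda>_. 0) \<tau>" using u by (simp add: Q_iff polydisc_def)
  qed
  have inv: "(\<lambda>m. u m - l i u * N i m) \<in> Q" (is "?r \<in> Q") if i: "i < k" and u: "u \<in> Q" for i u
  proof -
    have l_r: "l j ?r = (if j = i then 0 else l j u)" if "j < k" for j
      using l_diff[of j u "\<lambda>m. l i u * N i m"] l_N[OF i that] by simp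
    have "(\<Sum>j<k. N j m * l j ?r) = (\<Sum>j<k. N j m * l j u) - l i u * N i m" for m
    proof -
      have "(\<Sum>j<k. N j m * l j ?r) = (\<Sum>j<k. N j m * l j u - (if j = i then l i u * N i m else 0))"
        using l_r by (intro sum.cong) auto
      then show ?thesis using i by (simp add: sum_subtractf)
    qed
    then have eq: "?r m - (\<Sum>j<k. N j m * l j ?r) = u m - (\<Sum>j<k. N j m * l j u)" for m by simp
    show ?thesis
      unfolding Q_iff eq
    proof (intro conjI allI impI)
      show "?r \<in> Cn n" using u N_Cn[of i] by (simp add: Q_iff Cn_def)
      show "cmod (l j ?r) < \<epsilon>" if "j < k" for j using l_r[OF that] u \<epsilon> that by (simp add: Q_iff)
      show "cmod (u m - (\<Sum>j<k. N j m * l j u)) < \<epsilon>" if "m < n" for m using u that by (simp add: Q_iff)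
    qed
  qed
  have H_l: "H i x = l i (\<Phi> x)" if i: "i < k" for i x
  proof -
    have "l i (\<Phi> x) = l i (\<lambda>m. (fst x m - z0 m) + E m x)"
      unfolding l_def by (intro sum.cong) (auto simp: \<Phi>_def)
    also have "\<dots> = l i (\<lambda>m. fst x m - z0 m) + (H i x - l i (\<lambda>j. fst x j - z0 j))"
      unfolding l_add E_def l_comb[OF i, of "\<lambda>i. H i x - l i (\<lambda>j. fst x j - z0 j)"] ..
    finally show ?thesis by simp
  qed
  show thesis
  proof (rule that[OF G(1,3,4,5) Q, of N M \<Phi> G])
    show "N i \<in> Cn n" for i by (rule N_Cn)
    show "(\<Sum>m<n. M i m * N i' m) = (if i = i' then 1 else 0)" if "i < k" "i' < k" for i i'
      by (rule MN[OF that])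
    show "(\<lambda>m. u m - (\<Sum>j<n. M i j * u j) * N i m) \<in> Q" if "i < k" "u \<in> Q" for i u
      using inv[OF that] by (simp add: l_def)
    show "PH n (polydisc n z0 \<rho> \<times> W) (\<lambda>x. \<Phi> x m)" if "m < n" for m
      unfolding \<Phi>_def using that PH_subset[OF E_PH G(5)] by (simp add: PH_add PH_diff PH_coord PH_const)
    show "\<Phi> x \<in> Cn n" for x by (simp add: \<Phi>_def Cn_def)
    show "PH n (Q \<times> W) (\<lambda>x. G x m)" if "m < n" for m
      by (rule PH_subset[OF G_PH[OF that]]) (use Q_disc in auto)
    show "G (u, \<omega>) \<in> polydisc n z0 \<rho> \<and> \<Phi> (G (u, \<omega>), \<omega>) = u" if "u \<in> Q" "\<omega> \<in> W" for u \<omega>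
    proof -
      have "u m = 0" if "\<not> m < n" for m using \<open>u \<in> Q\<close> that by (simp add: Q_iff Cn_def)
      then show ?thesis using G_in[of u \<omega>] that Q_disc by (auto simp: \<Phi>_def fun_eq_iff)
    qed
    show "G (\<Phi> (z, \<omega>), \<omega>) = z" if "z \<in> polydisc n z0 \<rho>" "\<omega> \<in> W" "\<Phi> (z, \<omega>) \<in> Q" for z \<omega>
      by (rule G_unique) (use that Q_disc in \<open>auto simp: \<Phi>_def\<close>)
    show "H i x = (\<Sum>m<n. M i m * \<Phi> x m)" if "i < k" for i x
      using H_l[OF that] by (simp add: l_def)
    have "\<Phi> (z0, \<omega>0) = (\<lambda>_. 0)" by (simp add: \<Phi>_def E0 fun_eq_iff)
    then show "\<Phi> (z0, \<omega>0) \<in> Q" using \<epsilon> by (simp add: Q_iff Cn_def l_def)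
  qed
qed

section \<open>The straightened model\<close>

lemma direction_open:
  assumes "rel_open n P Z" "u \<in> Cn n" "N \<in> Cn n"
  shows "open {s. ((\<lambda>m. u m + s * N m), \<omega>) \<in> Z}"
proof -
  obtain O' where O': "open O'" "Z = (Cn n \<times> P) \<inter> O'" using assms(1) by (auto simp: openin_open)
  have "open ((\<lambda>s. ((\<lambda>m. u m + s * N m), \<omega>)) -` O')"
    using O'(1) by (intro open_vimage continuous_on_Pair continuous_on_coordinatewise_then_product continuous_intros)
  moreover have "{s. ((\<lambda>m. u m + s * N m), \<omega>) \<in> Z} = (if \<omega> \<in> P then (\<lambda>s. ((\<lambda>m. u m + s * N m), \<omega>)) -` O' else {})"
    using O'(2) assms(2,3) by (auto simp: Cn_def)
  ultimately show ?thesis by simp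
qed

text \<open>From a zero of the form, moving by \<open>s N\<close> gives the form the value
  \<open>s\<close>; so \<open>g\<close> vanishes for small nonzero \<open>s\<close>, and by
  continuity at \<open>s = 0\<close>.\<close>

lemma PH_cancel:
  assumes Z: "rel_open n P Z" and g: "PH n Z g" and N: "N \<in> Cn n" and aN: "(\<Sum>m<n. a m * N m) = 1"
    and zero: "\<And>u \<omega>. (u, \<omega>) \<in> Z \<Longrightarrow> (\<Sum>m<n. a m * u m) * g (u, \<omega>) = 0" and x: "(u, \<omega>) \<in> Z"
  shows "g (u, \<omega>) = 0"
proof (cases "(\<Sum>m<n. a m * u m) = 0")
  case False
  then show ?thesis using zero[OF x] by simp
next
  case True
  have u: "u \<in> Cn n" using x rel_open_sub[OF Z] by auto
  let ?D = "{s. ((\<lambda>m. u m + s * N m), \<omega>) \<in> Z}"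
  let ?\<gamma> = "\<lambda>s. g ((\<lambda>m. u m + s * N m), \<omega>)"
  have D: "open ?D" by (rule direction_open[OF Z u N])
  have 0: "0 \<in> ?D" using x by simp
  have "?\<gamma> holomorphic_on ?D"
    by (rule holomorphic_direction[OF Z g N u D]) simp
  then have "isCont ?\<gamma> 0"
    using D 0 holomorphic_on_imp_continuous_on continuous_on_eq_continuous_at by blast
  then have "(?\<gamma> \<longlongrightarrow> ?\<gamma> 0) (at 0)" by (simp add: isCont_def)
  moreover have "\<forall>\<^sub>F s in at 0. ?\<gamma> s = 0"
    unfolding eventually_at_topological
  proof (intro exI[of _ ?D] conjI ballI impI)
    fix s assume s: "s \<in> ?D" "s \<noteq> 0"
    have "(\<Sum>m<n. a m * (u m + s * N m)) = (\<Sum>m<n. a m * u m) + s * (\<Sum>m<n. a m * N m)"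
      by (simp add: algebra_simps sum.distrib sum_distrib_left)
    then show "?\<gamma> s = 0" using zero[of "\<lambda>m. u m + s * N m" \<omega>] s True aN by simp
  qed (use D 0 in auto)
  then have "(?\<gamma> \<longlongrightarrow> 0) (at 0)" by (rule tendsto_eventually)
  ultimately have "?\<gamma> 0 = 0" by (intro LIM_unique)
  then show ?thesis by simp
qed

text \<open>The projection along \<open>N i\<close> is linear in the point and trivial in the
  parameter, so composition with it preserves \<open>PH\<close>. Division and cancellation are those
  for the linear form \<open>M i\<close>, which has the value 1 at \<open>N i\<close>.\<close>

lemma straightened_model:
  fixes T :: "'x topology" and \<Theta> :: "'x \<Rightarrow> (nat \<Rightarrow> complex) \<times> 'p::topological_space"
    and M N :: "nat \<Rightarrow> nat \<Rightarrow> complex"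
  assumes homeo: "homeomorphic_maps T (top_of_set (Q \<times> W)) \<Theta> \<Theta>'"
    and Q: "openin (top_of_set (Cn n)) Q" and W: "openin (top_of_set P) W"
    and F: "\<And>U. openin T U \<Longrightarrow> F U = {f \<in> extensional U. PH n (\<Theta> ` U) (\<lambda>y. f (\<Theta>' y))}"
    and N: "\<And>i. i < k \<Longrightarrow> N i \<in> Cn n"
    and MN: "\<And>i i'. i < k \<Longrightarrow> i' < k \<Longrightarrow> (\<Sum>m<n. M i m * N i' m) = (if i = i' then 1 else 0)"
    and inv: "\<And>i u. i < k \<Longrightarrow> u \<in> Q \<Longrightarrow> (\<lambda>m. u m - (\<Sum>j<n. M i j * u j) * N i m) \<in> Q"
  shows "straightened T F k (\<lambda>i. \<lambda>x\<in>topspace T. \<Sum>m<n. M i m * fst (\<Theta> x) m)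
    (\<lambda>i x. \<Theta>' ((\<lambda>m. fst (\<Theta> x) m - (\<Sum>j<n. M i j * fst (\<Theta> x) j) * N i m), snd (\<Theta> x)))"
proof -
  define l where "l i u = (\<Sum>m<n. M i m * u m)" for i and u :: "nat \<Rightarrow> complex"
  define \<pi> where "\<pi> i y = ((\<lambda>m. fst y m - l i (fst y) * N i m), snd y)" for i and y :: "(nat \<Rightarrow> complex) \<times> 'p"
  have cont: "continuous_map T (top_of_set (Q \<times> W)) \<Theta>" "continuous_map (top_of_set (Q \<times> W)) T \<Theta>'"
    and inv1: "\<And>x. x \<in> topspace T \<Longrightarrow> \<Theta>' (\<Theta> x) = x" and inv2: "\<And>y. y \<in> Q \<times> W \<Longrightarrow> \<Theta> (\<Theta>' y) = y"
    using homeo by (auto simp: homeomorphic_maps_def)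
  have \<Theta>_in: "\<Theta> x \<in> Q \<times> W" if "x \<in> topspace T" for x
    using continuous_map_image_subset_topspace[OF cont(1)] that by auto
  have \<Theta>'_in: "\<Theta>' y \<in> topspace T" if "y \<in> Q \<times> W" for y
    using continuous_map_image_subset_topspace[OF cont(2)] that by auto
  have rel: "rel_open n P (\<Theta> ` U)" if "openin T U" for U
  proof -
    have "homeomorphic_map T (top_of_set (Q \<times> W)) \<Theta>" using homeo by (auto simp: homeomorphic_map_maps)
    then have "openin (top_of_set (Q \<times> W)) (\<Theta> ` U)"
      using that homeomorphic_imp_open_map open_map_def by blast
    moreover have "rel_open n P (Q \<times> W)" using Q W by (rule openin_Times)
    ultimately show ?thesis by (rule openin_trans)
  qed
  have sub: "U \<subseteq> topspace T" if "openin T U" for U using openin_subset[OF that] .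
  have F_in: "f \<in> F U \<longleftrightarrow> f \<in> extensional U \<and> PH n (\<Theta> ` U) (\<lambda>y. f (\<Theta>' y))" if "openin T U" for f U
    using F[OF that] by simp
  have mem: "\<Theta>' y \<in> U" if "openin T U" "y \<in> \<Theta> ` U" for U y
    using that inv1 sub by fastforce
  have l_\<pi>: "l j (fst (\<pi> i y)) = (if i = j then 0 else l j (fst y))" if "i < k" "j < k" for i j y
  proof -
    have "l j (fst (\<pi> i y)) = l j (fst y) - l i (fst y) * (\<Sum>m<n. M j m * N i m)"
      by (simp add: l_def \<pi>_def algebra_simps sum_subtractf sum_distrib_left)
    then show ?thesis using MN[OF that(2,1)] by auto
  qed
  have \<pi>_in: "\<pi> i y \<in> Q \<times> W" if "i < k" "y \<in> Q \<times> W" for i y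
    using inv[OF that(1), of "fst y"] that(2) by (auto simp: \<pi>_def l_def)
  have PH_l: "PH n S (\<lambda>y. l i (fst y))" for S :: "((nat \<Rightarrow> complex) \<times> 'p) set" and i
    unfolding l_def by (intro PH_sum PH_mult PH_const PH_coord) simp
  have PH_\<pi>: "PH n S (\<lambda>y. fst (\<pi> i y) m)" for S :: "((nat \<Rightarrow> complex) \<times> 'p) set" and i m
    unfolding \<pi>_def fst_conv by (intro PH_diff PH_mult PH_const PH_coord PH_l)
  define h where "h i = (\<lambda>x\<in>topspace T. l i (fst (\<Theta> x)))" for i
  define r where "r i x = \<Theta>' (\<pi> i (\<Theta> x))" for i x
  have r_in: "r i x \<in> topspace T" if "i < k" "x \<in> topspace T" for i x
    using \<Theta>'_in \<pi>_in \<Theta>_in that by (simp add: r_def)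
  have \<Theta>_r: "\<Theta> (r i x) = \<pi> i (\<Theta> x)" if "i < k" "x \<in> topspace T" for i x
    using inv2 \<pi>_in \<Theta>_in that by (simp add: r_def)
  have h_in: "h i \<in> F (topspace T)" for i
  proof -
    have "PH n (\<Theta> ` topspace T) (\<lambda>y. h i (\<Theta>' y))"
      by (rule PH_cong[OF PH_l rel[OF openin_topspace], of i]) (auto simp: h_def inv1)
    then show ?thesis by (simp add: F_in h_def)
  qed
  have r_cont: "continuous_map T T (r i)" if i: "i < k" for i
  proof -
    have "continuous_map (top_of_set (Q \<times> W)) (top_of_set (Q \<times> W)) (\<pi> i)"
    proof -
      have "continuous_on (Q \<times> W) (\<pi> i)"
        unfolding \<pi>_def
        by (intro continuous_on_Pair continuous_on_coordinatewise_then_product continuous_on_snd continuous_on_id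
            PH_continuous[of n] PH_diff PH_mult PH_const PH_coord PH_l)
      moreover have "\<pi> i \<in> Q \<times> W \<rightarrow> Q \<times> W" using \<pi>_in[OF i] by auto
      ultimately show ?thesis by (simp add: continuous_map_in_subtopology image_subset_iff_funcset)
    qed
    then have "continuous_map T T (\<Theta>' \<circ> (\<pi> i \<circ> \<Theta>))"
      using cont by (intro continuous_map_compose[of T "top_of_set (Q \<times> W)"] continuous_map_compose[of T "top_of_set (Q \<times> W)"])
    then show ?thesis by (simp add: comp_def r_def[abs_def])
  qed
  have sheaf: "function_sheaf T F"
  proof
    fix U assume U: "openin T U"
    have "(\<lambda>x\<in>U. c) \<in> F U" for c
      unfolding F_in[OF U] using PH_cong[OF PH_const rel[OF U], of c] mem[OF U] by auto
    moreover have "(\<lambda>x\<in>U. f x + g x) \<in> F U \<and> (\<lambda>x\<in>U. f x * g x) \<in> F U" if "f \<in> F U" "g \<in> F U" for f g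
    proof -
      have fg: "PH n (\<Theta> ` U) (\<lambda>y. f (\<Theta>' y))" "PH n (\<Theta> ` U) (\<lambda>y. g (\<Theta>' y))" using that F_in[OF U] by auto
      show ?thesis
        unfolding F_in[OF U]
        using PH_cong[OF PH_add[OF fg] rel[OF U], of "\<lambda>y. (\<lambda>x\<in>U. f x + g x) (\<Theta>' y)"]
          PH_cong[OF PH_mult[OF fg] rel[OF U], of "\<lambda>y. (\<lambda>x\<in>U. f x * g x) (\<Theta>' y)"] mem[OF U] by auto
    qed
    ultimately show "function_subring U (F U)" using F_in[OF U] by (auto simp: function_subring_def)
  next
    fix U U' f assume U: "openin T U" "openin T U'" "U' \<subseteq> U" and f: "f \<in> F U"
    have "PH n (\<Theta> ` U') (\<lambda>y. f (\<Theta>' y))"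
      using f F_in[OF U(1)] PH_subset[of n "\<Theta> ` U" _ "\<Theta> ` U'"] U(3) by blast
    then have "PH n (\<Theta> ` U') (\<lambda>y. restrict f U' (\<Theta>' y))"
      by (rule PH_cong[OF _ rel[OF U(2)]]) (use mem[OF U(2)] in auto)
    then show "restrict f U' \<in> F U'" by (simp add: F_in[OF U(2)])
  qed
  have "straightened_axioms T F k h r"
  proof
    fix i assume i: "i < k"
    show "continuous_map T T (r i)" by (rule r_cont[OF i])
    show "h i \<in> F (topspace T)" by (rule h_in)
    have "continuous_map (top_of_set (Q \<times> W)) euclidean (\<lambda>y. l i (fst y))"
      using PH_continuous[OF PH_l] by simp
    from continuous_map_compose[OF cont(1) this]
    have "continuous_map T euclidean (\<lambda>x. l i (fst (\<Theta> x)))" by (simp add: comp_def)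
    then have "openin T {x \<in> topspace T. l i (fst (\<Theta> x)) \<in> - {0}}"
      by (rule openin_continuous_map_preimage) auto
    moreover have "{x \<in> topspace T. h i x \<noteq> 0} = {x \<in> topspace T. l i (fst (\<Theta> x)) \<in> - {0}}"
      by (auto simp: h_def)
    ultimately show "openin T {x \<in> topspace T. h i x \<noteq> 0}" by simp
    show "h j (r i x) = (if i = j then 0 else h j x)" if "j < k" "x \<in> topspace T" for j x
      using l_\<pi>[OF i that(1)] r_in[OF i that(2)] \<Theta>_r[OF i that(2)] that(2) by (simp add: h_def)
    show "r i x = x" if "x \<in> topspace T" "h i x = 0" for x
      using that inv1 by (simp add: h_def r_def \<pi>_def)
    show "(\<lambda>x\<in>{x \<in> topspace T. r i x \<in> Z}. g (r i x)) \<in> F {x \<in> topspace T. r i x \<in> Z}"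
      if Z: "openin T Z" and g: "g \<in> F Z" for Z g
    proof -
      let ?Z = "{x \<in> topspace T. r i x \<in> Z}"
      have Z': "openin T ?Z" using r_cont[OF i] Z by (simp add: continuous_map)
      have PHg: "PH n (\<Theta> ` Z) (\<lambda>y. g (\<Theta>' y))" using g F_in[OF Z] by auto
      have "PH n (\<Theta> ` ?Z) (\<lambda>y. g (\<Theta>' (fst (\<pi> i y), snd y)))"
      proof (rule PH_compose[OF rel[OF Z] PHg rel[OF Z'], where \<sigma> = "\<lambda>\<omega>. \<omega>"])
        fix y assume "y \<in> \<Theta> ` ?Z"
        then obtain x where x: "x \<in> topspace T" "r i x \<in> Z" "y = \<Theta> x" by auto
        have "(fst (\<pi> i y), snd y) = \<Theta> (r i x)" using \<Theta>_r[OF i x(1)] x(3) by (simp add: \<pi>_def)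
        then show "(fst (\<pi> i y), snd y) \<in> \<Theta> ` Z" using x(2) by auto
      qed (auto intro: PH_\<pi> continuous_intros)
      then have "PH n (\<Theta> ` ?Z) (\<lambda>y. (\<lambda>x\<in>?Z. g (r i x)) (\<Theta>' y))"
        by (rule PH_cong[OF _ rel[OF Z']]) (auto simp: inv1 r_def \<pi>_def)
      then show ?thesis by (simp add: F_in[OF Z'])
    qed
    have MNi: "(\<Sum>m<n. M i m * N i m) = 1" using MN[OF i i] by simp
    show "\<exists>e\<in>F Z. \<forall>x\<in>Z. g x = h i x * e x"
      if Z: "openin T Z" and g: "g \<in> F Z" and g0: "\<And>x. x \<in> Z \<Longrightarrow> h i x = 0 \<Longrightarrow> g x = 0" for Z g
    proof -
      have PHg: "PH n (\<Theta> ` Z) (\<lambda>y. g (\<Theta>' y))" using g F_in[OF Z] by auto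
      have "g (\<Theta>' (u, \<omega>)) = 0" if "(u, \<omega>) \<in> \<Theta> ` Z" "(\<Sum>m<n. M i m * u m) = 0" for u \<omega>
      proof -
        obtain x where x: "x \<in> Z" "(u, \<omega>) = \<Theta> x" using \<open>(u, \<omega>) \<in> \<Theta> ` Z\<close> by auto
        moreover have "x \<in> topspace T" using x(1) sub[OF Z] by auto
        moreover have "fst (\<Theta> x) = u" using x(2) by (metis fst_conv)
        ultimately show ?thesis using g0[OF x(1)] that(2) by (simp add: inv1 h_def l_def)
      qed
      from PH_division[OF rel[OF Z] PHg N[OF i] MNi this]
      obtain e where e: "PH n (\<Theta> ` Z) e" "\<And>u \<omega>. (u, \<omega>) \<in> \<Theta> ` Z \<Longrightarrow> g (\<Theta>' (u, \<omega>)) = l i u * e (u, \<omega>)"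
        unfolding l_def by blast
      have "PH n (\<Theta> ` Z) (\<lambda>y. (\<lambda>x\<in>Z. e (\<Theta> x)) (\<Theta>' y))"
        by (rule PH_cong[OF e(1) rel[OF Z]]) (use sub[OF Z] inv1 in auto)
      then have "(\<lambda>x\<in>Z. e (\<Theta> x)) \<in> F Z" by (simp add: F_in[OF Z])
      moreover have "g x = h i x * (\<lambda>x\<in>Z. e (\<Theta> x)) x" if x: "x \<in> Z" for x
      proof -
        have xT: "x \<in> topspace T" using x sub[OF Z] by auto
        have "g (\<Theta>' (\<Theta> x)) = l i (fst (\<Theta> x)) * e (\<Theta> x)"
          using e(2)[of "fst (\<Theta> x)" "snd (\<Theta> x)"] x by simp
        then show ?thesis using x xT by (simp add: inv1 h_def)
      qed
      ultimately show ?thesis by blast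
    qed
    show "e x = 0"
      if Z: "openin T Z" and e: "e \<in> F Z" and e0: "\<And>x. x \<in> Z \<Longrightarrow> h i x * e x = 0" and x: "x \<in> Z" for Z e x
    proof -
      have PHe: "PH n (\<Theta> ` Z) (\<lambda>y. e (\<Theta>' y))" using e F_in[OF Z] by auto
      have xT: "x \<in> topspace T" using x sub[OF Z] by auto
      have "e (\<Theta>' (fst (\<Theta> x), snd (\<Theta> x))) = 0"
      proof (rule PH_cancel[OF rel[OF Z] PHe N[OF i] MNi])
        fix u \<omega> assume "(u, \<omega>) \<in> \<Theta> ` Z"
        then obtain y where y: "y \<in> Z" "(u, \<omega>) = \<Theta> y" by auto
        moreover have "y \<in> topspace T" using y(1) sub[OF Z] by auto
        moreover have "fst (\<Theta> y) = u" using y(2) by (metis fst_conv)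
        ultimately show "(\<Sum>m<n. M i m * u m) * e (\<Theta>' (u, \<omega>)) = 0"
          using e0[OF y(1)] by (simp add: inv1 h_def l_def)
      qed (use x in auto)
      then show ?thesis using inv1[OF xT] by simp
    qed
  qed
  then have "straightened T F k h r"
    using sheaf by (simp add: straightened_def)
  then show ?thesis unfolding h_def[abs_def] r_def[abs_def] \<pi>_def l_def .
qed

section \<open>The fibrewise compactification in charts\<close>

lemma topology_eq_id:
  assumes "continuous_map X Y (\<lambda>x. x)" "continuous_map Y X (\<lambda>x. x)"
  shows "X = Y"
proof -
  have top: "topspace X = topspace Y"
    using assms by (auto simp: continuous_map_def Pi_iff)
  have *: "openin S U" if "continuous_map S T (\<lambda>x. x)" "topspace S = topspace T" "openin T U" for S T :: "'a topology" and U
  proof -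
    have "{x \<in> topspace S. x \<in> U} = U" using openin_subset[OF that(3)] that(2) by blast
    then show ?thesis using openin_continuous_map_preimage[OF that(1,3)] by (simp only:)
  qed
  show ?thesis
    unfolding topology_eq using *[OF assms(1) top] *[OF assms(2) top[symmetric]] by blast
qed

text \<open>Off \<open>I\<close> extensional functions are constant, so these coordinates add
  nothing to the topology. Thus the weak star topology becomes a subspace topology of a type, and
  \<open>closure\<close> and \<open>continuous_on\<close> apply to the fibre.\<close>

lemma product_topology_extensional:
  fixes S :: "('i \<Rightarrow> 'b::topological_space) set"
  assumes "S \<subseteq> extensional I"
  shows "subtopology (product_topology (\<lambda>_. euclidean) I) S = top_of_set S"
proof (rule topology_eq_id)
  have top: "topspace (subtopology (product_topology (\<lambda>_. euclidean) I) S) = S"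
    using assms by (auto simp: PiE_def)
  have "continuous_map (subtopology (product_topology (\<lambda>_. euclidean) I) S) (product_topology (\<lambda>_. euclidean) UNIV) (\<lambda>x. x)"
    unfolding continuous_map_componentwise_UNIV
  proof
    fix k
    show "continuous_map (subtopology (product_topology (\<lambda>_. euclidean) I) S) euclidean (\<lambda>x. x k)"
    proof (cases "k \<in> I")
      case True
      then show ?thesis
        by (intro continuous_map_from_subtopology continuous_map_product_projection)
    next
      case False
      have "continuous_map (subtopology (product_topology (\<lambda>_. euclidean) I) S) euclidean (\<lambda>x. undefined)" by simp
      then show ?thesis
        by (rule continuous_map_eq) (use False assms top in \<open>auto simp: extensional_def\<close>)
    qed
  qed
  then show "continuous_map (subtopology (product_topology (\<lambda>_. euclidean) I) S) (top_of_set S) (\<lambda>x. x)"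
    using top by (simp add: euclidean_product_topology continuous_map_in_subtopology)
  have "continuous_on S (\<lambda>x. x k)" for k
    by (rule continuous_on_subset[OF continuous_on_product_coordinates]) simp
  then have "continuous_map (top_of_set S) (product_topology (\<lambda>_. euclidean) I) (\<lambda>x. x)"
    using assms by (auto simp: continuous_map_componentwise)
  then show "continuous_map (top_of_set S) (subtopology (product_topology (\<lambda>_. euclidean) I) S) (\<lambda>x. x)"
    by (simp add: continuous_map_in_subtopology)
qed

lemma max_ideal_space_extensional: "max_ideal_space G \<aa> \<subseteq> extensional \<aa>"
  by (auto simp: max_ideal_space_def)

lemma weak_star_eq: "weak_star_topology G \<aa> = top_of_set (max_ideal_space G \<aa>)"
  unfolding weak_star_topology_def by (rule product_topology_extensional[OF max_ideal_space_extensional])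

lemma topspace_Ghat: "topspace (Ghat G \<aa>) = max_ideal_space G \<aa> \<inter> closure (max_ideal_space G \<aa> \<inter> point_eval \<aa> ` G)"
  unfolding Ghat_def weak_star_eq by (simp add: closure_of_subtopology Int_commute)

lemma Ghat_eq: "Ghat G \<aa> = top_of_set (topspace (Ghat G \<aa>))"
proof -
  have "Ghat G \<aa> = subtopology euclidean (max_ideal_space G \<aa> \<inter> (top_of_set (max_ideal_space G \<aa>) closure_of point_eval \<aa> ` G))"
    unfolding Ghat_def weak_star_eq by (simp add: subtopology_subtopology)
  then show ?thesis by (metis topspace_euclidean_subtopology)
qed

text \<open>The density that \<open>PH_dense\<close> consumes.\<close>

lemma Ghat_dense: "topspace (Ghat G \<aa>) \<subseteq> closure (point_eval \<aa> ` G)"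
  unfolding topspace_Ghat using closure_mono[of "max_ideal_space G \<aa> \<inter> point_eval \<aa> ` G" "point_eval \<aa> ` G"] by blast

text \<open>Evaluations are continuous because a value is bounded by the supremum norm; the supremum
  is a genuine bound since the functions in \<open>linf\<close> are bounded.\<close>

lemma point_eval_in_Ghat:
  assumes \<aa>: "closed_unital_subalgebra G \<aa>" and g: "g \<in> G"
  shows "point_eval \<aa> g \<in> topspace (Ghat G \<aa>)"
proof -
  have 1: "(\<lambda>g\<in>G. 1) \<in> \<aa>" and sub: "\<aa> \<subseteq> linf G" using \<aa> by (auto simp: closed_unital_subalgebra_def)
  have close: "cmod (v g - u g) \<le> linf_norm G (\<lambda>g\<in>G. v g - u g)" if "u \<in> \<aa>" "v \<in> \<aa>" for u v
  proof -
    have "bounded (u ` G)" "bounded (v ` G)" using that sub by (auto simp: linf_def)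
    then obtain B C where "\<forall>x\<in>u ` G. cmod x \<le> B" "\<forall>x\<in>v ` G. cmod x \<le> C" by (auto simp: bounded_iff)
    then have "cmod (v h - u h) \<le> C + B" if "h \<in> G" for h
      using that norm_triangle_ineq4[of "v h" "u h"] by (smt (verit) image_eqI)
    then have "bdd_above ((\<lambda>h. cmod ((\<lambda>g\<in>G. v g - u g) h)) ` G)" by (intro bdd_aboveI2[of _ _ "C + B"]) simp
    from cSUP_upper[OF g this] g show ?thesis by (simp add: linf_norm_def)
  qed
  have "point_eval \<aa> g \<in> max_ideal_space G \<aa>"
    unfolding max_ideal_space_def
  proof (intro CollectI conjI ballI allI impI)
    show "point_eval \<aa> g \<in> extensional \<aa>" by (simp add: point_eval_def)
    show "\<exists>u\<in>\<aa>. point_eval \<aa> g u \<noteq> 0" using 1 g by (intro bexI[OF _ 1]) (simp add: point_eval_def)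
    show "\<exists>d>0. \<forall>v\<in>\<aa>. linf_norm G (\<lambda>g\<in>G. v g - u g) < d \<longrightarrow> cmod (point_eval \<aa> g v - point_eval \<aa> g u) < e"
      if "u \<in> \<aa>" "e > 0" for u e
      using close[OF that(1)] that by (intro exI[of _ e]) (auto simp: point_eval_def intro: le_less_trans)
  qed (use \<aa> g in \<open>auto simp: point_eval_def closed_unital_subalgebra_def\<close>)
  moreover from this have "point_eval \<aa> g \<in> closure (max_ideal_space G \<aa> \<inter> point_eval \<aa> ` G)"
    using g by (intro subsetD[OF closure_subset] IntI imageI)
  ultimately show ?thesis by (simp add: topspace_Ghat)
qed

section \<open>The glued space and its base projection\<close>

lemma topspace_quotient_topology: "topspace (quotient_topology X q) = q ` topspace X"
proof -
  have "openin (quotient_topology X q) (q ` topspace X)"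
    unfolding openin_quotient_topology by (auto simp: openin_topspace intro: back_subst[of "openin X"])
  then show ?thesis
    using openin_subset openin_quotient_topology[of X q "topspace (quotient_topology X q)"] by blast
qed

lemma topspace_local_pieces: "topspace (local_pieces D) = {(\<delta>, x, \<omega>). x \<in> cov D \<delta> \<and> \<omega> \<in> topspace (fibre D)}"
  by (auto simp: local_pieces_def)

lemma topspace_caX: "topspace (caX D) = {glue D `` {(\<delta>, x, \<omega>)} | \<delta> x \<omega>. x \<in> cov D \<delta> \<and> \<omega> \<in> topspace (fibre D)}"
  unfolding caX_def topspace_quotient_topology topspace_local_pieces by auto

lemma pbar_glue:
  assumes "x \<in> cov D \<delta>" "\<omega> \<in> topspace (fibre D)"
  shows "pbar D (glue D `` {(\<delta>, x, \<omega>)}) = x"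
proof -
  have "\<exists>e. e \<in> glue D `` {(\<delta>, x, \<omega>)}"
    using assms by (auto simp: glue_def)
  then have "(SOME e. e \<in> glue D `` {(\<delta>, x, \<omega>)}) \<in> glue D `` {(\<delta>, x, \<omega>)}" by (rule someI_ex)
  moreover have "fst (snd e) = x" if "e \<in> glue D `` {(\<delta>, x, \<omega>)}" for e
    using that by (auto simp: glue_def)
  ultimately show ?thesis by (simp add: pbar_def)
qed

lemma openin_pbar:
  assumes "open U"
  shows "openin (caX D) {P \<in> topspace (caX D). pbar D P \<in> U}"
proof -
  let ?V = "{P \<in> topspace (caX D). pbar D P \<in> U}"
  have "{e \<in> topspace (local_pieces D). glue D `` {e} \<in> ?V} = Sigma UNIV (\<lambda>\<gamma>. (cov D \<gamma> \<inter> U) \<times> topspace (fibre D))"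
    by (auto simp: topspace_local_pieces topspace_caX pbar_glue)
  moreover have "openin (local_pieces D) (Sigma UNIV (\<lambda>\<gamma>. (cov D \<gamma> \<inter> U) \<times> topspace (fibre D)))"
    unfolding local_pieces_def openin_sum_topology
  proof (intro conjI ballI)
    fix \<gamma>
    have "{x. (\<gamma>, x) \<in> (SIGMA \<gamma>:UNIV. (cov D \<gamma> \<inter> U) \<times> topspace (fibre D))} = (cov D \<gamma> \<inter> U) \<times> topspace (fibre D)" by auto
    moreover have "openin (top_of_set (cov D \<gamma>)) (cov D \<gamma> \<inter> U)" using assms by auto
    ultimately show "openin (prod_topology (top_of_set (cov D \<gamma>)) (fibre D)) {x. (\<gamma>, x) \<in> (SIGMA \<gamma>:UNIV. (cov D \<gamma> \<inter> U) \<times> topspace (fibre D))}"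
      by (simp add: openin_prod_Times_iff)
  qed auto
  ultimately show ?thesis
    by (auto simp: caX_def openin_quotient_topology topspace_quotient_topology)
qed

section \<open>The covering, the map \<open>iota\<close> and the two structure sheaves\<close>

locale fc =
  fixes D :: "('a::topological_space, 'b::{t2_space, second_countable_topology}, 'i) fc_data"
  assumes setting: "fc_setting D"
begin

abbreviation "G \<equiv> deckG D"
abbreviation "pe \<equiv> point_eval (calg D)"
abbreviation "L \<equiv> lift_atlas (cproj D) (catlas D)"
abbreviation "n \<equiv> cdim D"
abbreviation "p \<equiv> cproj D"

lemma atlas: "complex_atlas n (catlas D)"
  using setting unfolding fc_setting_def by (elim conjE)

lemma covering: "covering_space UNIV p UNIV"
  using setting unfolding fc_setting_def regular_covering_def by (elim conjE)

lemma alg: "closed_unital_subalgebra G (calg D)"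
  using setting unfolding fc_setting_def by (elim conjE)

lemma alg_inv:
  assumes "u \<in> calg D" "g \<in> G"
  shows "right_translate G g u \<in> calg D"
proof -
  have *: "\<forall>u\<in>calg D. \<forall>g\<in>G. right_translate G g u \<in> calg D"
    using setting unfolding fc_setting_def by (elim conjE)
  show ?thesis by (rule *[rule_format, OF assms])
qed

lemma cov_UN: "\<exists>\<gamma>. x \<in> cov D \<gamma>"
proof -
  have "(\<Union>\<gamma>. cov D \<gamma>) = UNIV" using setting unfolding fc_setting_def by (elim conjE)
  then show ?thesis by (metis UNIV_I UN_E)
qed

lemma cov_triv: "principal_triv p (cov D \<gamma>) (ctriv D \<gamma>)"
  and cov_open: "open (cov D \<gamma>)"
proof -
  have *: "\<forall>\<gamma>. open (cov D \<gamma>) \<and> simply_connected (cov D \<gamma>) \<and> principal_triv p (cov D \<gamma>) (ctriv D \<gamma>)"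
    using setting unfolding fc_setting_def by (elim conjE)
  show "principal_triv p (cov D \<gamma>) (ctriv D \<gamma>)" "open (cov D \<gamma>)" using *[rule_format, of \<gamma>] by simp_all
qed

lemma cocyc_G:
  assumes "x \<in> cov D \<gamma>" "x \<in> cov D \<delta>"
  shows "cocyc D \<delta> \<gamma> x \<in> G"
proof -
  have *: "\<forall>\<delta> \<gamma>. \<forall>x\<in>cov D \<gamma> \<inter> cov D \<delta>. cocyc D \<delta> \<gamma> x \<in> G \<and>
           (\<exists>V. open V \<and> x \<in> V \<and> V \<subseteq> cov D \<gamma> \<inter> cov D \<delta> \<and> cocyc D \<delta> \<gamma> constant_on V)"
    using setting unfolding fc_setting_def by (elim conjE)
  from *[rule_format, OF IntI[OF assms]] show ?thesis by (rule conjunct1)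
qed

lemma ctriv_cocyc:
  assumes "p y \<in> cov D \<gamma>" "p y \<in> cov D \<delta>"
  shows "ctriv D \<gamma> y = ctriv D \<delta> y \<circ> cocyc D \<delta> \<gamma> (p y)"
proof -
  have *: "\<forall>\<delta> \<gamma> y. p y \<in> cov D \<gamma> \<inter> cov D \<delta> \<longrightarrow> ctriv D \<gamma> y = ctriv D \<delta> y \<circ> cocyc D \<delta> \<gamma> (p y)"
    using setting unfolding fc_setting_def by (elim conjE)
  from *[rule_format, OF IntI[OF assms]] show ?thesis .
qed

lemma triv_image:
  assumes "principal_triv p U \<psi>"
  shows "(\<lambda>x. (p x, \<psi> x)) ` (p -` U) = U \<times> G"
proof -
  have "(\<lambda>x. (p x, \<psi> x)) ` topspace (top_of_set (p -` U)) = topspace (prod_topology (top_of_set U) (discrete_topology (deck p)))"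
    by (rule homeomorphic_imp_surjective_map[OF conjunct1[OF assms[unfolded principal_triv_def]]])
  then show ?thesis by (simp add: deckG_def)
qed

lemma triv_in_G:
  assumes "principal_triv p U \<psi>" "p y \<in> U"
  shows "\<psi> y \<in> G"
proof -
  have "(p y, \<psi> y) \<in> (\<lambda>x. (p x, \<psi> x)) ` (p -` U)" using assms(2) by blast
  then show ?thesis by (simp only: triv_image[OF assms(1)] mem_Sigma_iff)
qed

lemma triv_surj:
  assumes "principal_triv p U \<psi>" "z \<in> U" "g \<in> G"
  shows "\<exists>y. p y = z \<and> \<psi> y = g"
proof -
  have "(z, g) \<in> (\<lambda>x. (p x, \<psi> x)) ` (p -` U)"
    using assms(2,3) by (simp only: triv_image[OF assms(1)] mem_Sigma_iff)
  then show ?thesis by force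
qed

lemma triv_inj:
  assumes "principal_triv p U \<psi>" "p y \<in> U" "p y = p y'" "\<psi> y = \<psi> y'"
  shows "y = y'"
proof -
  have "inj_on (\<lambda>x. (p x, \<psi> x)) (p -` U)"
    using homeomorphic_imp_injective_map[OF conjunct1[OF assms(1)[unfolded principal_triv_def]]] by simp
  then show ?thesis using assms(2-4) by (auto dest: inj_onD)
qed

lemma continuous_p: "continuous_on UNIV p"
  using covering by (rule covering_space_imp_continuous)

text \<open>The deck group is discrete, so prescribing the value of the trivialization is an open
  condition.\<close>

lemma sheet_open:
  assumes "principal_triv p U \<psi>" "open U" "open U'" "U' \<subseteq> U"
  shows "open {y. p y \<in> U' \<and> \<psi> y = g}"
proof (cases "g \<in> G")
  case True
  have cont: "continuous_map (top_of_set (p -` U)) (prod_topology (top_of_set U) (discrete_topology (deck p))) (\<lambda>x. (p x, \<psi> x))"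
    by (rule homeomorphic_imp_continuous_map[OF conjunct1[OF assms(1)[unfolded principal_triv_def]]])
  have "openin (top_of_set U) U'" using assms(3,4) by (metis inf.absorb_iff2 openin_open)
  then have "openin (prod_topology (top_of_set U) (discrete_topology (deck p))) (U' \<times> {g})"
    using True by (simp add: openin_prod_Times_iff deckG_def)
  from openin_continuous_map_preimage[OF cont this]
  have "openin (top_of_set (p -` U)) {y \<in> p -` U. (p y, \<psi> y) \<in> U' \<times> {g}}" by simp
  moreover have "open (p -` U)" using continuous_p assms(2) by (simp add: open_vimage)
  ultimately have "open {y \<in> p -` U. (p y, \<psi> y) \<in> U' \<times> {g}}" by (simp add: openin_open_eq)
  moreover have "{y \<in> p -` U. (p y, \<psi> y) \<in> U' \<times> {g}} = {y. p y \<in> U' \<and> \<psi> y = g}" using assms(4) by auto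
  ultimately show ?thesis by simp
next
  case False
  then have "{y. p y \<in> U' \<and> \<psi> y = g} = {}" using triv_in_G[OF assms(1)] assms(4) by auto
  then show ?thesis by (simp only: open_empty)
qed

lemma pe_in: "g \<in> G \<Longrightarrow> pe g \<in> topspace (fibre D)"
  by (rule point_eval_in_Ghat[OF alg])

lemma right_action_pe:
  assumes "g \<in> G" "c \<in> G"
  shows "right_action G (calg D) (pe g) c = pe (g \<circ> c)"
  unfolding right_action_def point_eval_def
proof (rule restrict_ext)
  fix u assume u: "u \<in> calg D"
  then show "(\<lambda>u\<in>calg D. u g) (right_translate G c u) = u (g \<circ> c)"
    using alg_inv[OF u assms(2)] assms(1) by (simp add: right_translate_def)
qed

text \<open>Right translation of an evaluation is an evaluation (\<open>right_action_pe\<close>),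
  and the cocycle is that of the trivializations; so a class in the image of \<open>iota\<close>
  consists of one evaluation per member of the cover. Hence \<open>iota\<close> does not depend on
  the index chosen by \<open>SOME\<close>.\<close>

lemma glue_pe:
  assumes "p y \<in> cov D \<gamma>"
  shows "glue D `` {(\<gamma>, p y, pe (ctriv D \<gamma> y))} = {(\<gamma>', p y, pe (ctriv D \<gamma>' y)) | \<gamma>'. p y \<in> cov D \<gamma>'}"
proof -
  have "ctriv D \<gamma> y \<in> G" using triv_in_G[OF cov_triv assms] .
  then have R: "right_action G (calg D) (pe (ctriv D \<gamma> y)) (cocyc D \<gamma> \<gamma>' (p y)) = pe (ctriv D \<gamma>' y)" if "p y \<in> cov D \<gamma>'" for \<gamma>'
    using right_action_pe[OF _ cocyc_G[OF that assms]] ctriv_cocyc[OF that assms] by (simp only:)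
  have in_fibre: "pe (ctriv D \<gamma> y) \<in> topspace (fibre D)" by (rule pe_in[OF triv_in_G[OF cov_triv assms]])
  show ?thesis
  proof (intro subset_antisym subsetI)
    fix e assume "e \<in> glue D `` {(\<gamma>, p y, pe (ctriv D \<gamma> y))}"
    then have "((\<gamma>, p y, pe (ctriv D \<gamma> y)), e) \<in> glue D" by (simp only: Image_singleton_iff)
    then obtain \<gamma>' where "e = (\<gamma>', p y, right_action G (calg D) (pe (ctriv D \<gamma> y)) (cocyc D \<gamma> \<gamma>' (p y)))" "p y \<in> cov D \<gamma>'"
      unfolding glue_def by blast
    then show "e \<in> {(\<gamma>', p y, pe (ctriv D \<gamma>' y)) | \<gamma>'. p y \<in> cov D \<gamma>'}" using R by blast
  next
    fix e assume "e \<in> {(\<gamma>', p y, pe (ctriv D \<gamma>' y)) | \<gamma>'. p y \<in> cov D \<gamma>'}"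
    then obtain \<gamma>' where \<gamma>': "e = (\<gamma>', p y, pe (ctriv D \<gamma>' y))" "p y \<in> cov D \<gamma>'"
      unfolding mem_Collect_eq by (elim exE conjE) (rule that)
    have "((\<gamma>, p y, pe (ctriv D \<gamma> y)), e)
        = ((\<gamma>, p y, pe (ctriv D \<gamma> y)), \<gamma>', p y, right_action G (calg D) (pe (ctriv D \<gamma> y)) (cocyc D \<gamma> \<gamma>' (p y)))"
      by (simp only: \<gamma>'(1) R[OF \<gamma>'(2)])
    then have "((\<gamma>, p y, pe (ctriv D \<gamma> y)), e) \<in> glue D"
      unfolding glue_def mem_Collect_eq
      by (intro exI conjI) (assumption, rule IntI[OF \<gamma>'(2) assms], rule in_fibre)
    then show "e \<in> glue D `` {(\<gamma>, p y, pe (ctriv D \<gamma> y))}" by (simp only: Image_singleton_iff)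
  qed
qed

lemma iota_eq: "p y \<in> cov D \<gamma> \<Longrightarrow> iota D y = glue D `` {(\<gamma>, p y, pe (ctriv D \<gamma> y))}"
  unfolding iota_def Let_def by (rule trans[OF glue_pe[OF someI_ex[OF cov_UN]] glue_pe[symmetric]])

lemma iota_in: "iota D y \<in> topspace (caX D)"
  and pbar_iota: "pbar D (iota D y) = p y"
proof -
  obtain \<gamma> where \<gamma>: "p y \<in> cov D \<gamma>" using cov_UN by blast
  have \<omega>: "pe (ctriv D \<gamma> y) \<in> topspace (fibre D)" by (rule pe_in[OF triv_in_G[OF cov_triv \<gamma>]])
  show "iota D y \<in> topspace (caX D)"
    unfolding topspace_caX by (rule CollectI, intro exI conjI, rule iota_eq[OF \<gamma>], rule \<gamma>, rule \<omega>)
  show "pbar D (iota D y) = p y"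
    unfolding iota_eq[OF \<gamma>] by (rule pbar_glue[OF \<gamma> \<omega>])
qed

text \<open>On one sheet of a trivialization, \<open>iota\<close> is the map that keeps the fibre
  coordinate at \<open>pe g\<close>, followed by the quotient map.\<close>

lemma iota_open:
  assumes U: "openin (caX D) U"
  shows "open (iota D -` U)"
proof (subst open_subopen, intro ballI)
  fix y assume y: "y \<in> iota D -` U"
  obtain \<gamma> where \<gamma>: "p y \<in> cov D \<gamma>" using cov_UN by blast
  define g where "g = ctriv D \<gamma> y"
  have g: "g \<in> G" using triv_in_G[OF cov_triv \<gamma>] by (simp add: g_def)
  define E where "E = {e \<in> topspace (local_pieces D). glue D `` {e} \<in> U}"
  have "openin (local_pieces D) E"
    using U unfolding caX_def openin_quotient_topology E_def by (rule conjunct2)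
  then have E: "openin (prod_topology (top_of_set (cov D \<gamma>)) (fibre D)) {x. (\<gamma>, x) \<in> E}"
    unfolding local_pieces_def openin_sum_topology by simp
  have c: "continuous_map (top_of_set (cov D \<gamma>)) (prod_topology (top_of_set (cov D \<gamma>)) (fibre D)) (\<lambda>x. (x, pe g))"
    using pe_in[OF g] by (simp add: continuous_map_pairedI)
  define B where "B = {x \<in> topspace (top_of_set (cov D \<gamma>)). (x, pe g) \<in> {x. (\<gamma>, x) \<in> E}}"
  have "openin (top_of_set (cov D \<gamma>)) B"
    unfolding B_def by (rule openin_continuous_map_preimage[OF c E])
  then have B: "open B" using cov_open by (simp add: openin_open_eq)
  have BE: "x \<in> B \<longleftrightarrow> x \<in> cov D \<gamma> \<and> glue D `` {(\<gamma>, x, pe g)} \<in> U" for x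
    using pe_in[OF g] by (auto simp: B_def E_def topspace_local_pieces)
  define S where "S = {y'. p y' \<in> B \<and> ctriv D \<gamma> y' = g}"
  have "open S" unfolding S_def by (rule sheet_open[OF cov_triv cov_open B]) (simp add: BE subset_iff)
  moreover have "y \<in> S"
    using y \<gamma> iota_eq[OF \<gamma>] by (simp add: S_def BE g_def)
  moreover have "S \<subseteq> iota D -` U"
  proof
    fix y' assume "y' \<in> S"
    then have "p y' \<in> cov D \<gamma>" "ctriv D \<gamma> y' = g" "glue D `` {(\<gamma>, p y', pe g)} \<in> U" by (simp_all add: S_def BE)
    then show "y' \<in> iota D -` U" using iota_eq by simp
  qed
  ultimately show "\<exists>T. open T \<and> y \<in> T \<and> T \<subseteq> iota D -` U" by (intro exI[of _ S] conjI)
qed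

lemma chartD:
  assumes "(V, \<phi>) \<in> catlas D"
  shows "open V" "openin (top_of_set (Cn n)) (\<phi> ` V)" "homeomorphism V (\<phi> ` V) \<phi> (inv_into V \<phi>)"
proof -
  have "\<forall>(V, \<phi>)\<in>catlas D. open V \<and> openin (top_of_set (Cn n)) (\<phi> ` V) \<and> homeomorphism V (\<phi> ` V) \<phi> (inv_into V \<phi>)"
    using atlas unfolding complex_atlas_def by (elim conjE)
  from bspec[OF this assms]
  show "open V" "openin (top_of_set (Cn n)) (\<phi> ` V)" "homeomorphism V (\<phi> ` V) \<phi> (inv_into V \<phi>)" by simp_all
qed

lemma chart_image_open:
  assumes "(V, \<phi>) \<in> catlas D" "open U" "U \<subseteq> V"
  shows "openin (top_of_set (Cn n)) (\<phi> ` U)"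
proof -
  have "openin (top_of_set V) U" using assms(2,3) by (metis inf.absorb_iff2 openin_open)
  then have "openin (top_of_set (\<phi> ` V)) (\<phi> ` U)"
    by (rule homeomorphism_imp_open_map[OF chartD(3)[OF assms(1)]])
  then show ?thesis using chartD(2)[OF assms(1)] by (rule openin_trans)
qed

lemma transition:
  assumes "(V, \<phi>) \<in> catlas D" "(W, \<theta>) \<in> catlas D" "i < n"
  shows "holo_Cn n (\<phi> ` (V \<inter> W)) (\<lambda>z. \<theta> (inv_into V \<phi> z) i)"
proof -
  have "\<forall>(V, \<phi>)\<in>catlas D. \<forall>(W, \<theta>)\<in>catlas D. \<forall>i<n. holo_Cn n (\<phi> ` (V \<inter> W)) (\<lambda>z. \<theta> (inv_into V \<phi> z) i)"
    using atlas unfolding complex_atlas_def by (elim conjE)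
  from bspec[OF this assms(1)]
  have "\<forall>(W, \<theta>)\<in>catlas D. \<forall>i<n. holo_Cn n (\<phi> ` (V \<inter> W)) (\<lambda>z. \<theta> (inv_into V \<phi> z) i)" by (simp only: split_conv)
  from bspec[OF this assms(2)] show ?thesis using assms(3) by (simp only: split_conv)
qed

lemma lift_chart:
  assumes "(V, \<theta>) \<in> L"
  obtains B \<phi> where "(B, \<phi>) \<in> catlas D" "open V" "inj_on p V" "p ` V \<subseteq> B" "\<theta> = \<phi> \<circ> p" "inj_on \<theta> V"
proof -
  obtain B \<phi> where *: "(B, \<phi>) \<in> catlas D" "open V" "inj_on p V" "p ` V \<subseteq> B" "\<theta> = \<phi> \<circ> p"
    using assms by (auto simp: lift_atlas_def)
  have "inj_on \<phi> B" using chartD(3)[OF *(1)] by (metis homeomorphism_def inj_on_inverseI)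
  then have "inj_on \<theta> V" using * by (metis comp_inj_on inj_on_subset)
  then show thesis using * that by blast
qed

text \<open>Over each member of the cover \<open>p\<close> is a product projection.\<close>

lemma p_open_map:
  assumes "open O'"
  shows "open (p ` O')"
proof -
  have "open (p ` (O' \<inter> p -` cov D \<gamma>))" for \<gamma>
  proof -
    have "open_map (top_of_set (p -` cov D \<gamma>)) (prod_topology (top_of_set (cov D \<gamma>)) (discrete_topology (deck p))) (\<lambda>x. (p x, ctriv D \<gamma> x))"
      by (rule homeomorphic_imp_open_map[OF conjunct1[OF cov_triv[unfolded principal_triv_def]]])
    from open_map_compose[OF this open_map_fst]
    have "open_map (top_of_set (p -` cov D \<gamma>)) (top_of_set (cov D \<gamma>)) p" by (simp add: o_def)
    moreover have "openin (top_of_set (p -` cov D \<gamma>)) (O' \<inter> p -` cov D \<gamma>)"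
      using openin_open_Int[OF assms, of "p -` cov D \<gamma>"] by (simp only: Int_commute)
    ultimately have "openin (top_of_set (cov D \<gamma>)) (p ` (O' \<inter> p -` cov D \<gamma>))" by (simp only: open_map_def)
    then show ?thesis using cov_open by (simp add: openin_open_eq)
  qed
  then have "open (\<Union>\<gamma>. p ` (O' \<inter> p -` cov D \<gamma>))" by (intro open_UN ballI)
  moreover have "(\<Union>\<gamma>. p ` (O' \<inter> p -` cov D \<gamma>)) = p ` O'"
  proof (intro subset_antisym subsetI)
    fix z assume "z \<in> p ` O'"
    then obtain y where y: "z = p y" "y \<in> O'" by (rule imageE)
    obtain \<gamma> where "p y \<in> cov D \<gamma>" using cov_UN by (rule exE)
    with y show "z \<in> (\<Union>\<gamma>. p ` (O' \<inter> p -` cov D \<gamma>))" by (intro UN_I[of \<gamma>] image_eqI[of _ _ y]) simp_all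
  qed auto
  ultimately show ?thesis by (simp only:)
qed

lemma lift_chart_open:
  assumes "(V, \<theta>) \<in> L" "open W"
  shows "openin (top_of_set (Cn n)) (\<theta> ` (V \<inter> W))"
proof -
  obtain B \<phi> where *: "(B, \<phi>) \<in> catlas D" "open V" "p ` V \<subseteq> B" "\<theta> = \<phi> \<circ> p"
    using lift_chart[OF assms(1)] by blast
  have "open (p ` (V \<inter> W))"
    using *(2) assms(2) by (intro p_open_map open_Int)
  then have "openin (top_of_set (Cn n)) (\<phi> ` (p ` (V \<inter> W)))"
    using *(3) by (intro chart_image_open[OF *(1)]) auto
  then show ?thesis by (simp add: *(4) image_comp)
qed

text \<open>With the one-point parameter set, holomorphy on the manifold inherits its closure
  properties from \<open>PH\<close>.\<close>

lemma mfd_holo_iff: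
  "mfd_holo n L W f \<longleftrightarrow> open W \<and> (\<forall>(V, \<theta>)\<in>L. PH n (\<theta> ` (V \<inter> W) \<times> {0::real}) (\<lambda>x. f (inv_into V \<theta> (fst x))))"
proof -
  have "holo_Cn n (\<theta> ` (V \<inter> W)) (\<lambda>z. f (inv_into V \<theta> z)) \<longleftrightarrow> PH n (\<theta> ` (V \<inter> W) \<times> {0::real}) (\<lambda>x. f (inv_into V \<theta> (fst x)))"
    if "(V, \<theta>) \<in> L" "open W" for V \<theta>
    using holo_Cn_imp_PH[of n _ "\<lambda>z. f (inv_into V \<theta> z)"] PH_imp_holo_Cn[OF lift_chart_open[OF that], of "\<lambda>z. f (inv_into V \<theta> z)"]
    by (rule iffI)
  then show ?thesis unfolding mfd_holo_def by (intro conj_cong ball_cong refl) (simp add: split_beta)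
qed

lemma mfd_holo_open: "mfd_holo n L W f \<Longrightarrow> open W"
  unfolding mfd_holo_def by (rule conjunct1)

lemma mfd_holoD:
  assumes "mfd_holo n L W f" "(V, \<theta>) \<in> L"
  shows "PH n (\<theta> ` (V \<inter> W) \<times> {0::real}) (\<lambda>x. f (inv_into V \<theta> (fst x)))"
  using bspec[OF assms(1)[unfolded mfd_holo_iff, THEN conjunct2] assms(2)] by (simp only: split_conv)

lemma mfd_holoI:
  assumes "open W" "\<And>V \<theta>. (V, \<theta>) \<in> L \<Longrightarrow> PH n (\<theta> ` (V \<inter> W) \<times> {0::real}) (\<lambda>x. f (inv_into V \<theta> (fst x)))"
  shows "mfd_holo n L W f"
  unfolding mfd_holo_iff
proof (intro conjI assms(1) ballI)
  fix c assume c: "c \<in> L"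
  obtain V \<theta> where "c = (V, \<theta>)" by (cases c)
  then show "case c of (V, \<theta>) \<Rightarrow> PH n (\<theta> ` (V \<inter> W) \<times> {0::real}) (\<lambda>x. f (inv_into V \<theta> (fst x)))"
    using assms(2)[of V \<theta>] c by (simp only: split_conv)
qed

lemma mfd_holo_const: "open W \<Longrightarrow> mfd_holo n L W (\<lambda>_. c)"
  by (rule mfd_holoI) (assumption, rule PH_const)

lemma mfd_holo_add: "mfd_holo n L W f \<Longrightarrow> mfd_holo n L W g \<Longrightarrow> mfd_holo n L W (\<lambda>x. f x + g x)"
  by (rule mfd_holoI[OF mfd_holo_open PH_add[OF mfd_holoD mfd_holoD]])

lemma mfd_holo_mult: "mfd_holo n L W f \<Longrightarrow> mfd_holo n L W g \<Longrightarrow> mfd_holo n L W (\<lambda>x. f x * g x)"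
  by (rule mfd_holoI[OF mfd_holo_open PH_mult[OF mfd_holoD mfd_holoD]])

lemma mfd_holo_subset:
  assumes "mfd_holo n L W f" "open W'" "W' \<subseteq> W"
  shows "mfd_holo n L W' f"
proof (rule mfd_holoI[OF assms(2)])
  fix V \<theta> assume "(V, \<theta>) \<in> L"
  then show "PH n (\<theta> ` (V \<inter> W') \<times> {0::real}) (\<lambda>x. f (inv_into V \<theta> (fst x)))"
    by (rule PH_subset[OF mfd_holoD[OF assms(1)]]) (use assms(3) in auto)
qed

lemma mfd_holo_cong:
  assumes f: "mfd_holo n L W f" and eq: "\<And>x. x \<in> W \<Longrightarrow> f x = g x"
  shows "mfd_holo n L W g"
proof (rule mfd_holoI)
  show W: "open W" using f by (rule mfd_holo_open)
  fix V \<theta> assume VL: "(V, \<theta>) \<in> L"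
  have "inj_on \<theta> V" using lift_chart[OF VL] by blast
  then have "inv_into V \<theta> z \<in> W" if "z \<in> \<theta> ` (V \<inter> W)" for z using that by auto
  then have eq': "f (inv_into V \<theta> (fst x)) = g (inv_into V \<theta> (fst x))" if "x \<in> \<theta> ` (V \<inter> W) \<times> {0::real}" for x
    using that eq by auto
  have PHf: "PH n (\<theta> ` (V \<inter> W) \<times> {0::real}) (\<lambda>x. f (inv_into V \<theta> (fst x)))"
    by (rule mfd_holoD[OF f VL])
  have "rel_open n {0::real} (\<theta> ` (V \<inter> W) \<times> {0})"
    by (rule openin_Times[OF lift_chart_open[OF VL W]]) simp
  from PH_cong[OF PHf this eq'] show "PH n (\<theta> ` (V \<inter> W) \<times> {0::real}) (\<lambda>x. g (inv_into V \<theta> (fst x)))" .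
qed

lemma continuous_map_restrictI:
  assumes "continuous_map (subtopology X U) Y f"
  shows "continuous_map (subtopology X U) Y (\<lambda>x\<in>U. f x)"
  by (rule continuous_map_eq[OF assms]) simp

lemma continuous_map_complex_mult:
  fixes f g :: "'x \<Rightarrow> complex"
  assumes "continuous_map X euclidean f" "continuous_map X euclidean g"
  shows "continuous_map X euclidean (\<lambda>x. f x * g x)"
proof -
  have "continuous_map X (euclidean :: (complex \<times> complex) topology) (\<lambda>x. (f x, g x))"
    using assms by (simp add: continuous_map_pairedI flip: prod_topology_euclidean)
  moreover have "continuous_map euclidean euclidean (\<lambda>z::complex \<times> complex. fst z * snd z)"
    by (simp add: continuous_intros)
  ultimately have "continuous_map X euclidean ((\<lambda>z. fst z * snd z) \<circ> (\<lambda>x. (f x, g x)))"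
    by (rule continuous_map_compose)
  then show ?thesis by (simp add: o_def)
qed

lemma holo_caX_I:
  assumes "continuous_map (subtopology (caX D) U) euclidean f" "mfd_holo n L (iota D -` U) (\<lambda>x. f (iota D x))"
  shows "(\<lambda>x\<in>U. f x) \<in> holo_caX D U"
  unfolding holo_caX_def
proof (intro CollectI conjI restrict_extensional continuous_map_restrictI[OF assms(1)])
  show "mfd_holo n L (iota D -` U) (\<lambda>x. (\<lambda>x\<in>U. f x) (iota D x))"
    by (rule mfd_holo_cong[OF assms(2)]) simp
qed

lemma holo_caX_D:
  assumes "f \<in> holo_caX D U"
  shows "f \<in> extensional U" "continuous_map (subtopology (caX D) U) euclidean f"
    "mfd_holo n L (iota D -` U) (\<lambda>x. f (iota D x))"
  using assms unfolding holo_caX_def by simp_all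

lemma function_subringI:
  assumes "F \<subseteq> extensional U" "\<And>c. (\<lambda>x\<in>U. c) \<in> F"
    "\<And>f g. f \<in> F \<Longrightarrow> g \<in> F \<Longrightarrow> (\<lambda>x\<in>U. f x + g x) \<in> F" "\<And>f g. f \<in> F \<Longrightarrow> g \<in> F \<Longrightarrow> (\<lambda>x\<in>U. f x * g x) \<in> F"
  shows "function_subring U F"
  unfolding function_subring_def by (intro conjI allI ballI assms)

lemma sheaf_caX: "function_sheaf (caX D) (holo_caX D)"
proof
  fix U assume U: "openin (caX D) U"
  show "function_subring U (holo_caX D U)"
  proof (rule function_subringI)
    show "holo_caX D U \<subseteq> extensional U" using holo_caX_D(1) by blast
    show "(\<lambda>x\<in>U. c) \<in> holo_caX D U" for c
      by (rule holo_caX_I) (simp, rule mfd_holo_const[OF iota_open[OF U]])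
    fix f g assume fg: "f \<in> holo_caX D U" "g \<in> holo_caX D U"
    note c = holo_caX_D(2)[OF fg(1)] holo_caX_D(2)[OF fg(2)]
    note m = holo_caX_D(3)[OF fg(1)] holo_caX_D(3)[OF fg(2)]
    show "(\<lambda>x\<in>U. f x + g x) \<in> holo_caX D U"
      by (rule holo_caX_I[OF continuous_map_add[OF c] mfd_holo_add[OF m]])
    show "(\<lambda>x\<in>U. f x * g x) \<in> holo_caX D U"
      by (rule holo_caX_I[OF continuous_map_complex_mult[OF c] mfd_holo_mult[OF m]])
  qed
next
  fix U W f assume UW: "openin (caX D) U" "openin (caX D) W" "W \<subseteq> U" and f: "f \<in> holo_caX D U"
  have "iota D -` W \<subseteq> iota D -` U" using UW(3) by blast
  from mfd_holo_subset[OF holo_caX_D(3)[OF f] iota_open[OF UW(2)] this]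
  show "restrict f W \<in> holo_caX D W"
    by (rule holo_caX_I[OF continuous_map_from_subtopology_mono[OF holo_caX_D(2)[OF f] UW(3)]])
qed

lemma iota_open_sub:
  assumes "openin (subtopology (caX D) Y) W"
  shows "openin (top_of_set (iota D -` Y)) (iota D -` W)"
proof -
  obtain U where U: "openin (caX D) U" "W = U \<inter> Y"
    using assms[unfolded openin_subtopology] by (elim exE conjE) (rule that)
  have "openin (top_of_set (iota D -` Y)) (iota D -` Y \<inter> iota D -` U)"
    by (rule openin_open_Int[OF iota_open[OF U(1)]])
  then show ?thesis by (simp only: U(2) vimage_Int Int_commute)
qed

lemma holo_submfd_I:
  assumes W: "openin (subtopology (caX D) Y) W"
    and c: "continuous_map (subtopology (caX D) W) euclidean f"
    and loc: "\<And>x. iota D x \<in> W \<Longrightarrow> \<exists>V F. x \<in> V \<and> mfd_holo n L V F \<and> (\<forall>y\<in>V \<inter> iota D -` W. F y = f (iota D y))"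
  shows "(\<lambda>x\<in>W. f x) \<in> holo_submfd D Y W"
  unfolding holo_submfd_def submfd_holo_def
proof (intro CollectI conjI ballI restrict_extensional continuous_map_restrictI[OF c] iota_open_sub[OF W])
  fix x assume "x \<in> iota D -` W"
  then obtain V F where "x \<in> V" "mfd_holo n L V F" "\<forall>y\<in>V \<inter> iota D -` W. F y = f (iota D y)"
    using loc[of x] by blast
  then show "\<exists>V F. x \<in> V \<and> mfd_holo n L V F \<and> (\<forall>y\<in>V \<inter> iota D -` W. F y = (\<lambda>x\<in>W. f x) (iota D y))"
    by (intro exI[of _ V] exI[of _ F]) simp
qed

lemma holo_submfd_D:
  assumes "f \<in> holo_submfd D Y W"
  shows "f \<in> extensional W" "continuous_map (subtopology (caX D) W) euclidean f"
    "\<And>x. iota D x \<in> W \<Longrightarrow> \<exists>V F. x \<in> V \<and> mfd_holo n L V F \<and> (\<forall>y\<in>V \<inter> iota D -` W. F y = f (iota D y))"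
proof -
  note * = assms[unfolded holo_submfd_def submfd_holo_def mem_Collect_eq]
  show "f \<in> extensional W" using * by (rule conjunct1)
  show "continuous_map (subtopology (caX D) W) euclidean f" using *[THEN conjunct2] by (rule conjunct1)
  fix x assume "iota D x \<in> W"
  then have "x \<in> iota D -` W" by simp
  then show "\<exists>V F. x \<in> V \<and> mfd_holo n L V F \<and> (\<forall>y\<in>V \<inter> iota D -` W. F y = f (iota D y))"
    by (rule bspec[OF *[THEN conjunct2, THEN conjunct2, THEN conjunct2]])
qed

lemma sheaf_submfd: "function_sheaf (subtopology (caX D) Y) (holo_submfd D Y)"
proof
  fix W assume W: "openin (subtopology (caX D) Y) W"
  show "function_subring W (holo_submfd D Y W)"
  proof (rule function_subringI)
    show "holo_submfd D Y W \<subseteq> extensional W" using holo_submfd_D(1) by blast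
    show "(\<lambda>x\<in>W. c) \<in> holo_submfd D Y W" for c
    proof (rule holo_submfd_I[OF W])
      fix x
      show "\<exists>V F. x \<in> V \<and> mfd_holo n L V F \<and> (\<forall>y\<in>V \<inter> iota D -` W. F y = c)"
        by (intro exI[of _ UNIV] exI[of _ "\<lambda>_. c"]) (simp add: mfd_holo_const)
    qed simp
    fix f g assume fg: "f \<in> holo_submfd D Y W" "g \<in> holo_submfd D Y W"
    note c = holo_submfd_D(2)[OF fg(1)] holo_submfd_D(2)[OF fg(2)]
    have loc: "\<exists>V F F'. x \<in> V \<and> mfd_holo n L V F \<and> mfd_holo n L V F' \<and>
        (\<forall>y\<in>V \<inter> iota D -` W. F y = f (iota D y) \<and> F' y = g (iota D y))" if x: "iota D x \<in> W" for x
    proof -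
      obtain V F where V: "x \<in> V" "mfd_holo n L V F" "\<forall>y\<in>V \<inter> iota D -` W. F y = f (iota D y)"
        using holo_submfd_D(3)[OF fg(1) x] by (elim exE conjE) (rule that)
      obtain V' F' where V': "x \<in> V'" "mfd_holo n L V' F'" "\<forall>y\<in>V' \<inter> iota D -` W. F' y = g (iota D y)"
        using holo_submfd_D(3)[OF fg(2) x] by (elim exE conjE) (rule that)
      have o: "open (V \<inter> V')" by (intro open_Int mfd_holo_open[OF V(2)] mfd_holo_open[OF V'(2)])
      have "mfd_holo n L (V \<inter> V') F" "mfd_holo n L (V \<inter> V') F'"
        by (rule mfd_holo_subset[OF V(2) o Int_lower1], rule mfd_holo_subset[OF V'(2) o Int_lower2])
      then show ?thesis using V V' by (intro exI[of _ "V \<inter> V'"] exI[of _ F] exI[of _ F']) simp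
    qed
    show "(\<lambda>x\<in>W. f x + g x) \<in> holo_submfd D Y W"
    proof (rule holo_submfd_I[OF W continuous_map_add[OF c]])
      fix x assume "iota D x \<in> W"
      from loc[OF this] obtain V F F' where V: "x \<in> V" "mfd_holo n L V F" "mfd_holo n L V F'"
        "\<forall>y\<in>V \<inter> iota D -` W. F y = f (iota D y) \<and> F' y = g (iota D y)" by (elim exE conjE) (rule that)
      then show "\<exists>V F. x \<in> V \<and> mfd_holo n L V F \<and> (\<forall>y\<in>V \<inter> iota D -` W. F y = f (iota D y) + g (iota D y))"
        using mfd_holo_add[OF V(2,3)] by (intro exI[of _ V] exI[of _ "\<lambda>x. F x + F' x"]) simp
    qed
    show "(\<lambda>x\<in>W. f x * g x) \<in> holo_submfd D Y W"
    proof (rule holo_submfd_I[OF W continuous_map_complex_mult[OF c]])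
      fix x assume "iota D x \<in> W"
      from loc[OF this] obtain V F F' where V: "x \<in> V" "mfd_holo n L V F" "mfd_holo n L V F'"
        "\<forall>y\<in>V \<inter> iota D -` W. F y = f (iota D y) \<and> F' y = g (iota D y)" by (elim exE conjE) (rule that)
      then show "\<exists>V F. x \<in> V \<and> mfd_holo n L V F \<and> (\<forall>y\<in>V \<inter> iota D -` W. F y = f (iota D y) * g (iota D y))"
        using mfd_holo_mult[OF V(2,3)] by (intro exI[of _ V] exI[of _ "\<lambda>x. F x * F' x"]) simp
    qed
  qed
next
  fix U W f assume UW: "openin (subtopology (caX D) Y) U" "openin (subtopology (caX D) Y) W" "W \<subseteq> U" and f: "f \<in> holo_submfd D Y U"
  show "restrict f W \<in> holo_submfd D Y W"
  proof (rule holo_submfd_I[OF UW(2) continuous_map_from_subtopology_mono[OF holo_submfd_D(2)[OF f] UW(3)]])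
    fix x assume "iota D x \<in> W"
    then have "iota D x \<in> U" using UW(3) by blast
    from holo_submfd_D(3)[OF f this] obtain V F where "x \<in> V" "mfd_holo n L V F" "\<forall>y\<in>V \<inter> iota D -` U. F y = f (iota D y)"
      by (elim exE conjE) (rule that)
    then show "\<exists>V F. x \<in> V \<and> mfd_holo n L V F \<and> (\<forall>y\<in>V \<inter> iota D -` W. F y = f (iota D y))"
      using UW(3) by (intro exI[of _ V] exI[of _ F]) blast
  qed
qed

lemma restrict_submfd:
  assumes U: "openin (caX D) U" and f: "f \<in> holo_caX D U"
  shows "restrict f (U \<inter> Y) \<in> holo_submfd D Y (U \<inter> Y)"
proof (rule holo_submfd_I[OF _ continuous_map_from_subtopology_mono[OF holo_caX_D(2)[OF f] Int_lower1]])
  show "openin (subtopology (caX D) Y) (U \<inter> Y)" unfolding openin_subtopology using U by blast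
  fix x assume "iota D x \<in> U \<inter> Y"
  then show "\<exists>V F. x \<in> V \<and> mfd_holo n L V F \<and> (\<forall>y\<in>V \<inter> iota D -` (U \<inter> Y). F y = f (iota D y))"
    using holo_caX_D(3)[OF f] by (intro exI[of _ "iota D -` U"] exI[of _ "\<lambda>x. f (iota D x)"]) simp
qed

end

section \<open>Charts of the compactification\<close>

lemma openin_subtopology_Int_iff:
  assumes "openin T V" "W \<subseteq> V \<inter> Y"
  shows "openin (subtopology T (V \<inter> Y)) W \<longleftrightarrow> openin (subtopology T Y) W"
proof
  assume "openin (subtopology T (V \<inter> Y)) W"
  then obtain U where U: "openin T U" "W = U \<inter> (V \<inter> Y)" unfolding openin_subtopology by (elim exE conjE) (rule that)
  show "openin (subtopology T Y) W"
    unfolding openin_subtopology using openin_Int[OF U(1) assms(1)] by (intro exI[of _ "U \<inter> V"] conjI) (auto simp: U(2))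
next
  assume "openin (subtopology T Y) W"
  then obtain U where U: "openin T U" "W = U \<inter> Y" unfolding openin_subtopology by (elim exE conjE) (rule that)
  have "W = U \<inter> (V \<inter> Y)" using assms(2) U(2) by blast
  then show "openin (subtopology T (V \<inter> Y)) W"
    unfolding openin_subtopology using U(1) by (intro exI[of _ U] conjI)
qed

lemma field_differentiable_cong_open:
  assumes "f field_differentiable at a" "open S" "a \<in> S" "\<And>x. x \<in> S \<Longrightarrow> f x = g x"
  shows "g field_differentiable at a"
proof -
  obtain f' where "(f has_field_derivative f') (at a)" using assms(1) unfolding field_differentiable_def by (rule exE)
  from has_field_derivative_transform_within_open[OF this assms(2,3,4)] show ?thesis
    unfolding field_differentiable_def by (rule exI)
qed

text \<open>A chart as in the definition of a submanifold, together with a chart of the base. On the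
  part \<open>Pi1\<close> of \<open>Pi0\<close> above \<open>Vc\<close>, the map \<open>chi\<close>
  has the base coordinates and the fibre coordinate as its two components.\<close>

locale fc_chart = fc D for D :: "('a::topological_space, 'b::{t2_space, second_countable_topology}, 'i) fc_data" +
  fixes U0 :: "'b set" and \<Psi> :: "('a, 'b, 'i) cpoint \<Rightarrow> 'b \<times> 'a character" and \<psi> :: "'a \<Rightarrow> 'a \<Rightarrow> 'a"
    and K :: "'a character set" and Vc :: "'b set" and \<phi> :: "'b \<Rightarrow> nat \<Rightarrow> complex"
  assumes U0: "open U0"
    and hom: "homeomorphic_map (subtopology (caX D) {P. pbar D P \<in> U0})
       (prod_topology (top_of_set U0) (fibre D)) \<Psi>"
    and fst_Psi: "P \<in> topspace (caX D) \<Longrightarrow> pbar D P \<in> U0 \<Longrightarrow> fst (\<Psi> P) = pbar D P"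
    and triv: "principal_triv p U0 \<psi>"
    and Psi_iota: "p x \<in> U0 \<Longrightarrow> \<Psi> (iota D x) = (p x, pe (\<psi> x))"
    and K: "openin (fibre D) K"
    and chart: "(Vc, \<phi>) \<in> catlas D"
begin

abbreviation "Pi0 \<equiv> Pi_hat D \<Psi> U0 K"
abbreviation "PF \<equiv> topspace (fibre D)"

definition "Pi1 = {P \<in> Pi0. pbar D P \<in> Vc}"
definition "Dom = \<phi> ` (U0 \<inter> Vc) \<times> K"
definition "chi P = (\<phi> (pbar D P), snd (\<Psi> P))"
definition "chi_inv y = inv_into Pi0 \<Psi> (inv_into Vc \<phi> (fst y), snd y)"

lemma K_sub: "K \<subseteq> PF" using K by (rule openin_subset)

lemma phi_inj: "inj_on \<phi> Vc"
  using chartD(3)[OF chart] by (metis homeomorphism_def inj_on_inverseI)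

lemma phi_inv: "z \<in> Vc \<Longrightarrow> inv_into Vc \<phi> (\<phi> z) = z"
  by (rule inv_into_f_f[OF phi_inj])

lemma Psi_inj: "inj_on \<Psi> {P \<in> topspace (caX D). pbar D P \<in> U0}"
  using homeomorphic_imp_injective_map[OF hom] by (simp only: topspace_subtopology Int_def mem_Collect_eq)

lemma Psi_image: "\<Psi> ` {P \<in> topspace (caX D). pbar D P \<in> U0} = U0 \<times> PF"
proof -
  have "topspace (subtopology (caX D) {P. pbar D P \<in> U0}) = {P \<in> topspace (caX D). pbar D P \<in> U0}" by auto
  moreover have "topspace (prod_topology (top_of_set U0) (fibre D)) = U0 \<times> PF" by simp
  ultimately show ?thesis using homeomorphic_imp_surjective_map[OF hom] by (simp only:)
qed

lemma Pi0D:
  assumes "P \<in> Pi0"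
  shows "P \<in> topspace (caX D)" "pbar D P \<in> U0" "snd (\<Psi> P) \<in> K" "\<Psi> P = (pbar D P, snd (\<Psi> P))"
proof -
  show 1: "P \<in> topspace (caX D)" "pbar D P \<in> U0" "snd (\<Psi> P) \<in> K" using assms by (auto simp: Pi_hat_def)
  show "\<Psi> P = (pbar D P, snd (\<Psi> P))" using fst_Psi[OF 1(1,2)] by (simp add: prod_eq_iff)
qed

lemma inv_Psi:
  assumes "z \<in> U0" "\<omega> \<in> K"
  shows "inv_into Pi0 \<Psi> (z, \<omega>) \<in> Pi0" "\<Psi> (inv_into Pi0 \<Psi> (z, \<omega>)) = (z, \<omega>)" "pbar D (inv_into Pi0 \<Psi> (z, \<omega>)) = z"
proof -
  have "(z, \<omega>) \<in> U0 \<times> PF" using assms K_sub by blast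
  then obtain P where P: "(z, \<omega>) = \<Psi> P" "P \<in> {P \<in> topspace (caX D). pbar D P \<in> U0}"
    unfolding Psi_image[symmetric] by (rule imageE)
  have "P \<in> Pi0" using P(2) assms by (simp add: Pi_hat_def P(1)[symmetric])
  then have *: "(z, \<omega>) \<in> \<Psi> ` Pi0" unfolding P(1) by (rule imageI)
  show in0: "inv_into Pi0 \<Psi> (z, \<omega>) \<in> Pi0" by (rule inv_into_into[OF *])
  show val: "\<Psi> (inv_into Pi0 \<Psi> (z, \<omega>)) = (z, \<omega>)" by (rule f_inv_into_f[OF *])
  show "pbar D (inv_into Pi0 \<Psi> (z, \<omega>)) = z" using Pi0D(4)[OF in0] unfolding val by (simp only: prod.inject)
qed

lemma inv_Psi_Psi: "P \<in> Pi0 \<Longrightarrow> inv_into Pi0 \<Psi> (\<Psi> P) = P"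
  by (rule inv_into_f_f[OF inj_on_subset[OF Psi_inj]]) (auto simp: Pi_hat_def)

lemma Pi1D: "P \<in> Pi1 \<Longrightarrow> P \<in> Pi0" "P \<in> Pi1 \<Longrightarrow> pbar D P \<in> Vc"
  by (simp_all add: Pi1_def)

lemma chi_in: "P \<in> Pi1 \<Longrightarrow> chi P \<in> Dom"
  unfolding chi_def Dom_def using Pi0D(2,3)[OF Pi1D(1)] Pi1D(2) by (intro SigmaI imageI IntI)

lemma chi_inv_props:
  assumes "y \<in> Dom"
  shows "chi_inv y \<in> Pi1" "chi (chi_inv y) = y"
proof -
  obtain z \<omega> where y: "y = (\<phi> z, \<omega>)" "z \<in> U0" "z \<in> Vc" "\<omega> \<in> K" using assms by (auto simp: Dom_def)
  have eq: "chi_inv y = inv_into Pi0 \<Psi> (z, \<omega>)" by (simp add: chi_inv_def y(1) phi_inv[OF y(3)])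
  show "chi_inv y \<in> Pi1" using inv_Psi[OF y(2,4)] y(3) by (simp add: eq Pi1_def)
  show "chi (chi_inv y) = y" unfolding eq using inv_Psi[OF y(2,4)] by (simp add: chi_def y(1))
qed

lemma chi_inv_chi: "P \<in> Pi1 \<Longrightarrow> chi_inv (chi P) = P"
  using inv_Psi_Psi[OF Pi1D(1), of P] Pi0D(4)[OF Pi1D(1), of P] phi_inv[OF Pi1D(2), of P] by (simp add: chi_inv_def chi_def)

lemma Pi0_open: "openin (caX D) Pi0"
proof -
  have K': "openin (prod_topology (top_of_set U0) (fibre D)) (U0 \<times> K)"
    using K by (simp add: openin_prod_Times_iff)
  have o: "openin (caX D) {P \<in> topspace (caX D). pbar D P \<in> U0}" by (rule openin_pbar[OF U0])
  have sub: "subtopology (caX D) {P. pbar D P \<in> U0} = subtopology (caX D) {P \<in> topspace (caX D). pbar D P \<in> U0}"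
    using subtopology_restrict[of "caX D" "{P. pbar D P \<in> U0}"] by (simp only: Int_def mem_Collect_eq)
  have "openin (subtopology (caX D) {P. pbar D P \<in> U0}) {P \<in> topspace (subtopology (caX D) {P. pbar D P \<in> U0}). \<Psi> P \<in> U0 \<times> K}"
    by (rule openin_continuous_map_preimage[OF homeomorphic_imp_continuous_map[OF hom] K'])
  moreover have "{P \<in> topspace (subtopology (caX D) {P. pbar D P \<in> U0}). \<Psi> P \<in> U0 \<times> K} = Pi0"
    by (auto simp: Pi_hat_def)
  ultimately show ?thesis using openin_trans_full[OF _ o] unfolding sub by (simp only:)
qed

lemma Pi1_open: "openin (caX D) Pi1"
proof -
  have "Pi1 = Pi0 \<inter> {P \<in> topspace (caX D). pbar D P \<in> Vc}" by (auto simp: Pi1_def Pi_hat_def)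
  then show ?thesis using openin_Int[OF Pi0_open openin_pbar[OF chartD(1)[OF chart]]] by (simp only:)
qed

lemma Dom_open: "rel_open n PF Dom"
  unfolding Dom_def
proof (rule openin_Times)
  show "openin (top_of_set (Cn n)) (\<phi> ` (U0 \<inter> Vc))"
    by (rule chart_image_open[OF chart open_Int[OF U0 chartD(1)[OF chart]] Int_lower2])
  show "openin (top_of_set PF) K" using K Ghat_eq[of G "calg D"] by simp
qed

lemma continuous_fibre: "continuous_map X (fibre D) f \<Longrightarrow> continuous_map X euclidean f"
  by (subst (asm) Ghat_eq) (simp only: continuous_map_in_subtopology)

lemma chi_cont: "continuous_map (subtopology (caX D) Pi1) (top_of_set Dom) chi"
proof -
  have "Pi1 \<subseteq> {P. pbar D P \<in> U0}" using Pi0D(2)[OF Pi1D(1)] by blast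
  then have c: "continuous_map (subtopology (caX D) Pi1) (prod_topology (top_of_set U0) (fibre D)) \<Psi>"
    by (rule continuous_map_from_subtopology_mono[OF homeomorphic_imp_continuous_map[OF hom]])
  have "continuous_map (subtopology (caX D) Pi1) (top_of_set U0) (fst \<circ> \<Psi>)"
    by (rule continuous_map_compose[OF c continuous_map_fst])
  then have "continuous_map (subtopology (caX D) Pi1) euclidean (fst \<circ> \<Psi>)"
    by (simp only: continuous_map_in_subtopology)
  then have "continuous_map (subtopology (caX D) Pi1) euclidean (pbar D)"
  proof (rule continuous_map_eq)
    fix P assume "P \<in> topspace (subtopology (caX D) Pi1)"
    then have "P \<in> Pi1" by simp
    then show "(fst \<circ> \<Psi>) P = pbar D P" using fst_Psi[OF Pi0D(1,2)[OF Pi1D(1)]] by simp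
  qed
  then have "continuous_map (subtopology (caX D) Pi1) (top_of_set Vc) (pbar D)"
    using Pi1D(2) by (auto simp: continuous_map_in_subtopology)
  moreover have "continuous_map (top_of_set Vc) euclidean \<phi>"
    using chartD(3)[OF chart] by (simp add: homeomorphism_def)
  ultimately have 1: "continuous_map (subtopology (caX D) Pi1) euclidean (\<phi> \<circ> pbar D)" by (rule continuous_map_compose)
  have 2: "continuous_map (subtopology (caX D) Pi1) euclidean (snd \<circ> \<Psi>)"
    by (rule continuous_fibre[OF continuous_map_compose[OF c continuous_map_snd]])
  have "continuous_map (subtopology (caX D) Pi1) (prod_topology euclidean euclidean) (\<lambda>P. ((\<phi> \<circ> pbar D) P, (snd \<circ> \<Psi>) P))"
    using 1 2 by (intro continuous_map_pairedI)
  then have "continuous_map (subtopology (caX D) Pi1) euclidean chi"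
    unfolding chi_def[abs_def] by (simp add: prod_topology_euclidean)
  then show ?thesis using chi_in by (auto simp: continuous_map_in_subtopology)
qed

lemma chi_inv_cont: "continuous_map (top_of_set Dom) (subtopology (caX D) Pi1) chi_inv"
proof -
  let ?X = "subtopology (caX D) {P. pbar D P \<in> U0}" and ?Y = "prod_topology (top_of_set U0) (fibre D)"
  obtain g where "homeomorphic_maps ?X ?Y \<Psi> g" using hom unfolding homeomorphic_map_maps by (rule exE)
  then have g: "continuous_map ?Y ?X g" and g\<Psi>: "\<And>P. P \<in> topspace ?X \<Longrightarrow> g (\<Psi> P) = P"
    unfolding homeomorphic_maps_def by simp_all
  have domE: "\<exists>z \<omega>. y = (\<phi> z, \<omega>) \<and> z \<in> U0 \<and> z \<in> Vc \<and> \<omega> \<in> K" if "y \<in> Dom" for y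
    using that by (auto simp: Dom_def)
  have inU: "inv_into Vc \<phi> (fst y) \<in> U0" if "y \<in> Dom" for y
    using domE[OF that] phi_inv by auto
  have fD: "fst y \<in> \<phi> ` Vc" if "y \<in> Dom" for y using domE[OF that] by auto
  have "continuous_on (\<phi> ` Vc) (inv_into Vc \<phi>)" using chartD(3)[OF chart] by (simp add: homeomorphism_def)
  moreover have "continuous_on Dom fst" by (rule continuous_on_fst[OF continuous_on_id])
  ultimately have "continuous_on Dom (\<lambda>y. inv_into Vc \<phi> (fst y))"
    by (rule continuous_on_compose2) (use fD in blast)
  then have 1: "continuous_map (top_of_set Dom) (top_of_set U0) (\<lambda>y. inv_into Vc \<phi> (fst y))"
    using inU by (auto simp: continuous_map_in_subtopology)
  have "snd y \<in> PF" if "y \<in> Dom" for y using that K_sub by (auto simp: Dom_def)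
  then have 2: "continuous_map (top_of_set Dom) (fibre D) snd"
    by (subst Ghat_eq) (auto simp: continuous_map_in_subtopology continuous_on_snd)
  have "continuous_map (top_of_set Dom) ?Y (\<lambda>y. (inv_into Vc \<phi> (fst y), snd y))"
    by (rule continuous_map_pairedI[OF 1 2])
  from continuous_map_compose[OF this g]
  have "continuous_map (top_of_set Dom) (caX D) (g \<circ> (\<lambda>y. (inv_into Vc \<phi> (fst y), snd y)))"
    by (simp only: continuous_map_in_subtopology)
  then have "continuous_map (top_of_set Dom) (caX D) chi_inv"
  proof (rule continuous_map_eq)
    fix y assume "y \<in> topspace (top_of_set Dom)"
    then have y: "y \<in> Dom" by simp
    have P: "chi_inv y \<in> Pi0" by (rule Pi1D(1)[OF chi_inv_props(1)[OF y]])
    have "snd y \<in> K" using y by (auto simp: Dom_def)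
    then have "\<Psi> (chi_inv y) = (inv_into Vc \<phi> (fst y), snd y)"
      unfolding chi_inv_def by (rule inv_Psi(2)[OF inU[OF y]])
    moreover have "g (\<Psi> (chi_inv y)) = chi_inv y" by (rule g\<Psi>) (simp add: Pi0D(1,2)[OF P])
    ultimately show "(g \<circ> (\<lambda>y. (inv_into Vc \<phi> (fst y), snd y))) y = chi_inv y" by simp
  qed
  then show ?thesis using chi_inv_props(1) by (auto simp: continuous_map_in_subtopology)
qed

lemma chi_homeo: "homeomorphic_maps (subtopology (caX D) Pi1) (top_of_set Dom) chi chi_inv"
  unfolding homeomorphic_maps_def
  using chi_cont chi_inv_cont chi_inv_chi chi_inv_props(2) by (intro conjI ballI) simp_all

lemma openin_Pi1:
  assumes "openin (caX D) W" "W \<subseteq> Pi1"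
  shows "openin (subtopology (caX D) Pi1) W"
  unfolding openin_subtopology using assms by (intro exI[of _ W]) auto

lemma chi_image_open:
  assumes "openin (caX D) W" "W \<subseteq> Pi1"
  shows "rel_open n PF (chi ` W)"
proof -
  have "homeomorphic_map (subtopology (caX D) Pi1) (top_of_set Dom) chi"
    unfolding homeomorphic_map_maps by (rule exI[where x = chi_inv], rule chi_homeo)
  then have "openin (top_of_set Dom) (chi ` W)"
    using homeomorphic_imp_open_map openin_Pi1[OF assms] unfolding open_map_def by blast
  then show ?thesis using Dom_open by (rule openin_trans)
qed

definition "sheet g = {x. p x \<in> U0 \<inter> Vc \<and> \<psi> x = g}"

lemma sheet_inj: "inj_on p (sheet g)"
  using triv_inj[OF triv] by (auto simp: sheet_def intro!: inj_onI)

text \<open>A sheet is the domain of a chart of the total space with the coordinates of the base, so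
  \<open>mfd_holo\<close> can be read on the slice \<open>pe g\<close> in the coordinates of
  \<open>chi\<close>.\<close>

lemma sheet_lift: "(sheet g, \<phi> \<circ> p) \<in> L"
  unfolding lift_atlas_def mem_Collect_eq
proof (intro exI conjI)
  show "open (sheet g)"
    unfolding sheet_def by (rule sheet_open[OF triv U0 open_Int[OF U0 chartD(1)[OF chart]] Int_lower1])
  show "p ` sheet g \<subseteq> Vc" by (auto simp: sheet_def)
qed (rule refl, rule chart, rule sheet_inj)

lemma iota_chi:
  assumes "iota D x \<in> Pi1"
  shows "p x \<in> U0" "p x \<in> Vc" "\<psi> x \<in> G" "chi (iota D x) = (\<phi> (p x), pe (\<psi> x))"
proof -
  show 1: "p x \<in> U0" "p x \<in> Vc"
    using Pi0D(2)[OF Pi1D(1)[OF assms]] Pi1D(2)[OF assms] by (simp_all add: pbar_iota)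
  show "\<psi> x \<in> G" by (rule triv_in_G[OF triv 1(1)])
  show "chi (iota D x) = (\<phi> (p x), pe (\<psi> x))" by (simp add: chi_def pbar_iota Psi_iota[OF 1(1)])
qed

lemma sheet_point:
  assumes "(u, pe g) \<in> Dom" "g \<in> G"
  obtains x where "x \<in> sheet g" "\<phi> (p x) = u" "iota D x = chi_inv (u, pe g)"
proof -
  obtain z where z: "u = \<phi> z" "z \<in> U0" "z \<in> Vc" and k: "pe g \<in> K" using assms(1) by (auto simp: Dom_def)
  obtain x where x: "p x = z" "\<psi> x = g" using triv_surj[OF triv z(2) assms(2)] by (elim exE conjE) (rule that)
  have \<Psi>x: "\<Psi> (iota D x) = (z, pe g)" using Psi_iota[of x] z x by simp
  have "iota D x \<in> Pi1"
    using z k by (simp add: Pi1_def Pi_hat_def iota_in pbar_iota x \<Psi>x)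
  from chi_inv_chi[OF this] iota_chi(4)[OF this] have "iota D x = chi_inv (u, pe g)" by (simp add: x z)
  moreover have "x \<in> sheet g" using x z by (simp add: sheet_def)
  ultimately show thesis using x(1) z(1) by (intro that[of x]) simp_all
qed

text \<open>Serves both structure sheaves: with \<open>T\<close> the coordinate map
  \<open>fst\<close> for functions on the compactification, with \<open>T\<close> a retraction for
  functions on \<open>Y\<close>, which have only local extensions in the covering. Their
  neighbourhoods may shrink from sheet to sheet; this does no harm, since \<open>PH_dense\<close>
  asks for continuity and for differentiability at each point of the slices \<open>pe g\<close>
  separately.\<close>

lemma PH_pullback:
  assumes Z: "rel_open n PF Z" and T: "\<And>j. j < n \<Longrightarrow> PH n Z (\<lambda>y. T y j)"
    and dom: "\<And>y. y \<in> Z \<Longrightarrow> (T y, snd y) \<in> Dom" and W: "\<And>y. y \<in> Z \<Longrightarrow> chi_inv (T y, snd y) \<in> W"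
    and f: "continuous_map (subtopology (caX D) W) euclidean f"
    and loc: "\<And>x. iota D x \<in> W \<Longrightarrow> \<exists>V F. x \<in> V \<and> mfd_holo n L V F \<and> (\<forall>y\<in>V \<inter> iota D -` W. F y = f (iota D y))"
  shows "PH n Z (\<lambda>y. f (chi_inv (T y, snd y)))"
proof -
  have TCn: "T y \<in> Cn n" if "y \<in> Z" for y using rel_open_sub[OF Dom_open] dom[OF that] by blast
  have contT: "continuous_on Z T"
    using PH_continuous[OF T] TCn by (rule continuous_on_Cn_valued)
  have "continuous_on Z (\<lambda>y. (T y, snd y))" by (intro continuous_on_Pair contT continuous_on_snd continuous_on_id)
  then have "continuous_map (top_of_set Z) (top_of_set Dom) (\<lambda>y. (T y, snd y))"
    using dom by (auto simp: continuous_map_in_subtopology)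
  from continuous_map_compose[OF this chi_inv_cont]
  have "continuous_map (top_of_set Z) (caX D) (chi_inv \<circ> (\<lambda>y. (T y, snd y)))"
    by (simp only: continuous_map_in_subtopology)
  then have "continuous_map (top_of_set Z) (subtopology (caX D) W) (chi_inv \<circ> (\<lambda>y. (T y, snd y)))"
    using W by (auto simp: continuous_map_in_subtopology)
  from continuous_map_compose[OF this f]
  have cont: "continuous_on Z (\<lambda>y. f (chi_inv (T y, snd y)))" by (simp add: o_def)
  show ?thesis
  proof (rule PH_dense[OF Z cont])
    show "pe ` G \<subseteq> PF" using pe_in by (rule image_subsetI)
    show "PF \<subseteq> closure (pe ` G)" by (rule Ghat_dense)
    fix u \<omega> i assume u: "(u, \<omega>) \<in> Z" "\<omega> \<in> pe ` G" and i: "i < n"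
    obtain g where g: "\<omega> = pe g" "g \<in> G" using u(2) by (rule imageE)
    have uZ: "(u, pe g) \<in> Z" using u(1) g(1) by simp
    have d0: "(T (u, pe g), pe g) \<in> Dom" using dom[OF uZ] by simp
    obtain x where x: "x \<in> sheet g" "\<phi> (p x) = T (u, pe g)" "iota D x = chi_inv (T (u, pe g), pe g)"
      by (rule sheet_point[OF d0 g(2)])
    have "iota D x \<in> W" using W[OF uZ] by (simp add: x(3))
    from loc[OF this] obtain V F where V: "x \<in> V" "mfd_holo n L V F" "\<forall>y\<in>V \<inter> iota D -` W. F y = f (iota D y)"
      by (elim exE conjE) (rule that)
    define S where "S = (\<phi> \<circ> p) ` (sheet g \<inter> V)"
    define \<sigma> where "\<sigma> = inv_into (sheet g) (\<phi> \<circ> p)"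
    have inj: "inj_on (\<phi> \<circ> p) (sheet g)"
      by (rule comp_inj_on[OF sheet_inj inj_on_subset[OF phi_inj]]) (auto simp: sheet_def)
    have \<sigma>: "\<sigma> (\<phi> (p y)) = y" if "y \<in> sheet g" for y
      using inv_into_f_f[OF inj that] by (simp add: \<sigma>_def)
    have S_open: "openin (top_of_set (Cn n)) S"
      unfolding S_def by (rule lift_chart_open[OF sheet_lift mfd_holo_open[OF V(2)]])
    have PHF: "PH n (S \<times> {0::real}) (\<lambda>y. F (\<sigma> (fst y)))"
      unfolding S_def \<sigma>_def by (rule mfd_holoD[OF V(2) sheet_lift])
    have S': "rel_open n {0::real} (S \<times> {0})" by (rule openin_Times[OF S_open]) simp
    obtain O1 where O1: "open O1" "S = Cn n \<inter> O1" using S_open unfolding openin_open by (elim exE conjE) (rule that)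
    obtain O2 where O2: "open O2" "Z = (Cn n \<times> PF) \<inter> O2" using Z unfolding openin_open by (elim exE conjE) (rule that)
    \<comment> \<open>\<open>pe g\<close> need not be an isolated point of the fibre, so the slice
      is turned into a family over the one-point parameter set \<open>{pe g}\<close>, to which
      \<open>PH_compose\<close> applies.\<close>
    define Z0 where "Z0 = (Cn n \<times> {pe g}) \<inter> O2"
    have Z0: "rel_open n {pe g} Z0" unfolding Z0_def by (rule openin_open_Int[OF O2(1)])
    have Z0Z: "Z0 \<subseteq> Z" using pe_in[OF g(2)] by (auto simp: Z0_def O2(2))
    define Z1 where "Z1 = {y \<in> Z0. T y \<in> O1}"
    have Z1: "rel_open n {pe g} Z1"
      unfolding Z1_def by (rule rel_open_preimage[OF Z0 continuous_on_subset[OF contT Z0Z] O1(1)])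
    have Z1Z: "Z1 \<subseteq> Z" using Z0Z by (auto simp: Z1_def)
    have T1: "T y \<in> S" if "y \<in> Z1" for y using that TCn[of y] Z1Z by (auto simp: Z1_def O1(2))
    have PH1: "PH n Z1 (\<lambda>y. F (\<sigma> (fst (T y, 0::real))))"
      by (rule PH_compose[OF S' PHF Z1 PH_subset[OF T Z1Z], where \<sigma> = "\<lambda>_. 0"]) (use T1 in \<open>auto intro: continuous_on_const\<close>)
    \<comment> \<open>The extension \<open>F\<close> agrees with \<open>f\<close> only at points of
      \<open>V\<close> lying over \<open>W\<close>; the choice of \<open>S\<close> forces
      \<open>T\<close> to land at such points of the sheet.\<close>
    have eq: "F (\<sigma> (T (v, pe g))) = f (chi_inv (T (v, pe g), pe g))" if v: "(v, pe g) \<in> Z1" for v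
    proof -
      have vZ: "(v, pe g) \<in> Z" using v Z1Z by blast
      have "(T (v, pe g), pe g) \<in> Dom" using dom[OF vZ] by simp
      then obtain x' where x': "x' \<in> sheet g" "\<phi> (p x') = T (v, pe g)" "iota D x' = chi_inv (T (v, pe g), pe g)"
        by (rule sheet_point[OF _ g(2)])
      have "T (v, pe g) \<in> (\<phi> \<circ> p) ` (sheet g \<inter> V)" using T1[OF v] by (simp only: S_def)
      then obtain y where y: "T (v, pe g) = (\<phi> \<circ> p) y" "y \<in> sheet g \<inter> V" by (rule imageE)
      have "y = x'" using y \<sigma>[of y] \<sigma>[OF x'(1)] x'(2) by simp
      then have "x' \<in> V \<inter> iota D -` W" using y(2) W[OF vZ] by (simp add: x'(3))
      then have "F x' = f (iota D x')" using V(3) by blast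
      moreover have "\<sigma> (T (v, pe g)) = x'" using \<sigma>[OF x'(1)] by (simp add: x'(2))
      ultimately show ?thesis by (simp add: x'(3))
    qed
    have uCn: "u \<in> Cn n" using rel_open_sub[OF Z] uZ by blast
    have uZ1: "(u, pe g) \<in> Z1"
    proof -
      have "T (u, pe g) \<in> S" unfolding S_def using x V(1) by (intro image_eqI[of _ _ x]) simp_all
      then show ?thesis using uZ uCn by (simp add: Z1_def Z0_def O1(2) O2(2))
    qed
    have "(\<lambda>t. F (\<sigma> (T (u(i := t), pe g)))) field_differentiable at (u i)"
      using PH_differentiable[OF PH1 uZ1 i] by simp
    then have "(\<lambda>t. f (chi_inv (T (u(i := t), pe g), pe g))) field_differentiable at (u i)"
    proof (rule field_differentiable_cong_open)
      show "open {t. (u(i := t), pe g) \<in> Z1}" by (rule line_open[OF Z1 uCn i])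
      show "u i \<in> {t. (u(i := t), pe g) \<in> Z1}" using uZ1 by simp
      fix t assume "t \<in> {t. (u(i := t), pe g) \<in> Z1}"
      then show "F (\<sigma> (T (u(i := t), pe g))) = f (chi_inv (T (u(i := t), pe g), pe g))" using eq by simp
    qed
    then show "(\<lambda>t. f (chi_inv (T (u(i := t), \<omega>), snd (u(i := t), \<omega>)))) field_differentiable at (u i)"
      by (simp add: g(1))
  qed
qed

text \<open>One direction is \<open>PH_pullback\<close> with the coordinate map. For the other, near
  each point of a lifted chart one stays on a single sheet, where the fibre coordinate is the
  constant \<open>pe g\<close> and only a transition map of the base remains to be composed.\<close>

lemma holo_caX_chart:
  assumes W: "openin (caX D) W" "W \<subseteq> Pi1"
  shows "holo_caX D W = {f \<in> extensional W. PH n (chi ` W) (\<lambda>y. f (chi_inv y))}"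
proof (intro subset_antisym subsetI)
  fix f assume f: "f \<in> holo_caX D W"
  have "PH n (chi ` W) (\<lambda>y. f (chi_inv (fst y, snd y)))"
  proof (rule PH_pullback[OF chi_image_open[OF W] PH_coord _ _ holo_caX_D(2)[OF f]])
    fix y assume "y \<in> chi ` W"
    then obtain P where P: "y = chi P" "P \<in> W" by (rule imageE)
    then have PP: "P \<in> Pi1" using W(2) by blast
    show "(fst y, snd y) \<in> Dom" using chi_in[OF PP] by (simp add: P(1))
    show "chi_inv (fst y, snd y) \<in> W" using chi_inv_chi[OF PP] P by simp
  next
    fix x assume "iota D x \<in> W"
    then show "\<exists>V F. x \<in> V \<and> mfd_holo n L V F \<and> (\<forall>y\<in>V \<inter> iota D -` W. F y = f (iota D y))"
      using holo_caX_D(3)[OF f] by (intro exI[of _ "iota D -` W"] exI[of _ "\<lambda>x. f (iota D x)"]) simp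
  qed
  then show "f \<in> {f \<in> extensional W. PH n (chi ` W) (\<lambda>y. f (chi_inv y))}"
    using holo_caX_D(1)[OF f] by simp
next
  fix f assume "f \<in> {f \<in> extensional W. PH n (chi ` W) (\<lambda>y. f (chi_inv y))}"
  then have f: "f \<in> extensional W" "PH n (chi ` W) (\<lambda>y. f (chi_inv y))" by simp_all
  have "continuous_map (subtopology (caX D) W) (top_of_set (chi ` W)) chi"
    using continuous_map_from_subtopology_mono[OF chi_cont W(2)] by (auto simp: continuous_map_in_subtopology)
  moreover have "continuous_map (top_of_set (chi ` W)) euclidean (\<lambda>y. f (chi_inv y))"
    using PH_continuous[OF f(2)] by simp
  ultimately have "continuous_map (subtopology (caX D) W) euclidean ((\<lambda>y. f (chi_inv y)) \<circ> chi)"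
    by (rule continuous_map_compose)
  then have cont: "continuous_map (subtopology (caX D) W) euclidean f"
  proof (rule continuous_map_eq)
    fix P assume "P \<in> topspace (subtopology (caX D) W)"
    then have "P \<in> Pi1" using W(2) by auto
    then show "((\<lambda>y. f (chi_inv y)) \<circ> chi) P = f P" by (simp add: chi_inv_chi)
  qed
  have oW: "open (iota D -` W)" by (rule iota_open[OF W(1)])
  have "mfd_holo n L (iota D -` W) (\<lambda>x. f (iota D x))"
  proof (rule mfd_holoI[OF oW])
    fix V \<theta> assume VL: "(V, \<theta>) \<in> L"
    obtain B \<phi>' where B: "(B, \<phi>') \<in> catlas D" "open V" "inj_on p V" "p ` V \<subseteq> B" "\<theta> = \<phi>' \<circ> p" "inj_on \<theta> V"
      by (rule lift_chart[OF VL])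
    have \<theta>inv: "inv_into V \<theta> (\<theta> x) = x" if "x \<in> V" for x by (rule inv_into_f_f[OF B(6) that])
    have "inj_on \<phi>' B" using chartD(3)[OF B(1)] by (metis homeomorphism_def inj_on_inverseI)
    then have \<phi>'inv: "inv_into B \<phi>' (\<phi>' z) = z" if "z \<in> B" for z by (rule inv_into_f_f[OF _ that])
    show "PH n (\<theta> ` (V \<inter> iota D -` W) \<times> {0::real}) (\<lambda>y. f (iota D (inv_into V \<theta> (fst y))))"
    proof (rule PH_local[where P = "{0::real}"])
      show "rel_open n {0::real} (\<theta> ` (V \<inter> iota D -` W) \<times> {0})"
        by (rule openin_Times[OF lift_chart_open[OF VL oW]]) simp
      fix y assume "y \<in> \<theta> ` (V \<inter> iota D -` W) \<times> {0::real}"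
      then obtain x0 where x0: "y = (\<theta> x0, 0)" "x0 \<in> V" "iota D x0 \<in> W" by auto
      have P0: "iota D x0 \<in> Pi1" using x0(3) W(2) by blast
      define g where "g = \<psi> x0"
      have x0g: "x0 \<in> sheet g" using iota_chi(1,2)[OF P0] by (simp add: sheet_def g_def)
      define Z where "Z = \<theta> ` (V \<inter> (iota D -` W \<inter> sheet g)) \<times> {0::real}"
      have "open (sheet g)" using lift_chart[OF sheet_lift[of g]] by blast
      then have "open (iota D -` W \<inter> sheet g)" using oW by (simp only: open_Int)
      then have Zo: "rel_open n {0::real} Z"
        unfolding Z_def by (intro openin_Times lift_chart_open[OF VL]) simp_all
      have ZE: "\<exists>x. y = (\<theta> x, 0) \<and> x \<in> V \<and> iota D x \<in> W \<and> x \<in> sheet g \<and> p x \<in> B" if "y \<in> Z" for y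
        using that B(4) by (auto simp: Z_def)
      \<comment> \<open>The transition map from the given base chart to
        \<open>\<phi>\<close>.\<close>
      define T where "T y = \<phi> (inv_into B \<phi>' (fst y))" for y :: "(nat \<Rightarrow> complex) \<times> real"
      have Tx: "T (\<theta> x, 0) = \<phi> (p x)" if "p x \<in> B" for x using \<phi>'inv[OF that] by (simp add: T_def B(5))
      have Z_sub: "Z \<subseteq> \<phi>' ` (B \<inter> Vc) \<times> {0}"
      proof
        fix y assume "y \<in> Z"
        from ZE[OF this] obtain x where x: "y = (\<theta> x, 0)" "x \<in> sheet g" "p x \<in> B" by (elim exE conjE) (rule that)
        then have "p x \<in> B \<inter> Vc" by (simp add: sheet_def)
        then show "y \<in> \<phi>' ` (B \<inter> Vc) \<times> {0}" by (simp add: x(1) B(5))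
      qed
      have T: "PH n Z (\<lambda>y. T y j)" if "j < n" for j
        using PH_subset[OF holo_Cn_imp_PH[OF transition[OF B(1) chart that]] Z_sub] by (simp only: T_def)
      have point: "(T y, pe g) \<in> chi ` W" "f (chi_inv (T y, pe g)) = f (iota D (inv_into V \<theta> (fst y)))" if "y \<in> Z" for y
      proof -
        from ZE[OF that] obtain x where x: "y = (\<theta> x, 0)" "x \<in> V" "iota D x \<in> W" "x \<in> sheet g" "p x \<in> B"
          by (elim exE conjE) (rule that)
        have P: "iota D x \<in> Pi1" using x(3) W(2) by blast
        have "\<psi> x = g" using x(4) by (simp add: sheet_def)
        then have c: "(T y, pe g) = chi (iota D x)" using iota_chi(4)[OF P] Tx[OF x(5)] by (simp add: x(1))
        show "(T y, pe g) \<in> chi ` W" unfolding c by (rule imageI[OF x(3)])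
        show "f (chi_inv (T y, pe g)) = f (iota D (inv_into V \<theta> (fst y)))"
          unfolding c chi_inv_chi[OF P] using \<theta>inv[OF x(2)] by (simp add: x(1))
      qed
      have "PH n Z (\<lambda>y. f (chi_inv (T y, pe g)))"
        by (rule PH_compose[OF chi_image_open[OF W] f(2) Zo T, where \<sigma> = "\<lambda>_. pe g"]) (use point(1) in \<open>auto intro: continuous_on_const\<close>)
      moreover have "y \<in> Z" using x0 x0g by (simp add: Z_def)
      moreover have "Z \<subseteq> \<theta> ` (V \<inter> iota D -` W) \<times> {0::real}" by (auto simp: Z_def)
      ultimately show "\<exists>Z' g'. rel_open n {0::real} Z' \<and> y \<in> Z' \<and> Z' \<subseteq> \<theta> ` (V \<inter> iota D -` W) \<times> {0::real} \<and>
          PH n Z' g' \<and> (\<forall>y\<in>Z'. g' y = f (iota D (inv_into V \<theta> (fst y))))"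
        using Zo point(2) by (intro exI[of _ Z] exI[of _ "\<lambda>y. f (chi_inv (T y, pe g))"] conjI ballI)
    qed
  qed
  then have "(\<lambda>x\<in>W. f x) \<in> holo_caX D W" by (rule holo_caX_I[OF cont])
  then show "f \<in> holo_caX D W" by (simp only: extensional_restrict[OF f(1)])
qed

text \<open>The chart is shrunk twice: into \<open>V0\<close>, over whose trace on \<open>Y\<close>
  the given resolution lives, and to the set \<open>V\<close> which \<open>\<Theta>\<close> maps
  homeomorphically onto \<open>Q \<times> W\<close>. There \<open>straightened_model\<close>
  applies, and it remains to identify the ring \<open>S.Fz k\<close> of the straightened zero set
  with the structure sheaf of \<open>Y\<close>.\<close>

lemma local_resolution:
  assumes A: "sheaf_of_modules (subtopology (caX D) Y) (\<lambda>W. function_ring W (holo_submfd D Y W)) A"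
    and y: "y \<in> Y" "y \<in> Pi1" and V0: "openin (caX D) V0" "y \<in> V0"
    and res: "\<And>N. 1 \<le> N \<Longrightarrow> has_free_resolution (subtopology (caX D) Y) (\<lambda>W. function_ring W (holo_submfd D Y W)) A (V0 \<inter> Y) N"
    and h: "\<And>i. i < k \<Longrightarrow> h i \<in> holo_caX D Pi0"
    and Y: "Y \<inter> Pi0 = {x \<in> Pi0. \<forall>i<k. h i x = 0}"
    and rank: "vec_space.rank k (mat k n (\<lambda>(i, j). PD j (\<lambda>x. h i (chi_inv x)) (chi y))) = k"
  shows "\<exists>V. openin (caX D) V \<and> y \<in> V \<and>
    (\<forall>N\<ge>1. has_free_resolution (caX D) (\<lambda>U. function_ring U (holo_caX D U)) (trivial_extension Y A) V N)"
proof -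
  define \<Omega> where "\<Omega> = chi ` (Pi1 \<inter> V0)"
  have \<Omega>_open: "rel_open n PF \<Omega>"
    unfolding \<Omega>_def by (rule chi_image_open[OF openin_Int[OF Pi1_open V0(1)] Int_lower1])
  have \<Omega>E: "\<exists>P. x = chi P \<and> P \<in> Pi1 \<and> P \<in> V0" if "x \<in> \<Omega>" for x
    using that unfolding \<Omega>_def by blast
  have \<Omega>_Dom: "x \<in> Dom" "chi_inv x \<in> Pi1" "chi_inv x \<in> V0" if "x \<in> \<Omega>" for x
  proof -
    obtain P where "x = chi P" "P \<in> Pi1" "P \<in> V0" using \<Omega>E[OF \<open>x \<in> \<Omega>\<close>] by (elim exE conjE) (rule that)
    then show "x \<in> Dom" "chi_inv x \<in> Pi1" "chi_inv x \<in> V0" using chi_in chi_inv_chi by simp_all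
  qed
  obtain z0 \<omega>0 where z0: "chi y = (z0, \<omega>0)" by (cases "chi y")
  have x0: "(z0, \<omega>0) \<in> \<Omega>" unfolding \<Omega>_def z0[symmetric] using y(2) V0(2) by (intro imageI IntI)
  define H where "H i x = h i (chi_inv x)" for i x
  have PH_H: "PH n \<Omega> (H i)" if i: "i < k" for i
  proof -
    have "PH n \<Omega> (\<lambda>x. h i (chi_inv (fst x, snd x)))"
    proof (rule PH_pullback[OF \<Omega>_open PH_coord _ _ holo_caX_D(2)[OF h[OF i]]])
      show "(fst x, snd x) \<in> Dom" "chi_inv (fst x, snd x) \<in> Pi0" if "x \<in> \<Omega>" for x
        using \<Omega>_Dom(1)[OF that] Pi1D(1)[OF \<Omega>_Dom(2)[OF that]] by simp_all
      show "\<exists>V F. x \<in> V \<and> mfd_holo n L V F \<and> (\<forall>y\<in>V \<inter> iota D -` Pi0. F y = h i (iota D y))" if "iota D x \<in> Pi0" for x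
        using holo_caX_D(3)[OF h[OF i]] that by (intro exI[of _ "iota D -` Pi0"] exI[of _ "\<lambda>x. h i (iota D x)"]) simp
    qed
    then show ?thesis by (simp add: H_def[abs_def])
  qed
  have H0: "H i (z0, \<omega>0) = 0" if "i < k" for i
  proof -
    have "y \<in> Y \<inter> Pi0" using y(1) Pi1D(1)[OF y(2)] by (rule IntI)
    then have "h i y = 0" unfolding Y using that by simp
    then show ?thesis by (simp add: H_def z0[symmetric] chi_inv_chi[OF y(2)])
  qed
  have rank': "vec_space.rank k (mat k n (\<lambda>(i, j). PD j (H i) (z0, \<omega>0))) = k"
    using rank by (simp only: z0 H_def[abs_def])
  obtain \<rho> W M N Q Gm \<Phi> where \<rho>: "\<rho> > 0" and W: "openin (top_of_set PF) W" "\<omega>0 \<in> W"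
    and B\<Omega>: "polydisc n z0 \<rho> \<times> W \<subseteq> \<Omega>"
    and Q: "openin (top_of_set (Cn n)) Q"
    and N: "\<And>i. i < k \<Longrightarrow> N i \<in> Cn n"
    and MN: "\<And>i i'. i < k \<Longrightarrow> i' < k \<Longrightarrow> (\<Sum>m<n. M i m * N i' m) = (if i = i' then 1 else 0)"
    and inv: "\<And>i u. i < k \<Longrightarrow> u \<in> Q \<Longrightarrow> (\<lambda>m. u m - (\<Sum>j<n. M i j * u j) * N i m) \<in> Q"
    and \<Phi>: "\<And>m. m < n \<Longrightarrow> PH n (polydisc n z0 \<rho> \<times> W) (\<lambda>x. \<Phi> x m)"
    and \<Phi>_Cn: "\<And>x. \<Phi> x \<in> Cn n"
    and Gm: "\<And>m. m < n \<Longrightarrow> PH n (Q \<times> W) (\<lambda>x. Gm x m)"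
    and \<Phi>G: "\<And>u \<omega>. u \<in> Q \<Longrightarrow> \<omega> \<in> W \<Longrightarrow> Gm (u, \<omega>) \<in> polydisc n z0 \<rho> \<and> \<Phi> (Gm (u, \<omega>), \<omega>) = u"
    and G\<Phi>: "\<And>z \<omega>. z \<in> polydisc n z0 \<rho> \<Longrightarrow> \<omega> \<in> W \<Longrightarrow> \<Phi> (z, \<omega>) \<in> Q \<Longrightarrow> Gm (\<Phi> (z, \<omega>), \<omega>) = z"
    and H\<Phi>: "\<And>i x. i < k \<Longrightarrow> H i x = (\<Sum>m<n. M i m * \<Phi> x m)"
    and \<Phi>0: "\<Phi> (z0, \<omega>0) \<in> Q"
    apply (rule PH_straighten[OF \<Omega>_open x0 PH_H H0 rank'], assumption, assumption)
    subgoal premises prems for \<rho> W Q N M \<Phi> Gm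
      by (rule that[of \<rho> W Q N M \<Phi> Gm]) (rule prems; assumption)+
    done
  define B where "B = polydisc n z0 \<rho> \<times> W"
  have B_open: "rel_open n PF B" unfolding B_def by (rule rel_open_polydisc[OF W(1)])
  have B_\<Omega>: "x \<in> \<Omega>" if "x \<in> B" for x using that B\<Omega> unfolding B_def by blast
  have B_Cn: "fst x \<in> Cn n" if "x \<in> B" for x using rel_open_sub[OF B_open] that by auto
  have cont\<Phi>: "continuous_on B \<Phi>"
    using PH_continuous[OF \<Phi>] \<Phi>_Cn unfolding B_def by (rule continuous_on_Cn_valued)
  obtain O1 where O1: "open O1" "Q = Cn n \<inter> O1" using Q unfolding openin_open by (elim exE conjE) (rule that)
  \<comment> \<open>\<open>\<Phi>\<close> may leave \<open>Q\<close> on the polydisc, and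
    \<open>Gm\<close> inverts it only over \<open>Q\<close>; so the domain is cut down to the
    preimage of \<open>Q\<close>.\<close>
  define Z where "Z = {x \<in> B. \<Phi> x \<in> O1}"
  have ZQ: "x \<in> Z \<longleftrightarrow> x \<in> B \<and> \<Phi> x \<in> Q" for x using \<Phi>_Cn by (simp add: Z_def O1(2))
  have Z_open: "rel_open n PF Z" unfolding Z_def by (rule rel_open_preimage[OF B_open cont\<Phi> O1(1)])
  have Z_Dom: "Z \<subseteq> Dom" using ZQ B_\<Omega> \<Omega>_Dom(1) by blast
  define V where "V = {P \<in> Pi1. chi P \<in> Z}"
  have V_Pi1: "V \<subseteq> Pi1" by (simp add: V_def)
  have V_open: "openin (caX D) V"
  proof -
    have "openin (top_of_set Dom) Z"
      by (rule openin_subset_trans[OF Z_open Z_Dom rel_open_sub[OF Dom_open]])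
    from openin_continuous_map_preimage[OF chi_cont this]
    have "openin (subtopology (caX D) Pi1) {P \<in> topspace (subtopology (caX D) Pi1). chi P \<in> Z}" .
    moreover have "{P \<in> topspace (subtopology (caX D) Pi1). chi P \<in> Z} = V"
      using openin_subset[OF Pi1_open] by (auto simp: V_def)
    ultimately show ?thesis using openin_trans_full[OF _ Pi1_open] by (simp only:)
  qed
  have yV: "y \<in> V"
    using y(2) \<Phi>0 W(2) polydisc_center[OF \<rho>, of z0] rel_open_sub[OF \<Omega>_open] x0
    by (auto simp: V_def ZQ z0 B_def)
  have V_V0: "V \<subseteq> V0"
  proof
    fix P assume "P \<in> V"
    then have "P \<in> Pi1" "chi P \<in> \<Omega>" using ZQ B_\<Omega> by (auto simp: V_def)
    then show "P \<in> V0" using \<Omega>_Dom(3)[of "chi P"] chi_inv_chi[of P] by simp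
  qed
  let ?T = "subtopology (caX D) V"
  have V_top: "topspace ?T = V" using openin_subset[OF V_open] by auto
  define \<Theta> where "\<Theta> P = (\<Phi> (chi P), snd (chi P))" for P
  define \<Theta>' where "\<Theta>' x = chi_inv (Gm x, snd x)" for x
  have chiV: "chi P \<in> B" "\<Phi> (chi P) \<in> Q" "chi_inv (chi P) = P" "snd (chi P) \<in> W" "fst (chi P) \<in> polydisc n z0 \<rho>"
    if "P \<in> V" for P
    using that ZQ chi_inv_chi[of P] by (auto simp: V_def B_def)
  have G_chi: "Gm (\<Theta> P) = fst (chi P)" if "P \<in> V" for P
    using G\<Phi>[of "fst (chi P)" "snd (chi P)"] chiV[OF that] by (simp add: \<Theta>_def)
  have \<Theta>'\<Theta>: "\<Theta>' (\<Theta> P) = P" if "P \<in> V" for P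
    using G_chi[OF that] chiV(3)[OF that] by (simp add: \<Theta>'_def \<Theta>_def)
  have \<Theta>_in: "\<Theta> P \<in> Q \<times> W" if "P \<in> V" for P using chiV[OF that] by (simp add: \<Theta>_def)
  have QW: "(Gm x, snd x) \<in> B" "\<Phi> (Gm x, snd x) = fst x" if "x \<in> Q \<times> W" for x
    using \<Phi>G[of "fst x" "snd x"] that by (auto simp: B_def)
  have QW_Z: "(Gm x, snd x) \<in> Z" if "x \<in> Q \<times> W" for x using QW[OF that] that by (auto simp: ZQ)
  have chi_\<Theta>': "chi (\<Theta>' x) = (Gm x, snd x)" if "x \<in> Q \<times> W" for x
    unfolding \<Theta>'_def by (rule chi_inv_props(2)[OF subsetD[OF Z_Dom QW_Z[OF that]]])
  have \<Theta>'_in: "\<Theta>' x \<in> V" if "x \<in> Q \<times> W" for x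
    using chi_inv_props(1)[OF subsetD[OF Z_Dom QW_Z[OF that]]] QW_Z[OF that] chi_\<Theta>'[OF that]
    by (simp add: V_def \<Theta>'_def)
  have \<Theta>\<Theta>': "\<Theta> (\<Theta>' x) = x" if "x \<in> Q \<times> W" for x
    unfolding \<Theta>_def chi_\<Theta>'[OF that] using QW(2)[OF that] by simp
  have chi_cont_V: "continuous_map ?T (top_of_set B) chi"
    using continuous_map_from_subtopology_mono[OF chi_cont V_Pi1] chiV(1) by (auto simp: continuous_map_in_subtopology V_top)
  have homeo: "homeomorphic_maps ?T (top_of_set (Q \<times> W)) \<Theta> \<Theta>'"
    unfolding homeomorphic_maps_def
  proof (intro conjI ballI)
    have "continuous_on B (\<lambda>x. (\<Phi> x, snd x))"
      by (intro continuous_on_Pair cont\<Phi> continuous_on_snd continuous_on_id)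
    then have "continuous_map (top_of_set B) euclidean (\<lambda>x. (\<Phi> x, snd x))" by simp
    from continuous_map_compose[OF chi_cont_V this]
    have "continuous_map ?T euclidean \<Theta>" by (simp add: o_def \<Theta>_def[abs_def])
    then show "continuous_map ?T (top_of_set (Q \<times> W)) \<Theta>"
      using \<Theta>_in by (auto simp: continuous_map_in_subtopology V_top)
    have "Gm x \<in> Cn n" if "x \<in> Q \<times> W" for x using B_Cn[OF QW(1)[OF that]] by simp
    with PH_continuous[OF Gm] have "continuous_on (Q \<times> W) Gm" by (rule continuous_on_Cn_valued)
    then have "continuous_on (Q \<times> W) (\<lambda>x. (Gm x, snd x))"
      by (intro continuous_on_Pair continuous_on_snd continuous_on_id)
    then have "continuous_map (top_of_set (Q \<times> W)) (top_of_set Dom) (\<lambda>x. (Gm x, snd x))"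
      using QW_Z Z_Dom by (auto simp: continuous_map_in_subtopology)
    from continuous_map_compose[OF this chi_inv_cont]
    have "continuous_map (top_of_set (Q \<times> W)) (caX D) \<Theta>'"
      by (simp add: continuous_map_in_subtopology o_def \<Theta>'_def[abs_def])
    then show "continuous_map (top_of_set (Q \<times> W)) ?T \<Theta>'"
      using \<Theta>'_in by (auto simp: continuous_map_in_subtopology)
  qed (use \<Theta>'\<Theta> \<Theta>\<Theta>' V_top in simp_all)
  have sub_open: "openin (caX D) U" "U \<subseteq> V" "U \<subseteq> Pi1" if "openin ?T U" for U
    using openin_trans_full[OF that V_open] openin_subset[OF that] V_Pi1 V_top by auto
  have \<Theta>_image_open: "rel_open n PF (\<Theta> ` U)" if "openin ?T U" for U
  proof -
    have "homeomorphic_map ?T (top_of_set (Q \<times> W)) \<Theta>"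
      unfolding homeomorphic_map_maps by (rule exI[where x = \<Theta>'], rule homeo)
    then have "openin (top_of_set (Q \<times> W)) (\<Theta> ` U)"
      using homeomorphic_imp_open_map that unfolding open_map_def by blast
    then show ?thesis using openin_Times[OF Q W(1)] by (rule openin_trans)
  qed
  \<comment> \<open>\<open>\<Theta>\<close> and \<open>chi\<close> differ by \<open>\<Phi>\<close>
    and its inverse \<open>Gm\<close>, both of type \<open>PH\<close> with the parameter kept, so
    they define the same holomorphic functions.\<close>
  have F: "holo_caX D U = {f \<in> extensional U. PH n (\<Theta> ` U) (\<lambda>y. f (\<Theta>' y))}" if U: "openin ?T U" for U
  proof -
    note U' = sub_open[OF U]
    have "PH n (chi ` U) (\<lambda>y. f (chi_inv y)) \<longleftrightarrow> PH n (\<Theta> ` U) (\<lambda>y. f (\<Theta>' y))" for f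
    proof
      assume f: "PH n (chi ` U) (\<lambda>y. f (chi_inv y))"
      have sub: "\<Theta> ` U \<subseteq> Q \<times> W" using \<Theta>_in U'(2) by blast
      have "PH n (\<Theta> ` U) (\<lambda>x. f (chi_inv (Gm x, snd x)))"
      proof (rule PH_compose[OF chi_image_open[OF U'(1,3)] f \<Theta>_image_open[OF U] PH_subset[OF Gm sub], where \<sigma> = "\<lambda>x. x"])
        fix x assume "x \<in> \<Theta> ` U"
        then obtain P where P: "x = \<Theta> P" "P \<in> U" by (rule imageE)
        then have "Gm x = fst (chi P)" using G_chi U'(2) by blast
        then have "(Gm x, snd x) = chi P" by (simp add: P(1) \<Theta>_def)
        then show "(Gm x, snd x) \<in> chi ` U" using P(2) by (simp only: imageI)
      qed (simp_all add: continuous_on_snd)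
      then show "PH n (\<Theta> ` U) (\<lambda>y. f (\<Theta>' y))" by (simp only: \<Theta>'_def)
    next
      assume f: "PH n (\<Theta> ` U) (\<lambda>y. f (\<Theta>' y))"
      have sub: "chi ` U \<subseteq> polydisc n z0 \<rho> \<times> W" using chiV(1) U'(2) unfolding B_def by blast
      have "PH n (chi ` U) (\<lambda>x. f (\<Theta>' (\<Phi> x, snd x)))"
      proof (rule PH_compose[OF \<Theta>_image_open[OF U] f chi_image_open[OF U'(1,3)] PH_subset[OF \<Phi> sub], where \<sigma> = "\<lambda>x. x"])
        fix x assume "x \<in> chi ` U"
        then obtain P where P: "x = chi P" "P \<in> U" by (rule imageE)
        then show "(\<Phi> x, snd x) \<in> \<Theta> ` U" by (intro image_eqI[of _ _ P]) (simp_all add: \<Theta>_def)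
      qed (simp_all add: continuous_on_snd)
      then show "PH n (chi ` U) (\<lambda>y. f (chi_inv y))"
      proof (rule PH_cong[OF _ chi_image_open[OF U'(1,3)]])
        fix x assume "x \<in> chi ` U"
        then obtain P where P: "x = chi P" "P \<in> U" by (rule imageE)
        then have PV: "P \<in> V" using U'(2) by blast
        have "(\<Phi> x, snd x) = \<Theta> P" by (simp add: \<Theta>_def P(1))
        then show "f (\<Theta>' (\<Phi> x, snd x)) = f (chi_inv x)" using \<Theta>'\<Theta>[OF PV] chiV(3)[OF PV] P(1) by simp
      qed
    qed
    then show ?thesis unfolding holo_caX_chart[OF U'(1,3)] by simp
  qed
  define h' where "h' i = (\<lambda>x\<in>topspace ?T. \<Sum>m<n. M i m * fst (\<Theta> x) m)" for i
  define r' where "r' i x = \<Theta>' ((\<lambda>m. fst (\<Theta> x) m - (\<Sum>j<n. M i j * fst (\<Theta> x) j) * N i m), snd (\<Theta> x))" for i x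
  have "straightened ?T (holo_caX D) k h' r'"
    unfolding h'_def[abs_def] r'_def[abs_def] by (rule straightened_model[OF homeo Q W(1) F N MN inv])
  then interpret S: straightened ?T "holo_caX D" k h' r' .
  \<comment> \<open>By \<open>H\<Phi>\<close> the linear forms in the new coordinates are the
    original equations, so their common zero set is the trace of \<open>Y\<close>.\<close>
  have zeros: "S.zeros k = V \<inter> Y"
  proof -
    have "h' i x = h i x" if "i < k" "x \<in> V" for i x
      using H\<Phi>[OF that(1), of "chi x"] chiV(3)[OF that(2)] that(2) V_top by (simp add: h'_def \<Theta>_def H_def)
    moreover have "x \<in> Y \<longleftrightarrow> (\<forall>i<k. h i x = 0)" if "x \<in> V" for x
    proof -
      have "x \<in> Pi0" using that V_Pi1 Pi1D(1) by blast
      then have "x \<in> Y \<longleftrightarrow> x \<in> Y \<inter> Pi0" by simp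
      then show ?thesis unfolding Y using \<open>x \<in> Pi0\<close> by simp
    qed
    ultimately show ?thesis unfolding S.zeros_def V_top by auto
  qed
  \<comment> \<open>The retractions move points within a slice only; this brings them into the form
    \<open>(T y, snd y)\<close> that \<open>PH_pullback\<close> requires.\<close>
  have chi_r: "snd (chi (r' i x)) = snd (chi x)" if "i < k" "x \<in> V" for i x
  proof -
    let ?u = "((\<lambda>m. fst (\<Theta> x) m - (\<Sum>j<n. M i j * fst (\<Theta> x) j) * N i m), snd (\<Theta> x))"
    have "?u \<in> Q \<times> W" using inv[OF that(1), of "fst (\<Theta> x)"] \<Theta>_in[OF that(2)] by auto
    from chi_\<Theta>'[OF this] show ?thesis by (simp add: r'_def \<Theta>_def)
  qed
  have chi_retr: "snd (chi (S.retr j x)) = snd (chi x)" if "j \<le> k" "x \<in> V" for j x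
    using that(1)
  proof (induction j)
    case (Suc j)
    then have "S.retr j x \<in> V" using S.retr_in[of j x, unfolded V_top] that(2) by simp
    then show ?case using chi_r[of j "S.retr j x"] Suc by simp
  qed simp
  have retr_V: "S.retr k x \<in> V" if "x \<in> V" for x using S.retr_in[of k x, unfolded V_top] that by simp
  have sub_Y: "subtopology ?T (V \<inter> Y) = subtopology (caX D) (V \<inter> Y)"
    by (simp add: subtopology_subtopology Int_absorb1 Int_assoc[symmetric])
  have Y_open: "openin (subtopology ?T (V \<inter> Y)) U \<longleftrightarrow> openin (subtopology (caX D) Y) U" if "U \<subseteq> V \<inter> Y" for U
    unfolding sub_Y by (rule openin_subtopology_Int_iff[OF V_open that])
  \<comment> \<open>A function on \<open>Y\<close> composed with the retraction is continuous, and
    on each slice it is locally a holomorphic extension composed with a holomorphic map. Conversely,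
    the composition is itself an extension as demanded by \<open>holo_submfd\<close>.\<close>
  have rings: "holo_submfd D Y U = S.Fz k U" if oU: "openin (subtopology (caX D) Y) U" and U: "U \<subseteq> V \<inter> Y" for U
  proof -
    have "openin (subtopology ?T (S.zeros k)) U" unfolding zeros using Y_open[OF U] oU by simp
    then have pre_T: "openin ?T (S.preim k U)" by (rule S.openin_preim[OF order_refl])
    note pre = sub_open[OF pre_T]
    have preE: "x \<in> S.preim k U \<longleftrightarrow> x \<in> V \<and> S.retr k x \<in> U" for x unfolding S.preim_def V_top by simp
    have id: "S.retr k x = x" if "x \<in> U" for x using S.retr_id[of k x] that U zeros by auto
    have U_pre: "U \<subseteq> S.preim k U" using id U by (auto simp: preE)
    show ?thesis
    proof (intro subset_antisym subsetI)
      fix f assume f: "f \<in> holo_submfd D Y U"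
      define T where "T x = fst (chi (S.retr k (chi_inv x)))" for x
      \<comment> \<open>The coordinates of the retraction are the pullbacks of the coordinate
        functions, so their holomorphy comes from \<open>S.pull_retr\<close>.\<close>
      have coord: "PH n (chi ` V) (\<lambda>x. T x j)" if j: "j < n" for j
      proof -
        have c: "(\<lambda>P\<in>V. fst (chi P) j) \<in> holo_caX D V"
        proof -
          have "PH n (chi ` V) (\<lambda>y. (\<lambda>P\<in>V. fst (chi P) j) (chi_inv y))"
          proof (rule PH_cong[OF PH_coord chi_image_open[OF V_open V_Pi1]])
            fix x assume "x \<in> chi ` V"
            then obtain P where "x = chi P" "P \<in> V" by (rule imageE)
            then show "fst x j = (\<lambda>P\<in>V. fst (chi P) j) (chi_inv x)" using chiV(3) by simp
          qed
          then show ?thesis unfolding holo_caX_chart[OF V_open V_Pi1] by simp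
        qed
        have oV: "openin ?T V" using openin_topspace[of ?T] unfolding V_top .
        have "S.preim k V = V" unfolding S.preim_def V_top using retr_V by blast
        then have "(\<lambda>x\<in>V. (\<lambda>P\<in>V. fst (chi P) j) (S.retr k x)) \<in> holo_caX D V"
          using conjunct2[OF S.pull_retr[OF order_refl oV c]] by (simp only:)
        then have "PH n (chi ` V) (\<lambda>y. (\<lambda>x\<in>V. (\<lambda>P\<in>V. fst (chi P) j) (S.retr k x)) (chi_inv y))"
          unfolding holo_caX_chart[OF V_open V_Pi1] by (simp only: mem_Collect_eq)
        then show ?thesis
        proof (rule PH_cong[OF _ chi_image_open[OF V_open V_Pi1]])
          fix x assume "x \<in> chi ` V"
          then obtain P where "x = chi P" "P \<in> V" by (rule imageE)
          then show "(\<lambda>x\<in>V. (\<lambda>P\<in>V. fst (chi P) j) (S.retr k x)) (chi_inv x) = T x j"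
            using chiV(3)[of P] retr_V[of P] by (simp add: T_def)
        qed
      qed
      have T_chi: "(T x, snd x) = chi (S.retr k P)" if "x = chi P" "P \<in> V" for x P
        unfolding that(1) T_def chiV(3)[OF that(2)] using chi_retr[OF order_refl that(2)] by (simp add: prod_eq_iff)
      have sub: "chi ` S.preim k U \<subseteq> chi ` V" by (rule image_mono[OF pre(2)])
      have "PH n (chi ` S.preim k U) (\<lambda>x. f (chi_inv (T x, snd x)))"
      proof (rule PH_pullback[OF chi_image_open[OF pre(1,3)] PH_subset[OF coord sub] _ _ holo_submfd_D(2,3)[OF f]])
        fix x assume "x \<in> chi ` S.preim k U"
        then obtain P where P: "x = chi P" "P \<in> S.preim k U" by (rule imageE)
        then have PV: "P \<in> V" "S.retr k P \<in> U" using preE by simp_all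
        have R1: "S.retr k P \<in> Pi1" using retr_V[OF PV(1)] V_Pi1 by blast
        show "(T x, snd x) \<in> Dom" unfolding T_chi[OF P(1) PV(1)] by (rule chi_in[OF R1])
        show "chi_inv (T x, snd x) \<in> U" unfolding T_chi[OF P(1) PV(1)] chi_inv_chi[OF R1] by (rule PV(2))
      qed
      then have "PH n (chi ` S.preim k U) (\<lambda>y. (\<lambda>x\<in>S.preim k U. f (S.retr k x)) (chi_inv y))"
      proof (rule PH_cong[OF _ chi_image_open[OF pre(1,3)]])
        fix x assume "x \<in> chi ` S.preim k U"
        then obtain P where P: "x = chi P" "P \<in> S.preim k U" by (rule imageE)
        then have PV: "P \<in> V" using preE by simp
        have R1: "S.retr k P \<in> Pi1" using retr_V[OF PV] V_Pi1 by blast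
        show "f (chi_inv (T x, snd x)) = (\<lambda>x\<in>S.preim k U. f (S.retr k x)) (chi_inv x)"
          unfolding T_chi[OF P(1) PV] chi_inv_chi[OF R1] using P chiV(3)[OF PV] by simp
      qed
      then have "(\<lambda>x\<in>S.preim k U. f (S.retr k x)) \<in> holo_caX D (S.preim k U)"
        unfolding holo_caX_chart[OF pre(1,3)] by simp
      then show "f \<in> S.Fz k U" unfolding S.Fz_def using holo_submfd_D(1)[OF f] by (intro CollectI conjI)
    next
      fix f assume "f \<in> S.Fz k U"
      then have f: "f \<in> extensional U" and g: "(\<lambda>x\<in>S.preim k U. f (S.retr k x)) \<in> holo_caX D (S.preim k U)"
        unfolding S.Fz_def by simp_all
      have gf: "(\<lambda>x\<in>S.preim k U. f (S.retr k x)) x = f x" if "x \<in> U" for x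
        using subsetD[OF U_pre that] id[OF that] by simp
      have "continuous_map (subtopology (caX D) U) euclidean (\<lambda>x\<in>S.preim k U. f (S.retr k x))"
        by (rule continuous_map_from_subtopology_mono[OF holo_caX_D(2)[OF g] U_pre])
      then have "continuous_map (subtopology (caX D) U) euclidean f"
        by (rule continuous_map_eq) (use gf in auto)
      then have "(\<lambda>x\<in>U. f x) \<in> holo_submfd D Y U"
      proof (rule holo_submfd_I[OF oU])
        fix x assume "iota D x \<in> U"
        then have x: "x \<in> iota D -` S.preim k U" using U_pre by blast
        show "\<exists>V F. x \<in> V \<and> mfd_holo n L V F \<and> (\<forall>y\<in>V \<inter> iota D -` U. F y = f (iota D y))"
        proof (intro exI conjI ballI)
          fix y assume "y \<in> iota D -` S.preim k U \<inter> iota D -` U"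
          then have "iota D y \<in> U" by simp
          then show "(\<lambda>x\<in>S.preim k U. f (S.retr k x)) (iota D y) = f (iota D y)" by (rule gf)
        qed (rule x, rule holo_caX_D(3)[OF g])
      qed
      then show "f \<in> holo_submfd D Y U" by (simp only: extensional_restrict[OF f])
    qed
  qed
  have sec: "sections_restrict (subtopology ?T (S.zeros k)) A"
  proof -
    have "openin (subtopology (caX D) Y) U" if U: "openin (subtopology ?T (S.zeros k)) U" for U
    proof -
      have "U \<subseteq> V \<inter> Y" using openin_subset[OF U] zeros by auto
      then show ?thesis using Y_open U unfolding zeros by blast
    qed
    note o = this
    note r = sheaf_of_modules_sections_restrict[OF A, unfolded sections_restrict_def]
    show ?thesis
      unfolding sections_restrict_def
    proof (intro conjI allI impI)
      fix U U' assume "openin (subtopology ?T (S.zeros k)) U \<and> openin (subtopology ?T (S.zeros k)) U' \<and> U' \<subseteq> U"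
      then have "openin (subtopology (caX D) Y) U \<and> openin (subtopology (caX D) Y) U' \<and> U' \<subseteq> U" using o by simp
      then show "res A U U' \<in> carrier (sec A U) \<rightarrow> carrier (sec A U')" by (rule r[THEN conjunct1, rule_format])
    qed (rule r[THEN conjunct2])
  qed
  have "has_free_resolution (caX D) (\<lambda>U. function_ring U (holo_caX D U)) (trivial_extension Y A) V m" if m: "1 \<le> m" for m
  proof -
    have "V \<inter> Y \<subseteq> V0 \<inter> Y" using V_V0 by blast
    from has_free_resolution_mono[OF res[OF m] this]
    have 0: "has_free_resolution (subtopology (caX D) Y) (\<lambda>W. function_ring W (holo_submfd D Y W)) A (V \<inter> Y) m" .
    \<comment> \<open>Below \<open>V \<inter> Y\<close> the open sets and the rings of the two
      descriptions of \<open>Y\<close> are the same.\<close>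
    have "has_free_resolution (subtopology ?T (V \<inter> Y)) (\<lambda>W. function_ring W (S.Fz k W)) A (V \<inter> Y) m"
      by (rule has_free_resolution_cong[OF Y_open _ agree_over_refl 0]) (simp_all only: rings)
    then have "has_free_resolution (subtopology ?T (S.zeros k)) (\<lambda>W. function_ring W (S.Fz k W)) A (S.zeros k) m"
      by (simp only: zeros)
    from S.free_resolution_extension[OF sec this]
    have 1: "has_free_resolution ?T (\<lambda>U. function_ring U (holo_caX D U)) (trivial_extension (V \<inter> Y) A) V m"
      by (simp only: zeros V_top)
    show ?thesis
    proof (rule has_free_resolution_cong[OF _ _ agree_over_trivial_extension_Int 1])
      fix U assume U: "U \<subseteq> V"
      show "openin (caX D) U \<longleftrightarrow> openin ?T U"
        using openin_open_subtopology[OF V_open, of U] U by simp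
    qed simp
  qed
  then show ?thesis using V_open yV by blast
qed

end

section \<open>Local resolutions at the points on and off the submanifold\<close>

theorem theorem5p10:
  fixes D :: "('a::topological_space, 'b::{t2_space, second_countable_topology}, 'i) fc_data"
    and k :: nat
    and Y :: "('a, 'b, 'i) cpoint set"
    and \<A> :: "(('a, 'b, 'i) cpoint, 's) msheaf"
  assumes "fc_setting D"
    and "complex_submanifold D k Y"
    and "coherent_sheaf (subtopology (caX D) Y) (O_submfd D Y) \<A>"
  shows "coherent_sheaf (caX D) (O_caX D) (trivial_extension Y \<A>)"
proof -
  interpret fc D by unfold_locales (rule assms(1))
  have O: "O_caX D = (\<lambda>U. function_ring U (holo_caX D U))" "O_submfd D Y = (\<lambda>W. function_ring W (holo_submfd D Y W))"
    by (simp_all add: fun_eq_iff O_caX_def O_submfd_def)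
  let ?R = "\<lambda>U. function_ring U (holo_caX D U)"
  note coh = assms(3)[unfolded O coherent_sheaf_def]
  note A = conjunct1[OF coh]
  note closed = conjunct1[OF assms(2)[unfolded complex_submanifold_def]]
  have "\<exists>V. openin (caX D) V \<and> y \<in> V \<and> (\<forall>N\<ge>1. has_free_resolution (caX D) ?R (trivial_extension Y \<A>) V N)"
    if y: "y \<in> topspace (caX D)" for y
  proof (cases "y \<in> Y")
    case False
    have "openin (caX D) (topspace (caX D) - Y)" using closed by (simp add: closedin_def)
    moreover have "has_free_resolution (caX D) ?R (trivial_extension Y \<A>) (topspace (caX D) - Y) N" for N
      by (rule free_resolution_off[OF sheaf_caX sheaf_submfd A calculation]) blast
    ultimately show ?thesis using y False by (intro exI[of _ "topspace (caX D) - Y"] conjI) simp_all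
  next
    case True
    obtain U0 \<Psi> K h where U0: "open U0" and \<Psi>: "compatible_triv D U0 \<Psi>" and K: "openin (fibre D) K"
      and yP: "y \<in> Pi_hat D \<Psi> U0 K" and h: "\<forall>i<k. h i \<in> holo_caX D (Pi_hat D \<Psi> U0 K)"
      and Yh: "Y \<inter> Pi_hat D \<Psi> U0 K = {x \<in> Pi_hat D \<Psi> U0 K. \<forall>i<k. h i x = 0}"
      and rank: "\<forall>z\<in>U0. \<forall>\<omega>\<in>K. inv_into (Pi_hat D \<Psi> U0 K) \<Psi> (z, \<omega>) \<in> Y \<longrightarrow>
           (\<forall>(V, \<phi>)\<in>catlas D. z \<in> V \<longrightarrow>
              chart_rank (cdim D) V \<phi> k (\<lambda>i z'. h i (inv_into (Pi_hat D \<Psi> U0 K) \<Psi> (z', \<omega>))) z = k)"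
      using bspec[OF conjunct2[OF assms(2)[unfolded complex_submanifold_def]] True]
      by (elim exE conjE) (rule that)
    obtain \<psi> where \<psi>: "principal_triv p U0 \<psi>" "\<forall>x. p x \<in> U0 \<longrightarrow> \<Psi> (iota D x) = (p x, pe (\<psi> x))"
      using \<Psi> unfolding compatible_triv_def by (elim exE conjE) (rule that)
    have "(\<Union>(V, \<phi>)\<in>catlas D. V) = UNIV" using atlas unfolding complex_atlas_def by (rule conjunct1)
    then have "pbar D y \<in> (\<Union>(V, \<phi>)\<in>catlas D. V)" by (simp only: UNIV_I)
    then obtain Vc \<phi> where c: "(Vc, \<phi>) \<in> catlas D" "pbar D y \<in> Vc" by blast
    interpret fc_chart D U0 \<Psi> \<psi> K Vc \<phi>
    proof
      show "homeomorphic_map (subtopology (caX D) {P. pbar D P \<in> U0}) (prod_topology (top_of_set U0) (fibre D)) \<Psi>"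
        using \<Psi> unfolding compatible_triv_def by (rule conjunct1)
      show "fst (\<Psi> P) = pbar D P" if "P \<in> topspace (caX D)" "pbar D P \<in> U0" for P
        using \<Psi>[unfolded compatible_triv_def, THEN conjunct2, THEN conjunct1] that by simp
      show "\<Psi> (iota D x) = (p x, pe (\<psi> x))" if "p x \<in> U0" for x using \<psi>(2) that by simp
    qed (rule U0 \<psi>(1) K c(1))+
    have y1: "y \<in> Pi1" using yP c(2) by (simp add: Pi1_def)
    have yY: "y \<in> topspace (subtopology (caX D) Y)" using y True by simp
    obtain V' where V': "openin (subtopology (caX D) Y) V'" "y \<in> V'"
      and res': "\<forall>N\<ge>1. has_free_resolution (subtopology (caX D) Y) (\<lambda>W. function_ring W (holo_submfd D Y W)) \<A> V' N"
      using bspec[OF conjunct2[OF coh] yY] by (elim exE conjE) (rule that)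
    \<comment> \<open>The resolution lives on an open subset of \<open>Y\<close>; an open set of the
      ambient space with this trace is what limits the size of the chart.\<close>
    obtain V0 where V0: "openin (caX D) V0" "V' = V0 \<inter> Y"
      using V'(1) unfolding openin_subtopology by (elim exE conjE) (rule that)
    \<comment> \<open>With the fibre coordinate of \<open>y\<close> frozen, the partial derivatives
      in \<open>chart_rank\<close> for the chart \<open>\<phi>\<close> are the \<open>PD\<close> in
      the coordinates \<open>chi\<close>.\<close>
    have "vec_space.rank k (mat k n (\<lambda>(i, j). PD j (\<lambda>x. h i (chi_inv x)) (chi y))) = k"
    proof -
      note yP' = Pi0D[OF yP]
      have inv: "inv_into (Pi_hat D \<Psi> U0 K) \<Psi> (pbar D y, snd (\<Psi> y)) = y"
        using inv_Psi_Psi[OF yP] unfolding yP'(4)[symmetric] .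
      have "chart_rank n Vc \<phi> k (\<lambda>i z'. h i (inv_into (Pi_hat D \<Psi> U0 K) \<Psi> (z', snd (\<Psi> y)))) (pbar D y) = k"
        using bspec[OF bspec[OF rank yP'(2)] yP'(3)] True c unfolding inv by blast
      then show ?thesis
        by (simp add: chart_rank_def partial_deriv_def PD_def chi_inv_def chi_def)
    qed
    then show ?thesis
      using res' V'(2) h unfolding V0(2)
      by (intro local_resolution[OF A True y1 V0(1) _ _ _ Yh]) simp_all
  qed
  then show ?thesis
    unfolding O coherent_sheaf_def
    using sheaf_of_modules_trivial_extension[OF sheaf_caX sheaf_submfd restrict_submfd A] by blast
qed

end
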